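(* Let $I\subset\mathbb{R}$ be an open interval, $(F_i,g_{F_i})$ pseudo-Riemannian manifolds with $\dim F_i=l_i$, $b_i:I\to(0,\infty)$ smooth ($i=1,\dots,m$), and let $M=I\times_{b_1}F_1\times_{b_2}F_2\cdots\times_{b_m}F_m$ be the multiply warped product with metric $g=-dt^2\oplus b_1^2g_{F_1}\oplus b_2^2g_{F_2}\cdots\oplus b_m^2g_{F_m}$; put $\overline n=\dim M$. Let $\lambda_1,\lambda_2$ be nonzero real constants, $P=\frac{\partial}{\partial t}$, and let $\overline\nabla$ be the quarter-symmetric connection on $M$ determined by $P,\lambda_1,\lambda_2$. Then $(M,\overline\nabla)$ is Einstein with Einstein constant $\alpha$ if and only if the following conditions are satisfied: (1) $(F_i,\nabla^{F_i})$ is Einstein with Einstein constant $\alpha_i$, for each $i\in\{1,\dots,m\}$; (2) $\sum_{i=1}^ml_i\left(\lambda_2\frac{b_i'}{b_i}-\frac{b_i''}{b_i}+\lambda_1^2-\lambda_1\lambda_2\right)=\alpha$; (3) for each $i\in\{1,\dots,m\}$, $\alpha_i-b_ib_i''+(1-l_i)(b_i')^2+(\lambda_2b_i^2-b_ib_i')\sum_{s\neq i}l_s\frac{b_s'}{b_s}+[\lambda_2^2+(1-\overline n)\lambda_1\lambda_2]b_i^2+[(\overline n-1)\lambda_1+(l_i-1)\lambda_2]b_ib_i'=\alpha b_i^2$.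
   Context: On a pseudo-Riemannian manifold $(M,g)$ with Levi-Civita connection $\nabla$, a vector field $P$, the 1-form $\pi(X)=g(X,P)$ and nonzero real constants $\lambda_1,\lambda_2$, the quarter-symmetric connection is $\overline\nabla_XY=\nabla_XY+\lambda_1\pi(Y)X-\lambda_2g(X,Y)P$. Its curvature is $\overline R(X,Y)=\overline\nabla_X\overline\nabla_Y-\overline\nabla_Y\overline\nabla_X-\overline\nabla_{[X,Y]}$ and its Ricci tensor is $\overline{Ric}(X,Y)=\sum_k\varepsilon_k\,g(\overline R(X,E_k)Y,E_k)$, where $(E_k)$ is a local orthonormal frame with $g(E_k,E_k)=\varepsilon_k=\pm1$ (note the sign convention; $\overline{Ric}$ need not be symmetric). The same formulas with the Levi-Civita connection $\nabla^{F_i}$ of $(F_i,g_{F_i})$ define $Ric^{F_i}$ (same sign convention). $(M,\overline\nabla)$ is Einstein with Einstein constant $\alpha\in\mathbb{R}$ if $\overline{Ric}(X,Y)=\alpha g(X,Y)$ for all vector fields $X,Y$; $(F_i,\nabla^{F_i})$ is Einstein with constant $\alpha_i\in\mathbb{R}$ if $Ric^{F_i}=\alpha_ig_{F_i}$. Primes denote $d/dt$. *)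

theory Defs
  imports "HOL-Analysis.Analysis"
begin

section \<open>Smooth manifolds of arbitrary finite dimension\<close>

text \<open>Coordinates are indexed by a finite set \<open>J\<close>; the model space is the library's product topology
  \<^term>\<open>powertop_real J\<close>, whose points are the extensional functions on \<open>J\<close>. In this way manifolds of
  different (and variable) dimensions share one type.\<close>

definition partial_deriv :: "'j \<Rightarrow> (('j \<Rightarrow> real) \<Rightarrow> real) \<Rightarrow> ('j \<Rightarrow> real) \<Rightarrow> real" where
  "partial_deriv j f x = deriv (\<lambda>s. f (x(j := s))) (x j)"

fun Ck_coord :: "'j set \<Rightarrow> nat \<Rightarrow> ('j \<Rightarrow> real) set \<Rightarrow> (('j \<Rightarrow> real) \<Rightarrow> real) \<Rightarrow> bool" where
  "Ck_coord J 0 S f \<longleftrightarrow> continuous_map (subtopology (powertop_real J) S) euclideanreal f"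
| "Ck_coord J (Suc k) S f \<longleftrightarrow>
     continuous_map (subtopology (powertop_real J) S) euclideanreal f \<and>
     (\<forall>j\<in>J. (\<forall>x\<in>S. (\<lambda>s. f (x(j := s))) field_differentiable (at (x j))) \<and>
            Ck_coord J k S (partial_deriv j f))"

definition smooth_coord :: "'j set \<Rightarrow> ('j \<Rightarrow> real) set \<Rightarrow> (('j \<Rightarrow> real) \<Rightarrow> real) \<Rightarrow> bool" where
  "smooth_coord J S f \<longleftrightarrow> (\<forall>k. Ck_coord J k S f)"

record ('a, 'j) smooth_space =
  sp_top :: "'a topology"
  coord_idx :: "'j set"
  atlas :: "('a set \<times> ('a \<Rightarrow> 'j \<Rightarrow> real)) set"

definition points :: "('a, 'j) smooth_space \<Rightarrow> 'a set" where
  "points M = topspace (sp_top M)"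

definition mdim :: "('a, 'j) smooth_space \<Rightarrow> nat" where
  "mdim M = card (coord_idx M)"

text \<open>The atlas is not required to be maximal: a compatible atlas determines the smooth structure.\<close>

definition smooth_manifold :: "('a, 'j) smooth_space \<Rightarrow> bool" where
  "smooth_manifold M \<longleftrightarrow>
     points M \<noteq> {} \<and> finite (coord_idx M) \<and>
     Hausdorff_space (sp_top M) \<and>
     (\<exists>B. countable B \<and> (\<forall>V\<in>B. openin (sp_top M) V) \<and>
          (\<forall>U x. openin (sp_top M) U \<and> x \<in> U \<longrightarrow> (\<exists>V\<in>B. x \<in> V \<and> V \<subseteq> U))) \<and>
     (\<forall>(U, \<phi>)\<in>atlas M.
        openin (sp_top M) U \<and> openin (powertop_real (coord_idx M)) (\<phi> ` U) \<and>
        homeomorphic_map (subtopology (sp_top M) U)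
                         (subtopology (powertop_real (coord_idx M)) (\<phi> ` U)) \<phi>) \<and>
     (\<Union>(U, \<phi>)\<in>atlas M. U) = points M \<and>
     (\<forall>(U, \<phi>)\<in>atlas M. \<forall>(V, \<psi>)\<in>atlas M. \<forall>j\<in>coord_idx M.
        smooth_coord (coord_idx M) (\<phi> ` (U \<inter> V)) (\<lambda>x. \<psi> (inv_into U \<phi> x) j))"

definition smooth_on :: "('a, 'j) smooth_space \<Rightarrow> 'a set \<Rightarrow> ('a \<Rightarrow> real) \<Rightarrow> bool" where
  "smooth_on M W f \<longleftrightarrow> openin (sp_top M) W \<and>
     (\<forall>(U, \<phi>)\<in>atlas M. smooth_coord (coord_idx M) (\<phi> ` (U \<inter> W)) (\<lambda>x. f (inv_into U \<phi> x)))"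

definition smooth_near :: "('a, 'j) smooth_space \<Rightarrow> 'a \<Rightarrow> ('a \<Rightarrow> real) \<Rightarrow> bool" where
  "smooth_near M p f \<longleftrightarrow> (\<exists>W. p \<in> W \<and> smooth_on M W f)"

section \<open>Tangent vectors and vector fields\<close>

type_synonym 'a tvec = "('a \<Rightarrow> real) \<Rightarrow> real"
type_synonym 'a vfield = "'a \<Rightarrow> 'a tvec"
type_synonym 'a metric_field = "'a \<Rightarrow> 'a tvec \<Rightarrow> 'a tvec \<Rightarrow> real"
type_synonym 'a connection_op = "'a vfield \<Rightarrow> 'a vfield \<Rightarrow> 'a vfield"

text \<open>Tangent vectors at \<open>p\<close> are the derivations of the algebra of functions that are smooth near \<open>p\<close>.
  All functions are total; a tangent vector takes the value \<open>0\<close> on functions that are not smooth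
  near \<open>p\<close>, so that equality of tangent vectors is equality of HOL functions.\<close>

definition tangent_space :: "('a, 'j) smooth_space \<Rightarrow> 'a \<Rightarrow> 'a tvec set" where
  "tangent_space M p = {v.
     (\<forall>f. \<not> smooth_near M p f \<longrightarrow> v f = 0) \<and>
     (\<forall>c f. smooth_near M p f \<longrightarrow> v (\<lambda>q. c * f q) = c * v f) \<and>
     (\<forall>f h. smooth_near M p f \<and> smooth_near M p h \<longrightarrow>
        v (\<lambda>q. f q + h q) = v f + v h \<and>
        v (\<lambda>q. f q * h q) = v f * h p + f p * v h)}"

text \<open>A vector field on the open set \<open>W\<close>; its values outside \<open>W\<close> are irrelevant.\<close>

definition vector_field :: "('a, 'j) smooth_space \<Rightarrow> 'a set \<Rightarrow> 'a vfield \<Rightarrow> bool" where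
  "vector_field M W X \<longleftrightarrow> openin (sp_top M) W \<and>
     (\<forall>p\<in>W. X p \<in> tangent_space M p) \<and>
     (\<forall>V f. V \<subseteq> W \<and> smooth_on M V f \<longrightarrow> smooth_on M V (\<lambda>p. X p f))"

definition lie_bracket :: "('a, 'j) smooth_space \<Rightarrow> 'a vfield \<Rightarrow> 'a vfield \<Rightarrow> 'a vfield" where
  "lie_bracket M X Y p f =
     (if smooth_near M p f then X p (\<lambda>q. Y q f) - Y p (\<lambda>q. X q f) else 0)"

definition pushforward ::
  "('a, 'j) smooth_space \<Rightarrow> ('b, 'k) smooth_space \<Rightarrow> ('a \<Rightarrow> 'b) \<Rightarrow> 'a \<Rightarrow> 'a tvec \<Rightarrow> 'b tvec" where
  "pushforward M N h p v f = (if smooth_near N (h p) f then v (\<lambda>q. f (h q)) else 0)"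

section \<open>Pseudo-Riemannian metrics and the Levi-Civita connection\<close>

definition has_index_at :: "('a, 'j) smooth_space \<Rightarrow> 'a metric_field \<Rightarrow> 'a \<Rightarrow> nat \<Rightarrow> bool" where
  "has_index_at M g p \<nu> \<longleftrightarrow> (\<exists>e.
     (\<forall>k<mdim M. e k \<in> tangent_space M p \<and> g p (e k) (e k) \<in> {-1, 1}) \<and>
     (\<forall>k<mdim M. \<forall>k'<mdim M. k \<noteq> k' \<longrightarrow> g p (e k) (e k') = 0) \<and>
     card {k. k < mdim M \<and> g p (e k) (e k) = -1} = \<nu>)"

definition pseudo_riemannian :: "('a, 'j) smooth_space \<Rightarrow> 'a metric_field \<Rightarrow> bool" where
  "pseudo_riemannian M g \<longleftrightarrow> smooth_manifold M \<and>
     (\<forall>p\<in>points M. \<forall>u\<in>tangent_space M p. \<forall>v\<in>tangent_space M p.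
        g p u v = g p v u \<and>
        (\<forall>c. g p (\<lambda>f. c * u f) v = c * g p u v) \<and>
        (\<forall>w\<in>tangent_space M p. g p (\<lambda>f. u f + w f) v = g p u v + g p w v)) \<and>
     (\<forall>p\<in>points M. \<forall>u\<in>tangent_space M p.
        (\<forall>v\<in>tangent_space M p. g p u v = 0) \<longrightarrow> u = (\<lambda>f. 0)) \<and>
     (\<exists>\<nu>. \<forall>p\<in>points M. has_index_at M g p \<nu>) \<and>
     (\<forall>W X Y. vector_field M W X \<and> vector_field M W Y \<longrightarrow>
        smooth_on M W (\<lambda>p. g p (X p) (Y p)))"

text \<open>Connections act on vector fields over every open set, since the Ricci tensor below is computed
  with local frames.\<close>

definition affine_connection :: "('a, 'j) smooth_space \<Rightarrow> 'a connection_op \<Rightarrow> bool" where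
  "affine_connection M D \<longleftrightarrow>
     (\<forall>W X Y. vector_field M W X \<and> vector_field M W Y \<longrightarrow> vector_field M W (D X Y)) \<and>
     (\<forall>W X Y Z. vector_field M W X \<and> vector_field M W Y \<and> vector_field M W Z \<longrightarrow>
        (\<forall>p\<in>W. \<forall>f. D (\<lambda>q h. X q h + Y q h) Z p f = D X Z p f + D Y Z p f \<and>
                   D X (\<lambda>q h. Y q h + Z q h) p f = D X Y p f + D X Z p f)) \<and>
     (\<forall>W X Y \<psi>. vector_field M W X \<and> vector_field M W Y \<and> smooth_on M W \<psi> \<longrightarrow>
        (\<forall>p\<in>W. \<forall>f. D (\<lambda>q h. \<psi> q * X q h) Y p f = \<psi> p * D X Y p f \<and>
                   D X (\<lambda>q h. \<psi> q * Y q h) p f = X p \<psi> * Y p f + \<psi> p * D X Y p f))"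

definition levi_civita ::
  "('a, 'j) smooth_space \<Rightarrow> 'a metric_field \<Rightarrow> 'a connection_op \<Rightarrow> bool" where
  "levi_civita M g D \<longleftrightarrow> affine_connection M D \<and>
     (\<forall>W X Y. vector_field M W X \<and> vector_field M W Y \<longrightarrow>
        (\<forall>p\<in>W. \<forall>f. D X Y p f - D Y X p f = lie_bracket M X Y p f)) \<and>
     (\<forall>W X Y Z. vector_field M W X \<and> vector_field M W Y \<and> vector_field M W Z \<longrightarrow>
        (\<forall>p\<in>W. X p (\<lambda>q. g q (Y q) (Z q)) = g p (D X Y p) (Z p) + g p (Y p) (D X Z p)))"

section \<open>Quarter-symmetric connection, curvature, Ricci tensor\<close>

definition quarter_symmetric ::
  "'a metric_field \<Rightarrow> 'a vfield \<Rightarrow> real \<Rightarrow> real \<Rightarrow> 'a connection_op \<Rightarrow> 'a connection_op" where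
  "quarter_symmetric g P lam1 lam2 D X Y p f =
     D X Y p f + lam1 * g p (Y p) (P p) * X p f - lam2 * g p (X p) (Y p) * P p f"

definition curvature ::
  "('a, 'j) smooth_space \<Rightarrow> 'a connection_op \<Rightarrow> 'a vfield \<Rightarrow> 'a vfield \<Rightarrow> 'a vfield \<Rightarrow> 'a vfield" where
  "curvature M D X Y Z p f =
     D X (D Y Z) p f - D Y (D X Z) p f - D (lie_bracket M X Y) Z p f"

definition orthonormal_frame ::
  "('a, 'j) smooth_space \<Rightarrow> 'a metric_field \<Rightarrow> 'a set \<Rightarrow> (nat \<Rightarrow> 'a vfield) \<Rightarrow> bool" where
  "orthonormal_frame M g W E \<longleftrightarrow>
     (\<forall>k<mdim M. vector_field M W (E k)) \<and>
     (\<forall>p\<in>W. \<forall>k<mdim M. g p (E k p) (E k p) \<in> {-1, 1}) \<and>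
     (\<forall>p\<in>W. \<forall>k<mdim M. \<forall>k'<mdim M. k \<noteq> k' \<longrightarrow> g p (E k p) (E k' p) = 0)"

text \<open>The sign convention is \<open>Ric(X,Y) = \<Sum>\<^sub>k \<epsilon>\<^sub>k g(R(X,E\<^sub>k)Y,E\<^sub>k)\<close> with \<open>\<epsilon>\<^sub>k = g(E\<^sub>k,E\<^sub>k)\<close>, i.e. the
  negative of the more common one; it need not be symmetric. The value does not depend on the local
  orthonormal frame chosen around \<open>p\<close>.\<close>

definition ricci ::
  "('a, 'j) smooth_space \<Rightarrow> 'a metric_field \<Rightarrow> 'a connection_op \<Rightarrow> 'a vfield \<Rightarrow> 'a vfield \<Rightarrow> 'a \<Rightarrow> real" where
  "ricci M g D X Y p =
     (let E = (SOME E. \<exists>W. p \<in> W \<and> orthonormal_frame M g W E)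
      in \<Sum>k<mdim M. g p (E k p) (E k p) * g p (curvature M D X (E k) Y p) (E k p))"

text \<open>The identity \<open>Ric = \<alpha> g\<close> of tensor fields, tested on all vector fields, globally defined ones
  (\<open>W = points M\<close>) and local ones.\<close>

definition einstein ::
  "('a, 'j) smooth_space \<Rightarrow> 'a metric_field \<Rightarrow> 'a connection_op \<Rightarrow> real \<Rightarrow> bool" where
  "einstein M g D \<alpha> \<longleftrightarrow>
     (\<forall>W X Y. vector_field M W X \<and> vector_field M W Y \<longrightarrow>
        (\<forall>p\<in>W. ricci M g D X Y p = \<alpha> * g p (X p) (Y p)))"

section \<open>Multiply warped products over an interval\<close>

definition smooth_fun_on :: "real set \<Rightarrow> (real \<Rightarrow> real) \<Rightarrow> bool" where
  "smooth_fun_on I b \<longleftrightarrow> (\<forall>k. \<forall>t\<in>I. ((deriv ^^ k) b) field_differentiable (at t))"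

text \<open>The product manifold \<open>I \<times> F\<^sub>1 \<times> \<dots> \<times> F\<^sub>m\<close> with its product charts. A point is a pair \<open>(t, x)\<close>, where
  \<open>x\<close> is an extensional function with \<open>x i\<close> in \<open>F\<^sub>i\<close>. The coordinate \<open>None\<close> is \<open>t\<close>, and \<open>Some (i, j)\<close> is
  the \<open>j\<close>-th coordinate on \<open>F\<^sub>i\<close>.\<close>

definition product_space ::
  "real set \<Rightarrow> nat \<Rightarrow> (nat \<Rightarrow> ('a, 'j) smooth_space) \<Rightarrow>
   (real \<times> (nat \<Rightarrow> 'a), (nat \<times> 'j) option) smooth_space" where
  "product_space I m F =
     (let J = insert None (Some ` (SIGMA i:{1..m}. coord_idx (F i)))
      in \<lparr> sp_top = prod_topology (top_of_set I) (product_topology (\<lambda>i. sp_top (F i)) {1..m}),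
           coord_idx = J,
           atlas = {(I \<times> (\<Pi>\<^sub>E i\<in>{1..m}. fst (c i)),
                     \<lambda>(t, x). restrict (\<lambda>a. case a of None \<Rightarrow> t | Some (i, j) \<Rightarrow> snd (c i) (x i) j) J)
                    | c. \<forall>i\<in>{1..m}. c i \<in> atlas (F i)} \<rparr>)"

definition time_field :: "real set \<Rightarrow> nat \<Rightarrow> (nat \<Rightarrow> ('a, 'j) smooth_space) \<Rightarrow>
   (real \<times> (nat \<Rightarrow> 'a)) vfield" where
  "time_field I m F p f =
     (if smooth_near (product_space I m F) p f then deriv (\<lambda>s. f (s, snd p)) (fst p) else 0)"

text \<open>\<open>g = -dt\<^sup>2 \<oplus> b\<^sub>1\<^sup>2 g\<^sub>F\<^sub>1 \<oplus> \<dots> \<oplus> b\<^sub>m\<^sup>2 g\<^sub>F\<^sub>m\<close>. Here \<open>u fst\<close> is \<open>dt(u)\<close>, as \<open>t\<close> is the function \<^const>\<open>fst\<close>.\<close>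

definition warped_metric ::
  "real set \<Rightarrow> nat \<Rightarrow> (nat \<Rightarrow> ('a, 'j) smooth_space) \<Rightarrow> (nat \<Rightarrow> 'a metric_field) \<Rightarrow>
   (nat \<Rightarrow> real \<Rightarrow> real) \<Rightarrow> (real \<times> (nat \<Rightarrow> 'a)) metric_field" where
  "warped_metric I m F gF b p u v =
     - (u fst * v fst) +
     (\<Sum>i\<in>{1..m}. (b i (fst p))\<^sup>2 *
        gF i (snd p i)
          (pushforward (product_space I m F) (F i) (\<lambda>q. snd q i) p u)
          (pushforward (product_space I m F) (F i) (\<lambda>q. snd q i) p v))"

end

(* Fields on the product are reduced to the unit time field and lifts of fields on the fibres. Together
   they contain orthogonal frames, and the Ricci tensor is a tensor that can be computed in any
   orthogonal frame, so only its values on such fields matter. The Koszul formula gives the Levi-Civita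
   connection on them, e.g. nabla_X Y = nabla^F_X Y + (b'/b) g(X,Y) d/dt for lifts from the same fibre and
   nabla_X Y = 0 for lifts from different fibres; the quarter-symmetric connection only modifies the
   coefficients. Its Ricci tensor has no mixed components; the time component gives condition (2),
   and on the i-th fibre it is Ric^F_i plus a function of t times g_F_i, which gives (1) and (3) because
   Ric^F_i does not depend on t. That the tangent space is spanned by the coordinate derivations
   is Hadamard's lemma. *)

theory Submission
  imports Defs "HOL-Library.Function_Algebras"
begin

section \<open>Smooth functions of coordinates\<close>

text \<open>The quarter-symmetric connection has torsion and need not preserve the metric, so its
  curvature lacks pair symmetry. Antisymmetry in the first two arguments remains, and the two mixed
  Ricci components are computed separately. The computation stays short because, apart from the
  fibre connections and fibre metrics, the coefficients depend on time alone: \<open>hubble\<close>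
  b'/b, \<open>radial\<close> b'/b - lam1, \<open>second_form\<close> b b' - lam2 b^2, and the
  constant lam2 - lam1. Lifts do not differentiate such functions. The numbers \<alpha>_i are not
  given by the Einstein condition on the product. They arise by freezing one time t0; evaluating on
  a nonnull fibre vector at any other time then yields (3) with the same numbers. Fields and
  functions are total, with arbitrary values off their domains, and connections act on these total
  objects. Locality must therefore be proved. The indicator of an open set does this: at points of
  the set it is smooth with value one and derivative zero, so it takes the part of a cutoff
  function.\<close>

lemma powertop_real_eq: "powertop_real J = top_of_set (J \<rightarrow>\<^sub>E UNIV)"
proof -
  let ?X = "powertop_real J" and ?Y = "top_of_set (J \<rightarrow>\<^sub>E UNIV) :: ('a \<Rightarrow> real) topology"
  \<comment> \<open>The type-class topology sees all coordinates, the model space only those in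
    \<open>J\<close>. On extensional functions the remaining coordinates are frozen at
    \<open>undefined\<close>, hence constant.\<close>
  have 1: "continuous_map ?X ?Y id"
  proof -
    have "continuous_map ?X (powertop_real UNIV) id"
      unfolding continuous_map_componentwise_UNIV
    proof
      fix k
      show "continuous_map ?X euclideanreal (\<lambda>x. id x k)"
      proof (cases "k \<in> J")
        case True
        then show ?thesis using continuous_map_product_projection[of k J "\<lambda>_. euclideanreal"] by simp
      next
        case False
        have "continuous_map ?X euclideanreal (\<lambda>x. undefined)" by simp
        then show ?thesis
          by (rule continuous_map_eq) (use False in \<open>auto simp: PiE_def extensional_def\<close>)
      qed
    qed
    then show ?thesis
      by (auto simp: continuous_map_in_subtopology euclidean_product_topology)
  qed
  have 2: "continuous_map ?Y ?X id"
    unfolding continuous_map_componentwise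
    by (auto simp: PiE_def intro!: continuous_on_product_then_coordinatewise continuous_on_id)
  have t: "topspace ?X = topspace ?Y" by simp
  show ?thesis
    unfolding topology_eq
  proof (intro allI iffI)
    fix S assume S: "openin ?X S"
    have "openin ?Y {x \<in> topspace ?Y. id x \<in> S}" using openin_continuous_map_preimage[OF 2 S] .
    moreover have "{x \<in> topspace ?Y. id x \<in> S} = S" using openin_subset[OF S] t by auto
    ultimately show "openin ?Y S" by simp
  next
    fix S assume S: "openin ?Y S"
    have "openin ?X {x \<in> topspace ?X. id x \<in> S}" using openin_continuous_map_preimage[OF 1 S] .
    moreover have "{x \<in> topspace ?X. id x \<in> S} = S" using openin_subset[OF S] t by auto
    ultimately show "openin ?X S" by simp
  qed
qed

lemma openin_powertop_subset:
  "openin (powertop_real J) S \<Longrightarrow> S \<subseteq> J \<rightarrow>\<^sub>E UNIV"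
  using openin_subset[of "powertop_real J" S] by simp

lemma continuous_map_powertop_iff:
  assumes "S \<subseteq> J \<rightarrow>\<^sub>E UNIV"
  shows "continuous_map (subtopology (powertop_real J) S) euclideanreal f \<longleftrightarrow> continuous_on S f"
proof -
  have "(J \<rightarrow>\<^sub>E UNIV) \<inter> S = S" using assms by auto
  then show ?thesis by (simp add: powertop_real_eq subtopology_subtopology)
qed

lemma open_slice:
  assumes "openin (powertop_real J) S" "x \<in> J \<rightarrow>\<^sub>E UNIV" "j \<in> J"
  shows "open {s. x(j := s) \<in> S}"
proof -
  have "continuous_map euclideanreal (powertop_real J) (\<lambda>s. x(j := s))"
    unfolding continuous_map_componentwise
  proof (intro conjI ballI)
    show "(\<lambda>s. x(j := s)) ` topspace euclideanreal \<subseteq> extensional J"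
      using assms(2,3) by (auto simp: PiE_def extensional_def)
    show "continuous_map euclideanreal euclideanreal (\<lambda>s. (x(j := s)) k)" for k
      by (cases "k = j") simp_all
  qed
  from openin_continuous_map_preimage[OF this assms(1)] show ?thesis by simp
qed

lemma eventually_slice:
  assumes "openin (powertop_real J) S" "x(j := s) \<in> S" "j \<in> J"
  shows "eventually (\<lambda>s. x(j := s) \<in> S) (nhds s)"
proof -
  have "x(j := s) \<in> J \<rightarrow>\<^sub>E UNIV" using assms openin_powertop_subset by blast
  from open_slice[OF assms(1) this assms(3)] have "open {s. x(j := s) \<in> S}" by simp
  from eventually_nhds_in_open[OF this, of s] show ?thesis using assms(2) by simp
qed

section \<open>Closure properties of C^k functions in coordinates\<close>

lemma Ck_coord_imp_continuous:
  assumes "Ck_coord J k S f" "openin (powertop_real J) S"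
  shows "continuous_on S f"
  using assms continuous_map_powertop_iff[OF openin_powertop_subset, of J S f] by (cases k) auto

lemma Ck_coord_partial: "Ck_coord J (Suc k) S f \<Longrightarrow> j \<in> J \<Longrightarrow> Ck_coord J k S (partial_deriv j f)"
  by auto

lemma Ck_coord_has_derivative:
  assumes "Ck_coord J (Suc k) S f" "j \<in> J" "x(j := s) \<in> S"
  shows "((\<lambda>s. f (x(j := s))) has_real_derivative partial_deriv j f (x(j := s))) (at s)"
proof -
  have "\<forall>y\<in>S. (\<lambda>\<sigma>. f (y(j := \<sigma>))) field_differentiable (at (y j))"
    using assms(1,2) by simp
  from bspec[OF this assms(3)]
  have "(\<lambda>\<sigma>. f ((x(j := s))(j := \<sigma>))) field_differentiable (at ((x(j := s)) j))" .
  from field_differentiable_derivI[OF this]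
  show ?thesis by (simp add: partial_deriv_def)
qed

lemma Ck_coord_has_derivative_at:
  assumes "Ck_coord J (Suc k) S f" "j \<in> J" "x \<in> S"
  shows "((\<lambda>s. f (x(j := s))) has_real_derivative partial_deriv j f x) (at (x j))"
  using Ck_coord_has_derivative[of J k S f j x "x j", unfolded fun_upd_triv] assms by blast

text \<open>Openness of \<open>S\<close> is essential: coordinate lines stay in \<open>S\<close> for
  a short time, so functions that agree on \<open>S\<close> have the same partial derivatives
  there.\<close>

lemma Ck_coord_cong_aux:
  assumes S: "openin (powertop_real J) S"
  shows "(\<And>x. x \<in> S \<Longrightarrow> f x = g x) \<Longrightarrow> Ck_coord J k S f \<Longrightarrow> Ck_coord J k S g"
proof (induction k arbitrary: f g)
  case 0
  then show ?case using continuous_map_powertop_iff[OF openin_powertop_subset[OF S]]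
    by (metis Ck_coord.simps(1) continuous_on_eq)
next
  case (Suc k)
  have ev: "eventually (\<lambda>s. f (x(j := s)) = g (x(j := s))) (nhds (x j))" if "x \<in> S" "j \<in> J" for x j
  proof (rule eventually_mono)
    show "eventually (\<lambda>s. x(j := s) \<in> S) (nhds (x j))"
      using eventually_slice[OF S, of x j "x j"] that by simp
  qed (rule Suc.prems(1))
  have "continuous_on S g"
    using Ck_coord_imp_continuous[OF Suc.prems(2) S] Suc.prems(1) by (metis continuous_on_eq)
  moreover have "(\<lambda>s. g (x(j := s))) field_differentiable (at (x j))" if "x \<in> S" "j \<in> J" for x j
  proof -
    have "((\<lambda>s. f (x(j := s))) has_real_derivative partial_deriv j f x) (at (x j))"
      using Ck_coord_has_derivative_at[OF Suc.prems(2) that(2,1)] .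
    then have "((\<lambda>s. g (x(j := s))) has_real_derivative partial_deriv j f x) (at (x j))"
      using DERIV_cong_ev[OF refl ev[OF that] refl] by blast
    then show ?thesis using field_differentiable_def by blast
  qed
  moreover have "Ck_coord J k S (partial_deriv j g)" if "j \<in> J" for j
  proof (rule Suc.IH[of "partial_deriv j f"])
    fix x assume "x \<in> S"
    then show "partial_deriv j f x = partial_deriv j g x"
      unfolding partial_deriv_def using deriv_cong_ev[OF ev[OF _ that]] by blast
  qed (use Suc.prems that in auto)
  ultimately show ?case
    using continuous_map_powertop_iff[OF openin_powertop_subset[OF S]] by auto
qed

lemma Ck_coord_cong:
  assumes "openin (powertop_real J) S" "\<And>x. x \<in> S \<Longrightarrow> f x = g x"
  shows "Ck_coord J k S f \<longleftrightarrow> Ck_coord J k S g"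
  using Ck_coord_cong_aux[OF assms(1), of f g] Ck_coord_cong_aux[OF assms(1), of g f] assms(2) by metis

text \<open>Candidates \<open>F j\<close> for the partial derivatives suffice, since
  \<open>deriv\<close> is determined by any derivative that exists. The closure properties below are
  proved by supplying the usual differentiation formula.\<close>

lemma Ck_coord_SucI:
  assumes S: "openin (powertop_real J) S" and "continuous_on S f"
    and d: "\<And>j x. j \<in> J \<Longrightarrow> x \<in> S \<Longrightarrow> ((\<lambda>s. f (x(j := s))) has_real_derivative F j x) (at (x j))"
    and "\<And>j. j \<in> J \<Longrightarrow> Ck_coord J k S (F j)"
  shows "Ck_coord J (Suc k) S f"
proof -
  have "Ck_coord J k S (partial_deriv j f)" if "j \<in> J" for j
  proof -
    have "F j x = partial_deriv j f x" if "x \<in> S" for x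
      unfolding partial_deriv_def using DERIV_imp_deriv[OF d[OF \<open>j \<in> J\<close> that]] by simp
    then show ?thesis using assms(4)[OF that] Ck_coord_cong[OF S] by blast
  qed
  moreover have "(\<lambda>s. f (x(j := s))) field_differentiable (at (x j))" if "x \<in> S" "j \<in> J" for x j
    using d[OF that(2,1)] field_differentiable_def by blast
  ultimately show ?thesis
    using assms(2) continuous_map_powertop_iff[OF openin_powertop_subset[OF S]] by auto
qed

lemma Ck_coord_lower:
  "openin (powertop_real J) S \<Longrightarrow> Ck_coord J (Suc k) S f \<Longrightarrow> Ck_coord J k S f"
proof (induction k arbitrary: f)
  case 0
  then show ?case by simp
next
  case (Suc k)
  have "\<And>j. j \<in> J \<Longrightarrow> Ck_coord J k S (partial_deriv j f)"
    using Suc.IH[OF Suc.prems(1)] Suc.prems(2) by simp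
  then show ?case using Suc.prems(2) by simp
qed

lemma Ck_coord_subset:
  "S' \<subseteq> S \<Longrightarrow> Ck_coord J k S f \<Longrightarrow> Ck_coord J k S' f"
proof (induction k arbitrary: f)
  case 0
  then show ?case
    using continuous_map_from_subtopology_mono by auto
next
  case (Suc k)
  then show ?case
    using continuous_map_from_subtopology_mono by fastforce
qed

text \<open>Continuity is glued by the pasting lemma from all open subsets of \<open>S\<close> where
  it holds. Differentiability is a pointwise condition, and the induction hypothesis handles the
  partial derivatives.\<close>

lemma Ck_coord_local:
  "openin (powertop_real J) S \<Longrightarrow>
   (\<And>x. x \<in> S \<Longrightarrow> \<exists>T. x \<in> T \<and> openin (powertop_real J) T \<and> Ck_coord J k T f) \<Longrightarrow> Ck_coord J k S f"
proof (induction k arbitrary: f)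
  case 0
  let ?I = "{T. openin (powertop_real J) T \<and> Ck_coord J 0 T f \<and> T \<subseteq> S}"
  have "continuous_map (subtopology (powertop_real J) S) euclideanreal f"
  proof (rule pasting_lemma[where I = ?I and T = "\<lambda>T. T" and f = "\<lambda>_. f"])
    fix T assume T: "T \<in> ?I"
    then show "openin (subtopology (powertop_real J) S) T"
      by (simp add: openin_subset_topspace_eq openin_open_subtopology[OF 0(1)])
    show "continuous_map (subtopology (subtopology (powertop_real J) S) T) euclideanreal f"
      using T by (simp add: subtopology_subtopology Int_absorb1)
  next
    fix x assume "x \<in> topspace (subtopology (powertop_real J) S)"
    then have "x \<in> S" by simp
    from 0(2)[OF this]
    obtain T where T: "x \<in> T" "openin (powertop_real J) T" "Ck_coord J 0 T f" by (elim exE conjE)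
    have "openin (powertop_real J) (T \<inter> S)" using openin_Int[OF T(2) 0(1)] .
    moreover have "Ck_coord J 0 (T \<inter> S) f" by (rule Ck_coord_subset[OF Int_lower1 T(3)])
    ultimately have "T \<inter> S \<in> ?I" by (simp del: Ck_coord.simps)
    then show "\<exists>j. j \<in> ?I \<and> x \<in> j \<and> f x = f x"
      using T(1) \<open>x \<in> S\<close> by (intro exI[of _ "T \<inter> S"] conjI) auto
  qed auto
  then show ?case by simp
next
  case (Suc k)
  have "Ck_coord J k S f"
  proof (rule Suc.IH[OF Suc.prems(1)])
    fix x assume "x \<in> S"
    from Suc.prems(2)[OF this] obtain T where
      T: "x \<in> T" "openin (powertop_real J) T" "Ck_coord J (Suc k) T f" by (elim exE conjE)
    then show "\<exists>T. x \<in> T \<and> openin (powertop_real J) T \<and> Ck_coord J k T f"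
      using Ck_coord_lower[OF T(2,3)] by (intro exI[of _ T] conjI)
  qed
  then have c: "continuous_on S f" using Ck_coord_imp_continuous Suc.prems(1) by blast
  show ?case
  proof (rule Ck_coord_SucI[OF Suc.prems(1) c])
    fix j x assume "j \<in> J" "x \<in> S"
    from Suc.prems(2)[OF this(2)] obtain T where
      T: "x \<in> T" "openin (powertop_real J) T" "Ck_coord J (Suc k) T f" by (elim exE conjE)
    show "((\<lambda>s. f (x(j := s))) has_real_derivative partial_deriv j f x) (at (x j))"
      using Ck_coord_has_derivative_at[OF T(3) \<open>j \<in> J\<close> T(1)] .
  next
    fix j assume "j \<in> J"
    show "Ck_coord J k S (partial_deriv j f)"
    proof (rule Suc.IH[OF Suc.prems(1)])
      fix x assume "x \<in> S"
      from Suc.prems(2)[OF this] obtain T where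
        T: "x \<in> T" "openin (powertop_real J) T" "Ck_coord J (Suc k) T f" by (elim exE conjE)
      then show "\<exists>T. x \<in> T \<and> openin (powertop_real J) T \<and> Ck_coord J k T (partial_deriv j f)"
        using Ck_coord_partial[OF T(3) \<open>j \<in> J\<close>] by (intro exI[of _ T] conjI)
    qed
  qed
qed

lemma Ck_coord_const: "Ck_coord J k S (\<lambda>x. c)"
proof (induction k arbitrary: c)
  case (Suc k)
  have "partial_deriv j (\<lambda>x. c) = (\<lambda>x. 0)" for j :: 'a
    by (auto simp: partial_deriv_def)
  then show ?case using Suc by simp
qed simp

lemma Ck_coord_add:
  assumes S: "openin (powertop_real J) S"
  shows "Ck_coord J k S f \<Longrightarrow> Ck_coord J k S g \<Longrightarrow> Ck_coord J k S (\<lambda>x. f x + g x)"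
proof (induction k arbitrary: f g)
  case 0
  then show ?case using continuous_map_powertop_iff[OF openin_powertop_subset[OF S]]
    by (simp add: continuous_on_add)
next
  case (Suc k)
  show ?case
  proof (rule Ck_coord_SucI[OF S])
    show "continuous_on S (\<lambda>x. f x + g x)"
      using Suc.prems[THEN Ck_coord_imp_continuous, OF S] by (intro continuous_intros)
    show "((\<lambda>s. f (x(j := s)) + g (x(j := s))) has_real_derivative
       partial_deriv j f x + partial_deriv j g x) (at (x j))" if "j \<in> J" "x \<in> S" for j x
      using Suc.prems[THEN Ck_coord_has_derivative_at, OF that] by (rule DERIV_add)
    show "Ck_coord J k S (\<lambda>x. partial_deriv j f x + partial_deriv j g x)" if "j \<in> J" for j
      using Suc that by simp
  qed
qed

lemma Ck_coord_mult:
  assumes S: "openin (powertop_real J) S"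
  shows "Ck_coord J k S f \<Longrightarrow> Ck_coord J k S g \<Longrightarrow> Ck_coord J k S (\<lambda>x. f x * g x)"
proof (induction k arbitrary: f g)
  case 0
  then show ?case using continuous_map_powertop_iff[OF openin_powertop_subset[OF S]]
    by (simp add: continuous_on_mult)
next
  case (Suc k)
  show ?case
  proof (rule Ck_coord_SucI[OF S])
    show "continuous_on S (\<lambda>x. f x * g x)"
      using Suc.prems[THEN Ck_coord_imp_continuous, OF S] by (intro continuous_intros)
    show "((\<lambda>s. f (x(j := s)) * g (x(j := s))) has_real_derivative
       partial_deriv j f x * g x + partial_deriv j g x * f x) (at (x j))" if "j \<in> J" "x \<in> S" for j x
      using DERIV_mult[OF Suc.prems[THEN Ck_coord_has_derivative_at, OF that]] unfolding fun_upd_triv .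
    show "Ck_coord J k S (\<lambda>x. partial_deriv j f x * g x + partial_deriv j g x * f x)" if "j \<in> J" for j
      using Suc that Ck_coord_lower[OF S] by (intro Ck_coord_add[OF S]) auto
  qed
qed

lemma Ck_coord_sum:
  assumes S: "openin (powertop_real J) S"
  shows "(\<And>i. i \<in> A \<Longrightarrow> Ck_coord J k S (f i)) \<Longrightarrow> Ck_coord J k S (\<lambda>x. \<Sum>i\<in>A. f i x)"
  by (induction A rule: infinite_finite_induct) (auto simp: Ck_coord_const Ck_coord_add[OF S])

lemma Ck_coord_coordinate:
  assumes S: "openin (powertop_real J) S" and "a \<in> J"
  shows "Ck_coord J k S (\<lambda>x. x a)"
proof -
  have c: "continuous_on S (\<lambda>x. x a)"
    by (rule continuous_on_product_then_coordinatewise[OF continuous_on_id])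
  show ?thesis
  proof (cases k)
    case 0
    then show ?thesis using c continuous_map_powertop_iff[OF openin_powertop_subset[OF S]] by simp
  next
    case (Suc k)
    have "Ck_coord J (Suc k) S (\<lambda>x. x a)"
    proof (rule Ck_coord_SucI[OF S c])
      fix j x
      show "((\<lambda>s. (x(j := s)) a) has_real_derivative (if j = a then 1 else 0)) (at (x j))" by simp
    qed (simp add: Ck_coord_const)
    then show ?thesis using Suc by simp
  qed
qed

text \<open>The exponent varies in the induction because differentiation lowers it. Exponent -1
  later gives quotients and exponent -1/2 gives unit vectors.\<close>

lemma Ck_coord_powr:
  assumes S: "openin (powertop_real J) S"
  shows "Ck_coord J k S f \<Longrightarrow> (\<And>x. x \<in> S \<Longrightarrow> f x > 0) \<Longrightarrow> Ck_coord J k S (\<lambda>x. f x powr r)"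
proof (induction k arbitrary: r)
  case 0
  then show ?case using continuous_map_powertop_iff[OF openin_powertop_subset[OF S]]
    by (simp add: continuous_on_powr less_imp_neq[symmetric] order_less_imp_not_eq2)
next
  case (Suc k)
  show ?case
  proof (rule Ck_coord_SucI[OF S])
    show "continuous_on S (\<lambda>x. f x powr r)"
      using Ck_coord_imp_continuous[OF Suc.prems(1) S] Suc.prems(2)
      by (simp add: continuous_on_powr order_less_imp_not_eq2)
    show "((\<lambda>s. f (x(j := s)) powr r) has_real_derivative
       r * f x powr (r - 1) * partial_deriv j f x) (at (x j))" if "j \<in> J" "x \<in> S" for j x
      using DERIV_chain2[OF has_real_derivative_powr Ck_coord_has_derivative_at[OF Suc.prems(1) that], of r]
        Suc.prems(2)[OF that(2)] unfolding fun_upd_triv by blast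
    show "Ck_coord J k S (\<lambda>x. r * f x powr (r - 1) * partial_deriv j f x)" if "j \<in> J" for j
      using Suc that Ck_coord_lower[OF S] by (intro Ck_coord_mult[OF S] Ck_coord_const) auto
  qed
qed

lemma smooth_fun_on_deriv: "smooth_fun_on I b \<Longrightarrow> smooth_fun_on I (deriv b)"
  unfolding smooth_fun_on_def by (metis funpow_Suc_right comp_apply)

lemma smooth_fun_on_has_derivative:
  "smooth_fun_on I b \<Longrightarrow> t \<in> I \<Longrightarrow> (b has_real_derivative deriv b t) (at t)"
  unfolding smooth_fun_on_def by (metis funpow_0 field_differentiable_derivI)

lemma Ck_coord_compose_real:
  assumes S: "openin (powertop_real J) S" and r: "\<And>x. x \<in> S \<Longrightarrow> f x \<in> I"
  shows "Ck_coord J k S f \<Longrightarrow> smooth_fun_on I b \<Longrightarrow> Ck_coord J k S (\<lambda>x. b (f x))"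
proof (induction k arbitrary: b)
  have c: "continuous_on I b" if "smooth_fun_on I b" for b
    using smooth_fun_on_has_derivative[OF that] DERIV_continuous continuous_at_imp_continuous_on
    by blast
  case 0
  then show ?case using continuous_map_powertop_iff[OF openin_powertop_subset[OF S]] c r
    by (metis Ck_coord.simps(1) continuous_on_compose2 image_subsetI)
next
  have c: "continuous_on I b" if "smooth_fun_on I b" for b
    using smooth_fun_on_has_derivative[OF that] DERIV_continuous continuous_at_imp_continuous_on
    by blast
  case (Suc k)
  show ?case
  proof (rule Ck_coord_SucI[OF S])
    show "continuous_on S (\<lambda>x. b (f x))"
      using Ck_coord_imp_continuous[OF Suc.prems(1) S] c[OF Suc.prems(2)] r
      by (metis continuous_on_compose2 image_subsetI)
    show "((\<lambda>s. b (f (x(j := s)))) has_real_derivative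
       deriv b (f x) * partial_deriv j f x) (at (x j))" if "j \<in> J" "x \<in> S" for j x
      using DERIV_chain2[OF _ Ck_coord_has_derivative_at[OF Suc.prems(1) that], of b "deriv b (f x)"]
        smooth_fun_on_has_derivative[OF Suc.prems(2) r[OF that(2)]] unfolding fun_upd_triv by blast
    show "Ck_coord J k S (\<lambda>x. deriv b (f x) * partial_deriv j f x)" if "j \<in> J" for j
      using Suc that Ck_coord_lower[OF S] smooth_fun_on_deriv by (intro Ck_coord_mult[OF S]) auto
  qed
qed

section \<open>Chain rule and Hadamard's lemma\<close>

lemma openin_powertop_extensional:
  "openin (powertop_real J) S \<Longrightarrow> x \<in> S \<Longrightarrow> x \<in> extensional J"
  using openin_powertop_subset[of J S] by (auto simp: PiE_def)

text \<open>Bounding the intermediate point by its distance from \<open>u\<close> avoids fixing the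
  order of \<open>u\<close> and \<open>v\<close>, and squeezes that point to \<open>u\<close> as
  \<open>v\<close> tends to \<open>u\<close>.\<close>

lemma mvt_between:
  fixes h :: "real \<Rightarrow> real"
  assumes "\<And>\<sigma>. \<bar>\<sigma> - u\<bar> \<le> \<bar>v - u\<bar> \<Longrightarrow> (h has_real_derivative h' \<sigma>) (at \<sigma>)"
  shows "\<exists>\<sigma>. \<bar>\<sigma> - u\<bar> \<le> \<bar>v - u\<bar> \<and> h v - h u = (v - u) * h' \<sigma>"
proof -
  consider "u < v" | "v < u" | "u = v" by linarith
  then show ?thesis
  proof cases
    case 1
    then obtain z where "u < z" "z < v" "h v - h u = (v - u) * h' z"
      using MVT2[of u v h h'] assms by force
    then show ?thesis by (intro exI[of _ z]) auto
  next
    case 2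
    then obtain z where "v < z" "z < u" "h u - h v = (u - v) * h' z"
      using MVT2[of v u h h'] assms by force
    then show ?thesis by (intro exI[of _ z]) (auto simp: algebra_simps)
  qed auto
qed

section \<open>Coordinate cubes and the chain rule\<close>

text \<open>Cubes are used instead of balls because they are open in the product topology for finite
  \<open>J\<close>, allow one coordinate to be changed at a time, and are stable under contraction
  to the centre.\<close>

definition coord_box :: "'j set \<Rightarrow> ('j \<Rightarrow> real) \<Rightarrow> real \<Rightarrow> ('j \<Rightarrow> real) set" where
  "coord_box J p e = (\<Pi>\<^sub>E j\<in>J. {p j - e<..<p j + e})"

lemma openin_coord_box: "finite J \<Longrightarrow> openin (powertop_real J) (coord_box J p e)"
  unfolding coord_box_def by (subst openin_PiE) auto

lemma coord_box_iff: "x \<in> coord_box J p e \<longleftrightarrow> x \<in> extensional J \<and> (\<forall>j\<in>J. \<bar>x j - p j\<bar> < e)"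
  unfolding coord_box_def PiE_iff by (auto simp: abs_less_iff)

lemma open_contains_coord_box:
  assumes "finite J" "openin (powertop_real J) S" "p \<in> S"
  obtains e where "e > 0" "coord_box J p e \<subseteq> S"
proof -
  obtain U where U: "\<And>i. i \<in> J \<Longrightarrow> open (U i)" "p \<in> Pi\<^sub>E J U" "Pi\<^sub>E J U \<subseteq> S"
  proof -
    from bspec[OF assms(2)[unfolded openin_product_topology_alt] assms(3)] obtain U where
      "\<forall>i\<in>J. openin euclideanreal (U i)" "p \<in> Pi\<^sub>E J U" "Pi\<^sub>E J U \<subseteq> S" by (elim exE conjE)
    then show ?thesis using that[of U] by simp
  qed
  have "\<forall>j\<in>J. eventually (\<lambda>e. {p j - e<..<p j + e} \<subseteq> U j) (at_right 0)"
  proof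
    fix j assume j: "j \<in> J"
    then have "p j \<in> U j" using U(2) by auto
    then obtain d where d: "d > 0" "ball (p j) d \<subseteq> U j" using U(1)[OF j] open_contains_ball by blast
    have "{p j - e<..<p j + e} \<subseteq> U j" if "e \<in> {0<..<d}" for e
      using d(2) that by (auto simp: ball_def dist_real_def subset_iff)
    then show "eventually (\<lambda>e. {p j - e<..<p j + e} \<subseteq> U j) (at_right 0)"
      unfolding eventually_at_right_field using d(1) by (intro exI[of _ d]) simp
  qed
  then have "eventually (\<lambda>e. \<forall>j\<in>J. {p j - e<..<p j + e} \<subseteq> U j) (at_right (0::real))"
    by (rule eventually_ball_finite[OF assms(1)])
  from this[unfolded eventually_at_right_field] obtain b :: real where
    "b > 0" "\<forall>e>0. e < b \<longrightarrow> (\<forall>j\<in>J. {p j - e<..<p j + e} \<subseteq> U j)" by (elim exE conjE)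
  then obtain e :: real where "e > 0" "\<forall>j\<in>J. {p j - e<..<p j + e} \<subseteq> U j"
    using that[of "b / 2"] by simp
  then show thesis
    using that[of e] U(3) PiE_mono[of J "\<lambda>j. {p j - e<..<p j + e}" U] unfolding coord_box_def by blast
qed

lemma tendsto_compose_coord:
  fixes f :: "('j \<Rightarrow> real) \<Rightarrow> real"
  assumes S: "openin (powertop_real J) S" and "continuous_on S f" "x \<in> S"
    and ev: "eventually (\<lambda>s. \<xi> s \<in> S) F"
    and lim: "\<And>j. j \<in> J \<Longrightarrow> ((\<lambda>s. \<xi> s j) \<longlongrightarrow> x j) F"
  shows "((\<lambda>s. f (\<xi> s)) \<longlongrightarrow> f x) F"
proof -
  have x: "x \<in> J \<rightarrow>\<^sub>E UNIV" using assms(3) openin_powertop_subset[OF S] by blast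
  have "limitin (powertop_real J) \<xi> x F"
    unfolding limitin_componentwise
    using x lim openin_powertop_subset[OF S] by (auto simp: PiE_def intro: eventually_mono[OF ev])
  then have "limitin (subtopology (powertop_real J) S) \<xi> x F"
    using assms(3) ev by (simp add: limitin_subtopology)
  moreover have "continuous_map (subtopology (powertop_real J) S) euclideanreal f"
    using assms(2) continuous_map_powertop_iff[OF openin_powertop_subset[OF S]] by simp
  ultimately have "limitin euclideanreal (f \<circ> \<xi>) (f x) F" by (rule continuous_map_limit[rotated])
  then show ?thesis by (simp add: comp_def)
qed

text \<open>The coordinates of the curve are switched on one at a time: \<open>mix K\<close> follows
  the curve on \<open>K\<close> and rests at its initial value elsewhere. Each new coordinate adds
  one partial derivative at an intermediate point, whose limit is found from continuity of that
  partial derivative.\<close>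

lemma coord_chain_rule_aux:
  assumes J: "finite J" and S: "openin (powertop_real J) S" and f: "Ck_coord J (Suc 0) S f"
    and \<gamma>0: "\<gamma> s0 \<in> S"
    and d: "\<And>j. j \<in> J \<Longrightarrow> ((\<lambda>s. \<gamma> s j) has_real_derivative d j) (at s0)"
  shows "K \<subseteq> J \<Longrightarrow> ((\<lambda>s. f (\<lambda>j. if j \<in> K then \<gamma> s j else \<gamma> s0 j)) has_real_derivative
           (\<Sum>j\<in>K. partial_deriv j f (\<gamma> s0) * d j)) (at s0)"
proof (induction K rule: infinite_finite_induct)
  case (infinite K)
  then show ?case using J finite_subset by blast
next
  case empty
  show ?case by simp
next
  case (insert a K)
  define mix where "mix K s = (\<lambda>j. if j \<in> K then \<gamma> s j else \<gamma> s0 j)" for K s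
  have a: "a \<in> J" "a \<notin> K" "K \<subseteq> J" using insert by auto
  obtain e where e: "e > 0" "coord_box J (\<gamma> s0) e \<subseteq> S"
    using open_contains_coord_box[OF J S \<gamma>0] .
  have ext: "\<gamma> s0 \<in> extensional J" using openin_powertop_extensional[OF S \<gamma>0] .
  have lim: "((\<lambda>s. \<gamma> s j) \<longlongrightarrow> \<gamma> s0 j) (at s0)" if "j \<in> J" for j
    using DERIV_isCont[OF d[OF that]] by (simp add: isCont_def)
  have near: "eventually (\<lambda>s. \<forall>j\<in>J. \<bar>\<gamma> s j - \<gamma> s0 j\<bar> < e) (at s0)"
  proof (rule eventually_ball_finite[OF J], rule ballI)
    fix j assume "j \<in> J"
    from tendstoD[OF lim[OF this] e(1)] show "eventually (\<lambda>s. \<bar>\<gamma> s j - \<gamma> s0 j\<bar> < e) (at s0)"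
      by (simp add: dist_real_def)
  qed
  \<comment> \<open>\<open>Q s\<close> describes the intermediate points that the mean value theorem
    offers when coordinate \<open>a\<close> moves from its initial value to its value at
    \<open>s\<close>.\<close>
  define Q where "Q s \<sigma> \<longleftrightarrow> \<bar>\<sigma> - \<gamma> s0 a\<bar> \<le> \<bar>\<gamma> s a - \<gamma> s0 a\<bar> \<and>
      f (mix (insert a K) s) - f (mix K s) = (\<gamma> s a - \<gamma> s0 a) * partial_deriv a f ((mix K s)(a := \<sigma>))" for s \<sigma>
  have box: "(mix K s)(a := \<sigma>) \<in> S"
    if "\<forall>j\<in>J. \<bar>\<gamma> s j - \<gamma> s0 j\<bar> < e" "\<bar>\<sigma> - \<gamma> s0 a\<bar> \<le> \<bar>\<gamma> s a - \<gamma> s0 a\<bar>" for s \<sigma>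
  proof -
    have "(mix K s)(a := \<sigma>) \<in> extensional J"
      using ext a by (auto simp: mix_def extensional_def)
    moreover have "\<bar>((mix K s)(a := \<sigma>)) j - \<gamma> s0 j\<bar> < e" if "j \<in> J" for j
      using \<open>\<forall>j\<in>J. _\<close> \<open>\<bar>\<sigma> - _\<bar> \<le> _\<close> e(1) that a by (auto simp: mix_def)
    ultimately show ?thesis using e(2) by (auto simp: coord_box_iff)
  qed
  have Q: "\<exists>\<sigma>. Q s \<sigma>" if "\<forall>j\<in>J. \<bar>\<gamma> s j - \<gamma> s0 j\<bar> < e" for s
  proof -
    have "\<exists>\<sigma>. \<bar>\<sigma> - \<gamma> s0 a\<bar> \<le> \<bar>\<gamma> s a - \<gamma> s0 a\<bar> \<and>
       f ((mix K s)(a := \<gamma> s a)) - f ((mix K s)(a := \<gamma> s0 a)) =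
       (\<gamma> s a - \<gamma> s0 a) * partial_deriv a f ((mix K s)(a := \<sigma>))"
      by (rule mvt_between[of "\<gamma> s0 a" "\<gamma> s a" "\<lambda>\<sigma>. f ((mix K s)(a := \<sigma>))"
            "\<lambda>\<sigma>. partial_deriv a f ((mix K s)(a := \<sigma>))"],
          rule Ck_coord_has_derivative[OF f a(1) box[OF that]])
    moreover have "(mix K s)(a := \<gamma> s0 a) = mix K s" "(mix K s)(a := \<gamma> s a) = mix (insert a K) s"
      using a by (auto simp: mix_def)
    ultimately show ?thesis by (simp add: Q_def)
  qed
  \<comment> \<open>The choice is meaningful only for \<open>s\<close> near \<open>s0\<close>, where
    the connecting segment lies in \<open>S\<close>; this is enough for a limit.\<close>
  define \<sigma> where "\<sigma> s = (SOME \<sigma>. Q s \<sigma>)" for s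
  have Q\<sigma>: "eventually (\<lambda>s. Q s (\<sigma> s)) (at s0)"
    using near by (rule eventually_mono) (metis Q \<sigma>_def someI_ex)
  define \<xi> where "\<xi> s = (mix K s)(a := \<sigma> s)" for s
  have "((\<lambda>s. partial_deriv a f (\<xi> s)) \<longlongrightarrow> partial_deriv a f (\<gamma> s0)) (at s0)"
  proof (rule tendsto_compose_coord[OF S _ \<gamma>0])
    show "continuous_on S (partial_deriv a f)"
      using Ck_coord_imp_continuous[OF Ck_coord_partial[OF f a(1)] S] .
    show "eventually (\<lambda>s. \<xi> s \<in> S) (at s0)"
      using near Q\<sigma> by eventually_elim (use box in \<open>simp add: \<xi>_def Q_def\<close>)
    fix j assume "j \<in> J"
    consider "j = a" | "j \<noteq> a" "j \<in> K" | "j \<noteq> a" "j \<notin> K" by blast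
    then show "((\<lambda>s. \<xi> s j) \<longlongrightarrow> \<gamma> s0 j) (at s0)"
    proof cases
      case 1
      have "((\<lambda>s. \<bar>\<gamma> s a - \<gamma> s0 a\<bar>) \<longlongrightarrow> 0) (at s0)"
        using lim[OF a(1)] by (simp add: LIM_zero tendsto_rabs_zero)
      then have "((\<lambda>s. \<sigma> s - \<gamma> s0 a) \<longlongrightarrow> 0) (at s0)"
        by (rule Lim_null_comparison[rotated])
           (use Q\<sigma> in \<open>auto simp: Q_def elim: eventually_mono\<close>)
      then show ?thesis using 1 by (simp add: \<xi>_def LIM_zero_cancel)
    next
      case 2
      then show ?thesis using lim[OF \<open>j \<in> J\<close>] by (simp add: \<xi>_def mix_def)
    next
      case 3
      then show ?thesis by (simp add: \<xi>_def mix_def)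
    qed
  qed
  moreover have "((\<lambda>s. (\<gamma> s a - \<gamma> s0 a) / (s - s0)) \<longlongrightarrow> d a) (at s0)"
    using d[OF a(1)] by (simp add: has_field_derivative_iff)
  ultimately have "((\<lambda>s. (\<gamma> s a - \<gamma> s0 a) / (s - s0) * partial_deriv a f (\<xi> s)) \<longlongrightarrow>
      d a * partial_deriv a f (\<gamma> s0)) (at s0)"
    by (intro tendsto_mult)
  moreover have "eventually (\<lambda>s. (\<gamma> s a - \<gamma> s0 a) / (s - s0) * partial_deriv a f (\<xi> s) =
     (f (mix (insert a K) s) - f (mix K s)) / (s - s0)) (at s0)"
    using Q\<sigma> by (rule eventually_mono) (simp add: Q_def \<xi>_def)
  ultimately have "((\<lambda>s. (f (mix (insert a K) s) - f (mix K s)) / (s - s0)) \<longlongrightarrow>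
      d a * partial_deriv a f (\<gamma> s0)) (at s0)"
    by (rule Lim_transform_eventually)
  moreover have "mix K s0 = \<gamma> s0" for K by (simp add: mix_def)
  ultimately have "((\<lambda>s. f (mix (insert a K) s) - f (mix K s)) has_real_derivative
      d a * partial_deriv a f (\<gamma> s0)) (at s0)"
    by (simp add: has_field_derivative_iff)
  from DERIV_add[OF this insert.IH[OF a(3), folded mix_def]]
  show ?case using a insert.hyps by (simp add: mix_def mult.commute)
qed

text \<open>Near \<open>s0\<close> an extensional curve is the same as its version moved only in the
  coordinates of \<open>J\<close>, because all its other coordinates are
  \<open>undefined\<close>.\<close>

lemma coord_chain_rule:
  assumes J: "finite J" and S: "openin (powertop_real J) S" and f: "Ck_coord J (Suc 0) S f"
    and \<gamma>0: "\<gamma> s0 \<in> S" and ext: "eventually (\<lambda>s. \<gamma> s \<in> extensional J) (nhds s0)"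
    and d: "\<And>j. j \<in> J \<Longrightarrow> ((\<lambda>s. \<gamma> s j) has_real_derivative d j) (at s0)"
  shows "((\<lambda>s. f (\<gamma> s)) has_real_derivative (\<Sum>j\<in>J. partial_deriv j f (\<gamma> s0) * d j)) (at s0)"
proof -
  have "eventually (\<lambda>s. f (\<lambda>j. if j \<in> J then \<gamma> s j else \<gamma> s0 j) = f (\<gamma> s)) (nhds s0)"
    using ext
  proof (rule eventually_mono)
    fix s assume "\<gamma> s \<in> extensional J"
    moreover have "\<gamma> s0 \<in> extensional J" using openin_powertop_extensional[OF S \<gamma>0] .
    ultimately have "(\<lambda>j. if j \<in> J then \<gamma> s j else \<gamma> s0 j) = \<gamma> s"
      by (auto simp: extensional_def)
    then show "f (\<lambda>j. if j \<in> J then \<gamma> s j else \<gamma> s0 j) = f (\<gamma> s)" by simp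
  qed
  from DERIV_cong_ev[OF refl this refl]
  show ?thesis using coord_chain_rule_aux[OF J S f \<gamma>0 d subset_refl] by blast
qed

text \<open>Only \<open>f\<close> varies in the induction: a partial derivative of the composite is
  a sum of products of a partial derivative of \<open>f\<close> after \<open>G\<close> with a
  partial derivative of a component of \<open>G\<close>.\<close>

lemma Ck_coord_compose:
  assumes J: "finite J" and S: "openin (powertop_real J) S" and S': "openin (powertop_real J') S'"
    and G: "\<And>x. x \<in> S' \<Longrightarrow> G x \<in> S"
  shows "Ck_coord J k S f \<Longrightarrow> (\<And>j. j \<in> J \<Longrightarrow> Ck_coord J' k S' (\<lambda>x. G x j)) \<Longrightarrow>
    Ck_coord J' k S' (\<lambda>x. f (G x))"
proof (induction k arbitrary: f)
  case 0
  have "continuous_on S' G"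
  proof (rule continuous_on_coordinatewise_then_product)
    fix j
    show "continuous_on S' (\<lambda>x. G x j)"
    proof (cases "j \<in> J")
      case True
      then show ?thesis using 0(2) Ck_coord_imp_continuous S' by blast
    next
      case False
      then have "\<forall>x\<in>S'. G x j = undefined"
        using G openin_powertop_subset[OF S] by (auto simp: PiE_def extensional_def)
      then show ?thesis using continuous_on_cong by (metis continuous_on_const)
    qed
  qed
  then have "continuous_on S' (\<lambda>x. f (G x))"
    using Ck_coord_imp_continuous[OF 0(1) S] G by (metis continuous_on_compose2 image_subsetI)
  then show ?case using continuous_map_powertop_iff[OF openin_powertop_subset[OF S']] by simp
next
  case (Suc k)
  have low: "Ck_coord J k S f" "\<And>j. j \<in> J \<Longrightarrow> Ck_coord J' k S' (\<lambda>x. G x j)"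
    using Suc.prems Ck_coord_lower S S' by blast+
  have C1: "Ck_coord J (Suc 0) S f" using Suc.prems(1)
    by (induction k) (use Ck_coord_lower[OF S] in blast)+
  show ?case
  proof (rule Ck_coord_SucI[OF S'])
    show "continuous_on S' (\<lambda>x. f (G x))"
      using Ck_coord_imp_continuous[OF Suc.IH[OF low] S'] .
    show "((\<lambda>s. f (G (x(a := s)))) has_real_derivative
        (\<Sum>j\<in>J. partial_deriv j f (G x) * partial_deriv a (\<lambda>x. G x j) x)) (at (x a))"
      if "a \<in> J'" "x \<in> S'" for a x
    proof -
      have ev: "eventually (\<lambda>s. G (x(a := s)) \<in> extensional J) (nhds (x a))"
        using eventually_slice[OF S', of x a "x a", unfolded fun_upd_triv, OF that(2,1)]
        by (rule eventually_mono) (use G openin_powertop_subset[OF S] in \<open>auto simp: PiE_def\<close>)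
      have G0: "G (x(a := x a)) \<in> S" using G that by (simp only: fun_upd_triv)
      have d: "((\<lambda>s. G (x(a := s)) j) has_real_derivative partial_deriv a (\<lambda>x. G x j) x) (at (x a))"
        if "j \<in> J" for j
        using Ck_coord_has_derivative_at[OF Suc.prems(2)[OF that] \<open>a \<in> J'\<close> \<open>x \<in> S'\<close>] .
      from coord_chain_rule[OF J S C1 G0 ev d] show ?thesis unfolding fun_upd_triv by blast
    qed
    show "Ck_coord J' k S' (\<lambda>x. \<Sum>j\<in>J. partial_deriv j f (G x) * partial_deriv a (\<lambda>x. G x j) x)"
      if "a \<in> J'" for a
    proof (rule Ck_coord_sum[OF S'])
      fix j assume j: "j \<in> J"
      show "Ck_coord J' k S' (\<lambda>x. partial_deriv j f (G x) * partial_deriv a (\<lambda>x. G x j) x)"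
        using Suc.IH[OF Ck_coord_partial[OF Suc.prems(1) j] low(2)]
          Ck_coord_partial[OF Suc.prems(2)[OF j] that] by (rule Ck_coord_mult[OF S'])
    qed
  qed
qed

section \<open>Hadamard's lemma\<close>

text \<open>The segment from \<open>p\<close> at \<open>t = 0\<close> to \<open>x\<close> at
  \<open>t = 1\<close>, restricted to \<open>J\<close> so that it stays among the extensional
  functions.\<close>

definition coord_contract :: "'j set \<Rightarrow> ('j \<Rightarrow> real) \<Rightarrow> real \<Rightarrow> ('j \<Rightarrow> real) \<Rightarrow> 'j \<Rightarrow> real" where
  "coord_contract J p t x = (\<lambda>j\<in>J. p j + t * (x j - p j))"

lemma coord_contract_in_box:
  assumes "x \<in> coord_box J p e" "t \<in> {0..1}"
  shows "coord_contract J p t x \<in> coord_box J p e"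
proof -
  have "\<bar>t * (x j - p j)\<bar> < e" if "j \<in> J" for j
  proof -
    have "\<bar>t * (x j - p j)\<bar> \<le> \<bar>x j - p j\<bar>"
      using assms(2) by (simp add: abs_mult mult_left_le_one_le)
    then show ?thesis using assms(1) that by (auto simp: coord_box_iff)
  qed
  then show ?thesis using assms(1) by (auto simp: coord_box_iff coord_contract_def)
qed

lemma coord_contract_upd:
  "j \<in> J \<Longrightarrow> coord_contract J p t (x(j := s)) = (coord_contract J p t x)(j := p j + t * (s - p j))"
  by (auto simp: coord_contract_def)

lemma continuous_on_contract:
  fixes F :: "('j \<Rightarrow> real) \<Rightarrow> real"
  assumes J: "finite J" and F: "continuous_on (coord_box J p e) F" and w: "continuous_on {0..1} w"
  shows "continuous_on (coord_box J p e \<times> {0..1}) (\<lambda>(x, t). w t * F (coord_contract J p t x))"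
proof -
  have "continuous_on (coord_box J p e \<times> {0..1}) (\<lambda>z. coord_contract J p (snd z) (fst z))"
  proof (rule continuous_on_coordinatewise_then_product)
    fix j
    have "continuous_on (coord_box J p e \<times> {0..1}) (\<lambda>z. (fst z :: 'j \<Rightarrow> real) j)"
      by (rule continuous_on_product_then_coordinatewise[OF continuous_on_fst[OF continuous_on_id]])
    from continuous_on_add[OF continuous_on_const[of _ "p j"] continuous_on_mult[OF
        continuous_on_snd[OF continuous_on_id] continuous_on_diff[OF this continuous_on_const[of _ "p j"]]]]
    show "continuous_on (coord_box J p e \<times> {0..1}) (\<lambda>z. coord_contract J p (snd z) (fst z) j)"
      by (cases "j \<in> J") (simp_all add: coord_contract_def)
  qed
  from continuous_on_compose2[OF F this]
  have "continuous_on (coord_box J p e \<times> {0..1}) (\<lambda>z. F (coord_contract J p (snd z) (fst z)))"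
    using coord_contract_in_box by fastforce
  moreover have "continuous_on (coord_box J p e \<times> {0..1}) (\<lambda>z. w (snd z))"
    by (rule continuous_on_compose2[OF w continuous_on_snd[OF continuous_on_id]]) auto
  ultimately show ?thesis
    using continuous_on_mult[of "coord_box J p e \<times> {0..1}" "\<lambda>z. w (snd z)"] unfolding split_beta by blast
qed

lemma continuous_on_contract_at:
  fixes F :: "('j \<Rightarrow> real) \<Rightarrow> real"
  assumes J: "finite J" and F: "continuous_on (coord_box J p e) F" and w: "continuous_on {0..1} w"
    and x: "x \<in> coord_box J p e"
  shows "continuous_on {0..1} (\<lambda>t. w t * F (coord_contract J p t x))"
proof -
  have "continuous_on {0..1} (\<lambda>t. (x, t))" by (intro continuous_intros)
  from continuous_on_compose2[OF continuous_on_contract[OF J F w] this] x show ?thesis by auto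
qed

text \<open>Differentiating under the integral in a coordinate of \<open>x\<close> produces a factor
  \<open>t\<close>. The arbitrary weight \<open>w\<close> absorbs these factors in the
  induction.\<close>

lemma Ck_coord_contract_integral:
  assumes J: "finite J" and p: "p \<in> extensional J"
  shows "Ck_coord J k (coord_box J p e) F \<Longrightarrow> continuous_on {0..1} w \<Longrightarrow>
    Ck_coord J k (coord_box J p e) (\<lambda>x. integral {0..1} (\<lambda>t. w t * F (coord_contract J p t x)))"
proof (induction k arbitrary: F w)
  case 0
  let ?B = "coord_box J p e"
  note B = openin_coord_box[OF J, of p e]
  have "continuous_on ?B F" using Ck_coord_imp_continuous[OF 0(1) B] .
  from integral_continuous_on_param[of ?B 0 "1::real", unfolded cbox_interval, OF continuous_on_contract[OF J this 0(2)]]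
  show ?case using continuous_map_powertop_iff[OF openin_powertop_subset[OF B]] by simp
next
  case (Suc k)
  let ?B = "coord_box J p e"
  note B = openin_coord_box[OF J, of p e]
  have cF: "continuous_on ?B F" using Ck_coord_imp_continuous[OF Suc.prems(1) B] .
  show ?case
  proof (rule Ck_coord_SucI[OF B])
    show "continuous_on ?B (\<lambda>x. integral {0..1} (\<lambda>t. w t * F (coord_contract J p t x)))"
      using integral_continuous_on_param[of ?B 0 "1::real", unfolded cbox_interval,
          OF continuous_on_contract[OF J cF Suc.prems(2)]] .
  next
    fix j x assume j: "j \<in> J" and x: "x \<in> ?B"
    let ?U = "{p j - e<..<p j + e}"
    let ?f = "\<lambda>s t. w t * F (coord_contract J p t (x(j := s)))"
    let ?fx = "\<lambda>s t. w t * t * partial_deriv j F (coord_contract J p t (x(j := s)))"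
    have upd: "x(j := s) \<in> ?B" if "s \<in> ?U" for s
      using x j that by (auto simp: coord_box_def PiE_def extensional_def)
    have cw: "continuous_on {0..1} (\<lambda>t. w t * t)" using Suc.prems(2) by (intro continuous_intros)
    have cdF: "continuous_on ?B (partial_deriv j F)"
      using Ck_coord_imp_continuous[OF Ck_coord_partial[OF Suc.prems(1) j] B] .
    \<comment> \<open>The Leibniz rule is applied in the single variable \<open>x j\<close>, which
      ranges over the corresponding open edge \<open>?U\<close> of the cube.\<close>
    have D: "((\<lambda>s. integral {0..1} (?f s)) has_real_derivative integral {0..1} (?fx (x j))) (at (x j) within ?U)"
    proof (rule leibniz_rule_field_derivative[of ?U 0 1 ?f ?fx "x j", unfolded cbox_interval])
      fix s t :: real assume s: "s \<in> ?U" and t: "t \<in> {0..1}"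
      have 1: "(coord_contract J p t x)(j := p j + t * (s - p j)) \<in> ?B"
        using coord_contract_in_box[OF upd[OF s] t] coord_contract_upd[OF j] by metis
      have "((\<lambda>s. p j + t * (s - p j)) has_real_derivative t) (at s)"
        by (auto intro!: derivative_eq_intros)
      from DERIV_chain2[OF Ck_coord_has_derivative[OF Suc.prems(1) j 1] this]
      have "((\<lambda>s. F (coord_contract J p t (x(j := s)))) has_real_derivative
          partial_deriv j F (coord_contract J p t (x(j := s))) * t) (at s)"
        unfolding coord_contract_upd[OF j] .
      from DERIV_cmult[OF this, of "w t"]
      show "((\<lambda>s. ?f s t) has_real_derivative ?fx s t) (at s within ?U)"
        by (simp only: mult.assoc mult.commute[of t] has_field_derivative_at_within)
    next
      fix s assume s: "s \<in> ?U"
      show "?f s integrable_on {0..1}"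
        using continuous_on_contract_at[OF J cF Suc.prems(2) upd[OF s]] by (rule integrable_continuous_interval)
    next
      have "continuous_on (?U \<times> {0..1}) (\<lambda>z. (x(j := fst z), snd z :: real))"
      proof (rule continuous_on_Pair[OF _ continuous_on_snd[OF continuous_on_id]],
          rule continuous_on_coordinatewise_then_product)
        fix i
        show "continuous_on (?U \<times> {0..1::real}) (\<lambda>z. (x(j := fst z)) i)"
          by (cases "i = j") (simp_all add: continuous_on_fst continuous_on_id)
      qed
      from continuous_on_compose2[OF continuous_on_contract[OF J cdF cw] this]
      show "continuous_on (?U \<times> {0..1}) (\<lambda>(s, t). ?fx s t)"
        using upd by (force simp: split_beta)
    next
      show "x j \<in> ?U" using x j by (auto simp: coord_box_def)
    qed (rule convex_real_interval)
    have "x j \<in> ?U" using x j by (auto simp: coord_box_def)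
    then have "at (x j) within ?U = at (x j)" by (rule at_within_open[OF _ open_greaterThanLessThan])
    from D[unfolded this fun_upd_triv]
    show "((\<lambda>s. integral {0..1} (?f s)) has_real_derivative
      integral {0..1} (\<lambda>t. w t * t * partial_deriv j F (coord_contract J p t x))) (at (x j))" .
  next
    fix j assume j: "j \<in> J"
    have cw: "continuous_on {0..1} (\<lambda>t. w t * t)" using Suc.prems(2) by (intro continuous_intros)
    show "Ck_coord J k ?B (\<lambda>x. integral {0..1} (\<lambda>t. w t * t * partial_deriv j F (coord_contract J p t x)))"
      using Suc.IH[OF Ck_coord_partial[OF Suc.prems(1) j] cw] .
  qed
qed

text \<open>Integrating the derivative of \<open>f\<close> along the segment from \<open>p\<close>
  to \<open>x\<close> and pulling the increments x_j - p_j out of the integral leaves the averages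
  \<open>h j\<close> of the partial derivatives. At \<open>x = p\<close> the segment is a point,
  which gives the value of \<open>h j p\<close>.\<close>

lemma hadamard:
  assumes J: "finite J" and p: "p \<in> extensional J" and e: "e > 0"
    and f: "smooth_coord J (coord_box J p e) f"
  obtains h where "\<And>j. j \<in> J \<Longrightarrow> smooth_coord J (coord_box J p e) (h j)"
    and "\<And>x. x \<in> coord_box J p e \<Longrightarrow> f x = f p + (\<Sum>j\<in>J. (x j - p j) * h j x)"
    and "\<And>j. j \<in> J \<Longrightarrow> h j p = partial_deriv j f p"
proof -
  let ?B = "coord_box J p e"
  note B = openin_coord_box[OF J, of p e]
  \<comment> \<open>The factor 1 is the initial weight to which
    \<open>Ck_coord_contract_integral\<close> applies.\<close>
  define h where "h j x = integral {0..1} (\<lambda>t. 1 * partial_deriv j f (coord_contract J p t x))" for j x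
  have C: "Ck_coord J k ?B f" for k using f by (simp add: smooth_coord_def)
  have "smooth_coord J ?B (h j)" if "j \<in> J" for j
    unfolding smooth_coord_def h_def
    using Ck_coord_contract_integral[OF J p Ck_coord_partial[OF C that] continuous_on_const] by blast
  moreover have "f x = f p + (\<Sum>j\<in>J. (x j - p j) * h j x)" if x: "x \<in> ?B" for x
  proof -
    have I1: "((\<lambda>t. \<Sum>j\<in>J. partial_deriv j f (coord_contract J p t x) * (x j - p j)) has_integral
        f (coord_contract J p 1 x) - f (coord_contract J p 0 x)) {0..1}"
    proof (rule fundamental_theorem_of_calculus)
      fix t :: real assume t: "t \<in> {0..1}"
      have "((\<lambda>t. f (coord_contract J p t x)) has_real_derivative
        (\<Sum>j\<in>J. partial_deriv j f (coord_contract J p t x) * (x j - p j))) (at t)"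
      proof (rule coord_chain_rule[OF J B C])
        show "coord_contract J p t x \<in> ?B" using coord_contract_in_box[OF x t] .
        show "eventually (\<lambda>s. coord_contract J p s x \<in> extensional J) (nhds t)"
          by (simp add: coord_contract_def)
        show "((\<lambda>s. coord_contract J p s x j) has_real_derivative x j - p j) (at t)" if "j \<in> J" for j
          using that by (auto simp: coord_contract_def intro!: derivative_eq_intros)
      qed
      then show "((\<lambda>t. f (coord_contract J p t x)) has_vector_derivative
        (\<Sum>j\<in>J. partial_deriv j f (coord_contract J p t x) * (x j - p j))) (at t within {0..1})"
        by (simp add: has_real_derivative_iff_has_vector_derivative has_vector_derivative_at_within)
    qed simp
    have e: "coord_contract J p 1 x = x" "coord_contract J p 0 x = p"
      using x p by (auto simp: coord_contract_def coord_box_iff extensional_def restrict_def)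
    have I2: "((\<lambda>t. \<Sum>j\<in>J. partial_deriv j f (coord_contract J p t x) * (x j - p j)) has_integral
        (\<Sum>j\<in>J. h j x * (x j - p j))) {0..1}"
    proof (rule has_integral_sum[OF J])
      fix j assume j: "j \<in> J"
      have "continuous_on ?B (partial_deriv j f)"
        using Ck_coord_imp_continuous[OF Ck_coord_partial[OF C j] B] .
      from continuous_on_contract_at[OF J this continuous_on_const x, of 1]
      have "((\<lambda>t. 1 * partial_deriv j f (coord_contract J p t x)) has_integral h j x) {0..1}"
        unfolding h_def by (intro integrable_integral integrable_continuous_interval)
      from has_integral_mult_left[OF this, of "x j - p j"]
      show "((\<lambda>t. partial_deriv j f (coord_contract J p t x) * (x j - p j)) has_integral
        h j x * (x j - p j)) {0..1}" by simp
    qed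
    have "f x - f p = (\<Sum>j\<in>J. h j x * (x j - p j))"
      using has_integral_unique[OF I1 I2] unfolding e .
    then show ?thesis by (simp add: mult.commute)
  qed
  moreover have "h j p = partial_deriv j f p" for j
  proof -
    have "coord_contract J p t p = p" for t
      using p by (auto simp: coord_contract_def extensional_def restrict_def)
    then show ?thesis by (simp add: h_def)
  qed
  ultimately show thesis using that by blast
qed

section \<open>Smooth functions, tangent vectors and vector fields\<close>

lemma smooth_coord_cong_imp:
  assumes o: "openin (powertop_real J) S" and f: "smooth_coord J S f" and e: "\<And>x. x \<in> S \<Longrightarrow> f x = g x"
  shows "smooth_coord J S g"
  unfolding smooth_coord_def
proof
  fix k
  have "Ck_coord J k S f" using f unfolding smooth_coord_def by (rule spec)
  from Ck_coord_cong_aux[OF o e this] show "Ck_coord J k S g" .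
qed

lemma smooth_coord_subset:
  assumes "smooth_coord J S f" "S' \<subseteq> S" shows "smooth_coord J S' f"
  using assms(1) Ck_coord_subset[OF assms(2)] unfolding smooth_coord_def by metis

lemma smooth_coord_partial: "smooth_coord J S f \<Longrightarrow> j \<in> J \<Longrightarrow> smooth_coord J S (partial_deriv j f)"
  unfolding smooth_coord_def using Ck_coord_partial by metis

lemma smooth_coord_has_derivative:
  assumes "smooth_coord J S f" "j \<in> J" "x \<in> S"
  shows "((\<lambda>s. f (x(j := s))) has_real_derivative partial_deriv j f x) (at (x j))"
proof -
  have "Ck_coord J (Suc 0) S f" using assms(1) unfolding smooth_coord_def by (rule spec)
  from Ck_coord_has_derivative_at[OF this assms(2,3)] show ?thesis .
qed

lemma smooth_coord_compose:
  assumes "finite J" "openin (powertop_real J) S" "openin (powertop_real J') S'"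
    and "\<And>x. x \<in> S' \<Longrightarrow> G x \<in> S" "smooth_coord J S f"
    and "\<And>j. j \<in> J \<Longrightarrow> smooth_coord J' S' (\<lambda>x. G x j)"
  shows "smooth_coord J' S' (\<lambda>x. f (G x))"
  unfolding smooth_coord_def
proof
  fix k
  show "Ck_coord J' k S' (\<lambda>x. f (G x))"
    by (rule Ck_coord_compose[OF assms(1-4)]) (use assms(5,6) in \<open>simp_all add: smooth_coord_def\<close>)
qed

section \<open>Charts and smooth functions\<close>

text \<open>The chart data of a smooth manifold, isolated so that the same theory of functions and
  fields serves the fibres and, once product charts are checked, the product.\<close>

locale charted_space =
  fixes M :: "('a, 'j) smooth_space"
  assumes finite_idx: "finite (coord_idx M)"
    and chart_open: "\<And>U \<phi>. (U, \<phi>) \<in> atlas M \<Longrightarrow> openin (sp_top M) U"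
    and chart_image: "\<And>U \<phi>. (U, \<phi>) \<in> atlas M \<Longrightarrow> openin (powertop_real (coord_idx M)) (\<phi> ` U)"
    and chart_homeo: "\<And>U \<phi>. (U, \<phi>) \<in> atlas M \<Longrightarrow>
      homeomorphic_map (subtopology (sp_top M) U) (subtopology (powertop_real (coord_idx M)) (\<phi> ` U)) \<phi>"
    and chart_cover: "\<And>p. p \<in> points M \<Longrightarrow> \<exists>U \<phi>. (U, \<phi>) \<in> atlas M \<and> p \<in> U"
    and chart_transition: "\<And>U \<phi> V \<psi> j. (U, \<phi>) \<in> atlas M \<Longrightarrow> (V, \<psi>) \<in> atlas M \<Longrightarrow> j \<in> coord_idx M \<Longrightarrow>
      smooth_coord (coord_idx M) (\<phi> ` (U \<inter> V)) (\<lambda>x. \<psi> (inv_into U \<phi> x) j)"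

lemma smooth_manifold_charted: "smooth_manifold M \<Longrightarrow> charted_space M"
proof (rule charted_space.intro)
  assume M: "smooth_manifold M"
  note M' = M[unfolded smooth_manifold_def]
  show "finite (coord_idx M)" using M' by (elim conjE)
  have 1: "\<forall>(U, \<phi>)\<in>atlas M.
        openin (sp_top M) U \<and> openin (powertop_real (coord_idx M)) (\<phi> ` U) \<and>
        homeomorphic_map (subtopology (sp_top M) U)
                         (subtopology (powertop_real (coord_idx M)) (\<phi> ` U)) \<phi>"
    using M' by (elim conjE)
  show "openin (sp_top M) U" "openin (powertop_real (coord_idx M)) (\<phi> ` U)"
    "homeomorphic_map (subtopology (sp_top M) U)
                         (subtopology (powertop_real (coord_idx M)) (\<phi> ` U)) \<phi>"
    if "(U, \<phi>) \<in> atlas M" for U \<phi> using bspec[OF 1 that] by simp_all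
  have 2: "(\<Union>(U, \<phi>)\<in>atlas M. U) = points M" using M' by (elim conjE)
  show "\<exists>U \<phi>. (U, \<phi>) \<in> atlas M \<and> p \<in> U" if "p \<in> points M" for p
    using that unfolding 2[symmetric] by blast
  have 3: "\<forall>(U, \<phi>)\<in>atlas M. \<forall>(V, \<psi>)\<in>atlas M. \<forall>j\<in>coord_idx M.
        smooth_coord (coord_idx M) (\<phi> ` (U \<inter> V)) (\<lambda>x. \<psi> (inv_into U \<phi> x) j)"
    using M' by (elim conjE)
  show "smooth_coord (coord_idx M) (\<phi> ` (U \<inter> V)) (\<lambda>x. \<psi> (inv_into U \<phi> x) j)"
    if "(U, \<phi>) \<in> atlas M" "(V, \<psi>) \<in> atlas M" "j \<in> coord_idx M" for U \<phi> V \<psi> j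
    using bspec[OF 3 that(1)] that(2,3) by auto
qed

context charted_space
begin

abbreviation "J \<equiv> coord_idx M"
abbreviation "mopen \<equiv> openin (sp_top M)"

lemma mopen_points: "mopen W \<Longrightarrow> p \<in> W \<Longrightarrow> p \<in> points M"
  unfolding points_def using openin_subset by blast

lemma chart_inj: "(U, \<phi>) \<in> atlas M \<Longrightarrow> inj_on \<phi> U"
  using homeomorphic_imp_injective_map[OF chart_homeo] openin_subset[OF chart_open]
  by (simp add: Int_absorb1)

lemma chart_inv: "(U, \<phi>) \<in> atlas M \<Longrightarrow> p \<in> U \<Longrightarrow> inv_into U \<phi> (\<phi> p) = p"
  using chart_inj inv_into_f_f by metis

lemma chart_image_open:
  assumes A: "(U, \<phi>) \<in> atlas M" and V: "mopen V" "V \<subseteq> U"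
  shows "openin (powertop_real J) (\<phi> ` V)"
proof -
  have "openin (subtopology (sp_top M) U) V"
    using V openin_open_subtopology[OF chart_open[OF A]] by simp
  then have "openin (subtopology (powertop_real J) (\<phi> ` U)) (\<phi> ` V)"
    using homeomorphic_imp_open_map[OF chart_homeo[OF A]] by (auto simp: open_map_def)
  then show ?thesis using openin_trans_full chart_image[OF A] by blast
qed

lemma chart_preimage_open:
  assumes A: "(U, \<phi>) \<in> atlas M" and S: "openin (powertop_real J) S"
  shows "mopen {p \<in> U. \<phi> p \<in> S}"
proof -
  have "continuous_map (subtopology (sp_top M) U) (powertop_real J) \<phi>"
    using homeomorphic_imp_continuous_map[OF chart_homeo[OF A]] continuous_map_in_subtopology by blast
  from openin_continuous_map_preimage[OF this S]
  have "openin (subtopology (sp_top M) U) {p \<in> U. \<phi> p \<in> S}"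
    using openin_subset[OF chart_open[OF A]] by (simp add: Int_absorb1)
  then show ?thesis using openin_trans_full chart_open[OF A] by blast
qed

lemma smooth_on_open: "smooth_on M W f \<Longrightarrow> mopen W"
  by (simp add: smooth_on_def)

lemma smooth_on_chart:
  "smooth_on M W f \<Longrightarrow> (U, \<phi>) \<in> atlas M \<Longrightarrow> smooth_coord J (\<phi> ` (U \<inter> W)) (\<lambda>x. f (inv_into U \<phi> x))"
  by (auto simp: smooth_on_def)

lemma smooth_onI:
  assumes "mopen W"
    and "\<And>U \<phi>. (U, \<phi>) \<in> atlas M \<Longrightarrow> openin (powertop_real J) (\<phi> ` (U \<inter> W)) \<Longrightarrow>
      smooth_coord J (\<phi> ` (U \<inter> W)) (\<lambda>x. f (inv_into U \<phi> x))"
  shows "smooth_on M W f"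
  using assms chart_image_open[OF _ openin_Int[OF chart_open assms(1)]]
  unfolding smooth_on_def by fastforce

lemma smooth_on_subset:
  assumes "smooth_on M W f" "mopen V" "V \<subseteq> W" shows "smooth_on M V f"
proof (rule smooth_onI[OF assms(2)])
  fix U \<phi> assume "(U, \<phi>) \<in> atlas M"
  from smooth_on_chart[OF assms(1) this] show "smooth_coord J (\<phi> ` (U \<inter> V)) (\<lambda>x. f (inv_into U \<phi> x))"
    by (rule smooth_coord_subset) (use assms(3) in blast)
qed

lemma smooth_on_cong:
  assumes "smooth_on M W f" "\<And>p. p \<in> W \<Longrightarrow> f p = g p" shows "smooth_on M W g"
proof (rule smooth_onI[OF smooth_on_open[OF assms(1)]])
  fix U \<phi> assume A: "(U, \<phi>) \<in> atlas M" and o: "openin (powertop_real J) (\<phi> ` (U \<inter> W))"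
  have "f (inv_into U \<phi> x) = g (inv_into U \<phi> x)" if "x \<in> \<phi> ` (U \<inter> W)" for x
    using that assms(2) chart_inv[OF A] by auto
  then show "smooth_coord J (\<phi> ` (U \<inter> W)) (\<lambda>x. g (inv_into U \<phi> x))"
    by (rule smooth_coord_cong_imp[OF o smooth_on_chart[OF assms(1) A]])
qed

lemma smooth_on_local:
  assumes W: "mopen W" and "\<And>p. p \<in> W \<Longrightarrow> \<exists>V. p \<in> V \<and> smooth_on M V f"
  shows "smooth_on M W f"
proof (rule smooth_onI[OF W])
  fix U \<phi> assume A: "(U, \<phi>) \<in> atlas M" and o: "openin (powertop_real J) (\<phi> ` (U \<inter> W))"
  show "smooth_coord J (\<phi> ` (U \<inter> W)) (\<lambda>x. f (inv_into U \<phi> x))"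
    unfolding smooth_coord_def
  proof (intro allI Ck_coord_local[OF o])
    fix k x assume "x \<in> \<phi> ` (U \<inter> W)"
    then obtain p where p: "p \<in> U" "p \<in> W" "x = \<phi> p" by blast
    obtain V where V: "p \<in> V" "smooth_on M V f" using assms(2)[OF p(2)] by blast
    have "openin (powertop_real J) (\<phi> ` (U \<inter> V))"
      using chart_image_open[OF A openin_Int[OF chart_open[OF A] smooth_on_open[OF V(2)]]] by simp
    moreover have "Ck_coord J k (\<phi> ` (U \<inter> V)) (\<lambda>x. f (inv_into U \<phi> x))"
      using smooth_on_chart[OF V(2) A] by (simp add: smooth_coord_def)
    ultimately show "\<exists>T. x \<in> T \<and> openin (powertop_real J) T \<and> Ck_coord J k T (\<lambda>x. f (inv_into U \<phi> x))"
      using p V(1) by (intro exI[of _ "\<phi> ` (U \<inter> V)"] conjI) auto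
  qed
qed

text \<open>One chart suffices, because the expression in any other chart arises from this one by
  composition with a smooth transition map.\<close>

lemma smooth_on_in_chart:
  assumes A: "(U, \<phi>) \<in> atlas M" and W: "mopen W" "W \<subseteq> U"
    and f: "smooth_coord J (\<phi> ` W) (\<lambda>x. f (inv_into U \<phi> x))"
  shows "smooth_on M W f"
proof (rule smooth_onI[OF W(1)])
  fix V \<psi> assume B: "(V, \<psi>) \<in> atlas M" and o: "openin (powertop_real J) (\<psi> ` (V \<inter> W))"
  have "smooth_coord J (\<psi> ` (V \<inter> W)) (\<lambda>y. f (inv_into U \<phi> (\<phi> (inv_into V \<psi> y))))"
  proof (rule smooth_coord_compose[OF finite_idx chart_image_open[OF A W] o _ f])
    show "\<phi> (inv_into V \<psi> x) \<in> \<phi> ` W" if "x \<in> \<psi> ` (V \<inter> W)" for x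
      using that chart_inv[OF B] by auto
    show "smooth_coord J (\<psi> ` (V \<inter> W)) (\<lambda>x. \<phi> (inv_into V \<psi> x) j)" if "j \<in> J" for j
      by (rule smooth_coord_subset[OF chart_transition[OF B A that]]) (use W(2) in blast)
  qed
  moreover have "f (inv_into U \<phi> (\<phi> (inv_into V \<psi> y))) = f (inv_into V \<psi> y)" if "y \<in> \<psi> ` (V \<inter> W)" for y
    using that chart_inv[OF B] chart_inv[OF A] W(2) by auto
  ultimately show "smooth_coord J (\<psi> ` (V \<inter> W)) (\<lambda>y. f (inv_into V \<psi> y))"
    by (rule smooth_coord_cong_imp[OF o])
qed

lemma smooth_on_const: "mopen W \<Longrightarrow> smooth_on M W (\<lambda>p. c)"
  by (rule smooth_onI) (simp_all add: smooth_coord_def Ck_coord_const)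

lemma smooth_on_add:
  assumes "smooth_on M W f" "smooth_on M W g" shows "smooth_on M W (\<lambda>p. f p + g p)"
  by (rule smooth_onI[OF smooth_on_open[OF assms(1)]])
    (use smooth_on_chart[OF assms(1)] smooth_on_chart[OF assms(2)] in \<open>simp add: smooth_coord_def Ck_coord_add\<close>)

lemma smooth_on_mult:
  assumes "smooth_on M W f" "smooth_on M W g" shows "smooth_on M W (\<lambda>p. f p * g p)"
  by (rule smooth_onI[OF smooth_on_open[OF assms(1)]])
    (use smooth_on_chart[OF assms(1)] smooth_on_chart[OF assms(2)] in \<open>simp add: smooth_coord_def Ck_coord_mult\<close>)

lemma smooth_on_cmult: "smooth_on M W f \<Longrightarrow> smooth_on M W (\<lambda>p. c * f p)"
  using smooth_on_mult[OF smooth_on_const] smooth_on_open by blast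

lemma smooth_on_minus: "smooth_on M W f \<Longrightarrow> smooth_on M W (\<lambda>p. - f p)"
  using smooth_on_cmult[of W f "-1"] by simp

lemma smooth_on_diff: "smooth_on M W f \<Longrightarrow> smooth_on M W g \<Longrightarrow> smooth_on M W (\<lambda>p. f p - g p)"
  using smooth_on_add[OF _ smooth_on_minus, of W f g] by simp

lemma smooth_on_sum:
  "mopen W \<Longrightarrow> (\<And>i. i \<in> A \<Longrightarrow> smooth_on M W (f i)) \<Longrightarrow> smooth_on M W (\<lambda>p. \<Sum>i\<in>A. f i p)"
  by (induction A rule: infinite_finite_induct) (simp_all add: smooth_on_const smooth_on_add)

lemma smooth_on_powr:
  assumes "smooth_on M W f" "\<And>p. p \<in> W \<Longrightarrow> f p > 0" shows "smooth_on M W (\<lambda>p. f p powr r)"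
proof (rule smooth_onI[OF smooth_on_open[OF assms(1)]])
  fix U \<phi> assume A: "(U, \<phi>) \<in> atlas M" and o: "openin (powertop_real J) (\<phi> ` (U \<inter> W))"
  show "smooth_coord J (\<phi> ` (U \<inter> W)) (\<lambda>x. f (inv_into U \<phi> x) powr r)"
    unfolding smooth_coord_def
  proof (intro allI Ck_coord_powr[OF o])
    show "Ck_coord J k (\<phi> ` (U \<inter> W)) (\<lambda>x. f (inv_into U \<phi> x))" for k
      using smooth_on_chart[OF assms(1) A] by (simp add: smooth_coord_def)
    show "f (inv_into U \<phi> x) > 0" if "x \<in> \<phi> ` (U \<inter> W)" for x
      using that assms(2) chart_inv[OF A] by auto
  qed
qed

lemma smooth_on_compose_real:
  assumes "smooth_on M W f" "\<And>p. p \<in> W \<Longrightarrow> f p \<in> I" "smooth_fun_on I b"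
  shows "smooth_on M W (\<lambda>p. b (f p))"
proof (rule smooth_onI[OF smooth_on_open[OF assms(1)]])
  fix U \<phi> assume A: "(U, \<phi>) \<in> atlas M" and o: "openin (powertop_real J) (\<phi> ` (U \<inter> W))"
  show "smooth_coord J (\<phi> ` (U \<inter> W)) (\<lambda>x. b (f (inv_into U \<phi> x)))"
    unfolding smooth_coord_def
  proof (intro allI Ck_coord_compose_real[OF o _ _ assms(3)])
    show "Ck_coord J k (\<phi> ` (U \<inter> W)) (\<lambda>x. f (inv_into U \<phi> x))" for k
      using smooth_on_chart[OF assms(1) A] by (simp add: smooth_coord_def)
    show "f (inv_into U \<phi> x) \<in> I" if "x \<in> \<phi> ` (U \<inter> W)" for x
      using that assms(2) chart_inv[OF A] by auto
  qed
qed

lemma smooth_on_indicator: "mopen W \<Longrightarrow> smooth_on M W (\<lambda>p. if p \<in> W then 1 else 0)"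
  by (rule smooth_on_cong[OF smooth_on_const[of W 1]]) auto

lemma smooth_on_coordinate:
  assumes A: "(U, \<phi>) \<in> atlas M" and "j \<in> J"
  shows "smooth_on M U (\<lambda>p. \<phi> p j)"
proof (rule smooth_on_in_chart[OF A chart_open[OF A] subset_refl])
  have "\<phi> (inv_into U \<phi> x) j = x j" if "x \<in> \<phi> ` U" for x using that by (simp add: f_inv_into_f)
  then show "smooth_coord J (\<phi> ` U) (\<lambda>x. \<phi> (inv_into U \<phi> x) j)"
    using smooth_coord_cong_imp[OF chart_image[OF A], of "\<lambda>x. x j" "\<lambda>x. \<phi> (inv_into U \<phi> x) j"]
      Ck_coord_coordinate[OF chart_image[OF A] assms(2)] by (simp add: smooth_coord_def)
qed

text \<open>Continuity of smooth functions, in the form that keeps a squared length positive on a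
  neighbourhood during orthonormalisation.\<close>

lemma smooth_on_preimage_open:
  assumes f: "smooth_on M W f" and O: "open O'"
  shows "mopen {p \<in> W. f p \<in> O'}"
proof (subst openin_subopen, intro ballI)
  fix p assume p: "p \<in> {p \<in> W. f p \<in> O'}"
  then obtain U \<phi> where A: "(U, \<phi>) \<in> atlas M" "p \<in> U"
    using chart_cover mopen_points[OF smooth_on_open[OF f]] by blast
  let ?S = "\<phi> ` (U \<inter> W)"
  have S: "openin (powertop_real J) ?S"
    using chart_image_open[OF A(1) openin_Int[OF chart_open[OF A(1)] smooth_on_open[OF f]]] by simp
  have "Ck_coord J 0 ?S (\<lambda>x. f (inv_into U \<phi> x))"
    using smooth_on_chart[OF f A(1)] unfolding smooth_coord_def by blast
  then have "continuous_map (subtopology (powertop_real J) ?S) euclideanreal (\<lambda>x. f (inv_into U \<phi> x))"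
    by simp
  from openin_continuous_map_preimage[OF this, of O'] O
  have "openin (subtopology (powertop_real J) ?S)
      {x \<in> topspace (subtopology (powertop_real J) ?S). f (inv_into U \<phi> x) \<in> O'}" by simp
  moreover have "topspace (subtopology (powertop_real J) ?S) = ?S"
    using openin_subset[OF S] by (simp add: Int_absorb1)
  ultimately have "openin (subtopology (powertop_real J) ?S) {x \<in> ?S. f (inv_into U \<phi> x) \<in> O'}"
    by (simp only:)
  then have "openin (powertop_real J) {x \<in> ?S. f (inv_into U \<phi> x) \<in> O'}"
    using openin_trans_full[OF _ S] by blast
  from chart_preimage_open[OF A(1) this]
  have "mopen {q \<in> U. \<phi> q \<in> ?S \<and> f (inv_into U \<phi> (\<phi> q)) \<in> O'}" by simp
  moreover have "{q \<in> U. \<phi> q \<in> ?S \<and> f (inv_into U \<phi> (\<phi> q)) \<in> O'} = {q \<in> U \<inter> W. f q \<in> O'}"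
  proof (rule Collect_cong)
    fix q
    show "q \<in> U \<and> \<phi> q \<in> ?S \<and> f (inv_into U \<phi> (\<phi> q)) \<in> O' \<longleftrightarrow> q \<in> U \<inter> W \<and> f q \<in> O'"
      using chart_inv[OF A(1), of q] inj_on_image_mem_iff[OF chart_inj[OF A(1)], of q "U \<inter> W"]
      by (cases "q \<in> U") simp_all
  qed
  ultimately show "\<exists>T. mopen T \<and> p \<in> T \<and> T \<subseteq> {p \<in> W. f p \<in> O'}"
    using p A(2) by (intro exI[of _ "{q \<in> U \<inter> W. f q \<in> O'}"]) auto
qed

lemma smooth_nearI: "smooth_on M W f \<Longrightarrow> p \<in> W \<Longrightarrow> smooth_near M p f"
  unfolding smooth_near_def by blast

lemma smooth_nearE:
  assumes "smooth_near M p f" obtains W where "smooth_on M W f" "p \<in> W"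
  using assms unfolding smooth_near_def by blast

lemma smooth_near_cong_imp:
  assumes "mopen W" "p \<in> W" "\<And>q. q \<in> W \<Longrightarrow> f q = g q" "smooth_near M p f"
  shows "smooth_near M p g"
proof -
  obtain V where V: "smooth_on M V f" "p \<in> V" using assms(4) by (rule smooth_nearE)
  have "smooth_on M (V \<inter> W) f"
    using smooth_on_subset[OF V(1) openin_Int[OF smooth_on_open[OF V(1)] assms(1)]] by simp
  then have "smooth_on M (V \<inter> W) g" by (rule smooth_on_cong) (use assms(3) in auto)
  then show ?thesis using V(2) assms(2) smooth_nearI by blast
qed

lemma smooth_near_cong:
  assumes "mopen W" "p \<in> W" "\<And>q. q \<in> W \<Longrightarrow> f q = g q"
  shows "smooth_near M p f \<longleftrightarrow> smooth_near M p g"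
  using smooth_near_cong_imp[OF assms(1,2), of f g] smooth_near_cong_imp[OF assms(1,2), of g f] assms(3) by auto

lemma smooth_near_const: "p \<in> points M \<Longrightarrow> smooth_near M p (\<lambda>q. c)"
  by (rule smooth_nearI[of "points M"]) (auto simp: points_def intro: smooth_on_const)

lemma smooth_near_binary:
  assumes "smooth_near M p f" "smooth_near M p g"
    and "\<And>W. smooth_on M W f \<Longrightarrow> smooth_on M W g \<Longrightarrow> smooth_on M W h"
  shows "smooth_near M p h"
proof -
  obtain V where V: "smooth_on M V f" "p \<in> V" using assms(1) by (rule smooth_nearE)
  obtain W where W: "smooth_on M W g" "p \<in> W" using assms(2) by (rule smooth_nearE)
  have o: "mopen (V \<inter> W)" using V W smooth_on_open by blast
  have "smooth_on M (V \<inter> W) f" "smooth_on M (V \<inter> W) g"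
    using smooth_on_subset[OF V(1) o] smooth_on_subset[OF W(1) o] by auto
  from assms(3)[OF this] show ?thesis using V(2) W(2) smooth_nearI by blast
qed

lemma smooth_near_add: "smooth_near M p f \<Longrightarrow> smooth_near M p g \<Longrightarrow> smooth_near M p (\<lambda>q. f q + g q)"
  using smooth_near_binary smooth_on_add by blast

lemma smooth_near_mult: "smooth_near M p f \<Longrightarrow> smooth_near M p g \<Longrightarrow> smooth_near M p (\<lambda>q. f q * g q)"
  using smooth_near_binary smooth_on_mult by blast

lemma smooth_near_cmult: "smooth_near M p f \<Longrightarrow> smooth_near M p (\<lambda>q. c * f q)"
  unfolding smooth_near_def using smooth_on_cmult by blast

lemma smooth_near_sum:
  "p \<in> points M \<Longrightarrow> (\<And>i. i \<in> A \<Longrightarrow> smooth_near M p (f i)) \<Longrightarrow> smooth_near M p (\<lambda>q. \<Sum>i\<in>A. f i q)"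
  by (induction A rule: infinite_finite_induct) (simp_all add: smooth_near_const smooth_near_add)

section \<open>Tangent vectors as derivations\<close>

lemma tangentI:
  assumes "\<And>f. \<not> smooth_near M p f \<Longrightarrow> v f = 0"
    and "\<And>c f. smooth_near M p f \<Longrightarrow> v (\<lambda>q. c * f q) = c * v f"
    and "\<And>f h. smooth_near M p f \<Longrightarrow> smooth_near M p h \<Longrightarrow> v (\<lambda>q. f q + h q) = v f + v h"
    and "\<And>f h. smooth_near M p f \<Longrightarrow> smooth_near M p h \<Longrightarrow> v (\<lambda>q. f q * h q) = v f * h p + f p * v h"
  shows "v \<in> tangent_space M p"
  unfolding tangent_space_def using assms by blast

lemma tangent_nonsmooth: "v \<in> tangent_space M p \<Longrightarrow> \<not> smooth_near M p f \<Longrightarrow> v f = 0"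
  unfolding tangent_space_def by blast

lemma tangent_cmult: "v \<in> tangent_space M p \<Longrightarrow> smooth_near M p f \<Longrightarrow> v (\<lambda>q. c * f q) = c * v f"
  unfolding tangent_space_def by blast

lemma tangent_add:
  "v \<in> tangent_space M p \<Longrightarrow> smooth_near M p f \<Longrightarrow> smooth_near M p h \<Longrightarrow> v (\<lambda>q. f q + h q) = v f + v h"
  unfolding tangent_space_def by blast

lemma tangent_mult:
  "v \<in> tangent_space M p \<Longrightarrow> smooth_near M p f \<Longrightarrow> smooth_near M p h \<Longrightarrow>
    v (\<lambda>q. f q * h q) = v f * h p + f p * v h"
  unfolding tangent_space_def by blast

text \<open>An indicator of a neighbourhood is idempotent, so derivations vanish on it; this makes
  derivations local without any bump functions.\<close>

lemma tangent_indicator: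
  assumes "v \<in> tangent_space M p" "mopen W" "p \<in> W"
  shows "v (\<lambda>q. if q \<in> W then 1 else 0) = 0"
proof -
  let ?i = "\<lambda>q. if q \<in> W then 1 else (0::real)"
  have s: "smooth_near M p ?i" using smooth_on_indicator assms smooth_nearI by blast
  have "(\<lambda>q. ?i q * ?i q) = ?i" by auto
  with tangent_mult[OF assms(1) s s] assms(3) show ?thesis by simp
qed

text \<open>By the Leibniz rule multiplication with the indicator of \<open>W\<close> does not
  change the derivative at a point of \<open>W\<close>. After multiplication both functions are
  equal everywhere, so the derivation cannot tell them apart.\<close>

lemma tangent_cong:
  assumes v: "v \<in> tangent_space M p" and W: "mopen W" "p \<in> W" and e: "\<And>q. q \<in> W \<Longrightarrow> f q = g q"
  shows "v f = v g"
proof (cases "smooth_near M p f")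
  case False
  then show ?thesis using tangent_nonsmooth[OF v] smooth_near_cong[OF W, of f g] e by metis
next
  case True
  then have g: "smooth_near M p g" using smooth_near_cong[OF W, of f g] e by metis
  let ?i = "\<lambda>q. if q \<in> W then 1 else (0::real)"
  have s: "smooth_near M p ?i" using smooth_on_indicator W smooth_nearI by blast
  have "v (\<lambda>q. f q * ?i q) = v f" "v (\<lambda>q. g q * ?i q) = v g"
    using tangent_mult[OF v True s] tangent_mult[OF v g s] tangent_indicator[OF v W] W(2) by simp_all
  moreover have "(\<lambda>q. f q * ?i q) = (\<lambda>q. g q * ?i q)" using e by auto
  ultimately show ?thesis by metis
qed

lemma tangent_const:
  assumes "v \<in> tangent_space M p" "p \<in> points M" shows "v (\<lambda>q. c) = 0"
proof -
  have s: "smooth_near M p (\<lambda>q. 1)" using smooth_near_const assms(2) .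
  have "v (\<lambda>q. 1) = 0" using tangent_mult[OF assms(1) s s] by simp
  then show ?thesis using tangent_cmult[OF assms(1) s, of c] by simp
qed

lemma tangent_sum:
  assumes v: "v \<in> tangent_space M p" and p: "p \<in> points M"
  shows "(\<And>i. i \<in> A \<Longrightarrow> smooth_near M p (f i)) \<Longrightarrow> v (\<lambda>q. \<Sum>i\<in>A. f i q) = (\<Sum>i\<in>A. v (f i))"
  by (induction A rule: infinite_finite_induct)
    (simp_all add: tangent_const[OF v p] tangent_add[OF v] smooth_near_sum[OF p])

lemma tangent_space_zero: "(\<lambda>f. 0) \<in> tangent_space M p"
  by (rule tangentI) auto

lemma tangent_space_add:
  "u \<in> tangent_space M p \<Longrightarrow> v \<in> tangent_space M p \<Longrightarrow> (\<lambda>f. u f + v f) \<in> tangent_space M p"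
  by (rule tangentI)
    (simp_all add: tangent_nonsmooth tangent_cmult tangent_add tangent_mult algebra_simps)

lemma tangent_space_scale: "v \<in> tangent_space M p \<Longrightarrow> (\<lambda>f. c * v f) \<in> tangent_space M p"
  by (rule tangentI)
    (simp_all add: tangent_nonsmooth tangent_cmult tangent_add tangent_mult algebra_simps)

lemma tangent_space_sum:
  "(\<And>i. i \<in> A \<Longrightarrow> v i \<in> tangent_space M p) \<Longrightarrow> (\<lambda>f. \<Sum>i\<in>A. c i * v i f) \<in> tangent_space M p"
  by (induction A rule: infinite_finite_induct)
    (simp_all add: tangent_space_zero tangent_space_add tangent_space_scale)

text \<open>The default value 0 on functions that are not smooth near the point is the one that
  \<open>tangent_space\<close> prescribes; without it this would not be an element of that
  space.\<close>

definition coord_vec :: "'a set \<Rightarrow> ('a \<Rightarrow> 'j \<Rightarrow> real) \<Rightarrow> 'j \<Rightarrow> 'a vfield" where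
  "coord_vec U \<phi> j p f =
     (if smooth_near M p f then partial_deriv j (\<lambda>x. f (inv_into U \<phi> x)) (\<phi> p) else 0)"

lemma coord_vec_derivative:
  assumes A: "(U, \<phi>) \<in> atlas M" "p \<in> U" "j \<in> J" and f: "smooth_near M p f"
  shows "((\<lambda>s. f (inv_into U \<phi> ((\<phi> p)(j := s)))) has_real_derivative coord_vec U \<phi> j p f) (at (\<phi> p j))"
proof -
  obtain W where W: "smooth_on M W f" "p \<in> W" using f by (rule smooth_nearE)
  have "\<phi> p \<in> \<phi> ` (U \<inter> W)" using A W by blast
  from smooth_coord_has_derivative[OF smooth_on_chart[OF W(1) A(1)] A(3) this]
  show ?thesis using f by (simp add: coord_vec_def)
qed

lemma coord_vec_eqI:
  assumes A: "(U, \<phi>) \<in> atlas M" "p \<in> U" "j \<in> J" and f: "smooth_near M p f"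
    and "((\<lambda>s. f (inv_into U \<phi> ((\<phi> p)(j := s)))) has_real_derivative d) (at (\<phi> p j))"
  shows "coord_vec U \<phi> j p f = d"
  using DERIV_unique[OF coord_vec_derivative[OF A f] assms(5)] .

lemma coord_vec_tangent:
  assumes A: "(U, \<phi>) \<in> atlas M" "p \<in> U" "j \<in> J"
  shows "coord_vec U \<phi> j p \<in> tangent_space M p"
proof (rule tangentI)
  show "coord_vec U \<phi> j p f = 0" if "\<not> smooth_near M p f" for f
    using that by (simp add: coord_vec_def)
  note d = coord_vec_derivative[OF A]
  fix c f assume f: "smooth_near M p f"
  show "coord_vec U \<phi> j p (\<lambda>q. c * f q) = c * coord_vec U \<phi> j p f"
    by (rule coord_vec_eqI[OF A smooth_near_cmult[OF f] DERIV_cmult[OF d[OF f]]])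
next
  note d = coord_vec_derivative[OF A]
  fix f h assume f: "smooth_near M p f" and h: "smooth_near M p h"
  show "coord_vec U \<phi> j p (\<lambda>q. f q + h q) = coord_vec U \<phi> j p f + coord_vec U \<phi> j p h"
    by (rule coord_vec_eqI[OF A smooth_near_add[OF f h] DERIV_add[OF d[OF f] d[OF h]]])
  have "coord_vec U \<phi> j p (\<lambda>q. f q * h q) = coord_vec U \<phi> j p f * h (inv_into U \<phi> ((\<phi> p)(j := \<phi> p j)))
      + coord_vec U \<phi> j p h * f (inv_into U \<phi> ((\<phi> p)(j := \<phi> p j)))"
    by (rule coord_vec_eqI[OF A smooth_near_mult[OF f h] DERIV_mult[OF d[OF f] d[OF h]]])
  then show "coord_vec U \<phi> j p (\<lambda>q. f q * h q) = coord_vec U \<phi> j p f * h p + f p * coord_vec U \<phi> j p h"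
    unfolding fun_upd_triv chart_inv[OF A(1,2)] by (simp add: mult.commute)
qed

section \<open>Vector fields, coordinate expansion and Lie brackets\<close>

lemma vector_fieldI:
  assumes "mopen W" "\<And>p. p \<in> W \<Longrightarrow> X p \<in> tangent_space M p"
    and "\<And>V f. V \<subseteq> W \<Longrightarrow> smooth_on M V f \<Longrightarrow> smooth_on M V (\<lambda>p. X p f)"
  shows "vector_field M W X"
  using assms unfolding vector_field_def by blast

lemma vf_open: "vector_field M W X \<Longrightarrow> mopen W"
  unfolding vector_field_def by blast

lemma vf_points: "vector_field M W X \<Longrightarrow> p \<in> W \<Longrightarrow> p \<in> points M"
  using vf_open mopen_points by blast

lemma vf_tangent: "vector_field M W X \<Longrightarrow> p \<in> W \<Longrightarrow> X p \<in> tangent_space M p"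
  unfolding vector_field_def by blast

lemma vf_smooth: "vector_field M W X \<Longrightarrow> V \<subseteq> W \<Longrightarrow> smooth_on M V f \<Longrightarrow> smooth_on M V (\<lambda>p. X p f)"
  unfolding vector_field_def by blast

lemma vf_smooth_near:
  assumes "vector_field M W X" "p \<in> W" "smooth_near M p f"
  shows "smooth_near M p (\<lambda>q. X q f)"
proof -
  obtain V where V: "smooth_on M V f" "p \<in> V" using assms(3) by (rule smooth_nearE)
  have "smooth_on M (V \<inter> W) f"
    using smooth_on_subset[OF V(1) openin_Int[OF smooth_on_open[OF V(1)] vf_open[OF assms(1)]]] by simp
  from vf_smooth[OF assms(1) _ this] have "smooth_on M (V \<inter> W) (\<lambda>p. X p f)" by simp
  then show ?thesis using V(2) assms(2) smooth_nearI by blast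
qed

lemma vf_subset: "vector_field M W X \<Longrightarrow> mopen V \<Longrightarrow> V \<subseteq> W \<Longrightarrow> vector_field M V X"
  unfolding vector_field_def by blast

lemma vf_cong:
  assumes "vector_field M W X" "\<And>p. p \<in> W \<Longrightarrow> X p = Y p" shows "vector_field M W Y"
proof (rule vector_fieldI[OF vf_open[OF assms(1)]])
  show "Y p \<in> tangent_space M p" if "p \<in> W" for p using vf_tangent[OF assms(1) that] assms(2)[OF that] by simp
  fix V f assume V: "V \<subseteq> W" "smooth_on M V f"
  from vf_smooth[OF assms(1) V] show "smooth_on M V (\<lambda>p. Y p f)"
    by (rule smooth_on_cong) (use assms(2) V in auto)
qed

lemma vf_local:
  assumes W: "mopen W" and l: "\<And>p. p \<in> W \<Longrightarrow> \<exists>V. p \<in> V \<and> vector_field M V X"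
  shows "vector_field M W X"
proof (rule vector_fieldI[OF W])
  show "X p \<in> tangent_space M p" if "p \<in> W" for p using l[OF that] vf_tangent by blast
  fix V f assume V: "V \<subseteq> W" "smooth_on M V f"
  show "smooth_on M V (\<lambda>p. X p f)"
  proof (rule smooth_on_local[OF smooth_on_open[OF V(2)]])
    fix p assume p: "p \<in> V"
    then obtain V' where V': "p \<in> V'" "vector_field M V' X" using l V(1) by blast
    have "smooth_on M (V \<inter> V') f"
      using smooth_on_subset[OF V(2) openin_Int[OF smooth_on_open[OF V(2)] vf_open[OF V'(2)]]] by simp
    from vf_smooth[OF V'(2) _ this] have "smooth_on M (V \<inter> V') (\<lambda>p. X p f)" by simp
    then show "\<exists>V. p \<in> V \<and> smooth_on M V (\<lambda>p. X p f)" using p V'(1) by blast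
  qed
qed

lemma vf_zero: "mopen W \<Longrightarrow> vector_field M W (\<lambda>q h. 0)"
  by (rule vector_fieldI) (auto simp: tangent_space_zero intro: smooth_on_const smooth_on_open)

lemma vf_add: "vector_field M W X \<Longrightarrow> vector_field M W Y \<Longrightarrow> vector_field M W (\<lambda>q h. X q h + Y q h)"
  by (rule vector_fieldI)
    (simp_all add: vf_open vf_tangent tangent_space_add smooth_on_add vf_smooth)

lemma vf_scale:
  assumes "vector_field M W X" "smooth_on M W \<psi>" shows "vector_field M W (\<lambda>q h. \<psi> q * X q h)"
proof (rule vector_fieldI[OF vf_open[OF assms(1)]])
  show "(\<lambda>h. \<psi> p * X p h) \<in> tangent_space M p" if "p \<in> W" for p
    using tangent_space_scale vf_tangent[OF assms(1) that] by blast
  fix V f assume V: "V \<subseteq> W" "smooth_on M V f"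
  show "smooth_on M V (\<lambda>p. \<psi> p * X p f)"
    using smooth_on_mult[OF smooth_on_subset[OF assms(2) smooth_on_open[OF V(2)] V(1)] vf_smooth[OF assms(1) V]] .
qed

lemma vf_cscale: "vector_field M W X \<Longrightarrow> vector_field M W (\<lambda>q h. c * X q h)"
  using vf_scale smooth_on_const vf_open by blast

lemma vf_diff:
  "vector_field M W X \<Longrightarrow> vector_field M W Y \<Longrightarrow> vector_field M W (\<lambda>q h. X q h - Y q h)"
  using vf_add[OF _ vf_cscale[of W Y "-1"]] by simp

lemma vf_sum:
  "mopen W \<Longrightarrow> (\<And>i. i \<in> A \<Longrightarrow> vector_field M W (B i)) \<Longrightarrow> (\<And>i. i \<in> A \<Longrightarrow> smooth_on M W (c i)) \<Longrightarrow>
   vector_field M W (\<lambda>q h. \<Sum>i\<in>A. c i q * B i q h)"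
  by (induction A rule: infinite_finite_induct) (simp_all add: vf_zero vf_add vf_scale)

lemma coord_vec_field:
  assumes A: "(U, \<phi>) \<in> atlas M" "j \<in> J"
  shows "vector_field M U (coord_vec U \<phi> j)"
proof (rule vector_fieldI[OF chart_open[OF A(1)] coord_vec_tangent[OF A(1) _ A(2)]])
  fix V f assume V: "V \<subseteq> U" "smooth_on M V f"
  note oV = smooth_on_open[OF V(2)]
  show "smooth_on M V (\<lambda>p. coord_vec U \<phi> j p f)"
  proof (rule smooth_on_in_chart[OF A(1) oV V(1)])
    let ?g = "partial_deriv j (\<lambda>x. f (inv_into U \<phi> x))"
    have "smooth_coord J (\<phi> ` V) (\<lambda>x. f (inv_into U \<phi> x))"
      using smooth_on_chart[OF V(2) A(1)] V(1) by (simp add: Int_absorb1)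
    then have "smooth_coord J (\<phi> ` V) ?g" by (rule smooth_coord_partial[OF _ A(2)])
    moreover have "?g x = coord_vec U \<phi> j (inv_into U \<phi> x) f" if x: "x \<in> \<phi> ` V" for x
    proof -
      obtain q where q: "q \<in> V" "x = \<phi> q" using x by blast
      then have "inv_into U \<phi> x = q" using chart_inv[OF A(1)] V(1) by auto
      moreover have "smooth_near M q f" using V(2) q smooth_nearI by blast
      ultimately show ?thesis using q by (simp add: coord_vec_def)
    qed
    ultimately show "smooth_coord J (\<phi> ` V) (\<lambda>x. coord_vec U \<phi> j (inv_into U \<phi> x) f)"
      by (rule smooth_coord_cong_imp[OF chart_image_open[OF A(1) oV V(1)]])
  qed
qed

text \<open>Hadamard's lemma writes \<open>f\<close> as a constant plus products of x_j - p_j with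
  smooth functions. A derivation kills the constant, and in each product only the term with the
  first factor differentiated survives at \<open>p\<close>. On functions that are not smooth near
  \<open>p\<close> both sides are 0.\<close>

lemma tangent_expand:
  assumes A: "(U, \<phi>) \<in> atlas M" "p \<in> U" and v: "v \<in> tangent_space M p"
  shows "v f = (\<Sum>j\<in>J. v (\<lambda>q. \<phi> q j) * coord_vec U \<phi> j p f)"
proof (cases "smooth_near M p f")
  case False
  then show ?thesis using tangent_nonsmooth[OF v] by (simp add: coord_vec_def)
next
  case True
  then obtain W where W: "smooth_on M W f" "p \<in> W" by (rule smooth_nearE)
  have pM: "p \<in> points M" using A chart_open mopen_points by blast
  have o: "openin (powertop_real J) (\<phi> ` (U \<inter> W))"
    using chart_image_open[OF A(1) openin_Int[OF chart_open[OF A(1)] smooth_on_open[OF W(1)]]] by simp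
  have "\<phi> p \<in> \<phi> ` (U \<inter> W)" using A W by blast
  then obtain e where e: "e > 0" "coord_box J (\<phi> p) e \<subseteq> \<phi> ` (U \<inter> W)"
    using open_contains_coord_box[OF finite_idx o] by blast
  let ?B = "coord_box J (\<phi> p) e"
  have ext: "\<phi> p \<in> extensional J"
    using openin_powertop_extensional[OF o] A W by blast
  have "smooth_coord J ?B (\<lambda>x. f (inv_into U \<phi> x))"
    using smooth_coord_subset[OF smooth_on_chart[OF W(1) A(1)] e(2)] .
  from hadamard[OF finite_idx ext e(1) this]
  obtain h where h: "\<And>j. j \<in> J \<Longrightarrow> smooth_coord J ?B (h j)"
    and fh: "\<And>x. x \<in> ?B \<Longrightarrow> f (inv_into U \<phi> x) = f (inv_into U \<phi> (\<phi> p)) + (\<Sum>j\<in>J. (x j - \<phi> p j) * h j x)"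
    and hp: "\<And>j. j \<in> J \<Longrightarrow> h j (\<phi> p) = partial_deriv j (\<lambda>x. f (inv_into U \<phi> x)) (\<phi> p)"
    by blast
  define V where "V = {q \<in> U. \<phi> q \<in> ?B}"
  have V: "mopen V" "V \<subseteq> U"
    using chart_preimage_open[OF A(1) openin_coord_box[OF finite_idx]] by (auto simp: V_def)
  have pV: "p \<in> V" using A(2) ext e(1) by (simp add: V_def coord_box_iff)
  have hs: "smooth_near M p (\<lambda>q. h j (\<phi> q))" if j: "j \<in> J" for j
  proof (rule smooth_nearI[OF _ pV], rule smooth_on_in_chart[OF A(1) V])
    have "smooth_coord J (\<phi> ` V) (h j)" by (rule smooth_coord_subset[OF h[OF j]]) (auto simp: V_def)
    moreover have "h j x = h j (\<phi> (inv_into U \<phi> x))" if "x \<in> \<phi> ` V" for x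
      using that V(2) by (metis f_inv_into_f image_mono subsetD)
    ultimately show "smooth_coord J (\<phi> ` V) (\<lambda>x. h j (\<phi> (inv_into U \<phi> x)))"
      by (rule smooth_coord_cong_imp[OF chart_image_open[OF A(1) V]])
  qed
  have cs: "smooth_near M p (\<lambda>q. \<phi> q j)" if "j \<in> J" for j
    using smooth_on_coordinate[OF A(1) that] A(2) smooth_nearI by blast
  \<comment> \<open>The difference is kept as a sum with a negated constant so that additivity of
    the derivation applies directly.\<close>
  have ds: "smooth_near M p (\<lambda>q. \<phi> q j + - \<phi> p j)" if "j \<in> J" for j
    using smooth_near_add[OF cs[OF that] smooth_near_const[OF pM]] .
  have vd: "v (\<lambda>q. \<phi> q j + - \<phi> p j) = v (\<lambda>q. \<phi> q j)" if "j \<in> J" for j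
    by (simp only: tangent_add[OF v cs[OF that] smooth_near_const[OF pM]] tangent_const[OF v pM] add_0_right)
  have vm: "v (\<lambda>q. (\<phi> q j + - \<phi> p j) * h j (\<phi> q)) = v (\<lambda>q. \<phi> q j) * h j (\<phi> p)" if "j \<in> J" for j
    using tangent_mult[OF v ds[OF that] hs[OF that]] vd[OF that] by simp
  have ms: "smooth_near M p (\<lambda>q. (\<phi> q j + - \<phi> p j) * h j (\<phi> q))" if "j \<in> J" for j
    using smooth_near_mult[OF ds[OF that] hs[OF that]] .
  \<comment> \<open>Hadamard's decomposition holds only on \<open>V\<close>, so the replacement
    relies on locality of the derivation.\<close>
  have "v f = v (\<lambda>q. f p + (\<Sum>j\<in>J. (\<phi> q j + - \<phi> p j) * h j (\<phi> q)))"
  proof (rule tangent_cong[OF v V(1) pV])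
    fix q assume "q \<in> V"
    then have "q \<in> U" "\<phi> q \<in> ?B" by (auto simp: V_def)
    with fh[of "\<phi> q"] show "f q = f p + (\<Sum>j\<in>J. (\<phi> q j + - \<phi> p j) * h j (\<phi> q))"
      using chart_inv[OF A(1)] A(2) by simp
  qed
  also have "\<dots> = (\<Sum>j\<in>J. v (\<lambda>q. (\<phi> q j + - \<phi> p j) * h j (\<phi> q)))"
  proof -
    have "smooth_near M p (\<lambda>q. \<Sum>j\<in>J. (\<phi> q j + - \<phi> p j) * h j (\<phi> q))"
      by (rule smooth_near_sum[OF pM ms])
    moreover have "v (\<lambda>q. \<Sum>j\<in>J. (\<phi> q j + - \<phi> p j) * h j (\<phi> q)) =
        (\<Sum>j\<in>J. v (\<lambda>q. (\<phi> q j + - \<phi> p j) * h j (\<phi> q)))"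
      by (rule tangent_sum[OF v pM ms])
    ultimately show ?thesis
      by (simp only: tangent_add[OF v smooth_near_const[OF pM]] tangent_const[OF v pM] add_0_left)
  qed
  also have "\<dots> = (\<Sum>j\<in>J. v (\<lambda>q. \<phi> q j) * coord_vec U \<phi> j p f)"
    using vm hp True by (intro sum.cong) (simp_all add: coord_vec_def)
  finally show ?thesis .
qed

lemma tangent_eqI:
  assumes "(U, \<phi>) \<in> atlas M" "p \<in> U" "u \<in> tangent_space M p" "v \<in> tangent_space M p"
    and "\<And>j. j \<in> J \<Longrightarrow> u (\<lambda>q. \<phi> q j) = v (\<lambda>q. \<phi> q j)"
  shows "u = v"
proof
  fix f
  show "u f = v f"
    unfolding tangent_expand[OF assms(1-3), of f] tangent_expand[OF assms(1,2,4), of f]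
    by (rule sum.cong) (simp_all add: assms(5))
qed

text \<open>Each second derivative alone violates the Leibniz rule by the mixed products of first
  derivatives of \<open>f\<close> and \<open>h\<close>; these are symmetric in \<open>X\<close> and
  \<open>Y\<close> and cancel in the commutator.\<close>

lemma lie_bracket_field:
  assumes X: "vector_field M W X" and Y: "vector_field M W Y"
  shows "vector_field M W (lie_bracket M X Y)"
proof (rule vector_fieldI[OF vf_open[OF X]])
  fix p assume p: "p \<in> W"
  note tX = vf_tangent[OF X p] and tY = vf_tangent[OF Y p]
  note sX = vf_smooth_near[OF X p] and sY = vf_smooth_near[OF Y p]
  \<comment> \<open>The outer derivative acts on a function whose formula is known only where
    \<open>f\<close> and \<open>h\<close> are smooth, so a common neighbourhood is needed to rewrite
    it.\<close>
  have nbhd: "\<exists>V. mopen V \<and> p \<in> V \<and> (\<forall>q\<in>V. q \<in> W \<and> smooth_near M q f \<and> smooth_near M q h)"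
    if f: "smooth_near M p f" and h: "smooth_near M p h" for f h
  proof -
    obtain A B where "smooth_on M A f" "p \<in> A" "smooth_on M B h" "p \<in> B"
      using f h by (meson smooth_nearE)
    then show ?thesis
      using smooth_on_open vf_open[OF X] p smooth_nearI by (intro exI[of _ "A \<inter> B \<inter> W"]) blast
  qed
  show "lie_bracket M X Y p \<in> tangent_space M p"
  proof (rule tangentI)
    show "lie_bracket M X Y p f = 0" if "\<not> smooth_near M p f" for f
      using that by (simp add: lie_bracket_def)
  next
    fix c f assume f: "smooth_near M p f"
    obtain V where V: "mopen V" "p \<in> V" "\<forall>q\<in>V. q \<in> W \<and> smooth_near M q f" using nbhd[OF f f] by blast
    have "X p (\<lambda>q. Y q (\<lambda>r. c * f r)) = X p (\<lambda>q. c * Y q f)"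
      by (rule tangent_cong[OF tX V(1,2)]) (use V(3) tangent_cmult vf_tangent[OF Y] in blast)
    moreover have "Y p (\<lambda>q. X q (\<lambda>r. c * f r)) = Y p (\<lambda>q. c * X q f)"
      by (rule tangent_cong[OF tY V(1,2)]) (use V(3) tangent_cmult vf_tangent[OF X] in blast)
    ultimately show "lie_bracket M X Y p (\<lambda>q. c * f q) = c * lie_bracket M X Y p f"
      using f tangent_cmult[OF tX sY[OF f]] tangent_cmult[OF tY sX[OF f]] smooth_near_cmult[OF f]
      by (simp add: lie_bracket_def algebra_simps)
  next
    fix f h assume f: "smooth_near M p f" and h: "smooth_near M p h"
    obtain V where V: "mopen V" "p \<in> V" "\<forall>q\<in>V. q \<in> W \<and> smooth_near M q f \<and> smooth_near M q h"
      using nbhd[OF f h] by blast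
    have "X p (\<lambda>q. Y q (\<lambda>r. f r + h r)) = X p (\<lambda>q. Y q f + Y q h)"
      by (rule tangent_cong[OF tX V(1,2)]) (use V(3) tangent_add vf_tangent[OF Y] in blast)
    moreover have "Y p (\<lambda>q. X q (\<lambda>r. f r + h r)) = Y p (\<lambda>q. X q f + X q h)"
      by (rule tangent_cong[OF tY V(1,2)]) (use V(3) tangent_add vf_tangent[OF X] in blast)
    ultimately show "lie_bracket M X Y p (\<lambda>q. f q + h q) = lie_bracket M X Y p f + lie_bracket M X Y p h"
      using f h tangent_add[OF tX sY[OF f] sY[OF h]] tangent_add[OF tY sX[OF f] sX[OF h]] smooth_near_add[OF f h]
      by (simp add: lie_bracket_def)
    have "X p (\<lambda>q. Y q (\<lambda>r. f r * h r)) = X p (\<lambda>q. Y q f * h q + f q * Y q h)"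
      by (rule tangent_cong[OF tX V(1,2)]) (use V(3) tangent_mult vf_tangent[OF Y] in blast)
    moreover have "Y p (\<lambda>q. X q (\<lambda>r. f r * h r)) = Y p (\<lambda>q. X q f * h q + f q * X q h)"
      by (rule tangent_cong[OF tY V(1,2)]) (use V(3) tangent_mult vf_tangent[OF X] in blast)
    ultimately show "lie_bracket M X Y p (\<lambda>q. f q * h q) =
        lie_bracket M X Y p f * h p + f p * lie_bracket M X Y p h"
      using f h tangent_add[OF tX smooth_near_mult[OF sY[OF f] h] smooth_near_mult[OF f sY[OF h]]]
        tangent_add[OF tY smooth_near_mult[OF sX[OF f] h] smooth_near_mult[OF f sX[OF h]]]
        tangent_mult[OF tX sY[OF f] h] tangent_mult[OF tX f sY[OF h]]
        tangent_mult[OF tY sX[OF f] h] tangent_mult[OF tY f sX[OF h]] smooth_near_mult[OF f h]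
      by (simp add: lie_bracket_def algebra_simps)
  qed
next
  fix V f assume V: "V \<subseteq> W" "smooth_on M V f"
  have "smooth_on M V (\<lambda>p. X p (\<lambda>q. Y q f) - Y p (\<lambda>q. X q f))"
    using V vf_smooth[OF X] vf_smooth[OF Y] by (intro smooth_on_diff) auto
  then show "smooth_on M V (\<lambda>p. lie_bracket M X Y p f)"
    by (rule smooth_on_cong) (use V(2) smooth_nearI in \<open>auto simp: lie_bracket_def\<close>)
qed

end

section \<open>Connections, metrics and orthogonal frames\<close>

lemma sum_fun_eq: "(\<Sum>i\<in>A. (\<lambda>x. f i x :: real)) = (\<lambda>x. \<Sum>i\<in>A. f i x)"
  by (induction A rule: infinite_finite_induct) (auto simp: zero_fun_def plus_fun_def)

text \<open>Tangent vectors are plain functions here. This vector space structure makes the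
  library's bound on independent families available for counting dimensions.\<close>

lemma vector_space_fun: "vector_space (\<lambda>c (f :: 'x \<Rightarrow> real) x. c * f x)"
  by unfold_locales (auto simp: plus_fun_def algebra_simps)

section \<open>Affine connections and their curvature\<close>

locale affine_manifold = charted_space +
  fixes D
  assumes affine: "affine_connection M D"
begin

lemma D_field:
  assumes "vector_field M W X" "vector_field M W Y" shows "vector_field M W (D X Y)"
proof -
  have "\<forall>W X Y. vector_field M W X \<and> vector_field M W Y \<longrightarrow> vector_field M W (D X Y)"
    using affine unfolding affine_connection_def by (elim conjE)
  then show ?thesis using assms by metis
qed

lemma
  assumes "vector_field M W X" "vector_field M W Y" "vector_field M W Z" "p \<in> W"
  shows D_add_left: "D (\<lambda>q h. X q h + Y q h) Z p f = D X Z p f + D Y Z p f"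
    and D_add_right: "D X (\<lambda>q h. Y q h + Z q h) p f = D X Y p f + D X Z p f"
proof -
  have "\<forall>W X Y Z. vector_field M W X \<and> vector_field M W Y \<and> vector_field M W Z \<longrightarrow>
        (\<forall>p\<in>W. \<forall>f. D (\<lambda>q h. X q h + Y q h) Z p f = D X Z p f + D Y Z p f \<and>
                   D X (\<lambda>q h. Y q h + Z q h) p f = D X Y p f + D X Z p f)"
    using affine unfolding affine_connection_def by (elim conjE)
  from this[rule_format, of W X Y Z p f] assms
  show "D (\<lambda>q h. X q h + Y q h) Z p f = D X Z p f + D Y Z p f"
    "D X (\<lambda>q h. Y q h + Z q h) p f = D X Y p f + D X Z p f" by simp_all
qed

lemma
  assumes "vector_field M W X" "vector_field M W Y" "smooth_on M W \<psi>" "p \<in> W"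
  shows D_scale_left: "D (\<lambda>q h. \<psi> q * X q h) Y p f = \<psi> p * D X Y p f"
    and D_scale_right: "D X (\<lambda>q h. \<psi> q * Y q h) p f = X p \<psi> * Y p f + \<psi> p * D X Y p f"
proof -
  have "\<forall>W X Y \<psi>. vector_field M W X \<and> vector_field M W Y \<and> smooth_on M W \<psi> \<longrightarrow>
        (\<forall>p\<in>W. \<forall>f. D (\<lambda>q h. \<psi> q * X q h) Y p f = \<psi> p * D X Y p f \<and>
                   D X (\<lambda>q h. \<psi> q * Y q h) p f = X p \<psi> * Y p f + \<psi> p * D X Y p f)"
    using affine unfolding affine_connection_def by (elim conjE)
  from this[rule_format, of W X Y \<psi> p f] assms
  show "D (\<lambda>q h. \<psi> q * X q h) Y p f = \<psi> p * D X Y p f"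
    "D X (\<lambda>q h. \<psi> q * Y q h) p f = X p \<psi> * Y p f + \<psi> p * D X Y p f" by simp_all
qed

text \<open>The products of \<open>X\<close> and \<open>X'\<close> with the indicator of
  \<open>W\<close> are the same total field, and likewise for \<open>Y\<close>. Function-linearity
  and the Leibniz rule then remove the indicator, whose value at \<open>p\<close> is one and whose
  derivative is zero.\<close>

lemma D_cong:
  assumes X: "vector_field M W X" and Y: "vector_field M W Y" and p: "p \<in> W"
    and eX: "\<And>q. q \<in> W \<Longrightarrow> X q = X' q" and eY: "\<And>q. q \<in> W \<Longrightarrow> Y q = Y' q"
  shows "D X Y p = D X' Y' p"
proof
  fix f
  let ?i = "\<lambda>q. if q \<in> W then 1 else (0::real)"
  note i = smooth_on_indicator[OF vf_open[OF X]]
  note X' = vf_cong[OF X eX] and Y' = vf_cong[OF Y eY]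
  have 1: "(\<lambda>q h. ?i q * X q h) = (\<lambda>q h. ?i q * X' q h)" using eX by auto
  have 2: "(\<lambda>q h. ?i q * Y q h) = (\<lambda>q h. ?i q * Y' q h)" using eY by auto
  have z: "X' p ?i = 0" using tangent_indicator[OF vf_tangent[OF X' p] vf_open[OF X] p] .
  have "D X Y p f = D (\<lambda>q h. ?i q * X q h) Y p f"
    using D_scale_left[OF X Y i p, of f] p by simp
  also have "\<dots> = D X' Y p f"
    unfolding 1 using D_scale_left[OF X' Y i p, of f] p by simp
  also have "\<dots> = D X' (\<lambda>q h. ?i q * Y q h) p f"
    using D_scale_right[OF X' Y i p, of f] p z by simp
  also have "\<dots> = D X' Y' p f"
    unfolding 2 using D_scale_right[OF X' Y' i p, of f] p z by simp
  finally show "D X Y p f = D X' Y' p f" .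
qed

abbreviation "R \<equiv> curvature M D"

lemma R_field:
  assumes "vector_field M W X" "vector_field M W Y" "vector_field M W Z"
  shows "vector_field M W (R X Y Z)"
proof -
  have "R X Y Z = (\<lambda>p f. D X (D Y Z) p f - D Y (D X Z) p f - D (lie_bracket M X Y) Z p f)"
    by (intro ext) (simp add: curvature_def)
  moreover have "vector_field M W (\<lambda>p f. D X (D Y Z) p f - D Y (D X Z) p f - D (lie_bracket M X Y) Z p f)"
    using assms by (intro vf_diff D_field lie_bracket_field)
  ultimately show ?thesis by simp
qed

lemma lie_bracket_add_left:
  assumes X: "vector_field M W X" and X': "vector_field M W X'" and Y: "vector_field M W Y" and p: "p \<in> W"
  shows "lie_bracket M (\<lambda>q h. X q h + X' q h) Y p = (\<lambda>f. lie_bracket M X Y p f + lie_bracket M X' Y p f)"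
proof
  fix f
  show "lie_bracket M (\<lambda>q h. X q h + X' q h) Y p f = lie_bracket M X Y p f + lie_bracket M X' Y p f"
  proof (cases "smooth_near M p f")
    case True
    then show ?thesis
      using tangent_add[OF vf_tangent[OF Y p] vf_smooth_near[OF X p True] vf_smooth_near[OF X' p True]]
      by (simp add: lie_bracket_def)
  qed (simp add: lie_bracket_def)
qed

lemma lie_bracket_scale_left:
  assumes X: "vector_field M W X" and Y: "vector_field M W Y" and \<psi>: "smooth_on M W \<psi>" and p: "p \<in> W"
  shows "lie_bracket M (\<lambda>q h. \<psi> q * X q h) Y p = (\<lambda>f. \<psi> p * lie_bracket M X Y p f + (- Y p \<psi>) * X p f)"
proof
  fix f
  show "lie_bracket M (\<lambda>q h. \<psi> q * X q h) Y p f = \<psi> p * lie_bracket M X Y p f + (- Y p \<psi>) * X p f"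
  proof (cases "smooth_near M p f")
    case True
    then show ?thesis
      using tangent_mult[OF vf_tangent[OF Y p] smooth_nearI[OF \<psi> p] vf_smooth_near[OF X p True]]
      by (simp add: lie_bracket_def algebra_simps)
  qed (simp add: lie_bracket_def tangent_nonsmooth[OF vf_tangent[OF X p]])
qed

lemma lie_bracket_antisym: "lie_bracket M Y X p = (\<lambda>f. (-1) * lie_bracket M X Y p f)"
  by (auto simp: lie_bracket_def)

lemma R_antisym:
  assumes X: "vector_field M W X" and Y: "vector_field M W Y" and Z: "vector_field M W Z" and p: "p \<in> W"
  shows "R Y X Z p f = - R X Y Z p f"
proof -
  note B = lie_bracket_field[OF X Y]
  have "D (lie_bracket M Y X) Z p f = D (\<lambda>q h. (-1) * lie_bracket M X Y q h) Z p f"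
    using D_cong[OF lie_bracket_field[OF Y X] Z p lie_bracket_antisym refl] by metis
  also have "\<dots> = - D (lie_bracket M X Y) Z p f"
    using D_scale_left[OF B Z smooth_on_const[OF vf_open[OF X], of "-1"] p, of f] by simp
  finally show ?thesis by (simp add: curvature_def)
qed

lemma R_add_1:
  assumes X: "vector_field M W X" and X': "vector_field M W X'" and Y: "vector_field M W Y"
    and Z: "vector_field M W Z" and p: "p \<in> W"
  shows "R (\<lambda>q h. X q h + X' q h) Y Z p f = R X Y Z p f + R X' Y Z p f"
proof -
  note XX = vf_add[OF X X'] and B = lie_bracket_field[OF X Y] and B' = lie_bracket_field[OF X' Y]
  have 1: "D (\<lambda>q h. X q h + X' q h) (D Y Z) p f = D X (D Y Z) p f + D X' (D Y Z) p f"
    using D_add_left[OF X X' D_field[OF Y Z] p] .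
  have "D Y (D (\<lambda>q h. X q h + X' q h) Z) p = D Y (\<lambda>q h. D X Z q h + D X' Z q h) p"
    using D_add_left[OF X X' Z] by (intro D_cong[OF Y D_field[OF XX Z] p]) (auto intro!: ext)
  then have 2: "D Y (D (\<lambda>q h. X q h + X' q h) Z) p f = D Y (D X Z) p f + D Y (D X' Z) p f"
    using D_add_right[OF Y D_field[OF X Z] D_field[OF X' Z] p] by simp
  have "D (lie_bracket M (\<lambda>q h. X q h + X' q h) Y) Z p =
      D (\<lambda>q h. lie_bracket M X Y q h + lie_bracket M X' Y q h) Z p"
    using lie_bracket_add_left[OF X X' Y] by (intro D_cong[OF lie_bracket_field[OF XX Y] Z p]) auto
  then have 3: "D (lie_bracket M (\<lambda>q h. X q h + X' q h) Y) Z p f =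
      D (lie_bracket M X Y) Z p f + D (lie_bracket M X' Y) Z p f"
    using D_add_left[OF B B' Z p] by simp
  show ?thesis unfolding curvature_def 1 2 3 by simp
qed

text \<open>The derivative of \<psi> along \<open>Y\<close> appears once from the second covariant
  derivative and once from the bracket of \<psi>X with \<open>Y\<close>; the two contributions
  cancel.\<close>

lemma R_scale_1:
  assumes X: "vector_field M W X" and Y: "vector_field M W Y"
    and Z: "vector_field M W Z" and \<psi>: "smooth_on M W \<psi>" and p: "p \<in> W"
  shows "R (\<lambda>q h. \<psi> q * X q h) Y Z p f = \<psi> p * R X Y Z p f"
proof -
  note XX = vf_scale[OF X \<psi>] and B = lie_bracket_field[OF X Y]
  have Y\<psi>: "smooth_on M W (\<lambda>q. - Y q \<psi>)" using smooth_on_minus[OF vf_smooth[OF Y subset_refl \<psi>]] .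
  have 1: "D (\<lambda>q h. \<psi> q * X q h) (D Y Z) p f = \<psi> p * D X (D Y Z) p f"
    using D_scale_left[OF X D_field[OF Y Z] \<psi> p] .
  have "D Y (D (\<lambda>q h. \<psi> q * X q h) Z) p = D Y (\<lambda>q h. \<psi> q * D X Z q h) p"
    using D_scale_left[OF X Z \<psi>] by (intro D_cong[OF Y D_field[OF XX Z] p]) (auto intro!: ext)
  then have 2: "D Y (D (\<lambda>q h. \<psi> q * X q h) Z) p f = Y p \<psi> * D X Z p f + \<psi> p * D Y (D X Z) p f"
    using D_scale_right[OF Y D_field[OF X Z] \<psi> p] by simp
  have "D (lie_bracket M (\<lambda>q h. \<psi> q * X q h) Y) Z p =
      D (\<lambda>q h. \<psi> q * lie_bracket M X Y q h + (- Y q \<psi>) * X q h) Z p"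
    using lie_bracket_scale_left[OF X Y \<psi>] by (intro D_cong[OF lie_bracket_field[OF XX Y] Z p]) auto
  then have 3: "D (lie_bracket M (\<lambda>q h. \<psi> q * X q h) Y) Z p f =
      \<psi> p * D (lie_bracket M X Y) Z p f - Y p \<psi> * D X Z p f"
    using D_add_left[OF vf_scale[OF B \<psi>] vf_scale[OF X Y\<psi>] Z p, of f]
      D_scale_left[OF B Z \<psi> p, of f] D_scale_left[OF X Z Y\<psi> p, of f] by simp
  show ?thesis unfolding curvature_def 1 2 3 by (simp add: algebra_simps)
qed

lemma R_add_2:
  assumes "vector_field M W X" "vector_field M W Y" "vector_field M W Y'" "vector_field M W Z" "p \<in> W"
  shows "R X (\<lambda>q h. Y q h + Y' q h) Z p f = R X Y Z p f + R X Y' Z p f"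
  using R_add_1[OF assms(2,3,1,4,5), of f] R_antisym[OF vf_add[OF assms(2,3)] assms(1,4,5), of f]
    R_antisym[OF assms(2,1,4,5), of f] R_antisym[OF assms(3,1,4,5), of f] by simp

lemma R_scale_2:
  assumes "vector_field M W X" "vector_field M W Y" "vector_field M W Z" "smooth_on M W \<psi>" "p \<in> W"
  shows "R X (\<lambda>q h. \<psi> q * Y q h) Z p f = \<psi> p * R X Y Z p f"
  using R_scale_1[OF assms(2,1,3,4,5), of f] R_antisym[OF vf_scale[OF assms(2,4)] assms(1,3,5), of f]
    R_antisym[OF assms(2,1,3,5), of f] by simp

lemma R_add_3:
  assumes X: "vector_field M W X" and Y: "vector_field M W Y" and Z: "vector_field M W Z"
    and Z': "vector_field M W Z'" and p: "p \<in> W"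
  shows "R X Y (\<lambda>q h. Z q h + Z' q h) p f = R X Y Z p f + R X Y Z' p f"
proof -
  note ZZ = vf_add[OF Z Z']
  have *: "D A (D B (\<lambda>q h. Z q h + Z' q h)) p f = D A (D B Z) p f + D A (D B Z') p f"
    if A: "vector_field M W A" and B: "vector_field M W B" for A B
  proof -
    have "D A (D B (\<lambda>q h. Z q h + Z' q h)) p = D A (\<lambda>q h. D B Z q h + D B Z' q h) p"
      using D_add_right[OF B Z Z'] by (intro D_cong[OF A D_field[OF B ZZ] p]) (auto intro!: ext)
    then show ?thesis using D_add_right[OF A D_field[OF B Z] D_field[OF B Z'] p] by simp
  qed
  show ?thesis
    unfolding curvature_def *[OF X Y] *[OF Y X] D_add_right[OF lie_bracket_field[OF X Y] Z Z' p] by simp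
qed

text \<open>The products of first derivatives are symmetric in \<open>X\<close> and \<open>Y\<close>
  and cancel. The second derivatives of \<psi> combine to its derivative along the bracket, which
  the last term of the curvature removes.\<close>

lemma R_scale_3:
  assumes X: "vector_field M W X" and Y: "vector_field M W Y" and Z: "vector_field M W Z"
    and \<psi>: "smooth_on M W \<psi>" and p: "p \<in> W"
  shows "R X Y (\<lambda>q h. \<psi> q * Z q h) p f = \<psi> p * R X Y Z p f"
proof -
  note ZZ = vf_scale[OF Z \<psi>]
  have *: "D A (D B (\<lambda>q h. \<psi> q * Z q h)) p f = A p (\<lambda>q. B q \<psi>) * Z p f + B p \<psi> * D A Z p f
      + A p \<psi> * D B Z p f + \<psi> p * D A (D B Z) p f"
    if A: "vector_field M W A" and B: "vector_field M W B" for A B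
  proof -
    have B\<psi>: "smooth_on M W (\<lambda>q. B q \<psi>)" using vf_smooth[OF B subset_refl \<psi>] .
    have "D A (D B (\<lambda>q h. \<psi> q * Z q h)) p = D A (\<lambda>q h. B q \<psi> * Z q h + \<psi> q * D B Z q h) p"
      using D_scale_right[OF B Z \<psi>] by (intro D_cong[OF A D_field[OF B ZZ] p]) (auto intro!: ext)
    then show ?thesis
      using D_add_right[OF A vf_scale[OF Z B\<psi>] vf_scale[OF D_field[OF B Z] \<psi>] p, of f]
        D_scale_right[OF A Z B\<psi> p, of f] D_scale_right[OF A D_field[OF B Z] \<psi> p, of f] by simp
  qed
  have b: "lie_bracket M X Y p \<psi> = X p (\<lambda>q. Y q \<psi>) - Y p (\<lambda>q. X q \<psi>)"
    using smooth_nearI[OF \<psi> p] by (simp add: lie_bracket_def)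
  show ?thesis
    unfolding curvature_def *[OF X Y] *[OF Y X] D_scale_right[OF lie_bracket_field[OF X Y] Z \<psi> p] b
    by (simp add: algebra_simps)
qed

end

section \<open>Functionals of a field that depend only on its value at a point\<close>

context charted_space
begin

text \<open>The conditions range over all open sets containing \<open>p\<close>, so that the
  functional can be applied to fields that are defined only locally and expanded in local
  frames.\<close>

definition tensorial_at :: "'a \<Rightarrow> ('a vfield \<Rightarrow> real) \<Rightarrow> bool" where
  "tensorial_at p T \<longleftrightarrow>
    (\<forall>W X Y. p \<in> W \<and> vector_field M W X \<and> vector_field M W Y \<longrightarrow> T (\<lambda>q h. X q h + Y q h) = T X + T Y) \<and>
    (\<forall>W X \<psi>. p \<in> W \<and> vector_field M W X \<and> smooth_on M W \<psi> \<longrightarrow> T (\<lambda>q h. \<psi> q * X q h) = \<psi> p * T X)"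

text \<open>Fields restrict to smaller open sets without changing as HOL functions, so testing
  inside one neighbourhood of \<open>p\<close> is enough.\<close>

lemma tensorial_atI:
  assumes V: "mopen V" "p \<in> V"
    and add: "\<And>W X Y. p \<in> W \<Longrightarrow> W \<subseteq> V \<Longrightarrow> vector_field M W X \<Longrightarrow> vector_field M W Y \<Longrightarrow>
      T (\<lambda>q h. X q h + Y q h) = T X + T Y"
    and scale: "\<And>W X \<psi>. p \<in> W \<Longrightarrow> W \<subseteq> V \<Longrightarrow> vector_field M W X \<Longrightarrow> smooth_on M W \<psi> \<Longrightarrow>
      T (\<lambda>q h. \<psi> q * X q h) = \<psi> p * T X"
  shows "tensorial_at p T"
  unfolding tensorial_at_def
proof (intro conjI allI impI; elim conjE)
  fix W X Y assume W: "p \<in> W" and X: "vector_field M W X" and Y: "vector_field M W Y"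
  have o: "mopen (V \<inter> W)" using V vf_open[OF X] by blast
  show "T (\<lambda>q h. X q h + Y q h) = T X + T Y"
    by (rule add[of "V \<inter> W"]) (use V W vf_subset[OF X o] vf_subset[OF Y o] in auto)
next
  fix W X \<psi> assume W: "p \<in> W" and X: "vector_field M W X" and \<psi>: "smooth_on M W \<psi>"
  have o: "mopen (V \<inter> W)" using V vf_open[OF X] by blast
  show "T (\<lambda>q h. \<psi> q * X q h) = \<psi> p * T X"
    by (rule scale[of "V \<inter> W"]) (use V W vf_subset[OF X o] smooth_on_subset[OF \<psi> o] in auto)
qed

lemma tensorial_add:
  "tensorial_at p T \<Longrightarrow> p \<in> W \<Longrightarrow> vector_field M W X \<Longrightarrow> vector_field M W Y \<Longrightarrow>
   T (\<lambda>q h. X q h + Y q h) = T X + T Y"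
  unfolding tensorial_at_def by blast

lemma tensorial_scale:
  "tensorial_at p T \<Longrightarrow> p \<in> W \<Longrightarrow> vector_field M W X \<Longrightarrow> smooth_on M W \<psi> \<Longrightarrow>
   T (\<lambda>q h. \<psi> q * X q h) = \<psi> p * T X"
  unfolding tensorial_at_def by blast

text \<open>The argument of \<open>D_cong\<close> again: multiplying by the indicator of
  \<open>W\<close> makes the two fields equal as functions and does not change the value of
  \<open>T\<close>.\<close>

lemma tensorial_cong:
  assumes T: "tensorial_at p T" and p: "p \<in> W" and X: "vector_field M W X"
    and e: "\<And>q. q \<in> W \<Longrightarrow> X q = Y q"
  shows "T X = T Y"
proof -
  let ?i = "\<lambda>q. if q \<in> W then 1 else (0::real)"
  note i = smooth_on_indicator[OF vf_open[OF X]]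
  have "(\<lambda>q h. ?i q * X q h) = (\<lambda>q h. ?i q * Y q h)" using e by auto
  then show ?thesis
    using tensorial_scale[OF T p X i] tensorial_scale[OF T p vf_cong[OF X e] i] p by simp
qed

lemma tensorial_sum:
  assumes T: "tensorial_at p T" and p: "p \<in> W" and W: "mopen W"
  shows "(\<And>k. k \<in> K \<Longrightarrow> vector_field M W (B k)) \<Longrightarrow> (\<And>k. k \<in> K \<Longrightarrow> smooth_on M W (c k)) \<Longrightarrow>
   T (\<lambda>q h. \<Sum>k\<in>K. c k q * B k q h) = (\<Sum>k\<in>K. c k p * T (B k))"
proof (induction K rule: infinite_finite_induct)
  have z: "T (\<lambda>q h. 0) = 0"
    using tensorial_scale[OF T p vf_zero[OF W] smooth_on_const[OF W, of 0]] by simp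
  case (infinite A)
  then show ?case using z by simp
next
  have z: "T (\<lambda>q h. 0) = 0"
    using tensorial_scale[OF T p vf_zero[OF W] smooth_on_const[OF W, of 0]] by simp
  case empty
  then show ?case using z by simp
next
  case (insert k K)
  have "T (\<lambda>q h. c k q * B k q h + (\<Sum>k\<in>K. c k q * B k q h)) =
      T (\<lambda>q h. c k q * B k q h) + T (\<lambda>q h. \<Sum>k\<in>K. c k q * B k q h)"
    using insert.prems by (intro tensorial_add[OF T p] vf_scale vf_sum[OF W]) auto
  moreover have "T (\<lambda>q h. c k q * B k q h) = c k p * T (B k)"
    using insert.prems by (intro tensorial_scale[OF T p]) auto
  ultimately show ?case using insert by simp
qed

text \<open>The reciprocal of \<open>h\<close> is written as \<open>h\<close> times the power -1 of
  \<open>h * h\<close>, so that the base of the power is positive whatever the sign of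
  \<open>h\<close>.\<close>

lemma smooth_on_divide:
  assumes "smooth_on M W f" "smooth_on M W h" "\<And>p. p \<in> W \<Longrightarrow> h p \<noteq> 0"
  shows "smooth_on M W (\<lambda>p. f p / h p)"
proof -
  have "smooth_on M W (\<lambda>p. f p * (h p * (h p * h p) powr (-1)))"
    using assms(3) by (intro smooth_on_mult smooth_on_powr assms(1,2)) (auto simp: zero_less_mult_iff linorder_neq_iff)
  then show ?thesis
    by (rule smooth_on_cong) (use assms(3) in \<open>simp add: powr_minus divide_simps zero_le_mult_iff linorder_linear\<close>)
qed

end

section \<open>Metrics, orthogonal frames and the Koszul formula\<close>

locale metric_manifold = charted_space +
  fixes g :: "'a metric_field"
  assumes g_sym: "\<And>p u v. p \<in> points M \<Longrightarrow> u \<in> tangent_space M p \<Longrightarrow> v \<in> tangent_space M p \<Longrightarrow> g p u v = g p v u"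
    and g_scale: "\<And>p u v c. p \<in> points M \<Longrightarrow> u \<in> tangent_space M p \<Longrightarrow> v \<in> tangent_space M p \<Longrightarrow>
      g p (\<lambda>f. c * u f) v = c * g p u v"
    and g_add: "\<And>p u v w. p \<in> points M \<Longrightarrow> u \<in> tangent_space M p \<Longrightarrow> v \<in> tangent_space M p \<Longrightarrow>
      w \<in> tangent_space M p \<Longrightarrow> g p (\<lambda>f. u f + w f) v = g p u v + g p w v"
    and g_smooth: "\<And>W X Y. vector_field M W X \<Longrightarrow> vector_field M W Y \<Longrightarrow> smooth_on M W (\<lambda>p. g p (X p) (Y p))"
begin

lemma g_zero:
  assumes "p \<in> points M" "v \<in> tangent_space M p" shows "g p (\<lambda>f. 0) v = 0"
  using g_scale[OF assms(1) tangent_space_zero assms(2), of 0] by simp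

lemma g_sum:
  assumes p: "p \<in> points M" and v: "v \<in> tangent_space M p"
  shows "(\<And>k. k \<in> K \<Longrightarrow> e k \<in> tangent_space M p) \<Longrightarrow>
    g p (\<lambda>f. \<Sum>k\<in>K. c k * e k f) v = (\<Sum>k\<in>K. c k * g p (e k) v)"
proof (induction K rule: infinite_finite_induct)
  case (insert k K)
  have "g p (\<lambda>f. c k * e k f + (\<Sum>k\<in>K. c k * e k f)) v = g p (\<lambda>f. c k * e k f) v + g p (\<lambda>f. \<Sum>k\<in>K. c k * e k f) v"
    using insert.prems by (intro g_add[OF p _ v] tangent_space_scale tangent_space_sum) auto
  then show ?case using insert g_scale[OF p _ v] by simp
qed (simp_all add: g_zero[OF p v])

lemma g_add_right:
  assumes "p \<in> points M" "u \<in> tangent_space M p" "v \<in> tangent_space M p" "w \<in> tangent_space M p"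
  shows "g p u (\<lambda>f. v f + w f) = g p u v + g p u w"
  using g_add[OF assms(1,3,2,4)] g_sym[OF assms(1,2)] assms tangent_space_add by metis

lemma g_scale_right:
  assumes "p \<in> points M" "u \<in> tangent_space M p" "v \<in> tangent_space M p"
  shows "g p u (\<lambda>f. c * v f) = c * g p u v"
  using g_scale[OF assms(1,3,2)] g_sym[OF assms(1,2)] assms tangent_space_scale by metis

lemma g_diff:
  assumes "p \<in> points M" "u \<in> tangent_space M p" "v \<in> tangent_space M p" "w \<in> tangent_space M p"
  shows "g p (\<lambda>f. u f - w f) v = g p u v - g p w v"
  using g_add[OF assms(1,2,3) tangent_space_scale[OF assms(4)], of "-1"] g_scale[OF assms(1,4,3), of "-1"]
  by simp

text \<open>By \<open>tangent_expand\<close> the tangent space has dimension at most \<open>mdim M\<close>, so a nonzero component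
  orthogonal to \<open>mdim M\<close> orthogonal vectors would yield too many independent vectors.\<close>

lemma orthogonal_expand:
  assumes p: "p \<in> points M" and K: "finite K" "card K = mdim M"
    and e: "\<And>k. k \<in> K \<Longrightarrow> e k \<in> tangent_space M p" "\<And>k. k \<in> K \<Longrightarrow> g p (e k) (e k) \<noteq> 0"
    and orth: "\<And>k k'. k \<in> K \<Longrightarrow> k' \<in> K \<Longrightarrow> k \<noteq> k' \<Longrightarrow> g p (e k) (e k') = 0"
    and u: "u \<in> tangent_space M p"
  shows "u = (\<lambda>f. \<Sum>k\<in>K. g p u (e k) / g p (e k) (e k) * e k f)"
proof -
  define s where "s = (\<lambda>f. \<Sum>k\<in>K. g p u (e k) / g p (e k) (e k) * e k f)"
  define w where "w = (\<lambda>f. u f - s f)"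
  have sT: "s \<in> tangent_space M p" unfolding s_def by (rule tangent_space_sum[OF e(1)])
  have wT: "w \<in> tangent_space M p"
    unfolding w_def using tangent_space_add[OF u tangent_space_scale[OF sT, of "-1"]] by simp
  have w0: "g p w (e k) = 0" if k: "k \<in> K" for k
  proof -
    have "g p s (e k) = (\<Sum>k'\<in>K. g p u (e k') / g p (e k') (e k') * g p (e k') (e k))"
      unfolding s_def by (rule g_sum[OF p e(1)[OF k] e(1)])
    also have "\<dots> = (\<Sum>k'\<in>K. if k' = k then g p u (e k) else 0)"
      using orth[OF _ k] e(2)[OF k] by (intro sum.cong) auto
    also have "\<dots> = g p u (e k)" using K(1) k by simp
    finally show ?thesis using g_diff[OF p u e(1)[OF k] sT] by (simp add: w_def)
  qed
  have "w = (\<lambda>f. 0)"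
  proof (rule ccontr)
    assume wn: "w \<noteq> (\<lambda>f. 0)"
    interpret vs: vector_space "\<lambda>c (f :: ('a \<Rightarrow> real) \<Rightarrow> real) x. c * f x" by (rule vector_space_fun)
    obtain U \<phi> where A: "(U, \<phi>) \<in> atlas M" "p \<in> U" using chart_cover[OF p] by blast
    let ?B = "(\<lambda>j. coord_vec U \<phi> j p) ` J" and ?S = "insert w (e ` K)"
    have inj: "inj_on e K" using orth e(2) by (intro inj_onI) metis
    have wn': "w \<notin> e ` K" using w0 e(2) by auto
    have span: "v \<in> vs.span ?B" if v: "v \<in> tangent_space M p" for v
    proof -
      have "v = (\<Sum>j\<in>J. (\<lambda>x. v (\<lambda>q. \<phi> q j) * coord_vec U \<phi> j p x))"
        by (subst sum_fun_eq) (rule ext, rule tangent_expand[OF A v])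
      also have "\<dots> \<in> vs.span ?B" by (intro vs.span_sum vs.span_scale vs.span_base) auto
      finally show ?thesis .
    qed
    have fin: "finite ?S" using K(1) by simp
    \<comment> \<open>Pairing a linear relation with \<open>e k\<close> isolates the coefficient of
      \<open>e k\<close>, since \<open>w\<close> and the other vectors are orthogonal to it. What
      remains is a multiple of the nonzero vector \<open>w\<close>.\<close>
    have "vs.independent ?S"
    proof
      assume "vs.dependent ?S"
      from iffD1[OF vs.dependent_finite[OF fin] this]
      obtain a where a: "\<exists>v\<in>?S. a v \<noteq> 0" "(\<Sum>v\<in>?S. (\<lambda>x. a v * v x)) = 0"
        by (elim exE conjE)
      have z: "(\<lambda>x. \<Sum>v\<in>?S. a v * v x) = (\<lambda>x. 0)"
      proof -
        have "(\<lambda>x. \<Sum>v\<in>?S. a v * v x) = (\<Sum>v\<in>?S. (\<lambda>x. a v * v x))" by (rule sum_fun_eq[symmetric])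
        also have "\<dots> = 0" by (rule a(2))
        also have "\<dots> = (\<lambda>x. 0)" by (rule zero_fun_def)
        finally show ?thesis .
      qed
      have ST: "v \<in> tangent_space M p" if "v \<in> ?S" for v using that wT e(1) by auto
      have ak: "a (e k) = 0" if k: "k \<in> K" for k
      proof -
        have "0 = (\<Sum>v\<in>?S. a v * g p v (e k))"
          using g_sum[OF p e(1)[OF k] ST, of ?S "\<lambda>v. v" a] g_zero[OF p e(1)[OF k]] unfolding z by simp
        also have "\<dots> = (\<Sum>k'\<in>K. a (e k') * g p (e k') (e k))"
          using K(1) wn' w0[OF k] by (simp add: sum.reindex[OF inj])
        also have "\<dots> = (\<Sum>k'\<in>K. if k' = k then a (e k) * g p (e k) (e k) else 0)"
          using orth[OF _ k] by (intro sum.cong) auto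
        also have "\<dots> = a (e k) * g p (e k) (e k)" using K(1) k by simp
        finally show ?thesis using e(2)[OF k] by simp
      qed
      have "(\<lambda>x. a w * w x) = (\<lambda>x. 0)"
      proof
        fix x
        have "(\<Sum>v\<in>?S. a v * v x) = a w * w x"
          using K(1) wn' ak by (simp add: sum.reindex[OF inj])
        then show "a w * w x = 0" using fun_cong[OF z, of x] by simp
      qed
      then have "a w = 0" using wn by (metis mult_eq_0_iff)
      then show False using a(1) ak by auto
    qed
    then have "card ?S \<le> card ?B"
      using vs.independent_span_bound[of ?B ?S] span wT e(1) finite_idx by auto
    moreover have "card ?B \<le> card J" by (rule card_image_le[OF finite_idx])
    moreover have "card ?S = Suc (card K)" using K(1) wn' card_image[OF inj] by simp
    ultimately show False using K(2) by (simp add: mdim_def)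
  qed
  then have "u f = s f" for f unfolding w_def by (metis eq_iff_diff_eq_0)
  then show ?thesis unfolding s_def by (intro ext)
qed

text \<open>Norms only have to be nonzero and the index set is arbitrary: the natural frame of the
  product is indexed by time and by pairs of a fibre and a number, and its lifted vectors have norm
  b^2 or -b^2.\<close>

definition orthogonal_frame :: "'k set \<Rightarrow> 'a set \<Rightarrow> ('k \<Rightarrow> 'a vfield) \<Rightarrow> bool" where
  "orthogonal_frame K W E \<longleftrightarrow> finite K \<and> card K = mdim M \<and> mopen W \<and>
    (\<forall>k\<in>K. vector_field M W (E k)) \<and>
    (\<forall>p\<in>W. \<forall>k\<in>K. g p (E k p) (E k p) \<noteq> 0) \<and>
    (\<forall>p\<in>W. \<forall>k\<in>K. \<forall>k'\<in>K. k \<noteq> k' \<longrightarrow> g p (E k p) (E k' p) = 0)"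

lemma orthonormal_imp_orthogonal:
  "mopen W \<Longrightarrow> orthonormal_frame M g W E \<Longrightarrow> orthogonal_frame {..<mdim M} W E"
  unfolding orthogonal_frame_def orthonormal_frame_def
  by (intro conjI ballI impI; elim conjE) (simp_all, metis empty_iff insert_iff neg_equal_0_iff_equal zero_neq_one)

lemma frame_field: "orthogonal_frame K W E \<Longrightarrow> k \<in> K \<Longrightarrow> vector_field M W (E k)"
  unfolding orthogonal_frame_def by (elim conjE) (erule bspec)

lemma frame_open: "orthogonal_frame K W E \<Longrightarrow> mopen W"
  unfolding orthogonal_frame_def by blast

lemma frame_norm: "orthogonal_frame K W E \<Longrightarrow> k \<in> K \<Longrightarrow> p \<in> W \<Longrightarrow> g p (E k p) (E k p) \<noteq> 0"
  unfolding orthogonal_frame_def by blast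

lemma frame_orth: "orthogonal_frame K W E \<Longrightarrow> k \<in> K \<Longrightarrow> k' \<in> K \<Longrightarrow> p \<in> W \<Longrightarrow> k \<noteq> k' \<Longrightarrow> g p (E k p) (E k' p) = 0"
  unfolding orthogonal_frame_def by blast

lemma frame_expand:
  assumes F: "orthogonal_frame K W E" and p: "p \<in> W" and u: "u \<in> tangent_space M p"
  shows "u = (\<lambda>f. \<Sum>k\<in>K. g p u (E k p) / g p (E k p) (E k p) * E k p f)"
proof (rule orthogonal_expand[OF _ _ _ _ _ _ u])
  show "p \<in> points M" using mopen_points[OF frame_open[OF F] p] .
  show "finite K" "card K = mdim M" using F by (auto simp: orthogonal_frame_def)
qed (use frame_norm[OF F _ p] frame_orth[OF F _ _ p] vf_tangent[OF frame_field[OF F] p] in auto)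

text \<open>Nondegeneracy in the form used to identify covariant derivatives: a vector is known once
  its inner products with a frame are known.\<close>

lemma frame_eqI:
  assumes F: "orthogonal_frame K W E" and p: "p \<in> W" and u: "u \<in> tangent_space M p" "v \<in> tangent_space M p"
    and e: "\<And>k. k \<in> K \<Longrightarrow> g p u (E k p) = g p v (E k p)"
  shows "u = v"
proof -
  have "(\<lambda>f. \<Sum>k\<in>K. g p u (E k p) / g p (E k p) (E k p) * E k p f) =
      (\<lambda>f. \<Sum>k\<in>K. g p v (E k p) / g p (E k p) (E k p) * E k p f)"
    by (intro ext sum.cong refl) (simp add: e)
  then show ?thesis using frame_expand[OF F p u(1)] frame_expand[OF F p u(2)] by simp
qed

lemma frame_parseval:
  assumes F: "orthogonal_frame K W E" and p: "p \<in> W" and u: "u \<in> tangent_space M p" "v \<in> tangent_space M p"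
  shows "g p u v = (\<Sum>k\<in>K. g p u (E k p) * g p v (E k p) / g p (E k p) (E k p))"
proof -
  have pM: "p \<in> points M" using mopen_points[OF frame_open[OF F] p] .
  have E: "E k p \<in> tangent_space M p" if "k \<in> K" for k using vf_tangent[OF frame_field[OF F that] p] .
  have "g p u v = g p (\<lambda>f. \<Sum>k\<in>K. g p u (E k p) / g p (E k p) (E k p) * E k p f) v"
    using frame_expand[OF F p u(1)] by simp
  also have "\<dots> = (\<Sum>k\<in>K. g p u (E k p) / g p (E k p) (E k p) * g p (E k p) v)"
    by (rule g_sum[OF pM u(2) E])
  also have "\<dots> = (\<Sum>k\<in>K. g p u (E k p) * g p v (E k p) / g p (E k p) (E k p))"
    by (rule sum.cong) (simp_all add: g_sym[OF pM E u(2)])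
  finally show ?thesis .
qed

text \<open>The coefficients are quotients of smooth functions on the common domain with
  nonvanishing denominators, so the expansion is a combination of fields with smooth coefficients
  near \<open>p\<close>.\<close>

lemma tensorial_expand:
  assumes T: "tensorial_at p T" and X: "vector_field M V X" "p \<in> V"
    and F: "orthogonal_frame K W E" "p \<in> W"
  shows "T X = (\<Sum>k\<in>K. g p (X p) (E k p) / g p (E k p) (E k p) * T (E k))"
proof -
  have o: "mopen (V \<inter> W)" using vf_open[OF X(1)] frame_open[OF F(1)] by blast
  note X' = vf_subset[OF X(1) o Int_lower1]
  have E': "vector_field M (V \<inter> W) (E k)" if "k \<in> K" for k
    using vf_subset[OF frame_field[OF F(1) that] o Int_lower2] .
  have p: "p \<in> V \<inter> W" using X F by simp
  have "T X = T (\<lambda>q h. \<Sum>k\<in>K. (g q (X q) (E k q) / g q (E k q) (E k q)) * E k q h)"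
  proof (rule tensorial_cong[OF T p X'])
    fix q assume "q \<in> V \<inter> W"
    then show "X q = (\<lambda>h. \<Sum>k\<in>K. (g q (X q) (E k q) / g q (E k q) (E k q)) * E k q h)"
      using frame_expand[OF F(1) _ vf_tangent[OF X']] by blast
  qed
  also have "\<dots> = (\<Sum>k\<in>K. g p (X p) (E k p) / g p (E k p) (E k p) * T (E k))"
    by (rule tensorial_sum[OF T p o E'])
      (use frame_norm[OF F(1)] in \<open>auto intro!: smooth_on_divide g_smooth X' E'\<close>)
  finally show ?thesis .
qed

text \<open>Each vector of one frame is expanded twice in the other, and the sum over the first
  frame then collapses by Parseval's identity. \<open>A\<close> is only bilinear; symmetry is not
  assumed, as befits the Ricci tensor of a connection with torsion.\<close>

lemma trace_frame_independent:
  assumes T1: "\<And>W Y. p \<in> W \<Longrightarrow> vector_field M W Y \<Longrightarrow> tensorial_at p (\<lambda>X. A X Y)"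
    and T2: "\<And>W X. p \<in> W \<Longrightarrow> vector_field M W X \<Longrightarrow> tensorial_at p (A X)"
    and F: "orthogonal_frame K V E" "p \<in> V" and F': "orthogonal_frame K' V' E'" "p \<in> V'"
  shows "(\<Sum>k\<in>K. A (E k) (E k) / g p (E k p) (E k p)) = (\<Sum>k\<in>K'. A (E' k) (E' k) / g p (E' k p) (E' k p))"
proof -
  define N where "N k = g p (E k p) (E k p)" for k
  define N' where "N' k = g p (E' k p) (E' k p)" for k
  define c where "c k a = g p (E k p) (E' a p)" for k a
  have pM: "p \<in> points M" using mopen_points[OF frame_open[OF F(1)] F(2)] .
  have E: "E k p \<in> tangent_space M p" if "k \<in> K" for k using vf_tangent[OF frame_field[OF F(1) that] F(2)] .
  have E': "E' k p \<in> tangent_space M p" if "k \<in> K'" for k using vf_tangent[OF frame_field[OF F'(1) that] F'(2)] .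
  have K': "finite K'" using F'(1) by (simp add: orthogonal_frame_def)
  have 1: "A (E k) (E k) = (\<Sum>a\<in>K'. \<Sum>b\<in>K'. c k a * c k b / (N' a * N' b) * A (E' a) (E' b))" if k: "k \<in> K" for k
  proof -
    have "A (E k) (E k) = (\<Sum>a\<in>K'. c k a / N' a * A (E' a) (E k))"
      unfolding c_def N'_def
      by (rule tensorial_expand[OF T1[OF F(2) frame_field[OF F(1) k]] frame_field[OF F(1) k] F(2) F'])
    also have "\<dots> = (\<Sum>a\<in>K'. c k a / N' a * (\<Sum>b\<in>K'. c k b / N' b * A (E' a) (E' b)))"
      unfolding c_def N'_def
      by (intro sum.cong refl arg_cong2[of _ _ _ _ "(*)"]
          tensorial_expand[OF T2[OF F'(2) frame_field[OF F'(1)]] frame_field[OF F(1) k] F(2) F'])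
    also have "\<dots> = (\<Sum>a\<in>K'. \<Sum>b\<in>K'. c k a * c k b / (N' a * N' b) * A (E' a) (E' b))"
      by (simp add: sum_distrib_left mult.assoc)
    finally show ?thesis .
  qed
  \<comment> \<open>Parseval's identity in the frame \<open>E\<close> for the pair
    \<open>E' a\<close>, \<open>E' b\<close>: the orthogonality relation of the change of
    frame.\<close>
  have 2: "(\<Sum>k\<in>K. c k a * c k b / N k) = (if a = b then N' a else 0)" if "a \<in> K'" "b \<in> K'" for a b
  proof -
    have "(\<Sum>k\<in>K. c k a * c k b / N k) = g p (E' a p) (E' b p)"
      unfolding frame_parseval[OF F E'[OF that(1)] E'[OF that(2)]] c_def N_def
      by (rule sum.cong) (simp_all add: g_sym[OF pM E] E' that)
    then show ?thesis using frame_orth[OF F'(1) that F'(2)] by (auto simp: N'_def)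
  qed
  have "(\<Sum>k\<in>K. A (E k) (E k) / N k) =
      (\<Sum>k\<in>K. \<Sum>a\<in>K'. \<Sum>b\<in>K'. c k a * c k b / N k * (A (E' a) (E' b) / (N' a * N' b)))"
    by (rule sum.cong) (simp_all add: 1 sum_divide_distrib ac_simps)
  also have "\<dots> = (\<Sum>a\<in>K'. \<Sum>k\<in>K. \<Sum>b\<in>K'. c k a * c k b / N k * (A (E' a) (E' b) / (N' a * N' b)))"
    by (rule sum.swap)
  also have "\<dots> = (\<Sum>a\<in>K'. \<Sum>b\<in>K'. \<Sum>k\<in>K. c k a * c k b / N k * (A (E' a) (E' b) / (N' a * N' b)))"
    by (intro sum.cong refl sum.swap)
  also have "\<dots> = (\<Sum>a\<in>K'. \<Sum>b\<in>K'. (if a = b then N' a else 0) * (A (E' a) (E' b) / (N' a * N' b)))"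
    by (intro sum.cong refl) (simp only: sum_distrib_right[symmetric] 2)
  also have "\<dots> = (\<Sum>a\<in>K'. A (E' a) (E' a) / N' a)"
  proof (rule sum.cong[OF refl])
    fix a assume a: "a \<in> K'"
    have n: "N' a \<noteq> 0" using frame_norm[OF F'(1) a F'(2)] by (simp add: N'_def)
    have "(\<Sum>b\<in>K'. (if a = b then N' a else 0) * (A (E' a) (E' b) / (N' a * N' b))) =
      (\<Sum>b\<in>K'. if b = a then A (E' a) (E' a) / N' a else 0)"
      using n by (intro sum.cong) auto
    then show "(\<Sum>b\<in>K'. (if a = b then N' a else 0) * (A (E' a) (E' b) / (N' a * N' b))) = A (E' a) (E' a) / N' a"
      using K' a by simp
  qed
  finally show ?thesis by (simp add: N_def N'_def)
qed

text \<open>Three compatibility identities with the fields permuted are combined, and differences of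
  covariant derivatives become brackets by vanishing torsion. The right-hand side no longer contains
  the connection.\<close>

lemma koszul:
  assumes L: "levi_civita M g D"
    and X: "vector_field M W X" and Y: "vector_field M W Y" and Z: "vector_field M W Z" and p: "p \<in> W"
  shows "2 * g p (D X Y p) (Z p) = X p (\<lambda>q. g q (Y q) (Z q)) + Y p (\<lambda>q. g q (X q) (Z q))
    - Z p (\<lambda>q. g q (X q) (Y q)) + g p (lie_bracket M X Y p) (Z p)
    - g p (lie_bracket M X Z p) (Y p) - g p (lie_bracket M Y Z p) (X p)"
proof -
  interpret affine_manifold M D
    by unfold_locales (use L in \<open>simp add: levi_civita_def\<close>)
  have pM: "p \<in> points M" using vf_points[OF X p] .
  have tor: "g p (lie_bracket M A B p) (C p) = g p (D A B p) (C p) - g p (D B A p) (C p)"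
    if A: "vector_field M W A" and B: "vector_field M W B" and C: "vector_field M W C" for A B C
  proof -
    have "lie_bracket M A B p = (\<lambda>f. D A B p f - D B A p f)"
      using L A B p unfolding levi_civita_def by (intro ext) metis
    then show ?thesis
      using g_diff[OF pM vf_tangent[OF D_field[OF A B] p] vf_tangent[OF C p] vf_tangent[OF D_field[OF B A] p]] by simp
  qed
  have comp: "A p (\<lambda>q. g q (B q) (C q)) = g p (D A B p) (C p) + g p (D A C p) (B p)"
    if A: "vector_field M W A" and B: "vector_field M W B" and C: "vector_field M W C" for A B C
    using L A B C p g_sym[OF pM vf_tangent[OF B p] vf_tangent[OF D_field[OF A C] p]]
    unfolding levi_civita_def by metis
  show ?thesis
    unfolding comp[OF X Y Z] comp[OF Y X Z] comp[OF Z X Y] tor[OF X Y Z] tor[OF X Z Y] tor[OF Y Z X]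
    by simp
qed

text \<open>Both correction terms are function-linear in each argument, so the derivative term of
  the Leibniz rule comes from \<open>D\<close> alone.\<close>

lemma quarter_symmetric_affine:
  assumes "affine_connection M D" and P: "vector_field M (points M) P"
  shows "affine_connection M (quarter_symmetric g P l1 l2 D)"
proof -
  interpret affine_manifold M D by unfold_locales fact
  have P': "vector_field M W P" if "mopen W" for W
    using vf_subset[OF P that] mopen_points[OF that] by blast
  have eq: "quarter_symmetric g P l1 l2 D X Y =
      (\<lambda>p f. D X Y p f + (l1 * g p (Y p) (P p)) * X p f - (l2 * g p (X p) (Y p)) * P p f)" for X Y
    by (intro ext) (simp add: quarter_symmetric_def)
  show ?thesis
    unfolding affine_connection_def
  proof (intro conjI allI impI ballI; elim conjE)
    fix W X Y assume X: "vector_field M W X" and Y: "vector_field M W Y"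
    show "vector_field M W (quarter_symmetric g P l1 l2 D X Y)"
      unfolding eq
      by (intro vf_diff vf_add vf_scale D_field X Y P'[OF vf_open[OF X]] smooth_on_cmult g_smooth)
  next
    fix W X Y Z p f
    assume X: "vector_field M W X" and Y: "vector_field M W Y" and Z: "vector_field M W Z" and p: "p \<in> W"
    note P'' = P'[OF vf_open[OF X]] and pM = vf_points[OF X p]
    note T = vf_tangent[OF X p] vf_tangent[OF Y p] vf_tangent[OF Z p] vf_tangent[OF P'' p]
    show "quarter_symmetric g P l1 l2 D (\<lambda>q h. X q h + Y q h) Z p f =
        quarter_symmetric g P l1 l2 D X Z p f + quarter_symmetric g P l1 l2 D Y Z p f"
      by (simp add: eq D_add_left[OF X Y Z p] g_add[OF pM] T algebra_simps)
    show "quarter_symmetric g P l1 l2 D X (\<lambda>q h. Y q h + Z q h) p f =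
        quarter_symmetric g P l1 l2 D X Y p f + quarter_symmetric g P l1 l2 D X Z p f"
      by (simp add: eq D_add_right[OF X Y Z p] g_add[OF pM] g_add_right[OF pM] T algebra_simps)
  next
    fix W X Y \<psi> p f
    assume X: "vector_field M W X" and Y: "vector_field M W Y" and \<psi>: "smooth_on M W \<psi>" and p: "p \<in> W"
    note P'' = P'[OF vf_open[OF X]] and pM = vf_points[OF X p]
    note T = vf_tangent[OF X p] vf_tangent[OF Y p] vf_tangent[OF P'' p]
    show "quarter_symmetric g P l1 l2 D (\<lambda>q h. \<psi> q * X q h) Y p f = \<psi> p * quarter_symmetric g P l1 l2 D X Y p f"
      by (simp add: eq D_scale_left[OF X Y \<psi> p] g_scale[OF pM] T algebra_simps)
    show "quarter_symmetric g P l1 l2 D X (\<lambda>q h. \<psi> q * Y q h) p f =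
        X p \<psi> * Y p f + \<psi> p * quarter_symmetric g P l1 l2 D X Y p f"
      by (simp add: eq D_scale_right[OF X Y \<psi> p] g_scale[OF pM] g_scale_right[OF pM] T algebra_simps)
  qed
qed

text \<open>Gram--Schmidt, starting from constant-coefficient extensions of an orthonormal basis at \<open>p\<close>.\<close>

lemma orthonormal_extension:
  fixes n :: nat
  assumes p: "p \<in> points M"
  shows "(\<And>k. k < n \<Longrightarrow> e k \<in> tangent_space M p) \<Longrightarrow> (\<And>k. k < n \<Longrightarrow> g p (e k) (e k) \<in> {-1, 1}) \<Longrightarrow>
    (\<And>k k'. k < n \<Longrightarrow> k' < n \<Longrightarrow> k \<noteq> k' \<Longrightarrow> g p (e k) (e k') = 0) \<Longrightarrow>
    \<exists>W E. p \<in> W \<and> mopen W \<and> (\<forall>k<n. vector_field M W (E k) \<and> E k p = e k) \<and>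
    (\<forall>q\<in>W. (\<forall>k<n. g q (E k q) (E k q) \<in> {-1, 1}) \<and>
      (\<forall>k<n. \<forall>k'<n. k \<noteq> k' \<longrightarrow> g q (E k q) (E k' q) = 0))"
proof (induction n)
  case 0
  have "mopen (points M)" by (simp add: points_def)
  then show ?case using p by (intro exI[of _ "points M"]) auto
next
  case (Suc n)
  have "\<exists>W E. p \<in> W \<and> mopen W \<and> (\<forall>k<n. vector_field M W (E k) \<and> E k p = e k) \<and>
    (\<forall>q\<in>W. (\<forall>k<n. g q (E k q) (E k q) \<in> {-1, 1}) \<and>
      (\<forall>k<n. \<forall>k'<n. k \<noteq> k' \<longrightarrow> g q (E k q) (E k' q) = 0))"
    by (rule Suc.IH) (use Suc.prems in auto)
  then obtain W E where W: "p \<in> W" "mopen W" and E1: "\<forall>k<n. vector_field M W (E k) \<and> E k p = e k"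
    and E2: "\<forall>q\<in>W. (\<forall>k<n. g q (E k q) (E k q) \<in> {-1, 1}) \<and>
      (\<forall>k<n. \<forall>k'<n. k \<noteq> k' \<longrightarrow> g q (E k q) (E k' q) = 0)"
    by (elim exE conjE)
  have E: "vector_field M W (E k)" and Ep: "E k p = e k" if "k < n" for k
    using E1 that by simp_all
  have En: "g q (E k q) (E k q) \<in> {-1, 1}" if "q \<in> W" "k < n" for q k
    using bspec[OF E2 that(1)] that(2) by blast
  have Eo: "g q (E k q) (E k' q) = 0" if "q \<in> W" "k < n" "k' < n" "k \<noteq> k'" for q k k'
    using bspec[OF E2 that(1)] that(2-4) by blast
  obtain U \<phi> where A: "(U, \<phi>) \<in> atlas M" "p \<in> U" using chart_cover[OF p] by blast
  define Z where "Z = (\<lambda>q h. \<Sum>j\<in>J. e n (\<lambda>q. \<phi> q j) * coord_vec U \<phi> j q h)"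
  define V where "V = W \<inter> U"
  have oV: "mopen V" "p \<in> V" using W A chart_open by (auto simp: V_def)
  have Z: "vector_field M V Z"
    unfolding Z_def
    by (intro vf_sum oV(1) smooth_on_const) (rule vf_subset[OF coord_vec_field[OF A(1)] oV(1)], auto simp: V_def)
  have Zp: "Z p = e n"
    unfolding Z_def by (rule ext) (rule tangent_expand[OF A Suc.prems(1)[OF lessI], symmetric])
  have EV: "vector_field M V (E k)" if "k < n" for k
    using vf_subset[OF E[OF that] oV(1)] by (simp add: V_def)
  define S where "S = (\<lambda>q h. \<Sum>k<n. (g q (E k q) (E k q) * g q (Z q) (E k q)) * E k q h)"
  have S: "vector_field M V S"
    unfolding S_def by (intro vf_sum oV(1) smooth_on_mult g_smooth EV Z) auto
  define Y where "Y = (\<lambda>q h. Z q h - S q h)"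
  have Y: "vector_field M V Y" unfolding Y_def by (rule vf_diff[OF Z S])
  have Yo: "g q (Y q) (E k q) = 0" if q: "q \<in> V" and k: "k < n" for q k
  proof -
    have qM: "q \<in> points M" using mopen_points oV q by blast
    have qW: "q \<in> W" using q by (simp add: V_def)
    have Ek: "E k q \<in> tangent_space M q" if "k < n" for k using vf_tangent[OF EV[OF that] q] .
    have "g q (S q) (E k q) = (\<Sum>k'<n. (g q (E k' q) (E k' q) * g q (Z q) (E k' q)) * g q (E k' q) (E k q))"
      unfolding S_def by (rule g_sum[OF qM Ek[OF k]]) (simp add: Ek)
    also have "\<dots> = (\<Sum>k'<n. if k' = k then g q (Z q) (E k q) else 0)"
      using Eo[OF qW _ k] En[OF qW k] by (intro sum.cong) auto
    also have "\<dots> = g q (Z q) (E k q)" using k by simp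
    finally show ?thesis
      using g_diff[OF qM vf_tangent[OF Z q] Ek[OF k] vf_tangent[OF S q]] by (simp add: Y_def)
  qed
  \<comment> \<open>The projection vanishes at \<open>p\<close> because \<open>e n\<close> is
    already orthogonal to the earlier vectors, so the extension keeps its prescribed value
    there.\<close>
  have "S p = (\<lambda>h. 0)"
    unfolding S_def using Suc.prems(3)[of n] by (intro ext sum.neutral) (simp add: Zp Ep)
  then have Yp: "Y p = e n" by (simp add: Y_def Zp)
  define s where "s = g p (e n) (e n)"
  have s: "s = 1 \<or> s = -1" using Suc.prems(2)[of n] by (auto simp: s_def)
  \<comment> \<open>The sign \<open>s\<close> makes \<open>N\<close> positive at \<open>p\<close>
    even for a timelike vector. Dividing by the square root of \<open>N\<close> is then possible on
    the open set where \<open>N\<close> stays positive.\<close>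
  define N where "N = (\<lambda>q. s * g q (Y q) (Y q))"
  have N: "smooth_on M V N" unfolding N_def by (intro smooth_on_cmult g_smooth Y)
  have Np: "N p = 1" using s by (auto simp: N_def Yp s_def[symmetric])
  define V' where "V' = {q \<in> V. N q \<in> {0<..}}"
  have V': "mopen V'" "p \<in> V'" "V' \<subseteq> V"
    using smooth_on_preimage_open[OF N open_greaterThan, of 0] oV Np by (simp_all add: V'_def)
  have N': "smooth_on M V' (\<lambda>q. N q powr (- 1/2))"
    using smooth_on_subset[OF N V'(1,3)] by (rule smooth_on_powr) (simp add: V'_def)
  define E' where "E' = E(n := (\<lambda>q h. N q powr (- 1/2) * Y q h))"
  have Y': "vector_field M V' Y" using vf_subset[OF Y V'(1,3)] .
  have 1: "vector_field M V' (E' k) \<and> E' k p = e k" if "k < Suc n" for k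
  proof (cases "k = n")
    case True
    then show ?thesis using vf_scale[OF Y' N'] Np Yp by (simp add: E'_def)
  next
    case False
    then show ?thesis using that vf_subset[OF EV V'(1,3)] Ep by (simp add: E'_def)
  qed
  have 2: "(\<forall>k<Suc n. g q (E' k q) (E' k q) \<in> {-1, 1}) \<and>
      (\<forall>k<Suc n. \<forall>k'<Suc n. k \<noteq> k' \<longrightarrow> g q (E' k q) (E' k' q) = 0)" if q: "q \<in> V'" for q
  proof -
    have qV: "q \<in> V" and qW: "q \<in> W" using q V'(3) by (auto simp: V_def)
    have qM: "q \<in> points M" using mopen_points oV qV by blast
    have Tq: "Y q \<in> tangent_space M q" using vf_tangent[OF Y qV] .
    have TE: "E k q \<in> tangent_space M q" if "k < n" for k using vf_tangent[OF EV[OF that] qV] .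
    have pos: "N q > 0" using q by (simp add: V'_def)
    have "g q (E' n q) (E' n q) = (N q powr (- 1/2) * N q powr (- 1/2)) * g q (Y q) (Y q)"
      using g_scale[OF qM Tq Tq] g_scale_right[OF qM tangent_space_scale[OF Tq] Tq] by (simp add: E'_def)
    also have "\<dots> = g q (Y q) (Y q) / N q"
    proof -
      have "N q powr (- 1/2) * N q powr (- 1/2) = N q powr (- 1/2 + - 1/2)" by (rule powr_add[symmetric])
      also have "- 1/2 + - 1/2 = (- 1 :: real)" by simp
      also have "N q powr (- 1) = 1 / N q" using pos by (rule powr_neg_one)
      finally have pw: "N q powr (- 1/2) * N q powr (- 1/2) = 1 / N q" .
      show ?thesis unfolding pw by simp
    qed
    also have "\<dots> = s" using s pos by (auto simp: N_def)
    finally have nn: "g q (E' n q) (E' n q) \<in> {-1, 1}" using s by auto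
    have o1: "g q (E' n q) (E' k q) = 0" if "k < n" for k
      using g_scale[OF qM Tq TE[OF that]] Yo[OF qV that] that by (simp add: E'_def)
    have o2: "g q (E' k q) (E' n q) = 0" if "k < n" for k
      using o1[OF that] g_sym[OF qM] 1[of n] 1[of k] vf_tangent[OF _ q] that by (metis less_Suc_eq)
    have o3: "E' k q = E k q" if "k < n" for k using that by (simp add: E'_def)
    show ?thesis
      using nn o1 o2 o3 En[OF qW] Eo[OF qW] by (metis less_Suc_eq)
  qed
  have a1: "\<forall>k<Suc n. vector_field M V' (E' k) \<and> E' k p = e k"
    by (intro allI impI) (rule 1)
  have a2: "\<forall>q\<in>V'. (\<forall>k<Suc n. g q (E' k q) (E' k q) \<in> {-1, 1}) \<and>
      (\<forall>k<Suc n. \<forall>k'<Suc n. k \<noteq> k' \<longrightarrow> g q (E' k q) (E' k' q) = 0)"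
    by (intro ballI) (rule 2)
  show ?case by (rule exI[of _ V'], rule exI[of _ E']) (intro conjI V'(1,2) a1 a2)
qed

end

lemma pseudo_riemannian_metric:
  assumes "pseudo_riemannian M g" shows "metric_manifold M g"
proof -
  note a = assms[unfolded pseudo_riemannian_def]
  have 1: "smooth_manifold M" using a by blast
  have 2: "\<forall>p\<in>points M. \<forall>u\<in>tangent_space M p. \<forall>v\<in>tangent_space M p.
        g p u v = g p v u \<and>
        (\<forall>c. g p (\<lambda>f. c * u f) v = c * g p u v) \<and>
        (\<forall>w\<in>tangent_space M p. g p (\<lambda>f. u f + w f) v = g p u v + g p w v)"
    using a by (elim conjE)
  have 3: "\<forall>W X Y. vector_field M W X \<and> vector_field M W Y \<longrightarrow> smooth_on M W (\<lambda>p. g p (X p) (Y p))"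
    using a by (elim conjE)
  interpret charted_space M by (rule smooth_manifold_charted[OF 1])
  show ?thesis by unfold_locales (use 2 3 in \<open>blast+\<close>)
qed

section \<open>The Ricci tensor as a trace over an arbitrary orthogonal frame\<close>

text \<open>Local orthonormal frames stand in for nondegeneracy and the index. On a
  pseudo-Riemannian manifold they come from Gram-Schmidt; on the product they are built from frames
  of the fibres.\<close>

locale framed_manifold = metric_manifold +
  assumes frame_exists: "\<And>p. p \<in> points M \<Longrightarrow> \<exists>W E. p \<in> W \<and> mopen W \<and> orthonormal_frame M g W E"

lemma pseudo_riemannian_framed:
  assumes "pseudo_riemannian M g" shows "framed_manifold M g"
proof -
  interpret metric_manifold M g by (rule pseudo_riemannian_metric[OF assms])
  show ?thesis
  proof unfold_locales
    fix p assume p: "p \<in> points M"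
    have "\<exists>\<nu>. \<forall>p\<in>points M. has_index_at M g p \<nu>" using assms unfolding pseudo_riemannian_def by (elim conjE)
    then have "\<exists>\<nu>. has_index_at M g p \<nu>" using p by blast
    then obtain e where e: "\<forall>k<mdim M. e k \<in> tangent_space M p \<and> g p (e k) (e k) \<in> {-1, 1}"
      "\<forall>k<mdim M. \<forall>k'<mdim M. k \<noteq> k' \<longrightarrow> g p (e k) (e k') = 0"
      unfolding has_index_at_def by (elim exE conjE)
    have "\<exists>W E. p \<in> W \<and> mopen W \<and> (\<forall>k<mdim M. vector_field M W (E k) \<and> E k p = e k) \<and>
      (\<forall>q\<in>W. (\<forall>k<mdim M. g q (E k q) (E k q) \<in> {-1, 1}) \<and>
      (\<forall>k<mdim M. \<forall>k'<mdim M. k \<noteq> k' \<longrightarrow> g q (E k q) (E k' q) = 0))"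
      by (rule orthonormal_extension[OF p]) (use e in simp_all)
    then obtain W E where W: "p \<in> W" "mopen W" "\<forall>k<mdim M. vector_field M W (E k) \<and> E k p = e k"
      "\<forall>q\<in>W. (\<forall>k<mdim M. g q (E k q) (E k q) \<in> {-1, 1}) \<and>
      (\<forall>k<mdim M. \<forall>k'<mdim M. k \<noteq> k' \<longrightarrow> g q (E k q) (E k' q) = 0)"
      by (elim exE conjE)
    show "\<exists>W E. p \<in> W \<and> mopen W \<and> orthonormal_frame M g W E"
      unfolding orthonormal_frame_def using W by (intro exI[of _ W] exI[of _ E] conjI) simp_all
  qed
qed

locale framed_connection = framed_manifold + affine_manifold
begin

text \<open>One scheme for an operator \<open>Q\<close> covers the three slots of the curvature. The
  vector \<open>v\<close> is fixed at \<open>p\<close>, so only the behaviour of \<open>Q A\<close>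
  at \<open>p\<close> matters.\<close>

lemma curvature_form_tensorial:
  assumes p: "p \<in> W" and X: "vector_field M W X" and Y: "vector_field M W Y"
    and Z: "vector_field M W Z" and v: "v \<in> tangent_space M p"
  shows "tensorial_at p (\<lambda>A. g p (R A Y Z p) v)" "tensorial_at p (\<lambda>A. g p (R X A Z p) v)"
    "tensorial_at p (\<lambda>A. g p (R X Y A p) v)"
proof -
  have pM: "p \<in> points M" using vf_points[OF X p] .
  note o = vf_open[OF X]
  have *: "tensorial_at p (\<lambda>A. g p (Q A p) v)"
    if Q: "\<And>V A. p \<in> V \<Longrightarrow> V \<subseteq> W \<Longrightarrow> vector_field M V A \<Longrightarrow> vector_field M V (Q A)"
      and add: "\<And>V A B f. p \<in> V \<Longrightarrow> V \<subseteq> W \<Longrightarrow> vector_field M V A \<Longrightarrow> vector_field M V B \<Longrightarrow>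
        Q (\<lambda>q h. A q h + B q h) p f = Q A p f + Q B p f"
      and scale: "\<And>V A \<psi> f. p \<in> V \<Longrightarrow> V \<subseteq> W \<Longrightarrow> vector_field M V A \<Longrightarrow> smooth_on M V \<psi> \<Longrightarrow>
        Q (\<lambda>q h. \<psi> q * A q h) p f = \<psi> p * Q A p f" for Q
  proof (rule tensorial_atI[OF o p])
    fix V A B assume V: "p \<in> V" "V \<subseteq> W" and A: "vector_field M V A" and B: "vector_field M V B"
    have "Q (\<lambda>q h. A q h + B q h) p = (\<lambda>f. Q A p f + Q B p f)" using add[OF V A B] by (intro ext)
    then show "g p (Q (\<lambda>q h. A q h + B q h) p) v = g p (Q A p) v + g p (Q B p) v"
      using g_add[OF pM vf_tangent[OF Q[OF V A] V(1)] v vf_tangent[OF Q[OF V B] V(1)]] by simp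
  next
    fix V A \<psi> assume V: "p \<in> V" "V \<subseteq> W" and A: "vector_field M V A" and \<psi>: "smooth_on M V \<psi>"
    have "Q (\<lambda>q h. \<psi> q * A q h) p = (\<lambda>f. \<psi> p * Q A p f)" using scale[OF V A \<psi>] by (intro ext)
    then show "g p (Q (\<lambda>q h. \<psi> q * A q h) p) v = \<psi> p * g p (Q A p) v"
      using g_scale[OF pM vf_tangent[OF Q[OF V A] V(1)] v] by simp
  qed
  have sX: "vector_field M V X" and sY: "vector_field M V Y" and sZ: "vector_field M V Z"
    if "vector_field M V A" "V \<subseteq> W" for V A
    using vf_subset[OF X vf_open[OF that(1)] that(2)] vf_subset[OF Y vf_open[OF that(1)] that(2)]
      vf_subset[OF Z vf_open[OF that(1)] that(2)] by simp_all
  show "tensorial_at p (\<lambda>A. g p (R A Y Z p) v)"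
  proof (rule *)
    show "vector_field M V (R A Y Z)" if "p \<in> V" "V \<subseteq> W" "vector_field M V A" for V A
      by (rule R_field[OF that(3) sY[OF that(3,2)] sZ[OF that(3,2)]])
    show "R (\<lambda>q h. A q h + B q h) Y Z p f = R A Y Z p f + R B Y Z p f"
      if "p \<in> V" "V \<subseteq> W" "vector_field M V A" "vector_field M V B" for V A B f
      by (rule R_add_1[OF that(3) that(4) sY[OF that(3,2)] sZ[OF that(3,2)] that(1)])
    show "R (\<lambda>q h. \<psi> q * A q h) Y Z p f = \<psi> p * R A Y Z p f"
      if "p \<in> V" "V \<subseteq> W" "vector_field M V A" "smooth_on M V \<psi>" for V A \<psi> f
      by (rule R_scale_1[OF that(3) sY[OF that(3,2)] sZ[OF that(3,2)] that(4,1)])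
  qed
  show "tensorial_at p (\<lambda>A. g p (R X A Z p) v)"
  proof (rule *)
    show "vector_field M V (R X A Z)" if "p \<in> V" "V \<subseteq> W" "vector_field M V A" for V A
      by (rule R_field[OF sX[OF that(3,2)] that(3) sZ[OF that(3,2)]])
    show "R X (\<lambda>q h. A q h + B q h) Z p f = R X A Z p f + R X B Z p f"
      if "p \<in> V" "V \<subseteq> W" "vector_field M V A" "vector_field M V B" for V A B f
      by (rule R_add_2[OF sX[OF that(3,2)] that(3) that(4) sZ[OF that(3,2)] that(1)])
    show "R X (\<lambda>q h. \<psi> q * A q h) Z p f = \<psi> p * R X A Z p f"
      if "p \<in> V" "V \<subseteq> W" "vector_field M V A" "smooth_on M V \<psi>" for V A \<psi> f
      by (rule R_scale_2[OF sX[OF that(3,2)] that(3) sZ[OF that(3,2)] that(4,1)])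
  qed
  show "tensorial_at p (\<lambda>A. g p (R X Y A p) v)"
  proof (rule *)
    show "vector_field M V (R X Y A)" if "p \<in> V" "V \<subseteq> W" "vector_field M V A" for V A
      by (rule R_field[OF sX[OF that(3,2)] sY[OF that(3,2)] that(3)])
    show "R X Y (\<lambda>q h. A q h + B q h) p f = R X Y A p f + R X Y B p f"
      if "p \<in> V" "V \<subseteq> W" "vector_field M V A" "vector_field M V B" for V A B f
      by (rule R_add_3[OF sX[OF that(3,2)] sY[OF that(3,2)] that(3) that(4) that(1)])
    show "R X Y (\<lambda>q h. \<psi> q * A q h) p f = \<psi> p * R X Y A p f"
      if "p \<in> V" "V \<subseteq> W" "vector_field M V A" "smooth_on M V \<psi>" for V A \<psi> f
      by (rule R_scale_3[OF sX[OF that(3,2)] sY[OF that(3,2)] that(3) that(4,1)])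
  qed
qed

lemma g_vf_tensorial:
  assumes p: "p \<in> points M" and u: "u \<in> tangent_space M p"
  shows "tensorial_at p (\<lambda>A. g p u (A p))"
  unfolding tensorial_at_def
  using g_add_right[OF p u] g_scale_right[OF p u] vf_tangent by blast

text \<open>\<open>ricci\<close> uses a frame selected by \<open>SOME\<close>. Existence of frames
  makes the selected one genuine, and frame independence of the trace replaces it by any convenient
  one.\<close>

lemma ricci_frame:
  assumes p: "p \<in> W" and X: "vector_field M W X" and Y: "vector_field M W Y"
    and F: "orthogonal_frame K V E" "p \<in> V"
  shows "ricci M g D X Y p = (\<Sum>k\<in>K. g p (R X (E k) Y p) (E k p) / g p (E k p) (E k p))"
proof -
  have pM: "p \<in> points M" using vf_points[OF X p] .
  define E0 where "E0 = (SOME E. \<exists>W. p \<in> W \<and> orthonormal_frame M g W E)"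
  have "\<exists>W. p \<in> W \<and> orthonormal_frame M g W E0"
    unfolding E0_def using frame_exists[OF pM] by (intro someI_ex[of "\<lambda>E. \<exists>W. p \<in> W \<and> orthonormal_frame M g W E"]) blast
  then obtain V0 where V0: "p \<in> V0" "orthonormal_frame M g V0 E0" by blast
  have ric: "ricci M g D X Y p = (\<Sum>k<mdim M. g p (E0 k p) (E0 k p) * g p (R X (E0 k) Y p) (E0 k p))"
    by (simp add: ricci_def Let_def E0_def)
  have K: "finite K" "card K = mdim M" using F by (auto simp: orthogonal_frame_def)
  show ?thesis
  \<comment> \<open>In dimension 0 an orthonormal frame contains no field, so its domain is not
    known to be open; both sums are then empty.\<close>
  proof (cases "mdim M = 0")
    case True
    then show ?thesis using ric K by simp
  next
    case False
    then have "vector_field M V0 (E0 0)" using V0(2) by (simp add: orthonormal_frame_def)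
    then have oV0: "mopen V0" by (rule vf_open)
    note F0 = orthonormal_imp_orthogonal[OF oV0 V0(2)]
    \<comment> \<open>Multiplying by a norm of 1 or -1 is dividing by it. The quotient is the form
      that remains correct for frames with other norms.\<close>
    have "g p (E0 k p) (E0 k p) * z = z / g p (E0 k p) (E0 k p)" if "k < mdim M" for k z
      using V0 that unfolding orthonormal_frame_def by (elim conjE) fastforce
    then have "ricci M g D X Y p = (\<Sum>k<mdim M. g p (R X (E0 k) Y p) (E0 k p) / g p (E0 k p) (E0 k p))"
      unfolding ric by (intro sum.cong) auto
    also have "\<dots> = (\<Sum>k\<in>K. g p (R X (E k) Y p) (E k p) / g p (E k p) (E k p))"
    proof (rule trace_frame_independent[OF _ _ F0 V0(1) F, where A = "\<lambda>A B. g p (R X A Y p) (B p)"])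
      fix U B assume U: "p \<in> U" "vector_field M U B"
      show "tensorial_at p (\<lambda>A. g p (R X A Y p) (B p))"
        using curvature_form_tensorial(2)[OF p X X Y vf_tangent[OF U(2,1)]] .
      have o: "mopen (U \<inter> W)" using vf_open[OF X] vf_open[OF U(2)] by blast
      have "R X B Y p \<in> tangent_space M p"
        by (rule vf_tangent[OF R_field[OF vf_subset[OF X o] vf_subset[OF U(2) o] vf_subset[OF Y o]]])
          (use U p in auto)
      then show "tensorial_at p (\<lambda>A. g p (R X B Y p) (A p))" by (rule g_vf_tensorial[OF pM])
    qed
    finally show ?thesis .
  qed
qed

lemma ricci_tensorial:
  assumes p: "p \<in> W" and X: "vector_field M W X" and Y: "vector_field M W Y"
  shows "tensorial_at p (\<lambda>A. ricci M g D A Y p)" "tensorial_at p (\<lambda>A. ricci M g D X A p)"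
proof -
  have pM: "p \<in> points M" using vf_points[OF X p] .
  obtain V E where V: "p \<in> V" "mopen V" "orthonormal_frame M g V E" using frame_exists[OF pM] by blast
  note F = orthonormal_imp_orthogonal[OF V(2,3)]
  let ?U = "V \<inter> W"
  have o: "mopen ?U" and pU: "p \<in> ?U" using V p vf_open[OF X] by auto
  note X' = vf_subset[OF X o Int_lower2] and Y' = vf_subset[OF Y o Int_lower2]
  note E' = vf_subset[OF frame_field[OF F] o Int_lower1]
  have t1: "tensorial_at p (\<lambda>A. g p (R A (E k) Y p) (E k p))" if "k < mdim M" for k
    using curvature_form_tensorial(1)[OF pU X' E' Y' vf_tangent[OF E' pU]] that by simp
  have t2: "tensorial_at p (\<lambda>A. g p (R X (E k) A p) (E k p))" if "k < mdim M" for k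
    using curvature_form_tensorial(3)[OF pU X' E' Y' vf_tangent[OF E' pU]] that by simp
  show "tensorial_at p (\<lambda>A. ricci M g D A Y p)"
  proof (rule tensorial_atI[OF o pU])
    fix U A B assume U: "p \<in> U" "U \<subseteq> ?U" and A: "vector_field M U A" and B: "vector_field M U B"
    have Y'': "vector_field M U Y" using vf_subset[OF Y' vf_open[OF A] U(2)] .
    show "ricci M g D (\<lambda>q h. A q h + B q h) Y p = ricci M g D A Y p + ricci M g D B Y p"
      unfolding ricci_frame[OF U(1) vf_add[OF A B] Y'' F V(1)] ricci_frame[OF U(1) A Y'' F V(1)]
        ricci_frame[OF U(1) B Y'' F V(1)] sum.distrib[symmetric]
      using tensorial_add[OF t1 U(1) A B] by (intro sum.cong) (simp_all add: add_divide_distrib)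
  next
    fix U A \<psi> assume U: "p \<in> U" "U \<subseteq> ?U" and A: "vector_field M U A" and \<psi>: "smooth_on M U \<psi>"
    have Y'': "vector_field M U Y" using vf_subset[OF Y' vf_open[OF A] U(2)] .
    show "ricci M g D (\<lambda>q h. \<psi> q * A q h) Y p = \<psi> p * ricci M g D A Y p"
      unfolding ricci_frame[OF U(1) vf_scale[OF A \<psi>] Y'' F V(1)] ricci_frame[OF U(1) A Y'' F V(1)]
        sum_distrib_left
      using tensorial_scale[OF t1 U(1) A \<psi>] by (intro sum.cong) simp_all
  qed
  show "tensorial_at p (\<lambda>A. ricci M g D X A p)"
  proof (rule tensorial_atI[OF o pU])
    fix U A B assume U: "p \<in> U" "U \<subseteq> ?U" and A: "vector_field M U A" and B: "vector_field M U B"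
    have X'': "vector_field M U X" using vf_subset[OF X' vf_open[OF A] U(2)] .
    show "ricci M g D X (\<lambda>q h. A q h + B q h) p = ricci M g D X A p + ricci M g D X B p"
      unfolding ricci_frame[OF U(1) X'' vf_add[OF A B] F V(1)] ricci_frame[OF U(1) X'' A F V(1)]
        ricci_frame[OF U(1) X'' B F V(1)] sum.distrib[symmetric]
      using tensorial_add[OF t2 U(1) A B] by (intro sum.cong) (simp_all add: add_divide_distrib)
  next
    fix U A \<psi> assume U: "p \<in> U" "U \<subseteq> ?U" and A: "vector_field M U A" and \<psi>: "smooth_on M U \<psi>"
    have X'': "vector_field M U X" using vf_subset[OF X' vf_open[OF A] U(2)] .
    show "ricci M g D X (\<lambda>q h. \<psi> q * A q h) p = \<psi> p * ricci M g D X A p"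
      unfolding ricci_frame[OF U(1) X'' vf_scale[OF A \<psi>] F V(1)] ricci_frame[OF U(1) X'' A F V(1)]
        sum_distrib_left
      using tensorial_scale[OF t2 U(1) A \<psi>] by (intro sum.cong) simp_all
  qed
qed

text \<open>Both sides of the Einstein equation are tensors, so each argument is expanded in the
  frame. The frame may depend on the point \<open>p\<close>, and only values at \<open>p\<close> are
  compared.\<close>

lemma einstein_frameI:
  fixes K :: "'k set"
  assumes "\<And>p. p \<in> points M \<Longrightarrow> \<exists>V E. p \<in> V \<and> orthogonal_frame K V E \<and>
      (\<forall>a\<in>K. \<forall>b\<in>K. ricci M g D (E a) (E b) p = \<alpha> * g p (E a p) (E b p))"
  shows "einstein M g D \<alpha>"
  unfolding einstein_def
proof (intro allI impI ballI; elim conjE)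
  fix W X Y p assume X: "vector_field M W X" and Y: "vector_field M W Y" and p: "p \<in> W"
  have pM: "p \<in> points M" using vf_points[OF X p] .
  from assms[OF pM] obtain V E where V: "p \<in> V" and F: "orthogonal_frame K V E"
    and ric0: "\<forall>a\<in>K. \<forall>b\<in>K. ricci M g D (E a) (E b) p = \<alpha> * g p (E a p) (E b p)"
    by (elim exE conjE)
  note ric = bspec[OF bspec[OF ric0]]
  note Ea = frame_field[OF F]
  define c where "c X a = g p (X p) (E a p) / g p (E a p) (E a p)" for X a
  have X1: "tensorial_at p (\<lambda>A. g p (A p) (Y p))"
    unfolding tensorial_at_def
    using g_add[OF pM _ vf_tangent[OF Y p]] g_scale[OF pM _ vf_tangent[OF Y p]] vf_tangent by blast
  have "ricci M g D X Y p = (\<Sum>a\<in>K. c X a * ricci M g D (E a) Y p)"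
    unfolding c_def by (rule tensorial_expand[OF ricci_tensorial(1)[OF p X Y] X p F V])
  also have "\<dots> = (\<Sum>a\<in>K. c X a * (\<alpha> * g p (E a p) (Y p)))"
  proof (intro sum.cong refl arg_cong2[of _ _ _ _ "(*)"])
    fix a assume a: "a \<in> K"
    have "ricci M g D (E a) Y p = (\<Sum>b\<in>K. c Y b * ricci M g D (E a) (E b) p)"
      unfolding c_def by (rule tensorial_expand[OF ricci_tensorial(2)[OF V Ea[OF a] Ea[OF a]] Y p F V])
    also have "\<dots> = \<alpha> * (\<Sum>b\<in>K. c Y b * g p (E a p) (E b p))"
      unfolding sum_distrib_left using ric[OF a] by (intro sum.cong) simp_all
    also have "(\<Sum>b\<in>K. c Y b * g p (E a p) (E b p)) = g p (E a p) (Y p)"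
      unfolding c_def
      by (rule tensorial_expand[OF g_vf_tensorial[OF pM vf_tangent[OF Ea[OF a] V]] Y p F V, symmetric])
    finally show "ricci M g D (E a) Y p = \<alpha> * g p (E a p) (Y p)" .
  qed
  also have "\<dots> = \<alpha> * (\<Sum>a\<in>K. c X a * g p (E a p) (Y p))"
    unfolding sum_distrib_left by (intro sum.cong) simp_all
  also have "(\<Sum>a\<in>K. c X a * g p (E a p) (Y p)) = g p (X p) (Y p)"
    unfolding c_def by (rule tensorial_expand[OF X1 X p F V, symmetric])
  finally show "ricci M g D X Y p = \<alpha> * g p (X p) (Y p)" .
qed

end

section \<open>The product manifold\<close>

lemma (in charted_space) chart_extensional: "(U, \<phi>) \<in> atlas M \<Longrightarrow> p \<in> U \<Longrightarrow> \<phi> p \<in> extensional J"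
  using openin_powertop_extensional[OF chart_image] by blast

lemma (in charted_space) chart_continuous:
  assumes "(U, \<phi>) \<in> atlas M"
  shows "continuous_map (subtopology (sp_top M) U) (powertop_real J) \<phi>"
  using homeomorphic_imp_continuous_map[OF chart_homeo[OF assms]] by (simp add: continuous_map_in_subtopology)

lemma (in charted_space) chart_inv_continuous:
  assumes A: "(U, \<phi>) \<in> atlas M"
  shows "continuous_map (subtopology (powertop_real J) (\<phi> ` U)) (sp_top M) (inv_into U \<phi>)"
proof -
  have t: "topspace (subtopology (sp_top M) U) = U" using openin_subset[OF chart_open[OF A]] by auto
  from chart_homeo[OF A] obtain \<psi> where
    \<psi>: "homeomorphic_maps (subtopology (sp_top M) U) (subtopology (powertop_real J) (\<phi> ` U)) \<phi> \<psi>"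
    unfolding homeomorphic_map_maps by (elim exE)
  have c: "continuous_map (subtopology (powertop_real J) (\<phi> ` U)) (sp_top M) \<psi>"
    and i: "\<And>q. q \<in> U \<Longrightarrow> \<psi> (\<phi> q) = q"
    using \<psi> t by (auto simp: homeomorphic_maps_def continuous_map_in_subtopology)
  from c show ?thesis
  proof (rule continuous_map_eq)
    fix y assume "y \<in> topspace (subtopology (powertop_real J) (\<phi> ` U))"
    then obtain q where "q \<in> U" "y = \<phi> q" by auto
    then show "\<psi> y = inv_into U \<phi> y" using i chart_inv[OF A] by simp
  qed
qed

section \<open>Product charts\<close>

locale product_charted =
  fixes I :: "real set" and m :: nat and F :: "nat \<Rightarrow> ('a, 'j) smooth_space"
  assumes I_open: "open I" and F_charted: "\<And>i. i \<in> {1..m} \<Longrightarrow> charted_space (F i)"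
begin

abbreviation "M \<equiv> product_space I m F"

definition chart_choice :: "(nat \<Rightarrow> 'a set \<times> ('a \<Rightarrow> 'j \<Rightarrow> real)) \<Rightarrow> bool" where
  "chart_choice c \<longleftrightarrow> (\<forall>i\<in>{1..m}. c i \<in> atlas (F i))"

definition prod_dom :: "(nat \<Rightarrow> 'a set \<times> ('a \<Rightarrow> 'j \<Rightarrow> real)) \<Rightarrow> (real \<times> (nat \<Rightarrow> 'a)) set" where
  "prod_dom c = I \<times> (\<Pi>\<^sub>E i\<in>{1..m}. fst (c i))"

definition prod_map ::
  "(nat \<Rightarrow> 'a set \<times> ('a \<Rightarrow> 'j \<Rightarrow> real)) \<Rightarrow> real \<times> (nat \<Rightarrow> 'a) \<Rightarrow> (nat \<times> 'j) option \<Rightarrow> real" where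
  "prod_map c = (\<lambda>(t, x). restrict (\<lambda>a. case a of None \<Rightarrow> t | Some (i, j) \<Rightarrow> snd (c i) (x i) j) (coord_idx M))"

text \<open>Extracts the coordinates belonging to one factor. The restriction puts the result into
  the model space of that factor, outside whose index set points are
  \<open>undefined\<close>.\<close>

definition block :: "nat \<Rightarrow> ((nat \<times> 'j) option \<Rightarrow> real) \<Rightarrow> 'j \<Rightarrow> real" where
  "block i z = (\<lambda>j\<in>coord_idx (F i). z (Some (i, j)))"

definition prod_img :: "(nat \<Rightarrow> 'a set \<times> ('a \<Rightarrow> 'j \<Rightarrow> real)) \<Rightarrow> ((nat \<times> 'j) option \<Rightarrow> real) set" where
  "prod_img c = {z \<in> extensional (coord_idx M). z None \<in> I \<and> (\<forall>i\<in>{1..m}. block i z \<in> snd (c i) ` fst (c i))}"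

text \<open>An explicit inverse of the product chart, through which \<open>inv_into\<close> for the
  whole chart becomes accessible one component at a time.\<close>

definition prod_inv ::
  "(nat \<Rightarrow> 'a set \<times> ('a \<Rightarrow> 'j \<Rightarrow> real)) \<Rightarrow> ((nat \<times> 'j) option \<Rightarrow> real) \<Rightarrow> real \<times> (nat \<Rightarrow> 'a)" where
  "prod_inv c z = (z None, \<lambda>i\<in>{1..m}. inv_into (fst (c i)) (snd (c i)) (block i z))"

lemma coord_idx_prod: "coord_idx M = insert None (Some ` (SIGMA i:{1..m}. coord_idx (F i)))"
  by (simp add: product_space_def Let_def)

lemma None_idx [simp]: "None \<in> coord_idx M" by (simp add: coord_idx_prod)

lemma Some_idx [simp]: "Some (i, j) \<in> coord_idx M \<longleftrightarrow> i \<in> {1..m} \<and> j \<in> coord_idx (F i)"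
  by (auto simp: coord_idx_prod)

lemma sp_top_prod: "sp_top M = prod_topology (top_of_set I) (product_topology (\<lambda>i. sp_top (F i)) {1..m})"
  by (simp add: product_space_def Let_def)

lemma points_prod: "points M = I \<times> (\<Pi>\<^sub>E i\<in>{1..m}. points (F i))"
  by (simp add: points_def sp_top_prod)

lemma atlas_prod: "atlas M = {(prod_dom c, prod_map c) | c. chart_choice c}"
  by (simp add: product_space_def Let_def prod_dom_def prod_map_def chart_choice_def)

lemma atlas_prodE:
  assumes "(U, \<phi>) \<in> atlas M" obtains c where "chart_choice c" "U = prod_dom c" "\<phi> = prod_map c"
  using assms unfolding atlas_prod by blast

lemma choice_atlas: "chart_choice c \<Longrightarrow> i \<in> {1..m} \<Longrightarrow> (fst (c i), snd (c i)) \<in> atlas (F i)"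
  by (simp add: chart_choice_def)

lemma prod_map_None [simp]: "prod_map c p None = fst p"
  by (simp add: prod_map_def split_beta)

lemma prod_map_Some: "i \<in> {1..m} \<Longrightarrow> j \<in> coord_idx (F i) \<Longrightarrow> prod_map c p (Some (i, j)) = snd (c i) (snd p i) j"
  by (simp add: prod_map_def split_beta)

lemma prod_map_extensional: "prod_map c p \<in> extensional (coord_idx M)"
  by (simp add: prod_map_def split_beta)

lemma prod_dom_component: "p \<in> prod_dom c \<Longrightarrow> i \<in> {1..m} \<Longrightarrow> snd p i \<in> fst (c i)"
  by (auto simp: prod_dom_def PiE_def Pi_def)

lemma block_prod_map:
  assumes c: "chart_choice c" and i: "i \<in> {1..m}" and p: "p \<in> prod_dom c"
  shows "block i (prod_map c p) = snd (c i) (snd p i)"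
proof -
  interpret Fi: charted_space "F i" by (rule F_charted[OF i])
  have "snd (c i) (snd p i) \<in> extensional (coord_idx (F i))"
    by (rule Fi.chart_extensional[OF choice_atlas[OF c i] prod_dom_component[OF p i]])
  then show ?thesis
    using i by (auto simp: block_def prod_map_Some restrict_def extensional_def)
qed

lemma prod_inv_map:
  assumes c: "chart_choice c" and p: "p \<in> prod_dom c"
  shows "prod_inv c (prod_map c p) = p"
proof -
  have "inv_into (fst (c i)) (snd (c i)) (block i (prod_map c p)) = snd p i" if i: "i \<in> {1..m}" for i
  proof -
    interpret Fi: charted_space "F i" by (rule F_charted[OF i])
    show ?thesis
      unfolding block_prod_map[OF c i p] by (rule Fi.chart_inv[OF choice_atlas[OF c i] prod_dom_component[OF p i]])
  qed
  then have "(\<lambda>i\<in>{1..m}. inv_into (fst (c i)) (snd (c i)) (block i (prod_map c p))) = snd p"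
    using p by (intro ext) (auto simp: prod_dom_def PiE_def extensional_def restrict_def)
  then show ?thesis by (simp add: prod_inv_def prod_eq_iff)
qed

lemma prod_map_in_img: "chart_choice c \<Longrightarrow> p \<in> prod_dom c \<Longrightarrow> prod_map c p \<in> prod_img c"
  using prod_dom_component[of p c]
  by (simp add: prod_img_def prod_map_extensional block_prod_map) (auto simp: prod_dom_def)

lemma prod_inv_in_dom: "z \<in> prod_img c \<Longrightarrow> prod_inv c z \<in> prod_dom c"
  by (auto simp: prod_inv_def prod_dom_def prod_img_def intro!: inv_into_into)

lemma prod_map_inv:
  assumes z: "z \<in> prod_img c" shows "prod_map c (prod_inv c z) = z"
proof
  fix a
  show "prod_map c (prod_inv c z) a = z a"
  proof (cases "a \<in> coord_idx M")
    case False
    then show ?thesis using z prod_map_extensional[of c] by (auto simp: prod_img_def extensional_def)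
  next
    case True
    show ?thesis
    proof (cases a)
      case None
      then show ?thesis by (simp add: prod_inv_def)
    next
      case (Some ij)
      obtain i j where ij: "ij = (i, j)" by (cases ij)
      have i: "i \<in> {1..m}" "j \<in> coord_idx (F i)" using True Some ij by simp_all
      have "snd (c i) (inv_into (fst (c i)) (snd (c i)) (block i z)) = block i z"
        using z i(1) by (intro f_inv_into_f) (simp add: prod_img_def)
      then show ?thesis using i Some ij by (simp add: prod_map_Some prod_inv_def block_def)
    qed
  qed
qed

lemma prod_map_image:
  assumes "chart_choice c" shows "prod_map c ` prod_dom c = prod_img c"
proof (intro equalityI subsetI)
  show "z \<in> prod_img c" if "z \<in> prod_map c ` prod_dom c" for z
    using that prod_map_in_img[OF assms] by (elim imageE) simp
  show "z \<in> prod_map c ` prod_dom c" if "z \<in> prod_img c" for z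
    using prod_map_inv[OF that, symmetric] prod_inv_in_dom[OF that] by (rule image_eqI)
qed

lemma prod_inv_into:
  assumes c: "chart_choice c" and p: "p \<in> prod_dom c"
  shows "inv_into (prod_dom c) (prod_map c) (prod_map c p) = p"
proof -
  have "inj_on (prod_map c) (prod_dom c)" by (rule inj_on_inverseI[of _ "prod_inv c"]) (rule prod_inv_map[OF c])
  then show ?thesis using p by (rule inv_into_f_f)
qed

lemma continuous_map_component:
  "i \<in> {1..m} \<Longrightarrow> continuous_map (sp_top M) (sp_top (F i)) (\<lambda>p. snd p i)"
  using continuous_map_compose[OF continuous_map_snd continuous_map_product_projection, of i "{1..m}"]
  unfolding sp_top_prod comp_def .

lemma continuous_map_time: "continuous_map (sp_top M) (top_of_set I) fst"
  unfolding sp_top_prod by (rule continuous_map_fst)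

lemma continuous_map_block:
  assumes "i \<in> {1..m}"
  shows "continuous_map (powertop_real (coord_idx M)) (powertop_real (coord_idx (F i))) (block i)"
  unfolding continuous_map_componentwise
proof (intro conjI ballI)
  show "block i ` topspace (powertop_real (coord_idx M)) \<subseteq> extensional (coord_idx (F i))"
    by (auto simp: block_def)
  fix j assume j: "j \<in> coord_idx (F i)"
  have "Some (i, j) \<in> coord_idx M" using assms j by simp
  from continuous_map_product_projection[OF this, of "\<lambda>_. euclideanreal"]
  show "continuous_map (powertop_real (coord_idx M)) euclideanreal (\<lambda>x. block i x j)"
    using j by (simp add: block_def)
qed

lemma openin_prod_dom:
  assumes c: "chart_choice c" shows "openin (sp_top M) (prod_dom c)"
proof -
  have "openin (product_topology (\<lambda>i. sp_top (F i)) {1..m}) (\<Pi>\<^sub>E i\<in>{1..m}. fst (c i))"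
    unfolding openin_PiE[OF finite_atLeastAtMost]
    using charted_space.chart_open[OF F_charted choice_atlas[OF c]] by blast
  then show ?thesis unfolding sp_top_prod prod_dom_def openin_prod_Times_iff by simp
qed

lemma openin_prod_img:
  assumes c: "chart_choice c" shows "openin (powertop_real (coord_idx M)) (prod_img c)"
proof -
  let ?T = "powertop_real (coord_idx M)"
  have 1: "openin ?T {z \<in> topspace ?T. block i z \<in> snd (c i) ` fst (c i)}" if i: "i \<in> {1..m}" for i
    by (rule openin_continuous_map_preimage[OF continuous_map_block[OF i]
          charted_space.chart_image[OF F_charted[OF i] choice_atlas[OF c i]]])
  have 2: "openin ?T {z \<in> topspace ?T. z None \<in> I}"
    by (rule openin_continuous_map_preimage[OF continuous_map_product_projection[OF None_idx]]) (simp add: I_open)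
  have "openin ?T ({z \<in> topspace ?T. z None \<in> I} \<inter>
      (\<Inter>i\<in>{1..m}. {z \<in> topspace ?T. block i z \<in> snd (c i) ` fst (c i)}))"
  \<comment> \<open>Over an empty index set the intersection is the whole type, not a subset of the
    model space, so this case is separate.\<close>
  proof (cases "{1..m} = {}")
    case True
    then show ?thesis using 2 by simp
  next
    case False
    then show ?thesis using 1 2 by (intro openin_Int openin_INT2) auto
  qed
  moreover have "({z \<in> topspace ?T. z None \<in> I} \<inter>
      (\<Inter>i\<in>{1..m}. {z \<in> topspace ?T. block i z \<in> snd (c i) ` fst (c i)})) = prod_img c"
    by (auto simp: prod_img_def PiE_def)
  ultimately show ?thesis by simp
qed

text \<open>Continuity in both directions is checked by components: the time coordinate, and in each
  factor the chart or its inverse.\<close>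

lemma prod_chart_homeo:
  assumes c: "chart_choice c"
  shows "homeomorphic_map (subtopology (sp_top M) (prod_dom c))
    (subtopology (powertop_real (coord_idx M)) (prod_map c ` prod_dom c)) (prod_map c)"
proof -
  let ?T = "subtopology (sp_top M) (prod_dom c)" and ?S = "subtopology (powertop_real (coord_idx M)) (prod_img c)"
  have tT: "topspace ?T = prod_dom c" using openin_subset[OF openin_prod_dom[OF c]] by auto
  have tS: "topspace ?S = prod_img c" using openin_subset[OF openin_prod_img[OF c]] by auto
  have 1: "continuous_map ?T (powertop_real (coord_idx M)) (prod_map c)"
    unfolding continuous_map_componentwise
  proof (intro conjI ballI)
    show "prod_map c ` topspace ?T \<subseteq> extensional (coord_idx M)" using prod_map_extensional by blast
    fix a assume a: "a \<in> coord_idx M"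
    show "continuous_map ?T euclideanreal (\<lambda>p. prod_map c p a)"
    proof (cases a)
      case None
      have "continuous_map ?T euclideanreal fst"
        using continuous_map_from_subtopology[OF continuous_map_time] by (simp add: continuous_map_in_subtopology)
      then show ?thesis using None by simp
    next
      case (Some ij)
      obtain i j where ij: "ij = (i, j)" by (cases ij)
      have i: "i \<in> {1..m}" "j \<in> coord_idx (F i)" using a Some ij by simp_all
      interpret Fi: charted_space "F i" by (rule F_charted[OF i(1)])
      have "continuous_map ?T (subtopology (sp_top (F i)) (fst (c i))) (\<lambda>p. snd p i)"
        using continuous_map_from_subtopology[OF continuous_map_component[OF i(1)], of "prod_dom c"]
          prod_dom_component[OF _ i(1)] tT
        by (auto simp: continuous_map_in_subtopology)
      from continuous_map_compose[OF continuous_map_compose[OF this Fi.chart_continuous[OF choice_atlas[OF c i(1)]]]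
          continuous_map_product_projection[OF i(2)]]
      show ?thesis using Some ij by (simp add: prod_map_Some[OF i] comp_def)
    qed
  qed
  have 2: "continuous_map ?S (sp_top M) (prod_inv c)"
    unfolding sp_top_prod prod_inv_def
  proof (rule continuous_map_pairedI)
    have "continuous_map ?S euclideanreal (\<lambda>z. z None)"
      using continuous_map_from_subtopology[OF continuous_map_product_projection[OF None_idx]] .
    then show "continuous_map ?S (top_of_set I) (\<lambda>z. z None)"
      using tS by (auto simp: continuous_map_in_subtopology prod_img_def)
    show "continuous_map ?S (product_topology (\<lambda>i. sp_top (F i)) {1..m})
        (\<lambda>z. \<lambda>i\<in>{1..m}. inv_into (fst (c i)) (snd (c i)) (block i z))"
      unfolding continuous_map_componentwise
    proof (intro conjI ballI)
      fix i assume i: "i \<in> {1..m}"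
      interpret Fi: charted_space "F i" by (rule F_charted[OF i])
      have "continuous_map ?S (subtopology (powertop_real (coord_idx (F i))) (snd (c i) ` fst (c i))) (block i)"
        using continuous_map_from_subtopology[OF continuous_map_block[OF i], of "prod_img c"] tS i
        by (auto simp: continuous_map_in_subtopology prod_img_def)
      from continuous_map_compose[OF this Fi.chart_inv_continuous[OF choice_atlas[OF c i]]]
      show "continuous_map ?S (sp_top (F i))
          (\<lambda>z. (\<lambda>i\<in>{1..m}. inv_into (fst (c i)) (snd (c i)) (block i z)) i)"
        using i by (simp add: comp_def)
    qed auto
  qed
  have "homeomorphic_maps ?T ?S (prod_map c) (prod_inv c)"
    unfolding homeomorphic_maps_def
  proof (intro conjI ballI)
    show "continuous_map ?T ?S (prod_map c)"
      using 1 prod_map_in_img[OF c] tT by (auto simp: continuous_map_in_subtopology)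
    show "continuous_map ?S ?T (prod_inv c)"
      using 2 prod_inv_in_dom tS by (auto simp: continuous_map_in_subtopology)
    show "prod_inv c (prod_map c p) = p" if "p \<in> topspace ?T" for p
      using that tT prod_inv_map[OF c] by simp
    show "prod_map c (prod_inv c z) = z" if "z \<in> topspace ?S" for z
      using that tS prod_map_inv by simp
  qed
  then show ?thesis unfolding prod_map_image[OF c] by (rule homeomorphic_maps_imp_map)
qed

lemma smooth_coord_coordinate: "openin (powertop_real K) S \<Longrightarrow> a \<in> K \<Longrightarrow> smooth_coord K S (\<lambda>z. z a)"
  by (simp add: smooth_coord_def Ck_coord_coordinate)

lemma finite_idx_prod: "finite (coord_idx M)"
  unfolding coord_idx_prod
  by (intro finite.insertI finite_imageI finite_SigmaI finite_atLeastAtMost charted_space.finite_idx[OF F_charted])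

lemma smooth_coord_block:
  assumes i: "i \<in> {1..m}" and S: "openin (powertop_real (coord_idx (F i))) S"
    and S': "openin (powertop_real (coord_idx M)) S'" and sub: "\<And>z. z \<in> S' \<Longrightarrow> block i z \<in> S"
    and f: "smooth_coord (coord_idx (F i)) S f"
  shows "smooth_coord (coord_idx M) S' (\<lambda>z. f (block i z))"
proof (rule smooth_coord_compose[OF charted_space.finite_idx[OF F_charted[OF i]] S S' sub f])
  fix j assume j: "j \<in> coord_idx (F i)"
  have "smooth_coord (coord_idx M) S' (\<lambda>z. z (Some (i, j)))"
    using i j by (intro smooth_coord_coordinate[OF S']) simp
  then show "smooth_coord (coord_idx M) S' (\<lambda>z. block i z j)" using j by (simp add: block_def)
qed

text \<open>A change between product charts leaves the time coordinate alone and acts on each block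
  by a transition map of the corresponding factor.\<close>

lemma charted_prod: "charted_space M"
proof (rule charted_space.intro)
  show "finite (coord_idx M)" by (rule finite_idx_prod)
  fix U \<phi> assume "(U, \<phi>) \<in> atlas M"
  then obtain c where c: "chart_choice c" and U: "U = prod_dom c" and \<phi>: "\<phi> = prod_map c" by (rule atlas_prodE)
  show "openin (sp_top M) U" unfolding U by (rule openin_prod_dom[OF c])
  show "openin (powertop_real (coord_idx M)) (\<phi> ` U)"
    unfolding U \<phi> prod_map_image[OF c] by (rule openin_prod_img[OF c])
  show "homeomorphic_map (subtopology (sp_top M) U) (subtopology (powertop_real (coord_idx M)) (\<phi> ` U)) \<phi>"
    unfolding U \<phi> by (rule prod_chart_homeo[OF c])
  fix V \<psi> a assume "(V, \<psi>) \<in> atlas M" and a: "a \<in> coord_idx M"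
  then obtain d where d: "chart_choice d" and V: "V = prod_dom d" and \<psi>: "\<psi> = prod_map d" by (elim atlas_prodE)
  let ?S = "prod_map c ` (prod_dom c \<inter> prod_dom d)"
  have o: "openin (powertop_real (coord_idx M)) ?S"
  proof -
    have "openin (subtopology (sp_top M) (prod_dom c)) (prod_dom c \<inter> prod_dom d)"
      using openin_prod_dom[OF c] openin_prod_dom[OF d] by (simp add: openin_open_subtopology openin_Int)
    then have "openin (subtopology (powertop_real (coord_idx M)) (prod_map c ` prod_dom c)) ?S"
      using homeomorphic_imp_open_map[OF prod_chart_homeo[OF c]] by (simp add: open_map_def)
    then show ?thesis unfolding prod_map_image[OF c] by (rule openin_trans_full[OF _ openin_prod_img[OF c]])
  qed
  have inv: "inv_into (prod_dom c) (prod_map c) z = prod_inv c z" "prod_inv c z \<in> prod_dom c \<inter> prod_dom d"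
    "z \<in> prod_img c" if "z \<in> ?S" for z
    using that prod_inv_into[OF c] prod_inv_map[OF c] prod_map_in_img[OF c] by auto
  show "smooth_coord (coord_idx M) (\<phi> ` (U \<inter> V)) (\<lambda>z. \<psi> (inv_into U \<phi> z) a)"
    unfolding U V \<phi> \<psi>
  proof (cases a)
    case None
    have "smooth_coord (coord_idx M) ?S (\<lambda>z. z None)" by (rule smooth_coord_coordinate[OF o None_idx])
    then show "smooth_coord (coord_idx M) ?S (\<lambda>z. prod_map d (inv_into (prod_dom c) (prod_map c) z) a)"
      by (rule smooth_coord_cong_imp[OF o]) (simp add: None inv(1), simp add: prod_inv_def)
  next
    case (Some ij)
    obtain i j where ij: "ij = (i, j)" by (cases ij)
    have i: "i \<in> {1..m}" "j \<in> coord_idx (F i)" using a Some ij by simp_all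
    interpret Fi: charted_space "F i" by (rule F_charted[OF i(1)])
    note ci = choice_atlas[OF c i(1)] and di = choice_atlas[OF d i(1)]
    have bl: "block i z \<in> snd (c i) ` (fst (c i) \<inter> fst (d i))"
      and pi: "snd (prod_inv c z) i = inv_into (fst (c i)) (snd (c i)) (block i z)" if z: "z \<in> ?S" for z
    proof -
      show pi: "snd (prod_inv c z) i = inv_into (fst (c i)) (snd (c i)) (block i z)"
        using i by (simp add: prod_inv_def)
      have "snd (prod_inv c z) i \<in> fst (c i) \<inter> fst (d i)"
        using inv(2)[OF z] prod_dom_component[OF _ i(1)] by blast
      moreover have "block i z = snd (c i) (snd (prod_inv c z) i)"
        unfolding pi using inv(3)[OF z] i(1) by (intro f_inv_into_f[symmetric]) (simp add: prod_img_def)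
      ultimately show "block i z \<in> snd (c i) ` (fst (c i) \<inter> fst (d i))" by blast
    qed
    have "smooth_coord (coord_idx M) ?S (\<lambda>z. snd (d i) (inv_into (fst (c i)) (snd (c i)) (block i z)) j)"
      by (rule smooth_coord_block[OF i(1) Fi.chart_image_open[OF ci openin_Int[OF Fi.chart_open[OF ci]
        Fi.chart_open[OF di]] Int_lower1] o bl Fi.chart_transition[OF ci di i(2)]])
    then show "smooth_coord (coord_idx M) ?S (\<lambda>z. prod_map d (inv_into (prod_dom c) (prod_map c) z) a)"
      by (rule smooth_coord_cong_imp[OF o]) (simp add: Some ij inv(1) pi prod_map_Some[OF i])
  qed
next
  fix p assume "p \<in> points M"
  then have p: "fst p \<in> I" "snd p \<in> (\<Pi>\<^sub>E i\<in>{1..m}. points (F i))" by (auto simp: points_prod)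
  have "\<forall>i\<in>{1..m}. \<exists>u. u \<in> atlas (F i) \<and> snd p i \<in> fst u"
  proof
    fix i assume i: "i \<in> {1..m}"
    then have "snd p i \<in> points (F i)" using p(2) by auto
    from charted_space.chart_cover[OF F_charted[OF i] this]
    obtain U \<phi> where "(U, \<phi>) \<in> atlas (F i)" "snd p i \<in> U" by (elim exE conjE)
    then show "\<exists>u. u \<in> atlas (F i) \<and> snd p i \<in> fst u" by (intro exI[of _ "(U, \<phi>)"]) simp
  qed
  from bchoice[OF this] obtain c where c: "\<forall>i\<in>{1..m}. c i \<in> atlas (F i) \<and> snd p i \<in> fst (c i)" by (elim exE)
  have "chart_choice c" using c by (simp add: chart_choice_def)
  moreover have "p \<in> prod_dom c"
    using c p by (cases p) (auto simp: prod_dom_def PiE_def)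
  ultimately show "\<exists>U \<phi>. (U, \<phi>) \<in> atlas M \<and> p \<in> U" unfolding atlas_prod by blast
qed

sublocale P: charted_space "product_space I m F" by (rule charted_prod)

lemma component_points: "p \<in> points M \<Longrightarrow> i \<in> {1..m} \<Longrightarrow> snd p i \<in> points (F i)"
  by (auto simp: points_prod)

lemma time_points: "p \<in> points M \<Longrightarrow> fst p \<in> I"
  by (auto simp: points_prod)

lemma prod_atlas: "chart_choice c \<Longrightarrow> (prod_dom c, prod_map c) \<in> atlas M"
  by (auto simp: atlas_prod)

lemma chart_at:
  assumes "p \<in> points M" obtains c where "chart_choice c" "p \<in> prod_dom c"
  using P.chart_cover[OF assms] by (auto elim: atlas_prodE)

section \<open>Functions pulled back from the factors, slices and lifted fields\<close>

definition cylinder :: "nat \<Rightarrow> 'a set \<Rightarrow> (real \<times> (nat \<Rightarrow> 'a)) set" where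
  "cylinder i V = {p \<in> points M. snd p i \<in> V}"

lemma cylinder_iff: "p \<in> cylinder i V \<longleftrightarrow> p \<in> points M \<and> snd p i \<in> V"
  by (simp add: cylinder_def)

lemma openin_cylinder: "i \<in> {1..m} \<Longrightarrow> openin (sp_top (F i)) V \<Longrightarrow> openin (sp_top M) (cylinder i V)"
  unfolding cylinder_def points_def by (rule openin_continuous_map_preimage[OF continuous_map_component])

text \<open>In a product chart the pulled-back function is the local expression of \<open>f\<close>
  after the coordinate projection \<open>block i\<close>.\<close>

lemma component_smooth:
  assumes i: "i \<in> {1..m}" and f: "smooth_on (F i) V f"
  shows "smooth_on M (cylinder i V) (\<lambda>p. f (snd p i))"
proof -
  interpret Fi: charted_space "F i" by (rule F_charted[OF i])
  show ?thesis
  proof (rule P.smooth_onI[OF openin_cylinder[OF i Fi.smooth_on_open[OF f]]])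
    fix U \<phi> assume "(U, \<phi>) \<in> atlas M" and o: "openin (powertop_real (coord_idx M)) (\<phi> ` (U \<inter> cylinder i V))"
    then obtain c where c: "chart_choice c" and U: "U = prod_dom c" and \<phi>: "\<phi> = prod_map c" by (elim atlas_prodE)
    note ci = choice_atlas[OF c i]
    have "smooth_coord (coord_idx M) (\<phi> ` (U \<inter> cylinder i V)) (\<lambda>z. f (inv_into (fst (c i)) (snd (c i)) (block i z)))"
    proof (rule smooth_coord_block[OF i _ o _ Fi.smooth_on_chart[OF f ci]])
      show "openin (powertop_real (coord_idx (F i))) (snd (c i) ` (fst (c i) \<inter> V))"
        by (rule Fi.chart_image_open[OF ci openin_Int[OF Fi.chart_open[OF ci] Fi.smooth_on_open[OF f]] Int_lower1])
      show "block i z \<in> snd (c i) ` (fst (c i) \<inter> V)" if z: "z \<in> \<phi> ` (U \<inter> cylinder i V)" for z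
      proof -
        obtain p where "p \<in> prod_dom c" "p \<in> cylinder i V" "z = prod_map c p" using z U \<phi> by blast
        then show ?thesis using block_prod_map[OF c i] prod_dom_component[OF _ i] by (simp add: cylinder_iff)
      qed
    qed
    then show "smooth_coord (coord_idx M) (\<phi> ` (U \<inter> cylinder i V)) (\<lambda>z. f (snd (inv_into U \<phi> z) i))"
    proof (rule smooth_coord_cong_imp[OF o])
      fix z assume "z \<in> \<phi> ` (U \<inter> cylinder i V)"
      then obtain p where p: "p \<in> prod_dom c" "z = prod_map c p" using U \<phi> by blast
      then show "f (inv_into (fst (c i)) (snd (c i)) (block i z)) = f (snd (inv_into U \<phi> z) i)"
        using Fi.chart_inv[OF ci prod_dom_component[OF p(1) i]]
        by (simp add: block_prod_map[OF c i] U \<phi> prod_inv_into[OF c])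
    qed
  qed
qed

lemma component_smooth_near:
  assumes i: "i \<in> {1..m}" and p: "p \<in> points M" and f: "smooth_near (F i) (snd p i) f"
  shows "smooth_near M p (\<lambda>q. f (snd q i))"
proof -
  interpret Fi: charted_space "F i" by (rule F_charted[OF i])
  obtain V where V: "smooth_on (F i) V f" "snd p i \<in> V" using f by (rule Fi.smooth_nearE)
  show ?thesis by (rule P.smooth_nearI[OF component_smooth[OF i V(1)]]) (simp add: cylinder_iff p V(2))
qed

lemma openin_points: "openin (sp_top M) (points M)"
  by (simp add: points_def)

lemma time_smooth: "smooth_on M (points M) fst"
proof (rule P.smooth_onI[OF openin_points])
  fix U \<phi> assume "(U, \<phi>) \<in> atlas M" and o: "openin (powertop_real (coord_idx M)) (\<phi> ` (U \<inter> points M))"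
  then obtain c where c: "chart_choice c" and U: "U = prod_dom c" and \<phi>: "\<phi> = prod_map c" by (elim atlas_prodE)
  have "smooth_coord (coord_idx M) (\<phi> ` (U \<inter> points M)) (\<lambda>z. z None)" by (rule smooth_coord_coordinate[OF o None_idx])
  then show "smooth_coord (coord_idx M) (\<phi> ` (U \<inter> points M)) (\<lambda>z. fst (inv_into U \<phi> z))"
    by (rule smooth_coord_cong_imp[OF o]) (auto simp: U \<phi> prod_inv_into[OF c])
qed

lemma time_fun_smooth: "smooth_fun_on I h \<Longrightarrow> smooth_on M (points M) (\<lambda>q. h (fst q))"
  by (rule P.smooth_on_compose_real[OF time_smooth time_points])

text \<open>The embedded copy of \<open>F i\<close> through \<open>p\<close>. Fields on the fibre
  act on functions on the product by differentiating along it.\<close>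

definition slice :: "real \<times> (nat \<Rightarrow> 'a) \<Rightarrow> nat \<Rightarrow> 'a \<Rightarrow> real \<times> (nat \<Rightarrow> 'a)" where
  "slice p i y = (fst p, (snd p)(i := y))"

lemma slice_simps [simp]: "fst (slice p i y) = fst p" "snd (slice p i y) i = y"
  "s \<noteq> i \<Longrightarrow> snd (slice p i y) s = snd p s" "slice (slice p i y) i y' = slice p i y'"
  by (simp_all add: slice_def)

lemma slice_self [simp]: "slice p i (snd p i) = p" by (simp add: slice_def)

lemma slice_points: "p \<in> points M \<Longrightarrow> i \<in> {1..m} \<Longrightarrow> y \<in> points (F i) \<Longrightarrow> slice p i y \<in> points M"
  by (auto simp: points_prod slice_def PiE_def extensional_def)

lemma continuous_map_slice:
  assumes i: "i \<in> {1..m}" and p: "p \<in> points M"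
  shows "continuous_map (sp_top (F i)) (sp_top M) (slice p i)"
  unfolding sp_top_prod slice_def
proof (rule continuous_map_pairedI)
  show "continuous_map (sp_top (F i)) (top_of_set I) (\<lambda>y. fst p)" using time_points[OF p] by simp
  show "continuous_map (sp_top (F i)) (product_topology (\<lambda>i. sp_top (F i)) {1..m}) (\<lambda>y. (snd p)(i := y))"
    unfolding continuous_map_componentwise
  proof (intro conjI ballI)
    show "(\<lambda>y. (snd p)(i := y)) ` topspace (sp_top (F i)) \<subseteq> extensional {1..m}"
      using p i by (auto simp: points_prod PiE_def extensional_def)
    fix s assume s: "s \<in> {1..m}"
    show "continuous_map (sp_top (F i)) (sp_top (F s)) (\<lambda>y. ((snd p)(i := y)) s)"
      using component_points[OF p s] by (cases "s = i") (simp_all add: points_def)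
  qed
qed

text \<open>In adapted charts the slice inclusion is the identity in the block of \<open>F i\<close>
  and constant in all other coordinates.\<close>

lemma slice_smooth:
  assumes i: "i \<in> {1..m}" and p: "p \<in> points M" and f: "smooth_on M W f"
  shows "smooth_on (F i) {y \<in> points (F i). slice p i y \<in> W} (\<lambda>y. f (slice p i y))"
proof -
  interpret Fi: charted_space "F i" by (rule F_charted[OF i])
  let ?W = "{y \<in> points (F i). slice p i y \<in> W}"
  obtain c0 where c0: "chart_choice c0" "p \<in> prod_dom c0" using chart_at[OF p] .
  have W: "openin (sp_top (F i)) ?W"
    unfolding points_def
    by (rule openin_continuous_map_preimage[OF continuous_map_slice[OF i p] P.smooth_on_open[OF f]])
  show ?thesis
  proof (rule Fi.smooth_onI[OF W])
    fix U \<phi> assume A: "(U, \<phi>) \<in> atlas (F i)" and o: "openin (powertop_real (coord_idx (F i))) (\<phi> ` (U \<inter> ?W))"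
    \<comment> \<open>A product chart around \<open>p\<close> with its \<open>i\<close>-th member
      exchanged for the given chart. It contains the slice over all of \<open>U\<close>, since the
      other components do not move.\<close>
    define c where "c = c0(i := (U, \<phi>))"
    have c: "chart_choice c" using c0(1) A by (simp add: chart_choice_def c_def)
    have dom: "slice p i y \<in> prod_dom c" if "y \<in> U" for y
      using c0(2) that i by (auto simp: prod_dom_def slice_def c_def PiE_def extensional_def)
    define G where "G z = prod_map c (slice p i (inv_into U \<phi> z))" for z
    have o': "openin (powertop_real (coord_idx M)) (prod_map c ` (prod_dom c \<inter> W))"
      by (rule P.chart_image_open[OF prod_atlas[OF c] openin_Int[OF openin_prod_dom[OF c] P.smooth_on_open[OF f]] Int_lower1])
    have "smooth_coord (coord_idx (F i)) (\<phi> ` (U \<inter> ?W)) (\<lambda>z. f (inv_into (prod_dom c) (prod_map c) (G z)))"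
    proof (rule smooth_coord_compose[OF finite_idx_prod o' o _ P.smooth_on_chart[OF f prod_atlas[OF c]]])
      fix z assume "z \<in> \<phi> ` (U \<inter> ?W)"
      then show "G z \<in> prod_map c ` (prod_dom c \<inter> W)"
        using dom Fi.chart_inv[OF A] by (auto simp: G_def)
    next
      fix a assume a: "a \<in> coord_idx M"
      show "smooth_coord (coord_idx (F i)) (\<phi> ` (U \<inter> ?W)) (\<lambda>z. G z a)"
      proof (cases a)
        case None
        then show ?thesis by (simp add: G_def smooth_coord_def Ck_coord_const)
      next
        case (Some sj)
        obtain s j where sj: "sj = (s, j)" by (cases sj)
        have s: "s \<in> {1..m}" "j \<in> coord_idx (F s)" using a Some sj by simp_all
        show ?thesis
        proof (cases "s = i")
          case True
          have "smooth_coord (coord_idx (F i)) (\<phi> ` (U \<inter> ?W)) (\<lambda>z. z j)"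
            using s(2) True by (intro smooth_coord_coordinate[OF o]) simp
          then show ?thesis
          proof (rule smooth_coord_cong_imp[OF o])
            fix z assume "z \<in> \<phi> ` (U \<inter> ?W)"
            then have "\<phi> (inv_into U \<phi> z) = z" by (intro f_inv_into_f) blast
            then show "z j = G z a"
              using Some sj s True by (simp add: G_def prod_map_Some c_def)
          qed
        next
          case False
          then have "G z a = snd (c s) (snd p s) j" for z
            using Some sj by (simp add: G_def prod_map_Some[OF s])
          then show ?thesis by (simp add: smooth_coord_def Ck_coord_const)
        qed
      qed
    qed
    then show "smooth_coord (coord_idx (F i)) (\<phi> ` (U \<inter> ?W)) (\<lambda>z. f (slice p i (inv_into U \<phi> z)))"
    proof (rule smooth_coord_cong_imp[OF o])
      fix z assume "z \<in> \<phi> ` (U \<inter> ?W)"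
      then have "inv_into U \<phi> z \<in> U" using Fi.chart_inv[OF A] by auto
      then show "f (inv_into (prod_dom c) (prod_map c) (G z)) = f (slice p i (inv_into U \<phi> z))"
        using prod_inv_into[OF c dom] by (simp add: G_def)
    qed
  qed
qed

lemma slice_smooth_near:
  assumes i: "i \<in> {1..m}" and p: "p \<in> points M" and f: "smooth_near M p f"
  shows "smooth_near (F i) (snd p i) (\<lambda>y. f (slice p i y))"
proof -
  interpret Fi: charted_space "F i" by (rule F_charted[OF i])
  obtain W where W: "smooth_on M W f" "p \<in> W" using f by (rule P.smooth_nearE)
  show ?thesis
    by (rule Fi.smooth_nearI[OF slice_smooth[OF i p W(1)]]) (simp add: component_points[OF p i] W(2))
qed

abbreviation "cvec c \<equiv> P.coord_vec (prod_dom c) (prod_map c)"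

text \<open>Times near that of a point of the product lie in \<open>I\<close> because
  \<open>I\<close> is open; varying them is varying the coordinate \<open>None\<close>. Smoothness
  of the time field is inherited from coordinate fields in this way.\<close>

lemma time_field_chart:
  assumes c: "chart_choice c" and p: "p \<in> prod_dom c"
  shows "time_field I m F p = cvec c None p"
proof
  fix f
  have ev: "eventually (\<lambda>s. s \<in> I) (nhds (fst p))"
    using p by (intro eventually_nhds_in_open[OF I_open]) (auto simp: prod_dom_def)
  have "deriv (\<lambda>s. f (s, snd p)) (fst p) =
      deriv (\<lambda>s. f (inv_into (prod_dom c) (prod_map c) ((prod_map c p)(None := s)))) (fst p)"
  proof (rule deriv_cong_ev[OF _ refl], rule eventually_mono[OF ev])
    fix s assume "s \<in> I"
    then have "(s, snd p) \<in> prod_dom c" using p by (auto simp: prod_dom_def)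
    moreover have "(prod_map c p)(None := s) = prod_map c (s, snd p)"
      by (rule ext) (auto simp: prod_map_def split_beta restrict_def split: option.split)
    ultimately show "f (s, snd p) = f (inv_into (prod_dom c) (prod_map c) ((prod_map c p)(None := s)))"
      using prod_inv_into[OF c] by simp
  qed
  then show "time_field I m F p f = cvec c None p f"
    by (simp add: time_field_def P.coord_vec_def partial_deriv_def)
qed

lemma time_field_vf: "vector_field M (points M) (time_field I m F)"
proof (rule P.vf_local[OF openin_points])
  fix p assume "p \<in> points M"
  then obtain c where c: "chart_choice c" "p \<in> prod_dom c" by (rule chart_at)
  have "vector_field M (prod_dom c) (time_field I m F)"
    by (rule P.vf_cong[OF P.coord_vec_field[OF prod_atlas[OF c(1)] None_idx]])
      (simp add: time_field_chart[OF c(1)])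
  then show "\<exists>V. p \<in> V \<and> vector_field M V (time_field I m F)" using c(2) by blast
qed

text \<open>Differentiation along the slice through \<open>p\<close>, so that time and the other
  components are held fixed. The default 0 is the convention of
  \<open>tangent_space\<close>.\<close>

definition lift :: "nat \<Rightarrow> 'a vfield \<Rightarrow> (real \<times> (nat \<Rightarrow> 'a)) vfield" where
  "lift i X p f = (if smooth_near M p f then X (snd p i) (\<lambda>y. f (slice p i y)) else 0)"

lemma coord_vec_slice:
  assumes c: "chart_choice c" and p: "p \<in> prod_dom c" and i: "i \<in> {1..m}" and j: "j \<in> coord_idx (F i)"
    and f: "smooth_near M p f"
  shows "charted_space.coord_vec (F i) (fst (c i)) (snd (c i)) j (snd p i) (\<lambda>y. f (slice p i y)) =
    cvec c (Some (i, j)) p f"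
proof -
  interpret Fi: charted_space "F i" by (rule F_charted[OF i])
  have pM: "p \<in> points M" using P.mopen_points[OF openin_prod_dom[OF c] p] .
  note ci = choice_atlas[OF c i]
  let ?U = "fst (c i)" and ?\<phi> = "snd (c i)"
  have xi: "snd p i \<in> ?U" using prod_dom_component[OF p i] .
  have eq: "(prod_map c p) (Some (i, j)) = ?\<phi> (snd p i) j" by (rule prod_map_Some[OF i j])
  have ev: "eventually (\<lambda>s. (?\<phi> (snd p i))(j := s) \<in> ?\<phi> ` ?U) (nhds (?\<phi> (snd p i) j))"
    using eventually_slice[OF Fi.chart_image[OF ci], of "?\<phi> (snd p i)" j "?\<phi> (snd p i) j", unfolded fun_upd_triv] xi j
    by blast
  have "deriv (\<lambda>s. f (slice p i (inv_into ?U ?\<phi> ((?\<phi> (snd p i))(j := s))))) (?\<phi> (snd p i) j) =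
      deriv (\<lambda>s. f (inv_into (prod_dom c) (prod_map c) ((prod_map c p)(Some (i, j) := s)))) (?\<phi> (snd p i) j)"
  proof (rule deriv_cong_ev[OF _ refl], rule eventually_mono[OF ev])
    fix s assume "(?\<phi> (snd p i))(j := s) \<in> ?\<phi> ` ?U"
    then obtain q where q: "q \<in> ?U" "(?\<phi> (snd p i))(j := s) = ?\<phi> q" by blast
    have "slice p i q \<in> prod_dom c"
      using p q(1) i by (auto simp: prod_dom_def slice_def PiE_def extensional_def)
    moreover have "(prod_map c p)(Some (i, j) := s) = prod_map c (slice p i q)"
    proof
      fix a
      show "((prod_map c p)(Some (i, j) := s)) a = prod_map c (slice p i q) a"
      proof (cases "a \<in> coord_idx M")
        case False
        then show ?thesis using i j prod_map_extensional by (auto simp: extensional_def)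
      next
        case True
        show ?thesis
        proof (cases a)
          case None
          then show ?thesis by simp
        next
          case (Some sk)
          obtain r k where rk: "sk = (r, k)" by (cases sk)
          have r: "r \<in> {1..m}" "k \<in> coord_idx (F r)" using True Some rk by simp_all
          show ?thesis
          proof (cases "r = i")
            case True
            have "((?\<phi> (snd p i))(j := s)) k = ?\<phi> q k" using q(2) by simp
            then show ?thesis using Some rk r True by (auto simp: prod_map_Some split: if_splits)
          next
            case False
            then show ?thesis using Some rk r by (simp add: prod_map_Some)
          qed
        qed
      qed
    qed
    ultimately show "f (slice p i (inv_into ?U ?\<phi> ((?\<phi> (snd p i))(j := s)))) =
        f (inv_into (prod_dom c) (prod_map c) ((prod_map c p)(Some (i, j) := s)))"
      using prod_inv_into[OF c] Fi.chart_inv[OF ci q(1)] q(2) by simp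
  qed
  then show ?thesis
    using f slice_smooth_near[OF i pM f]
    unfolding Fi.coord_vec_def P.coord_vec_def partial_deriv_def eq by simp
qed

text \<open>The chart components of a lift are those of \<open>X\<close> at the fibre point, pulled
  back from the factor. This is what makes lifts smooth.\<close>

lemma lift_chart:
  assumes c: "chart_choice c" and p: "p \<in> prod_dom c" and i: "i \<in> {1..m}"
    and X: "X (snd p i) \<in> tangent_space (F i) (snd p i)"
  shows "lift i X p = (\<lambda>f. \<Sum>j\<in>coord_idx (F i). X (snd p i) (\<lambda>q. snd (c i) q j) * cvec c (Some (i, j)) p f)"
proof
  fix f
  interpret Fi: charted_space "F i" by (rule F_charted[OF i])
  show "lift i X p f = (\<Sum>j\<in>coord_idx (F i). X (snd p i) (\<lambda>q. snd (c i) q j) * cvec c (Some (i, j)) p f)"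
  proof (cases "smooth_near M p f")
    case True
    have "X (snd p i) (\<lambda>y. f (slice p i y)) = (\<Sum>j\<in>coord_idx (F i). X (snd p i) (\<lambda>q. snd (c i) q j) *
        Fi.coord_vec (fst (c i)) (snd (c i)) j (snd p i) (\<lambda>y. f (slice p i y)))"
      by (rule Fi.tangent_expand[OF choice_atlas[OF c i] prod_dom_component[OF p i] X])
    also have "\<dots> = (\<Sum>j\<in>coord_idx (F i). X (snd p i) (\<lambda>q. snd (c i) q j) * cvec c (Some (i, j)) p f)"
      by (rule sum.cong) (simp_all add: coord_vec_slice[OF c p i _ True])
    finally show ?thesis using True by (simp add: lift_def)
  next
    case False
    then show ?thesis by (simp add: lift_def P.coord_vec_def)
  qed
qed

lemma lift_vf:
  assumes i: "i \<in> {1..m}" and X: "vector_field (F i) V X"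
  shows "vector_field M (cylinder i V) (lift i X)"
proof -
  interpret Fi: charted_space "F i" by (rule F_charted[OF i])
  have o: "openin (sp_top M) (cylinder i V)" by (rule openin_cylinder[OF i Fi.vf_open[OF X]])
  show ?thesis
  proof (rule P.vf_local[OF o])
    fix p assume p: "p \<in> cylinder i V"
    then have "p \<in> points M" by (simp add: cylinder_iff)
    then obtain c where c: "chart_choice c" "p \<in> prod_dom c" by (rule chart_at)
    note ci = choice_atlas[OF c(1) i]
    let ?W = "prod_dom c \<inter> cylinder i V"
    have oW: "openin (sp_top M) ?W" using openin_Int[OF openin_prod_dom[OF c(1)] o] .
    have "vector_field M ?W (\<lambda>q f. \<Sum>j\<in>coord_idx (F i). X (snd q i) (\<lambda>q. snd (c i) q j) * cvec c (Some (i, j)) q f)"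
    proof (rule P.vf_sum[OF oW])
      fix j assume j: "j \<in> coord_idx (F i)"
      show "vector_field M ?W (cvec c (Some (i, j)))"
        using i j by (intro P.vf_subset[OF P.coord_vec_field[OF prod_atlas[OF c(1)]] oW]) simp_all
      have oi: "openin (sp_top (F i)) (V \<inter> fst (c i))" using openin_Int[OF Fi.vf_open[OF X] Fi.chart_open[OF ci]] .
      have "smooth_on (F i) (V \<inter> fst (c i)) (\<lambda>q. X q (\<lambda>q. snd (c i) q j))"
        by (rule Fi.vf_smooth[OF X Int_lower1 Fi.smooth_on_subset[OF Fi.smooth_on_coordinate[OF ci j] oi Int_lower2]])
      from component_smooth[OF i this]
      show "smooth_on M ?W (\<lambda>q. X (snd q i) (\<lambda>q. snd (c i) q j))"
        by (rule P.smooth_on_subset[OF _ oW]) (rule subsetI, simp add: cylinder_iff prod_dom_component[OF _ i])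
    qed
    then have "vector_field M ?W (lift i X)"
      by (rule P.vf_cong)
        (simp add: lift_chart[where X = X, OF c(1) _ i Fi.vf_tangent[OF X]] cylinder_iff)
    then show "\<exists>V. p \<in> V \<and> vector_field M V (lift i X)" using p c(2) by blast
  qed
qed

text \<open>Each coordinate of a product chart is either time or a function of one fibre component,
  and coordinates determine a tangent vector.\<close>

lemma tangent_prod_eqI:
  assumes p: "p \<in> points M" and u: "u \<in> tangent_space M p" and v: "v \<in> tangent_space M p"
    and t: "u fst = v fst"
    and x: "\<And>i f. i \<in> {1..m} \<Longrightarrow> smooth_near (F i) (snd p i) f \<Longrightarrow> u (\<lambda>q. f (snd q i)) = v (\<lambda>q. f (snd q i))"
  shows "u = v"
proof -
  obtain c where c: "chart_choice c" "p \<in> prod_dom c" using chart_at[OF p] .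
  show ?thesis
  proof (rule P.tangent_eqI[OF prod_atlas[OF c(1)] c(2) u v])
    fix a assume a: "a \<in> coord_idx M"
    show "u (\<lambda>q. prod_map c q a) = v (\<lambda>q. prod_map c q a)"
    proof (cases a)
      case None
      then show ?thesis using t by simp
    next
      case (Some ij)
      obtain i j where ij: "ij = (i, j)" by (cases ij)
      have i: "i \<in> {1..m}" "j \<in> coord_idx (F i)" using a Some ij by simp_all
      interpret Fi: charted_space "F i" by (rule F_charted[OF i(1)])
      have "smooth_near (F i) (snd p i) (\<lambda>y. snd (c i) y j)"
        by (rule Fi.smooth_nearI[OF Fi.smooth_on_coordinate[OF choice_atlas[OF c(1) i(1)] i(2)]
              prod_dom_component[OF c(2) i(1)]])
      from x[OF i(1) this] show ?thesis using Some ij by (simp add: prod_map_Some[OF i])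
    qed
  qed
qed

lemma time_smooth_near: "p \<in> points M \<Longrightarrow> smooth_near M p fst"
  by (rule P.smooth_nearI[OF time_smooth])

lemma time_field_time: "p \<in> points M \<Longrightarrow> time_field I m F p fst = 1"
  by (simp add: time_field_def time_smooth_near)

lemma time_field_component:
  "p \<in> points M \<Longrightarrow> time_field I m F p (\<lambda>q. f (snd q i)) = 0"
  by (simp add: time_field_def)

lemma lift_time:
  assumes i: "i \<in> {1..m}" and p: "p \<in> points M" and X: "X (snd p i) \<in> tangent_space (F i) (snd p i)"
  shows "lift i X p (\<lambda>q. h (fst q)) = 0"
proof -
  interpret Fi: charted_space "F i" by (rule F_charted[OF i])
  show ?thesis by (simp add: lift_def Fi.tangent_const[OF X component_points[OF p i]])
qed

lemma lift_component_other:
  assumes i: "i \<in> {1..m}" and p: "p \<in> points M" and X: "X (snd p i) \<in> tangent_space (F i) (snd p i)"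
    and "s \<noteq> i"
  shows "lift i X p (\<lambda>q. h (snd q s)) = 0"
proof -
  interpret Fi: charted_space "F i" by (rule F_charted[OF i])
  show ?thesis using assms(4) by (simp add: lift_def Fi.tangent_const[OF X component_points[OF p i]])
qed

lemma lift_component:
  "i \<in> {1..m} \<Longrightarrow> p \<in> points M \<Longrightarrow> smooth_near (F i) (snd p i) f \<Longrightarrow>
    lift i X p (\<lambda>q. f (snd q i)) = X (snd p i) f"
  using component_smooth_near by (simp add: lift_def)

end

section \<open>The warped metric\<close>

locale warped_product =
  fixes I :: "real set" and m :: nat and F :: "nat \<Rightarrow> ('a, 'j) smooth_space"
    and gF :: "nat \<Rightarrow> 'a metric_field" and b :: "nat \<Rightarrow> real \<Rightarrow> real"
  assumes open_I: "open I"
    and framed_fiber: "\<And>i. i \<in> {1..m} \<Longrightarrow> framed_manifold (F i) (gF i)"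
    and b_smooth: "\<And>i. i \<in> {1..m} \<Longrightarrow> smooth_fun_on I (b i)"
    and b_pos: "\<And>i t. i \<in> {1..m} \<Longrightarrow> t \<in> I \<Longrightarrow> b i t > 0"

sublocale warped_product \<subseteq> product_charted I m F
proof (rule product_charted.intro)
  show "open I" by (rule open_I)
  fix i assume "i \<in> {1..m}"
  then interpret framed_manifold "F i" "gF i" by (rule framed_fiber)
  show "charted_space (F i)" by (rule charted_space_axioms)
qed

context warped_product
begin

abbreviation "g \<equiv> warped_metric I m F gF b"
abbreviation "dt \<equiv> time_field I m F"
abbreviation "push i \<equiv> pushforward M (F i) (\<lambda>q. snd q i)"

lemma push_tangent:
  assumes i: "i \<in> {1..m}" and p: "p \<in> points M" and u: "u \<in> tangent_space M p"
  shows "push i p u \<in> tangent_space (F i) (snd p i)"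
proof -
  interpret Fi: framed_manifold "F i" "gF i" by (rule framed_fiber[OF i])
  note s = component_smooth_near[OF i p]
  show ?thesis
  proof (rule Fi.tangentI)
    show "push i p u f = 0" if "\<not> smooth_near (F i) (snd p i) f" for f
      using that by (simp add: pushforward_def)
    show "push i p u (\<lambda>q. c * f q) = c * push i p u f" if "smooth_near (F i) (snd p i) f" for c f
      using that P.tangent_cmult[OF u s[OF that]] Fi.smooth_near_cmult[OF that] by (simp add: pushforward_def)
    fix f h assume f: "smooth_near (F i) (snd p i) f" and h: "smooth_near (F i) (snd p i) h"
    show "push i p u (\<lambda>q. f q + h q) = push i p u f + push i p u h"
      using f h P.tangent_add[OF u s[OF f] s[OF h]] Fi.smooth_near_add[OF f h] by (simp add: pushforward_def)
    show "push i p u (\<lambda>q. f q * h q) = push i p u f * h (snd p i) + f (snd p i) * push i p u h"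
      using f h P.tangent_mult[OF u s[OF f] s[OF h]] Fi.smooth_near_mult[OF f h] by (simp add: pushforward_def)
  qed
qed

lemma push_add: "push i p (\<lambda>f. u f + v f) = (\<lambda>f. push i p u f + push i p v f)"
  by (auto simp: pushforward_def)

lemma push_scale: "push i p (\<lambda>f. c * u f) = (\<lambda>f. c * push i p u f)"
  by (auto simp: pushforward_def)

text \<open>Symmetry and bilinearity pass from the fibres through the linear pushforwards. The work
  is in smoothness.\<close>

lemma metric_prod: "metric_manifold M g"
proof unfold_locales
  fix p u v assume p: "p \<in> points M" and u: "u \<in> tangent_space M p" and v: "v \<in> tangent_space M p"
  have comp: "metric_manifold (F i) (gF i)" "snd p i \<in> points (F i)" "push i p u \<in> tangent_space (F i) (snd p i)"
    "push i p v \<in> tangent_space (F i) (snd p i)" if "i \<in> {1..m}" for i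
    using framed_manifold.axioms(1)[OF framed_fiber[OF that]] component_points[OF p that]
      push_tangent[OF that p u] push_tangent[OF that p v] by simp_all
  show "g p u v = g p v u"
    unfolding warped_metric_def
    by (rule arg_cong2[of _ _ _ _ "(+)"], simp, rule sum.cong[OF refl])
      (simp only: metric_manifold.g_sym[OF comp])
  show "g p (\<lambda>f. c * u f) v = c * g p u v" for c
  proof -
    have "(b i (fst p))\<^sup>2 * gF i (snd p i) (push i p (\<lambda>f. c * u f)) (push i p v) =
      c * ((b i (fst p))\<^sup>2 * gF i (snd p i) (push i p u) (push i p v))" if "i \<in> {1..m}" for i
      unfolding push_scale metric_manifold.g_scale[OF comp[OF that]] by simp
    then have eq: "(\<Sum>i\<in>{1..m}. (b i (fst p))\<^sup>2 * gF i (snd p i) (push i p (\<lambda>f. c * u f)) (push i p v)) =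
      c * (\<Sum>i\<in>{1..m}. (b i (fst p))\<^sup>2 * gF i (snd p i) (push i p u) (push i p v))"
      unfolding sum_distrib_left by (rule sum.cong[OF refl])
    show ?thesis unfolding warped_metric_def eq by (simp add: algebra_simps)
  qed
  fix w assume w: "w \<in> tangent_space M p"
  show "g p (\<lambda>f. u f + w f) v = g p u v + g p w v"
  proof -
    have "(b i (fst p))\<^sup>2 * gF i (snd p i) (push i p (\<lambda>f. u f + w f)) (push i p v) =
      (b i (fst p))\<^sup>2 * gF i (snd p i) (push i p u) (push i p v) +
      (b i (fst p))\<^sup>2 * gF i (snd p i) (push i p w) (push i p v)" if "i \<in> {1..m}" for i
      unfolding push_add metric_manifold.g_add[OF comp[OF that] push_tangent[OF that p w]]
      by (simp add: distrib_left)
    then have eq: "(\<Sum>i\<in>{1..m}. (b i (fst p))\<^sup>2 * gF i (snd p i) (push i p (\<lambda>f. u f + w f)) (push i p v)) =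
      (\<Sum>i\<in>{1..m}. (b i (fst p))\<^sup>2 * gF i (snd p i) (push i p u) (push i p v)) +
      (\<Sum>i\<in>{1..m}. (b i (fst p))\<^sup>2 * gF i (snd p i) (push i p w) (push i p v))"
      unfolding sum.distrib[symmetric] by (rule sum.cong[OF refl])
    show ?thesis unfolding warped_metric_def eq by (simp add: algebra_simps)
  qed
next
  fix W X Y assume X: "vector_field M W X" and Y: "vector_field M W Y"
  note o = P.vf_open[OF X]
  have sub: "W \<subseteq> points M" using P.mopen_points[OF o] by blast
  have ft: "smooth_on M W fst" by (rule P.smooth_on_subset[OF time_smooth o sub])
  have "smooth_on M W (\<lambda>p. (b i (fst p))\<^sup>2 * gF i (snd p i) (push i p (X p)) (push i p (Y p)))"
    if i: "i \<in> {1..m}" for i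
  proof (rule P.smooth_on_mult)
    have "smooth_on M W (\<lambda>p. b i (fst p))"
      by (rule P.smooth_on_subset[OF time_fun_smooth[OF b_smooth[OF i]] o sub])
    then show "smooth_on M W (\<lambda>p. (b i (fst p))\<^sup>2)" unfolding power2_eq_square by (intro P.smooth_on_mult)
    interpret Fi: framed_manifold "F i" "gF i" by (rule framed_fiber[OF i])
    \<comment> \<open>The pushforward of a field depends on the whole point of the product and is
      not a field on the fibre. It is therefore expanded in coordinate fields of the fibre with
      coefficients smooth on the product.\<close>
    show "smooth_on M W (\<lambda>p. gF i (snd p i) (push i p (X p)) (push i p (Y p)))"
    proof (rule P.smooth_on_local[OF o])
      fix p assume p: "p \<in> W"
      then have pM: "p \<in> points M" using sub by blast
      obtain U \<phi> where A: "(U, \<phi>) \<in> atlas (F i)" "snd p i \<in> U"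
        using Fi.chart_cover[OF component_points[OF pM i]] by (elim exE conjE)
      let ?V = "W \<inter> cylinder i U"
      have oV: "openin (sp_top M) ?V" by (rule openin_Int[OF o openin_cylinder[OF i Fi.chart_open[OF A(1)]]])
      let ?J = "coord_idx (F i)"
      let ?e = "\<lambda>j q. Fi.coord_vec U \<phi> j q"
      let ?c = "\<lambda>Z j q. Z q (\<lambda>r. \<phi> (snd r i) j)"
      have cs: "smooth_on M ?V (?c Z j)" if Z: "vector_field M W Z" and j: "j \<in> ?J" for Z j
      proof (rule P.vf_smooth[OF Z Int_lower1])
        show "smooth_on M ?V (\<lambda>r. \<phi> (snd r i) j)"
          by (rule P.smooth_on_subset[OF component_smooth[OF i Fi.smooth_on_coordinate[OF A(1) j]] oV Int_lower2])
      qed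
      have ps: "push i q (Z q) = (\<lambda>f. \<Sum>j\<in>?J. ?c Z j q * ?e j (snd q i) f)"
        if Z: "vector_field M W Z" and q: "q \<in> ?V" for Z q
      proof
        fix f
        have qM: "q \<in> points M" and qU: "snd q i \<in> U" using q by (auto simp: cylinder_iff)
        have "push i q (Z q) (\<lambda>r. \<phi> r j) = ?c Z j q" if j: "j \<in> ?J" for j
          using Fi.smooth_nearI[OF Fi.smooth_on_coordinate[OF A(1) j] qU] by (simp add: pushforward_def)
        then show "push i q (Z q) f = (\<Sum>j\<in>?J. ?c Z j q * ?e j (snd q i) f)"
          using Fi.tangent_expand[OF A(1) qU push_tangent[OF i qM P.vf_tangent[OF Z]], of f] q
          by simp
      qed
      have "smooth_on M ?V (\<lambda>q. \<Sum>j\<in>?J. ?c X j q * (\<Sum>k\<in>?J. ?c Y k q * gF i (snd q i) (?e k (snd q i)) (?e j (snd q i))))"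
      proof (rule P.smooth_on_sum[OF oV], rule P.smooth_on_mult)
        fix j assume j: "j \<in> ?J"
        show "smooth_on M ?V (?c X j)" by (rule cs[OF X j])
        show "smooth_on M ?V (\<lambda>q. \<Sum>k\<in>?J. ?c Y k q * gF i (snd q i) (?e k (snd q i)) (?e j (snd q i)))"
        proof (rule P.smooth_on_sum[OF oV], rule P.smooth_on_mult)
          fix k assume k: "k \<in> ?J"
          show "smooth_on M ?V (?c Y k)" by (rule cs[OF Y k])
          have "smooth_on (F i) U (\<lambda>y. gF i y (?e k y) (?e j y))"
            by (rule Fi.g_smooth[OF Fi.coord_vec_field[OF A(1) k] Fi.coord_vec_field[OF A(1) j]])
          from P.smooth_on_subset[OF component_smooth[OF i this] oV Int_lower2]
          show "smooth_on M ?V (\<lambda>q. gF i (snd q i) (?e k (snd q i)) (?e j (snd q i)))" .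
        qed
      qed
      then have "smooth_on M ?V (\<lambda>q. gF i (snd q i) (push i q (X q)) (push i q (Y q)))"
      proof (rule P.smooth_on_cong)
        fix q assume q: "q \<in> ?V"
        have qM: "q \<in> points M" and qU: "snd q i \<in> U" using q by (auto simp: cylinder_iff)
        note yF = component_points[OF qM i]
        have e: "?e j (snd q i) \<in> tangent_space (F i) (snd q i)" if "j \<in> ?J" for j
          by (rule Fi.coord_vec_tangent[OF A(1) qU that])
        have pY: "push i q (Y q) \<in> tangent_space (F i) (snd q i)"
          using push_tangent[OF i qM P.vf_tangent[OF Y]] q by simp
        have "gF i (snd q i) (push i q (X q)) (push i q (Y q)) =
            (\<Sum>j\<in>?J. ?c X j q * gF i (snd q i) (?e j (snd q i)) (push i q (Y q)))"
          unfolding ps[OF X q] by (rule Fi.g_sum[OF yF pY e])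
        also have "\<dots> = (\<Sum>j\<in>?J. ?c X j q * (\<Sum>k\<in>?J. ?c Y k q * gF i (snd q i) (?e k (snd q i)) (?e j (snd q i))))"
        proof (intro sum.cong refl arg_cong2[of _ _ _ _ "(*)"])
          fix j assume j: "j \<in> ?J"
          have "gF i (snd q i) (?e j (snd q i)) (push i q (Y q)) = gF i (snd q i) (push i q (Y q)) (?e j (snd q i))"
            by (rule Fi.g_sym[OF yF e[OF j] pY])
          also have "\<dots> = (\<Sum>k\<in>?J. ?c Y k q * gF i (snd q i) (?e k (snd q i)) (?e j (snd q i)))"
            unfolding ps[OF Y q] by (rule Fi.g_sum[OF yF e[OF j] e])
          finally show "gF i (snd q i) (?e j (snd q i)) (push i q (Y q)) =
            (\<Sum>k\<in>?J. ?c Y k q * gF i (snd q i) (?e k (snd q i)) (?e j (snd q i)))" .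
        qed
        finally show "(\<Sum>j\<in>?J. ?c X j q * (\<Sum>k\<in>?J. ?c Y k q * gF i (snd q i) (?e k (snd q i)) (?e j (snd q i)))) =
          gF i (snd q i) (push i q (X q)) (push i q (Y q))" by (rule sym)
      qed
      then show "\<exists>V. p \<in> V \<and> smooth_on M V (\<lambda>p. gF i (snd p i) (push i p (X p)) (push i p (Y p)))"
        using p pM A(2) by (intro exI[of _ ?V]) (simp add: cylinder_iff)
    qed
  qed
  note sm = this
  have "smooth_on M W (\<lambda>p. - (X p fst * Y p fst) +
      (\<Sum>i\<in>{1..m}. (b i (fst p))\<^sup>2 * gF i (snd p i) (push i p (X p)) (push i p (Y p))))"
    by (rule P.smooth_on_add[OF P.smooth_on_minus[OF P.smooth_on_mult[OF P.vf_smooth[OF X subset_refl ft]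
            P.vf_smooth[OF Y subset_refl ft]]] P.smooth_on_sum[OF o sm]])
  then show "smooth_on M W (\<lambda>p. g p (X p) (Y p))" by (simp add: warped_metric_def)
qed

sublocale PM: metric_manifold "product_space I m F" "warped_metric I m F gF b"
  by (rule metric_prod)

lemma push_dt: "p \<in> points M \<Longrightarrow> push i p (dt p) = (\<lambda>f. 0)"
  by (auto simp: pushforward_def time_field_component)

lemma push_lift:
  assumes i: "i \<in> {1..m}" and p: "p \<in> points M" and X: "X (snd p i) \<in> tangent_space (F i) (snd p i)"
  shows "push i p (lift i X p) = X (snd p i)"
proof
  fix f
  interpret Fi: framed_manifold "F i" "gF i" by (rule framed_fiber[OF i])
  show "push i p (lift i X p) f = X (snd p i) f"
    using lift_component[OF i p, of f X] Fi.tangent_nonsmooth[OF X, of f] by (auto simp: pushforward_def)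
qed

lemma push_lift_other:
  assumes i: "i \<in> {1..m}" and p: "p \<in> points M" and X: "X (snd p i) \<in> tangent_space (F i) (snd p i)" and "s \<noteq> i"
  shows "push s p (lift i X p) = (\<lambda>f. 0)"
  using lift_component_other[where X = X and p = p and i = i, OF i p X assms(4)] by (auto simp: pushforward_def)

lemma g_dt:
  assumes p: "p \<in> points M" and v: "v \<in> tangent_space M p" shows "g p (dt p) v = - v fst"
proof -
  have "gF i (snd p i) (push i p (dt p)) (push i p v) = 0" if i: "i \<in> {1..m}" for i
  proof -
    interpret Fi: framed_manifold "F i" "gF i" by (rule framed_fiber[OF i])
    show ?thesis unfolding push_dt[OF p] by (rule Fi.g_zero[OF component_points[OF p i] push_tangent[OF i p v]])
  qed
  then show ?thesis by (simp add: warped_metric_def time_field_time[OF p])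
qed

lemma g_lift:
  assumes i: "i \<in> {1..m}" and p: "p \<in> points M" and X: "X (snd p i) \<in> tangent_space (F i) (snd p i)"
    and v: "v \<in> tangent_space M p"
  shows "g p (lift i X p) v = (b i (fst p))\<^sup>2 * gF i (snd p i) (X (snd p i)) (push i p v)"
proof -
  have "(b s (fst p))\<^sup>2 * gF s (snd p s) (push s p (lift i X p)) (push s p v) =
     (if s = i then (b i (fst p))\<^sup>2 * gF i (snd p i) (X (snd p i)) (push i p v) else 0)" if s: "s \<in> {1..m}" for s
  proof (cases "s = i")
    case True
    then show ?thesis by (simp add: push_lift[where X = X, OF i p X])
  next
    case False
    interpret Fs: framed_manifold "F s" "gF s" by (rule framed_fiber[OF s])
    show ?thesis
      using False Fs.g_zero[OF component_points[OF p s] push_tangent[OF s p v]]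
      by (simp add: push_lift_other[where X = X, OF i p X False])
  qed
  then have "(\<Sum>s\<in>{1..m}. (b s (fst p))\<^sup>2 * gF s (snd p s) (push s p (lift i X p)) (push s p v)) =
      (\<Sum>s\<in>{1..m}. if s = i then (b i (fst p))\<^sup>2 * gF i (snd p i) (X (snd p i)) (push i p v) else 0)"
    by (rule sum.cong[OF refl])
  also have "\<dots> = (b i (fst p))\<^sup>2 * gF i (snd p i) (X (snd p i)) (push i p v)" using i by simp
  finally have "(\<Sum>s\<in>{1..m}. (b s (fst p))\<^sup>2 * gF s (snd p s) (push s p (lift i X p)) (push s p v)) =
      (b i (fst p))\<^sup>2 * gF i (snd p i) (X (snd p i)) (push i p v)" .
  moreover have "lift i X p fst = 0" using lift_time[where X = X and h = "\<lambda>t. t", OF i p X] by simp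
  ultimately show ?thesis by (simp add: warped_metric_def)
qed

section \<open>Common domains of lifts, and frames of the product\<close>

text \<open>A domain that restricts every fibre component but not time, on which lifts from all the
  fibres are defined together.\<close>

definition fiber_box :: "(nat \<Rightarrow> 'a set) \<Rightarrow> (real \<times> (nat \<Rightarrow> 'a)) set" where
  "fiber_box V = {q \<in> points M. \<forall>i\<in>{1..m}. snd q i \<in> V i}"

definition open_family :: "(nat \<Rightarrow> 'a set) \<Rightarrow> bool" where
  "open_family V \<longleftrightarrow> (\<forall>i\<in>{1..m}. openin (sp_top (F i)) (V i))"

lemma box_points: "p \<in> fiber_box V \<Longrightarrow> p \<in> points M"
  by (simp add: fiber_box_def)

lemma box_component: "p \<in> fiber_box V \<Longrightarrow> i \<in> {1..m} \<Longrightarrow> snd p i \<in> V i"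
  by (simp add: fiber_box_def)

lemma openin_box:
  assumes "open_family V" shows "openin (sp_top M) (fiber_box V)"
proof (cases "{1..m} = {}")
  case True
  then show ?thesis using openin_points by (simp add: fiber_box_def)
next
  case False
  have "openin (sp_top M) (\<Inter>i\<in>{1..m}. cylinder i (V i))"
    using assms False by (intro openin_INT2 openin_cylinder) (auto simp: open_family_def)
  moreover have "(\<Inter>i\<in>{1..m}. cylinder i (V i)) = fiber_box V"
    using False by (auto simp: fiber_box_def cylinder_iff)
  ultimately show ?thesis by simp
qed

lemma dt_vf: "open_family V \<Longrightarrow> vector_field M (fiber_box V) dt"
  by (rule P.vf_subset[OF time_field_vf openin_box]) (auto simp: fiber_box_def)

lemma lift_box_vf:
  assumes V: "open_family V" and i: "i \<in> {1..m}" and X: "vector_field (F i) (V i) X"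
  shows "vector_field M (fiber_box V) (lift i X)"
  by (rule P.vf_subset[OF lift_vf[OF i X] openin_box[OF V]])
    (simp add: subset_iff cylinder_iff box_points box_component[OF _ i])

lemma fiber_tangent:
  assumes "p \<in> fiber_box V" "i \<in> {1..m}" "vector_field (F i) (V i) X"
  shows "X (snd p i) \<in> tangent_space (F i) (snd p i)"
  using charted_space.vf_tangent[OF F_charted[OF assms(2)] assms(3) box_component[OF assms(1,2)]] .

lemma g_dt_dt: "p \<in> points M \<Longrightarrow> g p (dt p) (dt p) = -1"
  using g_dt P.vf_tangent[OF time_field_vf] time_field_time by simp

context
  fixes V :: "nat \<Rightarrow> 'a set"
  assumes V: "open_family V"
begin

lemma lift_fst:
  assumes "p \<in> fiber_box V" "i \<in> {1..m}" "vector_field (F i) (V i) X"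
  shows "lift i X p fst = 0"
  using lift_time[where X = X and h = "\<lambda>t. t", OF assms(2) box_points[OF assms(1)] fiber_tangent[OF assms]] by simp

lemma g_dt_lift:
  assumes "p \<in> fiber_box V" "i \<in> {1..m}" "vector_field (F i) (V i) X"
  shows "g p (dt p) (lift i X p) = 0" "g p (lift i X p) (dt p) = 0"
proof -
  note T = P.vf_tangent[OF lift_box_vf[OF V assms(2,3)] assms(1)]
  show 1: "g p (dt p) (lift i X p) = 0"
    using g_dt[OF box_points[OF assms(1)] T] lift_fst[OF assms] by simp
  then show "g p (lift i X p) (dt p) = 0"
    using PM.g_sym[OF box_points[OF assms(1)] T P.vf_tangent[OF dt_vf[OF V] assms(1)]] by simp
qed

lemma g_lift_lift:
  assumes p: "p \<in> fiber_box V" and i: "i \<in> {1..m}" and X: "vector_field (F i) (V i) X" and Y: "vector_field (F i) (V i) Y"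
  shows "g p (lift i X p) (lift i Y p) = (b i (fst p))\<^sup>2 * gF i (snd p i) (X (snd p i)) (Y (snd p i))"
  using g_lift[where X = X, OF i box_points[OF p] fiber_tangent[OF p i X] P.vf_tangent[OF lift_box_vf[OF V i Y] p]]
    push_lift[where X = Y, OF i box_points[OF p] fiber_tangent[OF p i Y]] by simp

lemma g_lift_other:
  assumes p: "p \<in> fiber_box V" and i: "i \<in> {1..m}" and s: "s \<in> {1..m}" and si: "i \<noteq> s"
    and X: "vector_field (F i) (V i) X" and Y: "vector_field (F s) (V s) Y"
  shows "g p (lift i X p) (lift s Y p) = 0"
proof -
  interpret Fi: framed_manifold "F i" "gF i" by (rule framed_fiber[OF i])
  note pM = box_points[OF p]
  have "gF i (snd p i) (X (snd p i)) (\<lambda>f. 0) = 0"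
    using Fi.g_zero[OF component_points[OF pM i] fiber_tangent[OF p i X]]
      Fi.g_sym[OF component_points[OF pM i] fiber_tangent[OF p i X] Fi.tangent_space_zero] by simp
  then show ?thesis
    using g_lift[where X = X, OF i pM fiber_tangent[OF p i X] P.vf_tangent[OF lift_box_vf[OF V s Y] p]]
      push_lift_other[where X = Y, OF s pM fiber_tangent[OF p s Y] si] by simp
qed

end

definition frame_idx :: "(nat \<times> nat) option set" where
  "frame_idx = insert None (Some ` (SIGMA i:{1..m}. {..<mdim (F i)}))"

definition frame_fields :: "(nat \<Rightarrow> nat \<Rightarrow> 'a vfield) \<Rightarrow> (nat \<times> nat) option \<Rightarrow> (real \<times> (nat \<Rightarrow> 'a)) vfield" where
  "frame_fields E a = (case a of None \<Rightarrow> dt | Some (i, k) \<Rightarrow> lift i (E i k))"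

lemma finite_frame_idx: "finite frame_idx"
  by (simp add: frame_idx_def)

lemma sum_frame_idx: "(\<Sum>a\<in>frame_idx. f a) = f None + (\<Sum>i\<in>{1..m}. \<Sum>k<mdim (F i). f (Some (i, k)))"
proof -
  have "(\<Sum>a\<in>frame_idx. f a) = f None + (\<Sum>a\<in>Some ` (SIGMA i:{1..m}. {..<mdim (F i)}). f a)"
    unfolding frame_idx_def by (subst sum.insert) auto
  also have "(\<Sum>a\<in>Some ` (SIGMA i:{1..m}. {..<mdim (F i)}). f a) =
      (\<Sum>a\<in>(SIGMA i:{1..m}. {..<mdim (F i)}). f (Some a))"
    by (subst sum.reindex) (simp_all add: comp_def)
  also have "\<dots> = (\<Sum>i\<in>{1..m}. \<Sum>k<mdim (F i). f (Some (i, k)))"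
    by (subst sum.Sigma) (simp_all add: split_def)
  finally show ?thesis .
qed

lemma mdim_prod: "mdim M = 1 + (\<Sum>i\<in>{1..m}. mdim (F i))"
proof -
  have "mdim M = Suc (card (Some ` (SIGMA i:{1..m}. coord_idx (F i))))"
    unfolding mdim_def coord_idx_prod using finite_idx_prod
    by (subst card_insert_disjoint) (auto simp: coord_idx_prod)
  also have "card (Some ` (SIGMA i:{1..m}. coord_idx (F i))) = card (SIGMA i:{1..m}. coord_idx (F i))"
    by (rule card_image) simp
  also have "\<dots> = (\<Sum>i\<in>{1..m}. mdim (F i))"
    unfolding mdim_def using charted_space.finite_idx[OF F_charted] by (intro card_SigmaI) auto
  finally show ?thesis by simp
qed

lemma card_frame_idx: "card frame_idx = mdim M"
  using sum_frame_idx[of "\<lambda>a. 1::nat"] by (simp add: mdim_prod)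

text \<open>Lifts of unit vectors have norm b^2 or -b^2, nonzero because the warping functions are
  positive. Different fibres and time are mutually orthogonal.\<close>

lemma product_frame:
  assumes V: "open_family V"
    and E: "\<And>i. i \<in> {1..m} \<Longrightarrow> orthonormal_frame (F i) (gF i) (V i) (E i)"
  shows "PM.orthogonal_frame frame_idx (fiber_box V) (frame_fields E)"
  unfolding PM.orthogonal_frame_def
proof (intro conjI ballI impI)
  have Ei: "vector_field (F i) (V i) (E i k)" if "i \<in> {1..m}" "k < mdim (F i)" for i k
    using E[OF that(1)] that(2) unfolding orthonormal_frame_def by blast
  have idx: "a = None \<or> (\<exists>i k. a = Some (i, k) \<and> i \<in> {1..m} \<and> k < mdim (F i))" if "a \<in> frame_idx" for a
    using that by (auto simp: frame_idx_def)
  show "finite frame_idx" by (rule finite_frame_idx)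
  show "card frame_idx = mdim M" by (rule card_frame_idx)
  show "openin (sp_top M) (fiber_box V)" by (rule openin_box[OF V])
  fix a assume a: "a \<in> frame_idx"
  show "vector_field M (fiber_box V) (frame_fields E a)"
    using idx[OF a] dt_vf[OF V] lift_box_vf[OF V _ Ei] by (auto simp: frame_fields_def)
  fix p assume p: "p \<in> fiber_box V"
  note pM = box_points[OF p]
  {
    from idx[OF a] show "g p (frame_fields E a p) (frame_fields E a p) \<noteq> 0"
    proof (elim disjE exE conjE)
      assume "a = None"
      then show ?thesis using g_dt_dt[OF pM] by (simp add: frame_fields_def)
    next
      fix i k assume ik: "a = Some (i, k)" "i \<in> {1..m}" "k < mdim (F i)"
      have "gF i (snd p i) (E i k (snd p i)) (E i k (snd p i)) \<in> {-1, 1}"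
        using E[OF ik(2)] ik(3) box_component[OF p ik(2)] unfolding orthonormal_frame_def by blast
      moreover have "b i (fst p) > 0" using b_pos[OF ik(2) time_points[OF pM]] .
      ultimately show ?thesis
        using g_lift_lift[OF V p ik(2) Ei[OF ik(2,3)] Ei[OF ik(2,3)]] ik(1) by (auto simp: frame_fields_def)
    qed
  next
    fix a' assume a': "a' \<in> frame_idx" and ne: "a \<noteq> a'"
    from idx[OF a] idx[OF a'] show "g p (frame_fields E a p) (frame_fields E a' p) = 0"
    proof (elim disjE exE conjE)
      assume "a = None" "a' = None"
      then show ?thesis using ne by simp
    next
      fix i k assume "a = None" "a' = Some (i, k)" "i \<in> {1..m}" "k < mdim (F i)"
      then show ?thesis using g_dt_lift[OF V p] Ei by (simp add: frame_fields_def)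
    next
      fix i k assume "a' = None" "a = Some (i, k)" "i \<in> {1..m}" "k < mdim (F i)"
      then show ?thesis using g_dt_lift[OF V p] Ei by (simp add: frame_fields_def)
    next
      fix i k i' k' assume ik: "a = Some (i, k)" "i \<in> {1..m}" "k < mdim (F i)"
        "a' = Some (i', k')" "i' \<in> {1..m}" "k' < mdim (F i')"
      show ?thesis
      proof (cases "i = i'")
        case True
        then have "k \<noteq> k'" "k' < mdim (F i)" using ne ik by auto
        then have "gF i (snd p i) (E i k (snd p i)) (E i k' (snd p i)) = 0"
          using E[OF ik(2)] ik(3) box_component[OF p ik(2)] unfolding orthonormal_frame_def by blast
        then show ?thesis
          using g_lift_lift[OF V p ik(2) Ei[OF ik(2,3)] Ei[OF ik(2) \<open>k' < mdim (F i)\<close>]] ik True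
          by (simp add: frame_fields_def)
      next
        case False
        then show ?thesis
          using g_lift_other[OF V p ik(2,5) False Ei[OF ik(2,3)] Ei[OF ik(5,6)]] ik by (simp add: frame_fields_def)
      qed
    qed
  }
qed

lemma fiber_frames:
  assumes p: "p \<in> points M"
  obtains V E where "open_family V" "p \<in> fiber_box V" "\<forall>i\<in>{1..m}. orthonormal_frame (F i) (gF i) (V i) (E i)"
proof -
  have "\<forall>i\<in>{1..m}. \<exists>c. snd p i \<in> fst c \<and> openin (sp_top (F i)) (fst c) \<and> orthonormal_frame (F i) (gF i) (fst c) (snd c)"
  proof
    fix i assume i: "i \<in> {1..m}"
    from framed_manifold.frame_exists[OF framed_fiber[OF i] component_points[OF p i]] obtain W E where
      "snd p i \<in> W" "openin (sp_top (F i)) W" "orthonormal_frame (F i) (gF i) W E" by (elim exE conjE)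
    then show "\<exists>c. snd p i \<in> fst c \<and> openin (sp_top (F i)) (fst c) \<and> orthonormal_frame (F i) (gF i) (fst c) (snd c)"
      by (intro exI[of _ "(W, E)"]) simp
  qed
  from bchoice[OF this] obtain c where c: "\<forall>i\<in>{1..m}. snd p i \<in> fst (c i) \<and> openin (sp_top (F i)) (fst (c i)) \<and>
      orthonormal_frame (F i) (gF i) (fst (c i)) (snd (c i))" by (elim exE)
  show thesis
    by (rule that[of "\<lambda>i. fst (c i)" "\<lambda>i. snd (c i)"]) (use c p in \<open>simp_all add: open_family_def fiber_box_def\<close>)
qed

text \<open>The product frame becomes orthonormal when lifts from the \<open>i\<close>-th fibre are
  divided by the warping function of that fibre; the time field already has norm -1.\<close>

lemma framed_prod: "framed_manifold M g"
proof unfold_locales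
  fix p assume p: "p \<in> points M"
  obtain V E where V: "open_family V" "p \<in> fiber_box V"
    and E0: "\<forall>i\<in>{1..m}. orthonormal_frame (F i) (gF i) (V i) (E i)" by (rule fiber_frames[OF p])
  note E = bspec[OF E0]
  note B = product_frame[OF V(1) E]
  define r where "r a q = (case a of None \<Rightarrow> 1 | Some (i, k) \<Rightarrow> 1 / b i (fst q))" for a :: "(nat \<times> nat) option" and q :: "real \<times> (nat \<Rightarrow> 'a)"
  define E' where "E' a = (\<lambda>q h. r a q * frame_fields E a q h)" for a
  have idx: "a = None \<or> (\<exists>i k. a = Some (i, k) \<and> i \<in> {1..m} \<and> k < mdim (F i))" if "a \<in> frame_idx" for a
    using that by (auto simp: frame_idx_def)
  have r: "smooth_on M (fiber_box V) (r a)" if a: "a \<in> frame_idx" for a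
    using idx[OF a]
  proof (elim disjE exE conjE)
    assume "a = None"
    then have "r a = (\<lambda>q. 1)" by (intro ext) (simp add: r_def)
    then show ?thesis using P.smooth_on_const[OF openin_box[OF V(1)], of 1] by simp
  next
    fix i k assume ik: "a = Some (i, k)" "i \<in> {1..m}" "k < mdim (F i)"
    have "smooth_on M (fiber_box V) (\<lambda>q. b i (fst q))"
      by (rule P.smooth_on_subset[OF time_fun_smooth[OF b_smooth[OF ik(2)]] openin_box[OF V(1)]]) (auto simp: fiber_box_def)
    then have "smooth_on M (fiber_box V) (\<lambda>q. 1 / b i (fst q))"
      using b_pos[OF ik(2) time_points] box_points
      by (intro P.smooth_on_divide P.smooth_on_const openin_box[OF V(1)]) (auto simp: less_le)
    moreover have "r a = (\<lambda>q. 1 / b i (fst q))" using ik(1) by (intro ext) (simp add: r_def)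
    ultimately show ?thesis by simp
  qed
  have E'v: "vector_field M (fiber_box V) (E' a)" if "a \<in> frame_idx" for a
    unfolding E'_def by (rule P.vf_scale[OF PM.frame_field[OF B that] r[OF that]])
  have gE: "g q (E' a q) (E' a' q) = r a q * r a' q * g q (frame_fields E a q) (frame_fields E a' q)"
    if a: "a \<in> frame_idx" "a' \<in> frame_idx" and q: "q \<in> fiber_box V" for a a' q
  proof -
    note T = P.vf_tangent[OF PM.frame_field[OF B a(1)] q] P.vf_tangent[OF PM.frame_field[OF B a(2)] q]
    show ?thesis unfolding E'_def
      using PM.g_scale[OF box_points[OF q] T(1) P.tangent_space_scale[OF T(2)], of "r a q" "r a' q"]
        PM.g_scale_right[OF box_points[OF q] T, of "r a' q"] by simp
  qed
  have norm: "g q (E' a q) (E' a q) \<in> {-1, 1}" if a: "a \<in> frame_idx" and q: "q \<in> fiber_box V" for a q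
    using idx[OF a]
  proof (elim disjE exE conjE)
    assume "a = None"
    then show ?thesis using gE[OF a a q] g_dt_dt[OF box_points[OF q]] by (simp add: r_def frame_fields_def)
  next
    fix i k assume ik: "a = Some (i, k)" "i \<in> {1..m}" "k < mdim (F i)"
    have Ei: "vector_field (F i) (V i) (E i k)" using E[OF ik(2)] ik(3) unfolding orthonormal_frame_def by blast
    have "gF i (snd q i) (E i k (snd q i)) (E i k (snd q i)) \<in> {-1, 1}"
      using E[OF ik(2)] ik(3) box_component[OF q ik(2)] unfolding orthonormal_frame_def by blast
    moreover have "b i (fst q) > 0" using b_pos[OF ik(2) time_points[OF box_points[OF q]]] .
    ultimately show ?thesis
      using gE[OF a a q] g_lift_lift[OF V(1) q ik(2) Ei Ei] ik(1)
      by (auto simp: r_def frame_fields_def power2_eq_square)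
  qed
  \<comment> \<open>\<open>orthonormal_frame\<close> counts its vectors by natural numbers, so the
    frame is re-indexed by a bijection.\<close>
  obtain e where e: "bij_betw e {0..<mdim M} frame_idx"
    using ex_bij_betw_nat_finite[OF finite_frame_idx] unfolding card_frame_idx by (elim exE)
  have ek: "e k \<in> frame_idx" if "k < mdim M" for k using bij_betwE[OF e] that by simp
  have "orthonormal_frame M g (fiber_box V) (\<lambda>k. E' (e k))"
    unfolding orthonormal_frame_def
  proof (intro conjI allI impI ballI)
    fix k assume k: "k < mdim M"
    show "vector_field M (fiber_box V) (E' (e k))" by (rule E'v[OF ek[OF k]])
  next
    fix q k assume q: "q \<in> fiber_box V" and k: "k < mdim M"
    show "g q (E' (e k) q) (E' (e k) q) \<in> {-1, 1}" by (rule norm[OF ek[OF k] q])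
  next
    fix q k k' assume q: "q \<in> fiber_box V" and k: "k < mdim M" "k' < mdim M" "k \<noteq> k'"
    have "e k \<noteq> e k'" using bij_betw_imp_inj_on[OF e] k by (auto simp: inj_on_def)
    then show "g q (E' (e k) q) (E' (e k') q) = 0"
      using gE[OF ek[OF k(1)] ek[OF k(2)] q] PM.frame_orth[OF B ek[OF k(1)] ek[OF k(2)] q] by simp
  qed
  then show "\<exists>W E. p \<in> W \<and> openin (sp_top M) W \<and> orthonormal_frame M g W E"
    using V openin_box by blast
qed

sublocale FM: framed_manifold "product_space I m F" "warped_metric I m F gF b"
  by (rule framed_prod)

text \<open>Only the time field and lifts occur as test fields. The smaller families
  \<open>V\<close> are needed because frames of the fibres exist near the components of
  \<open>p\<close> but need not exist on all of \<open>V0\<close>.\<close>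

lemma warped_eqI:
  assumes V0: "open_family V0" "p \<in> fiber_box V0"
    and u: "u \<in> tangent_space M p" and v: "v \<in> tangent_space M p"
    and t: "g p u (dt p) = g p v (dt p)"
    and x: "\<And>V i Z. open_family V \<Longrightarrow> p \<in> fiber_box V \<Longrightarrow> (\<And>i. i \<in> {1..m} \<Longrightarrow> V i \<subseteq> V0 i) \<Longrightarrow> i \<in> {1..m} \<Longrightarrow>
      vector_field (F i) (V i) Z \<Longrightarrow> g p u (lift i Z p) = g p v (lift i Z p)"
  shows "u = v"
proof -
  obtain V1 E where V1: "open_family V1" "p \<in> fiber_box V1"
    and E0: "\<forall>i\<in>{1..m}. orthonormal_frame (F i) (gF i) (V1 i) (E i)" by (rule fiber_frames[OF box_points[OF V0(2)]])
  note E = bspec[OF E0]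
  let ?V = "\<lambda>i. V0 i \<inter> V1 i"
  have V: "open_family ?V" "p \<in> fiber_box ?V" using V0 V1 by (auto simp: open_family_def fiber_box_def)
  have E': "orthonormal_frame (F i) (gF i) (?V i) (E i)" if i: "i \<in> {1..m}" for i
  proof -
    have "openin (sp_top (F i)) (?V i)" using V(1) i by (simp add: open_family_def)
    then show ?thesis
      using E[OF i] charted_space.vf_subset[OF F_charted[OF i], of "V1 i" _ "?V i"]
      unfolding orthonormal_frame_def by (metis IntD2 Int_lower2)
  qed
  show ?thesis
  proof (rule PM.frame_eqI[OF product_frame[OF V(1) E'] V(2) u v])
    fix a assume a: "a \<in> frame_idx"
    show "g p u (frame_fields E a p) = g p v (frame_fields E a p)"
    proof (cases a)
      case None
      then show ?thesis using t by (simp add: frame_fields_def)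
    next
      case (Some ik)
      then obtain i k where ik: "a = Some (i, k)" "i \<in> {1..m}" "k < mdim (F i)"
        using a by (auto simp: frame_idx_def)
      have "vector_field (F i) (?V i) (E i k)" using E'[OF ik(2)] ik(3) unfolding orthonormal_frame_def by blast
      from x[OF V _ ik(2) this] show ?thesis using ik(1) by (simp add: frame_fields_def)
    qed
  qed
qed

end

section \<open>The connections on lifted fields\<close>

context affine_manifold
begin

lemma D_zero_left:
  assumes "vector_field M W Z" "p \<in> W" shows "D (\<lambda>q h. 0) Z p f = 0"
  using D_scale_left[OF vf_zero[OF vf_open[OF assms(1)]] assms(1) smooth_on_const[OF vf_open[OF assms(1)], of 0] assms(2), of f]
  by simp

lemma D_zero_right:
  assumes "vector_field M W X" "p \<in> W" shows "D X (\<lambda>q h. 0) p f = 0"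
  using D_scale_right[OF assms(1) vf_zero[OF vf_open[OF assms(1)]] smooth_on_const[OF vf_open[OF assms(1)], of 0] assms(2), of f]
    tangent_const[OF vf_tangent[OF assms] vf_points[OF assms], of 0]
  by simp

lemma D_cong_zero_left:
  assumes X: "vector_field M W X" and Z: "vector_field M W Z" and p: "p \<in> W"
    and e: "\<And>q. q \<in> W \<Longrightarrow> X q = (\<lambda>h. 0)"
  shows "D X Z p f = 0"
  using D_cong[OF X Z p, of "\<lambda>q h. 0" Z] e D_zero_left[OF Z p] by simp

lemma D_cong_zero_right:
  assumes X: "vector_field M W X" and Z: "vector_field M W Z" and p: "p \<in> W"
    and e: "\<And>q. q \<in> W \<Longrightarrow> Z q = (\<lambda>h. 0)"
  shows "D X Z p f = 0"
  using D_cong[OF X Z p, of X "\<lambda>q h. 0"] e D_zero_right[OF X p] by simp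

text \<open>For iterated covariant derivatives: the inner derivative is known as a multiple of a
  field on the whole open set, hence it can be differentiated again.\<close>

lemma D_cong_scale_right:
  assumes X: "vector_field M W X" and Y: "vector_field M W Y" and Z: "vector_field M W Z"
    and \<psi>: "smooth_on M W \<psi>" and p: "p \<in> W" and e: "\<And>q. q \<in> W \<Longrightarrow> Y q = (\<lambda>h. \<psi> q * Z q h)"
  shows "D X Y p f = X p \<psi> * Z p f + \<psi> p * D X Z p f"
proof -
  have "D X Y p = D X (\<lambda>q h. \<psi> q * Z q h) p" by (rule D_cong[OF X Y p refl e])
  then show ?thesis using D_scale_right[OF X Z \<psi> p, of f] by simp
qed

lemma D_cong_add_scale_right:
  assumes X: "vector_field M W X" and Y: "vector_field M W Y" and Z: "vector_field M W Z" and T: "vector_field M W T"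
    and \<psi>: "smooth_on M W \<psi>" and p: "p \<in> W" and e: "\<And>q. q \<in> W \<Longrightarrow> Y q = (\<lambda>h. Z q h + \<psi> q * T q h)"
  shows "D X Y p f = D X Z p f + X p \<psi> * T p f + \<psi> p * D X T p f"
proof -
  have "D X Y p = D X (\<lambda>q h. Z q h + \<psi> q * T q h) p" by (rule D_cong[OF X Y p refl e])
  then show ?thesis
    using D_scale_right[OF X T \<psi> p, of f] D_add_right[OF X Z vf_scale[OF T \<psi>] p, of f] by simp
qed

end

locale warped_connection = warped_product +
  fixes nablaF :: "nat \<Rightarrow> 'a connection_op"
    and nabla :: "(real \<times> (nat \<Rightarrow> 'a)) connection_op" and lam1 lam2 :: real
  assumes levi_civita_fiber: "\<And>i. i \<in> {1..m} \<Longrightarrow> levi_civita (F i) (gF i) (nablaF i)"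
    and levi_civita_prod: "levi_civita (product_space I m F) (warped_metric I m F gF b) nabla"
begin

lemma fiber_metric: "i \<in> {1..m} \<Longrightarrow> metric_manifold (F i) (gF i)"
  using framed_manifold.axioms(1)[OF framed_fiber] .

lemma fiber_affine: "i \<in> {1..m} \<Longrightarrow> affine_manifold (F i) (nablaF i)"
  using levi_civita_fiber F_charted unfolding levi_civita_def affine_manifold_def affine_manifold_axioms_def by blast

section \<open>Brackets of lifts and derivatives of their inner products\<close>

lemma const_on_box:
  assumes V: "open_family V" and p: "p \<in> fiber_box V" and u: "u \<in> tangent_space M p"
    and h: "\<And>q. q \<in> fiber_box V \<Longrightarrow> h q = c"
  shows "u h = 0"
  using P.tangent_cong[OF u openin_box[OF V] p, of h "\<lambda>q. c"] P.tangent_const[OF u box_points[OF p], of c] h by simp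

lemma dt_tangent: "p \<in> points M \<Longrightarrow> dt p \<in> tangent_space M p"
  by (rule P.vf_tangent[OF time_field_vf])

lemma lift_tangent:
  "open_family V \<Longrightarrow> p \<in> fiber_box V \<Longrightarrow> i \<in> {1..m} \<Longrightarrow> vector_field (F i) (V i) X \<Longrightarrow> lift i X p \<in> tangent_space M p"
  using P.vf_tangent[OF lift_box_vf] by blast

text \<open>The lift applied to a pulled-back function agrees with the pullback of
  \<open>X f\<close> wherever \<open>f\<close> is smooth, but not necessarily elsewhere. Locality of
  \<open>u\<close> makes this sufficient.\<close>

lemma deriv_lift_component:
  assumes V: "open_family V" and p: "p \<in> fiber_box V" and u: "u \<in> tangent_space M p" and i: "i \<in> {1..m}"
    and f: "smooth_near (F i) (snd p i) f"
  shows "u (\<lambda>q. lift i X q (\<lambda>r. f (snd r i))) = u (\<lambda>q. X (snd q i) f)"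
proof -
  interpret Fi: charted_space "F i" by (rule F_charted[OF i])
  obtain W where W: "smooth_on (F i) W f" "snd p i \<in> W" using f by (rule Fi.smooth_nearE)
  have o: "openin (sp_top M) (cylinder i W)" by (rule openin_cylinder[OF i Fi.smooth_on_open[OF W(1)]])
  show ?thesis
  proof (rule P.tangent_cong[OF u o])
    show "p \<in> cylinder i W" using W(2) box_points[OF p] by (simp add: cylinder_iff)
    show "lift i X q (\<lambda>r. f (snd r i)) = X (snd q i) f" if "q \<in> cylinder i W" for q
      using that lift_component[OF i] Fi.smooth_nearI[OF W(1)] by (simp add: cylinder_iff)
  qed
qed

lemma deriv_lift_component_other:
  assumes V: "open_family V" and p: "p \<in> fiber_box V" and u: "u \<in> tangent_space M p" and i: "i \<in> {1..m}"
    and X: "vector_field (F i) (V i) X" and "s \<noteq> i"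
  shows "u (\<lambda>q. lift i X q (\<lambda>r. f (snd r s))) = 0"
  by (rule const_on_box[OF V p u, of _ 0])
    (rule lift_component_other[where X = X, OF i box_points fiber_tangent[where V = V and X = X, OF _ i X] assms(6)])

lemma deriv_lift_time:
  assumes V: "open_family V" and p: "p \<in> fiber_box V" and u: "u \<in> tangent_space M p" and i: "i \<in> {1..m}"
    and X: "vector_field (F i) (V i) X"
  shows "u (\<lambda>q. lift i X q fst) = 0"
  by (rule const_on_box[OF V p u, of _ 0]) (rule lift_fst[OF V _ i X])

lemma deriv_dt_time:
  assumes V: "open_family V" and p: "p \<in> fiber_box V" and u: "u \<in> tangent_space M p"
  shows "u (\<lambda>q. dt q fst) = 0"
  by (rule const_on_box[OF V p u, of _ 1]) (rule time_field_time[OF box_points])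

lemma deriv_dt_component:
  assumes V: "open_family V" and p: "p \<in> fiber_box V" and u: "u \<in> tangent_space M p"
  shows "u (\<lambda>q. dt q (\<lambda>r. f (snd r s))) = 0"
  by (rule const_on_box[OF V p u, of _ 0]) (rule time_field_component[OF box_points])

text \<open>Brackets are compared on coordinate functions only, which avoids commuting partial derivatives.\<close>

lemma lie_dt_dt: "lie_bracket M dt dt p = (\<lambda>f. 0)"
  by (auto simp: lie_bracket_def)

lemma lie_lift_lift:
  assumes V: "open_family V" and p: "p \<in> fiber_box V" and i: "i \<in> {1..m}"
    and X: "vector_field (F i) (V i) X" and Y: "vector_field (F i) (V i) Y"
  shows "lie_bracket M (lift i X) (lift i Y) p = lift i (lie_bracket (F i) X Y) p"
proof -
  interpret Fi: charted_space "F i" by (rule F_charted[OF i])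
  note pM = box_points[OF p]
  note lX = lift_box_vf[OF V i X] and lY = lift_box_vf[OF V i Y]
  note tX = lift_tangent[OF V p i X] and tY = lift_tangent[OF V p i Y]
  note XY = Fi.lie_bracket_field[OF X Y]
  show ?thesis
  proof (rule tangent_prod_eqI[OF pM P.vf_tangent[OF P.lie_bracket_field[OF lX lY] p] lift_tangent[OF V p i XY]])
    show "lie_bracket M (lift i X) (lift i Y) p fst = lift i (lie_bracket (F i) X Y) p fst"
      using deriv_lift_time[OF V p tX i Y] deriv_lift_time[OF V p tY i X] lift_fst[OF V p i XY] time_smooth_near[OF pM]
      by (simp add: lie_bracket_def[of M])
    fix s f assume s: "s \<in> {1..m}" and f: "smooth_near (F s) (snd p s) f"
    note fM = component_smooth_near[OF s pM f]
    show "lie_bracket M (lift i X) (lift i Y) p (\<lambda>q. f (snd q s)) = lift i (lie_bracket (F i) X Y) p (\<lambda>q. f (snd q s))"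
    proof (cases "s = i")
      case True
      note f' = f[unfolded True]
      have sX: "smooth_near (F i) (snd p i) (\<lambda>y. X y f)" and sY: "smooth_near (F i) (snd p i) (\<lambda>y. Y y f)"
        using Fi.vf_smooth_near[OF X box_component[OF p i] f'] Fi.vf_smooth_near[OF Y box_component[OF p i] f'] .
      have "lift i X p (\<lambda>q. lift i Y q (\<lambda>r. f (snd r i))) = X (snd p i) (\<lambda>y. Y y f)"
        using deriv_lift_component[OF V p tX i f', of Y] lift_component[OF i pM sY, of X] by simp
      moreover have "lift i Y p (\<lambda>q. lift i X q (\<lambda>r. f (snd r i))) = Y (snd p i) (\<lambda>y. X y f)"
        using deriv_lift_component[OF V p tY i f', of X] lift_component[OF i pM sX, of Y] by simp
      ultimately show ?thesis
        using fM f' lift_component[OF i pM f'] True by (simp add: lie_bracket_def)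
    next
      case False
      then show ?thesis
        using deriv_lift_component_other[OF V p tX i Y False] deriv_lift_component_other[OF V p tY i X False]
          lift_component_other[where X = "lie_bracket (F i) X Y", OF i pM fiber_tangent[OF p i XY] False] fM
        by (simp add: lie_bracket_def[of M])
    qed
  qed
qed

lemma lie_lift_other:
  assumes V: "open_family V" and p: "p \<in> fiber_box V" and i: "i \<in> {1..m}" and k: "k \<in> {1..m}" and ik: "i \<noteq> k"
    and X: "vector_field (F i) (V i) X" and Y: "vector_field (F k) (V k) Y"
  shows "lie_bracket M (lift i X) (lift k Y) p = (\<lambda>f. 0)"
proof -
  note pM = box_points[OF p]
  note lX = lift_box_vf[OF V i X] and lY = lift_box_vf[OF V k Y]
  note tX = lift_tangent[OF V p i X] and tY = lift_tangent[OF V p k Y]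
  \<comment> \<open>One of the two second derivatives in the commutator; the other is the same
    statement with the two fibres exchanged.\<close>
  have *: "lift i X p (\<lambda>q. lift k Y q (\<lambda>r. f (snd r s))) = 0"
    if i: "i \<in> {1..m}" and k: "k \<in> {1..m}" and ik: "i \<noteq> k" and X: "vector_field (F i) (V i) X"
      and Y: "vector_field (F k) (V k) Y" and f: "smooth_near (F s) (snd p s) f" for i k X Y s f
  proof (cases "s = k")
    case True
    have "lift i X p (\<lambda>q. lift k Y q (\<lambda>r. f (snd r k))) = lift i X p (\<lambda>q. Y (snd q k) f)"
      using deriv_lift_component[OF V p lift_tangent[OF V p i X] k] f True by blast
    also have "\<dots> = 0"
      using lift_component_other[where X = X and s = k and h = "\<lambda>y. Y y f", OF i pM fiber_tangent[OF p i X]] ik by simp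
    finally show ?thesis using True by simp
  next
    case False
    then show ?thesis by (rule deriv_lift_component_other[OF V p lift_tangent[OF V p i X] k Y])
  qed
  show ?thesis
  proof (rule tangent_prod_eqI[OF pM P.vf_tangent[OF P.lie_bracket_field[OF lX lY] p] P.tangent_space_zero])
    show "lie_bracket M (lift i X) (lift k Y) p fst = 0"
      using deriv_lift_time[OF V p tX k Y] deriv_lift_time[OF V p tY i X] time_smooth_near[OF pM]
      by (simp add: lie_bracket_def)
    fix s f assume s: "s \<in> {1..m}" and f: "smooth_near (F s) (snd p s) f"
    show "lie_bracket M (lift i X) (lift k Y) p (\<lambda>q. f (snd q s)) = 0"
      using *[OF i k ik X Y f] *[OF k i ik[symmetric] Y X f] by (simp add: lie_bracket_def)
  qed
qed

lemma lie_dt_lift: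
  assumes V: "open_family V" and p: "p \<in> fiber_box V" and i: "i \<in> {1..m}" and X: "vector_field (F i) (V i) X"
  shows "lie_bracket M dt (lift i X) p = (\<lambda>f. 0)" "lie_bracket M (lift i X) dt p = (\<lambda>f. 0)"
proof -
  note pM = box_points[OF p]
  note lX = lift_box_vf[OF V i X]
  note tX = lift_tangent[OF V p i X] and tt = dt_tangent[OF pM]
  show 1: "lie_bracket M dt (lift i X) p = (\<lambda>f. 0)"
  proof (rule tangent_prod_eqI[OF pM P.vf_tangent[OF P.lie_bracket_field[OF dt_vf[OF V] lX] p] P.tangent_space_zero])
    show "lie_bracket M dt (lift i X) p fst = 0"
      using deriv_lift_time[OF V p tt i X] deriv_dt_time[OF V p tX] time_smooth_near[OF pM]
      by (simp add: lie_bracket_def)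
    fix s f assume s: "s \<in> {1..m}" and f: "smooth_near (F s) (snd p s) f"
    have "dt p (\<lambda>q. lift i X q (\<lambda>r. f (snd r s))) = 0"
    proof (cases "s = i")
      case True
      have "dt p (\<lambda>q. lift i X q (\<lambda>r. f (snd r i))) = dt p (\<lambda>q. X (snd q i) f)"
        using deriv_lift_component[OF V p tt i] f True by blast
      also have "\<dots> = 0" by (rule time_field_component[OF pM])
      finally show ?thesis using True by simp
    next
      case False
      then show ?thesis by (rule deriv_lift_component_other[OF V p tt i X])
    qed
    then show "lie_bracket M dt (lift i X) p (\<lambda>q. f (snd q s)) = 0"
      using deriv_dt_component[OF V p tX] by (simp add: lie_bracket_def)
  qed
  show "lie_bracket M (lift i X) dt p = (\<lambda>f. 0)"
  proof
    fix f
    show "lie_bracket M (lift i X) dt p f = 0"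
      using fun_cong[OF 1, of f] by (simp add: lie_bracket_def split: if_splits)
  qed
qed

lemma dt_fun:
  assumes "smooth_on M (points M) (\<lambda>q. c (fst q))" "(c has_real_derivative d) (at (fst p))" "p \<in> points M"
  shows "dt p (\<lambda>q. c (fst q)) = d"
  using P.smooth_nearI[OF assms(1,3)] DERIV_imp_deriv[OF assms(2)] by (simp add: time_field_def)

lemma fiber_product_smooth:
  assumes V: "open_family V" and i: "i \<in> {1..m}" and X: "vector_field (F i) (V i) X" and Y: "vector_field (F i) (V i) Y"
  shows "smooth_on M (fiber_box V) (\<lambda>q. gF i (snd q i) (X (snd q i)) (Y (snd q i)))"
  by (rule P.smooth_on_subset[OF component_smooth[OF i metric_manifold.g_smooth[OF fiber_metric[OF i] X Y]] openin_box[OF V]])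
    (simp add: subset_iff cylinder_iff box_points box_component[OF _ i])

lemma fiber_product_smooth_near:
  assumes p: "p \<in> fiber_box V" and i: "i \<in> {1..m}" and X: "vector_field (F i) (V i) X" and Y: "vector_field (F i) (V i) Y"
  shows "smooth_near (F i) (snd p i) (\<lambda>y. gF i y (X y) (Y y))"
  by (rule charted_space.smooth_nearI[OF F_charted[OF i] metric_manifold.g_smooth[OF fiber_metric[OF i] X Y]
        box_component[OF p i]])

lemma box_time_smooth:
  "open_family V \<Longrightarrow> smooth_on M (points M) (\<lambda>q. c (fst q)) \<Longrightarrow> smooth_on M (fiber_box V) (\<lambda>q. c (fst q))"
  by (rule P.smooth_on_subset[OF _ openin_box]) (auto simp: fiber_box_def)

text \<open>Inner products of lifts from one fibre have this form, with time factor b^2. Time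
  differentiates only the first factor, a lift from the same fibre only the second, and lifts from
  other fibres neither.\<close>

lemma separated_product:
  assumes V: "open_family V" and p: "p \<in> fiber_box V" and i: "i \<in> {1..m}"
    and c: "smooth_on M (points M) (\<lambda>q. c (fst q))" and G: "smooth_near (F i) (snd p i) G"
  shows "dt p (\<lambda>q. c (fst q) * G (snd q i)) = dt p (\<lambda>q. c (fst q)) * G (snd p i)"
    and "vector_field (F i) (V i) Z \<Longrightarrow> lift i Z p (\<lambda>q. c (fst q) * G (snd q i)) = c (fst p) * Z (snd p i) G"
    and "k \<in> {1..m} \<Longrightarrow> k \<noteq> i \<Longrightarrow> vector_field (F k) (V k) T \<Longrightarrow> lift k T p (\<lambda>q. c (fst q) * G (snd q i)) = 0"
proof -
  note pM = box_points[OF p]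
  have sc: "smooth_near M p (\<lambda>q. c (fst q))" by (rule P.smooth_nearI[OF c pM])
  note sG = component_smooth_near[OF i pM G]
  show "dt p (\<lambda>q. c (fst q) * G (snd q i)) = dt p (\<lambda>q. c (fst q)) * G (snd p i)"
    using P.tangent_mult[OF dt_tangent[OF pM] sc sG] time_field_component[OF pM, of G i] by simp
  show "lift i Z p (\<lambda>q. c (fst q) * G (snd q i)) = c (fst p) * Z (snd p i) G" if Z: "vector_field (F i) (V i) Z"
    using P.tangent_mult[OF lift_tangent[OF V p i Z] sc sG] lift_component[OF i pM G, of Z]
      lift_time[where X = Z and h = c, OF i pM fiber_tangent[OF p i Z]] by simp
  show "lift k T p (\<lambda>q. c (fst q) * G (snd q i)) = 0"
    if k: "k \<in> {1..m}" "k \<noteq> i" and T: "vector_field (F k) (V k) T"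
    using P.tangent_mult[OF lift_tangent[OF V p k(1) T] sc sG]
      lift_time[where X = T and h = c, OF k(1) pM fiber_tangent[OF p k(1) T]]
      lift_component_other[where X = T and s = i and h = G, OF k(1) pM fiber_tangent[OF p k(1) T]] k(2) by simp
qed

lemma b_deriv: "i \<in> {1..m} \<Longrightarrow> t \<in> I \<Longrightarrow> (b i has_real_derivative deriv (b i) t) (at t)"
  by (rule smooth_fun_on_has_derivative[OF b_smooth])

lemma b_deriv2: "i \<in> {1..m} \<Longrightarrow> t \<in> I \<Longrightarrow> (deriv (b i) has_real_derivative deriv (deriv (b i)) t) (at t)"
  by (rule smooth_fun_on_has_derivative[OF smooth_fun_on_deriv[OF b_smooth]])

lemma b_time: "i \<in> {1..m} \<Longrightarrow> smooth_on M (points M) (\<lambda>q. b i (fst q))"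
  by (rule time_fun_smooth[OF b_smooth])

lemma b'_time: "i \<in> {1..m} \<Longrightarrow> smooth_on M (points M) (\<lambda>q. deriv (b i) (fst q))"
  by (rule time_fun_smooth[OF smooth_fun_on_deriv[OF b_smooth]])

lemma b_sq_time: "i \<in> {1..m} \<Longrightarrow> smooth_on M (points M) (\<lambda>q. (b i (fst q))\<^sup>2)"
  unfolding power2_eq_square by (rule P.smooth_on_mult[OF b_time b_time])

lemma deriv_lift_lift:
  assumes V: "open_family V" and p: "p \<in> fiber_box V" and i: "i \<in> {1..m}"
    and X: "vector_field (F i) (V i) X" and Y: "vector_field (F i) (V i) Y"
  defines "f \<equiv> \<lambda>q. g q (lift i X q) (lift i Y q)" and "G \<equiv> \<lambda>y. gF i y (X y) (Y y)"
  shows "dt p f = 2 * b i (fst p) * deriv (b i) (fst p) * G (snd p i)"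
    and "vector_field (F i) (V i) Z \<Longrightarrow> lift i Z p f = (b i (fst p))\<^sup>2 * Z (snd p i) G"
    and "k \<in> {1..m} \<Longrightarrow> k \<noteq> i \<Longrightarrow> vector_field (F k) (V k) T \<Longrightarrow> lift k T p f = 0"
proof -
  note pM = box_points[OF p]
  have f: "u f = u (\<lambda>q. (b i (fst q))\<^sup>2 * G (snd q i))" if "u \<in> tangent_space M p" for u
    by (rule P.tangent_cong[OF that openin_box[OF V] p]) (simp add: f_def G_def g_lift_lift[OF V _ i X Y])
  note G = fiber_product_smooth_near[OF p i X Y, folded G_def]
  note sep = separated_product[OF V p i b_sq_time[OF i] G]
  have "((\<lambda>t. (b i t)\<^sup>2) has_real_derivative 2 * b i (fst p) * deriv (b i) (fst p)) (at (fst p))"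
    using b_deriv[OF i time_points[OF pM]] by (auto intro!: derivative_eq_intros)
  then show "dt p f = 2 * b i (fst p) * deriv (b i) (fst p) * G (snd p i)"
    unfolding f[OF dt_tangent[OF pM]] sep(1) using dt_fun[OF b_sq_time[OF i] _ pM] by simp
  show "lift i Z p f = (b i (fst p))\<^sup>2 * Z (snd p i) G" if Z: "vector_field (F i) (V i) Z"
    unfolding f[OF lift_tangent[OF V p i Z]] by (rule sep(2)[OF Z])
  show "lift k T p f = 0" if k: "k \<in> {1..m}" "k \<noteq> i" and T: "vector_field (F k) (V k) T"
    unfolding f[OF lift_tangent[OF V p k(1) T]] by (rule sep(3)[OF k T])
qed

lemma deriv_inner_zero:
  assumes V: "open_family V" and p: "p \<in> fiber_box V" and u: "u \<in> tangent_space M p"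
  shows "u (\<lambda>q. g q (dt q) (dt q)) = 0"
    and "i \<in> {1..m} \<Longrightarrow> vector_field (F i) (V i) X \<Longrightarrow> u (\<lambda>q. g q (dt q) (lift i X q)) = 0"
    and "i \<in> {1..m} \<Longrightarrow> vector_field (F i) (V i) X \<Longrightarrow> u (\<lambda>q. g q (lift i X q) (dt q)) = 0"
    and "i \<in> {1..m} \<Longrightarrow> k \<in> {1..m} \<Longrightarrow> i \<noteq> k \<Longrightarrow> vector_field (F i) (V i) X \<Longrightarrow> vector_field (F k) (V k) Y \<Longrightarrow>
      u (\<lambda>q. g q (lift i X q) (lift k Y q)) = 0"
proof -
  show "u (\<lambda>q. g q (dt q) (dt q)) = 0"
    by (rule const_on_box[OF V p u]) (rule g_dt_dt[OF box_points])
  show "u (\<lambda>q. g q (dt q) (lift i X q)) = 0" if "i \<in> {1..m}" "vector_field (F i) (V i) X"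
    by (rule const_on_box[OF V p u]) (rule g_dt_lift(1)[OF V _ that])
  show "u (\<lambda>q. g q (lift i X q) (dt q)) = 0" if "i \<in> {1..m}" "vector_field (F i) (V i) X"
    by (rule const_on_box[OF V p u]) (rule g_dt_lift(2)[OF V _ that])
  show "u (\<lambda>q. g q (lift i X q) (lift k Y q)) = 0"
    if "i \<in> {1..m}" "k \<in> {1..m}" "i \<noteq> k" "vector_field (F i) (V i) X" "vector_field (F k) (V k) Y"
    by (rule const_on_box[OF V p u]) (rule g_lift_other[OF V _ that])
qed

section \<open>The Levi-Civita connection of the warped product\<close>

text \<open>The logarithmic derivative of the warping function, known as the Hubble rate in
  cosmology.\<close>

definition hubble :: "nat \<Rightarrow> real \<Rightarrow> real" where
  "hubble i t = deriv (b i) t / b i t"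

lemma nabla_affine: "affine_manifold M nabla"
  using levi_civita_prod charted_prod unfolding levi_civita_def affine_manifold_def affine_manifold_axioms_def by blast

sublocale N: affine_manifold "product_space I m F" nabla by (rule nabla_affine)

context
  fixes V :: "nat \<Rightarrow> 'a set" and p :: "real \<times> (nat \<Rightarrow> 'a)"
  assumes V: "open_family V" and p: "p \<in> fiber_box V"
begin

lemma pM: "p \<in> points M" by (rule box_points[OF p])

lemma g_zero_left: "v \<in> tangent_space M p \<Longrightarrow> g p (\<lambda>f. 0) v = 0"
  by (rule PM.g_zero[OF pM])

lemma inner_dt_dt:
  "g p (nabla dt dt p) (dt p) = 0"
  "i \<in> {1..m} \<Longrightarrow> vector_field (F i) (V i) Z \<Longrightarrow> g p (nabla dt dt p) (lift i Z p) = 0"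
proof -
  note t = dt_vf[OF V] and tt = dt_tangent[OF pM]
  show "g p (nabla dt dt p) (dt p) = 0"
    using PM.koszul[OF levi_civita_prod t t t p] deriv_inner_zero(1)[OF V p tt] g_zero_left[OF tt]
    by (simp add: lie_dt_dt)
  show "g p (nabla dt dt p) (lift i Z p) = 0" if Z: "i \<in> {1..m}" "vector_field (F i) (V i) Z"
    using PM.koszul[OF levi_civita_prod t t lift_box_vf[OF V Z] p] deriv_inner_zero(1)[OF V p lift_tangent[OF V p Z]]
      deriv_inner_zero(2)[OF V p tt Z] g_zero_left[OF tt] g_zero_left[OF lift_tangent[OF V p Z]]
    by (simp add: lie_dt_dt lie_dt_lift[OF V p Z])
qed

text \<open>Brackets with the time field vanish. In the Koszul formula the derivative of b^2 is the
  only surviving term, and its factor 2 cancels against the one on the left.\<close>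

lemma inner_dt_lift:
  assumes i: "i \<in> {1..m}" and X: "vector_field (F i) (V i) X"
  shows "g p (nabla dt (lift i X) p) (dt p) = 0"
    and "vector_field (F i) (V i) Z \<Longrightarrow> g p (nabla dt (lift i X) p) (lift i Z p) =
      b i (fst p) * deriv (b i) (fst p) * gF i (snd p i) (X (snd p i)) (Z (snd p i))"
    and "k \<in> {1..m} \<Longrightarrow> k \<noteq> i \<Longrightarrow> vector_field (F k) (V k) T \<Longrightarrow> g p (nabla dt (lift i X) p) (lift k T p) = 0"
proof -
  interpret Fi: charted_space "F i" by (rule F_charted[OF i])
  note t = dt_vf[OF V] and tt = dt_tangent[OF pM] and lX = lift_box_vf[OF V i X] and tX = lift_tangent[OF V p i X]
  note z = deriv_inner_zero(1)[OF V p] deriv_inner_zero(2-3)[OF V p _ i X]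
  show "g p (nabla dt (lift i X) p) (dt p) = 0"
    using PM.koszul[OF levi_civita_prod t lX t p] z[OF tt] z[OF tX] g_zero_left[OF tt] g_zero_left[OF tX]
    by (simp add: lie_dt_dt lie_dt_lift[OF V p i X])
  show "g p (nabla dt (lift i X) p) (lift i Z p) =
      b i (fst p) * deriv (b i) (fst p) * gF i (snd p i) (X (snd p i)) (Z (snd p i))"
    if Z: "vector_field (F i) (V i) Z"
  proof -
    note lZ = lift_box_vf[OF V i Z] and tZ = lift_tangent[OF V p i Z]
    have "g p (lift i (lie_bracket (F i) X Z) p) (dt p) = 0"
      by (rule g_dt_lift(2)[OF V p i Fi.lie_bracket_field[OF X Z]])
    then show ?thesis
      using PM.koszul[OF levi_civita_prod t lX lZ p] deriv_lift_lift(1)[OF V p i X Z]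
        deriv_inner_zero(2)[OF V p tX i Z] deriv_inner_zero(2)[OF V p tZ i X] g_zero_left[OF tX] g_zero_left[OF tZ]
      by (simp add: lie_dt_lift[OF V p i X] lie_dt_lift[OF V p i Z] lie_lift_lift[OF V p i X Z])
  qed
  show "g p (nabla dt (lift i X) p) (lift k T p) = 0"
    if k: "k \<in> {1..m}" "k \<noteq> i" and T: "vector_field (F k) (V k) T"
  proof -
    note lT = lift_box_vf[OF V k(1) T] and tT = lift_tangent[OF V p k(1) T]
    show ?thesis
      using PM.koszul[OF levi_civita_prod t lX lT p] deriv_inner_zero(4)[OF V p tt i k(1) k(2)[symmetric] X T]
        deriv_inner_zero(2)[OF V p tX k(1) T] deriv_inner_zero(2)[OF V p tT i X]
        g_zero_left[OF tX] g_zero_left[OF tT] g_zero_left[OF tt]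
      by (simp add: lie_dt_lift[OF V p i X] lie_dt_lift[OF V p k(1) T] lie_lift_other[OF V p i k(1) k(2)[symmetric] X T])
  qed
qed

text \<open>Against the time field, the Koszul formula leaves minus the time derivative of the inner
  product. Against a lift from the same fibre, b^2 factors out of every term and leaves the Koszul
  formula of the fibre.\<close>

lemma inner_lift_lift:
  assumes i: "i \<in> {1..m}" and X: "vector_field (F i) (V i) X" and Y: "vector_field (F i) (V i) Y"
  shows "g p (nabla (lift i X) (lift i Y) p) (dt p) =
      - (b i (fst p) * deriv (b i) (fst p) * gF i (snd p i) (X (snd p i)) (Y (snd p i)))"
    and "vector_field (F i) (V i) Z \<Longrightarrow> g p (nabla (lift i X) (lift i Y) p) (lift i Z p) =
      (b i (fst p))\<^sup>2 * gF i (snd p i) (nablaF i X Y (snd p i)) (Z (snd p i))"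
    and "k \<in> {1..m} \<Longrightarrow> k \<noteq> i \<Longrightarrow> vector_field (F k) (V k) T \<Longrightarrow>
      g p (nabla (lift i X) (lift i Y) p) (lift k T p) = 0"
proof -
  interpret Fi: metric_manifold "F i" "gF i" by (rule fiber_metric[OF i])
  note t = dt_vf[OF V]
  note lX = lift_box_vf[OF V i X] and tX = lift_tangent[OF V p i X]
  note lY = lift_box_vf[OF V i Y] and tY = lift_tangent[OF V p i Y]
  note XY = Fi.lie_bracket_field[OF X Y]
  show "g p (nabla (lift i X) (lift i Y) p) (dt p) =
      - (b i (fst p) * deriv (b i) (fst p) * gF i (snd p i) (X (snd p i)) (Y (snd p i)))"
    using PM.koszul[OF levi_civita_prod lX lY t p] deriv_lift_lift(1)[OF V p i X Y]
      deriv_inner_zero(3)[OF V p tX i Y] deriv_inner_zero(3)[OF V p tY i X] g_zero_left[OF tX] g_zero_left[OF tY]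
      g_dt_lift(2)[OF V p i XY]
    by (simp add: lie_dt_lift[OF V p i X] lie_dt_lift[OF V p i Y] lie_lift_lift[OF V p i X Y])
  show "g p (nabla (lift i X) (lift i Y) p) (lift i Z p) =
      (b i (fst p))\<^sup>2 * gF i (snd p i) (nablaF i X Y (snd p i)) (Z (snd p i))"
    if Z: "vector_field (F i) (V i) Z"
  proof -
    note lZ = lift_box_vf[OF V i Z]
    note XZ = Fi.lie_bracket_field[OF X Z] and YZ = Fi.lie_bracket_field[OF Y Z]
    have "2 * g p (nabla (lift i X) (lift i Y) p) (lift i Z p) =
      (b i (fst p))\<^sup>2 * (2 * gF i (snd p i) (nablaF i X Y (snd p i)) (Z (snd p i)))"
      unfolding PM.koszul[OF levi_civita_prod lX lY lZ p]
        Fi.koszul[OF levi_civita_fiber[OF i] X Y Z box_component[OF p i]]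
        lie_lift_lift[OF V p i X Y] lie_lift_lift[OF V p i X Z] lie_lift_lift[OF V p i Y Z]
        deriv_lift_lift(2)[OF V p i X Y Z] deriv_lift_lift(2)[OF V p i X Z Y] deriv_lift_lift(2)[OF V p i Y Z X]
        g_lift_lift[OF V p i XY Z] g_lift_lift[OF V p i XZ Y] g_lift_lift[OF V p i YZ X]
      by (simp add: algebra_simps)
    then show ?thesis by simp
  qed
  show "g p (nabla (lift i X) (lift i Y) p) (lift k T p) = 0"
    if k: "k \<in> {1..m}" "k \<noteq> i" and T: "vector_field (F k) (V k) T"
  proof -
    note lT = lift_box_vf[OF V k(1) T]
    note ik = k(2)[symmetric]
    show ?thesis
      using PM.koszul[OF levi_civita_prod lX lY lT p] deriv_inner_zero(4)[OF V p tX i k(1) ik Y T]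
        deriv_inner_zero(4)[OF V p tY i k(1) ik X T] deriv_lift_lift(3)[OF V p i X Y k T]
        g_lift_other[OF V p i k(1) ik XY T] g_zero_left[OF tX] g_zero_left[OF tY]
      by (simp add: lie_lift_lift[OF V p i X Y] lie_lift_other[OF V p i k(1) ik X T] lie_lift_other[OF V p i k(1) ik Y T])
  qed
qed

text \<open>Fields from different fibres are orthogonal and commute. If the third field comes from
  one of the two fibres, the remaining inner product is that of two lifts from one fibre and is
  constant along the other.\<close>

lemma inner_lift_other:
  assumes i: "i \<in> {1..m}" and k: "k \<in> {1..m}" and ik: "i \<noteq> k"
    and X: "vector_field (F i) (V i) X" and Y: "vector_field (F k) (V k) Y"
  shows "g p (nabla (lift i X) (lift k Y) p) (dt p) = 0"
    and "r \<in> {1..m} \<Longrightarrow> vector_field (F r) (V r) Z \<Longrightarrow> g p (nabla (lift i X) (lift k Y) p) (lift r Z p) = 0"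
proof -
  note t = dt_vf[OF V] and tt = dt_tangent[OF pM] and ki = ik[symmetric]
  note lX = lift_box_vf[OF V i X] and tX = lift_tangent[OF V p i X]
  note lY = lift_box_vf[OF V k Y] and tY = lift_tangent[OF V p k Y]
  note z = g_zero_left[OF tX] g_zero_left[OF tY] g_zero_left[OF tt]
  show "g p (nabla (lift i X) (lift k Y) p) (dt p) = 0"
    using PM.koszul[OF levi_civita_prod lX lY t p] deriv_inner_zero(4)[OF V p tt i k ik X Y]
      deriv_inner_zero(3)[OF V p tX k Y] deriv_inner_zero(3)[OF V p tY i X] z
    by (simp add: lie_dt_lift[OF V p i X] lie_dt_lift[OF V p k Y] lie_lift_other[OF V p i k ik X Y])
  show "g p (nabla (lift i X) (lift k Y) p) (lift r Z p) = 0"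
    if r: "r \<in> {1..m}" and Z: "vector_field (F r) (V r) Z"
  proof -
    note lZ = lift_box_vf[OF V r Z] and tZ = lift_tangent[OF V p r Z]
    note K = PM.koszul[OF levi_civita_prod lX lY lZ p] deriv_inner_zero(4)[OF V p tZ i k ik X Y] z g_zero_left[OF tZ]
    consider "r = i" | "r = k" | "r \<noteq> i" "r \<noteq> k" by blast
    then show ?thesis
    proof cases
      case 1
      note Z' = Z[unfolded 1]
      note XZ = charted_space.lie_bracket_field[OF F_charted[OF i] X Z']
      show ?thesis
        using K deriv_inner_zero(4)[OF V p tX k i ki Y Z'] deriv_lift_lift(3)[OF V p i X Z' k ki Y]
          g_lift_other[OF V p i k ik XZ Y]
        by (simp add: 1 lie_lift_other[OF V p i k ik X Y] lie_lift_lift[OF V p i X Z'] lie_lift_other[OF V p k i ki Y Z'])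
    next
      case 2
      note Z' = Z[unfolded 2]
      note YZ = charted_space.lie_bracket_field[OF F_charted[OF k] Y Z']
      show ?thesis
        using K deriv_inner_zero(4)[OF V p tY i k ik X Z'] deriv_lift_lift(3)[OF V p k Y Z' i ik X]
          g_lift_other[OF V p k i ki YZ X]
        by (simp add: 2 lie_lift_other[OF V p i k ik X Y] lie_lift_lift[OF V p k Y Z'] lie_lift_other[OF V p i k ik X Z'])
    next
      case 3
      show ?thesis
        using K deriv_inner_zero(4)[OF V p tX k r 3(2)[symmetric] Y Z] deriv_inner_zero(4)[OF V p tY i r 3(1)[symmetric] X Z]
        by (simp add: lie_lift_other[OF V p i k ik X Y] lie_lift_other[OF V p i r 3(1)[symmetric] X Z]
            lie_lift_other[OF V p k r 3(2)[symmetric] Y Z])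
    qed
  qed
qed

end

lemma fiber_vf_subset:
  assumes "vector_field (F i) (V i) X" "open_family V'" "i \<in> {1..m}" "\<And>i. i \<in> {1..m} \<Longrightarrow> V' i \<subseteq> V i"
  shows "vector_field (F i) (V' i) X"
  using charted_space.vf_subset[OF F_charted[OF assms(3)] assms(1)] assms(2-4) by (auto simp: open_family_def)

context
  fixes V :: "nat \<Rightarrow> 'a set" and p :: "real \<times> (nat \<Rightarrow> 'a)"
  assumes V: "open_family V" and p: "p \<in> fiber_box V"
begin

lemma nabla_dt_dt: "nabla dt dt p = (\<lambda>f. 0)"
proof (rule warped_eqI[OF V p P.vf_tangent[OF N.D_field[OF dt_vf[OF V] dt_vf[OF V]] p] P.tangent_space_zero])
  show "g p (nabla dt dt p) (dt p) = g p (\<lambda>f. 0) (dt p)"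
    using inner_dt_dt(1)[OF V p] g_zero_left[OF V p dt_tangent[OF box_points[OF p]]] by simp
  fix V' i Z assume V': "open_family V'" "p \<in> fiber_box V'" and Z: "i \<in> {1..m}" "vector_field (F i) (V' i) Z"
  show "g p (nabla dt dt p) (lift i Z p) = g p (\<lambda>f. 0) (lift i Z p)"
    using inner_dt_dt(2)[OF V' Z] g_zero_left[OF V' lift_tangent[OF V' Z]] by simp
qed

lemma nabla_dt_lift:
  assumes i: "i \<in> {1..m}" and X: "vector_field (F i) (V i) X"
  shows "nabla dt (lift i X) p = (\<lambda>f. hubble i (fst p) * lift i X p f)"
proof -
  note pM = box_points[OF p]
  have bn: "b i (fst p) \<noteq> 0" using b_pos[OF i time_points[OF pM]] by simp
  note tX = lift_tangent[OF V p i X]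
  show ?thesis
  proof (rule warped_eqI[OF V p P.vf_tangent[OF N.D_field[OF dt_vf[OF V] lift_box_vf[OF V i X]] p]
        P.tangent_space_scale[OF tX]])
    show "g p (nabla dt (lift i X) p) (dt p) = g p (\<lambda>f. hubble i (fst p) * lift i X p f) (dt p)"
      unfolding PM.g_scale[OF pM tX dt_tangent[OF pM]]
      using inner_dt_lift(1)[OF V p i X] g_dt_lift(2)[OF V p i X] by simp
    fix V' k Z assume V': "open_family V'" "p \<in> fiber_box V'" and sub: "\<And>i. i \<in> {1..m} \<Longrightarrow> V' i \<subseteq> V i"
      and k: "k \<in> {1..m}" and Z: "vector_field (F k) (V' k) Z"
    note X' = fiber_vf_subset[where V = V, OF X V'(1) i sub]
    show "g p (nabla dt (lift i X) p) (lift k Z p) = g p (\<lambda>f. hubble i (fst p) * lift i X p f) (lift k Z p)"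
      unfolding PM.g_scale[OF pM tX lift_tangent[OF V' k Z]]
    proof (cases "k = i")
      case True
      note Z' = Z[unfolded True]
      show "g p (nabla dt (lift i X) p) (lift k Z p) = hubble i (fst p) * g p (lift i X p) (lift k Z p)"
        using inner_dt_lift(2)[OF V' i X' Z'] g_lift_lift[OF V' i X' Z'] bn True
        by (simp add: hubble_def power2_eq_square)
    next
      case False
      show "g p (nabla dt (lift i X) p) (lift k Z p) = hubble i (fst p) * g p (lift i X p) (lift k Z p)"
        using inner_dt_lift(3)[OF V' i X' k False Z] g_lift_other[OF V' i k False[symmetric] X' Z] by simp
    qed
  qed
qed

text \<open>The bracket of the time field with a lift vanishes, so by vanishing torsion the two
  arguments may be exchanged.\<close>

lemma nabla_lift_dt:
  assumes i: "i \<in> {1..m}" and X: "vector_field (F i) (V i) X"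
  shows "nabla (lift i X) dt p = (\<lambda>f. hubble i (fst p) * lift i X p f)"
proof
  fix f
  have "\<forall>W X Y. vector_field M W X \<and> vector_field M W Y \<longrightarrow>
      (\<forall>p\<in>W. \<forall>f. nabla X Y p f - nabla Y X p f = lie_bracket M X Y p f)"
    using levi_civita_prod unfolding levi_civita_def by (elim conjE)
  from this[rule_format, OF conjI[OF dt_vf[OF V] lift_box_vf[OF V i X]] p]
  have "nabla dt (lift i X) p f - nabla (lift i X) dt p f = lie_bracket M dt (lift i X) p f" .
  then show "nabla (lift i X) dt p f = hubble i (fst p) * lift i X p f"
    by (simp add: nabla_dt_lift[OF i X] lie_dt_lift[OF V p i X])
qed

text \<open>The inner product with the time field is negative, and so is the norm of the time field;
  the coefficient of \<open>dt\<close> is therefore positive in b b' times the fibre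
  product.\<close>

lemma nabla_lift_lift:
  assumes i: "i \<in> {1..m}" and X: "vector_field (F i) (V i) X" and Y: "vector_field (F i) (V i) Y"
  shows "nabla (lift i X) (lift i Y) p = (\<lambda>f. lift i (nablaF i X Y) p f +
    (b i (fst p) * deriv (b i) (fst p) * gF i (snd p i) (X (snd p i)) (Y (snd p i))) * dt p f)"
proof -
  interpret Fi: affine_manifold "F i" "nablaF i" by (rule fiber_affine[OF i])
  note pM = box_points[OF p]
  note XY = Fi.D_field[OF X Y]
  note tXY = lift_tangent[OF V p i XY] and tt = dt_tangent[OF pM]
  let ?c = "b i (fst p) * deriv (b i) (fst p) * gF i (snd p i) (X (snd p i)) (Y (snd p i))"
  have split: "g p (\<lambda>f. lift i (nablaF i X Y) p f + ?c * dt p f) v = g p (lift i (nablaF i X Y) p) v + ?c * g p (dt p) v"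
    if v: "v \<in> tangent_space M p" for v
    unfolding PM.g_add[OF pM tXY v P.tangent_space_scale[OF tt]] PM.g_scale[OF pM tt v] ..
  show ?thesis
  proof (rule warped_eqI[OF V p P.vf_tangent[OF N.D_field[OF lift_box_vf[OF V i X] lift_box_vf[OF V i Y]] p]
        P.tangent_space_add[OF tXY P.tangent_space_scale[OF tt]]])
    show "g p (nabla (lift i X) (lift i Y) p) (dt p) = g p (\<lambda>f. lift i (nablaF i X Y) p f + ?c * dt p f) (dt p)"
      unfolding split[OF tt]
      using inner_lift_lift(1)[OF V p i X Y] g_dt_lift(2)[OF V p i XY] g_dt_dt[OF pM] by simp
    fix V' k Z assume V': "open_family V'" "p \<in> fiber_box V'" and sub: "\<And>i. i \<in> {1..m} \<Longrightarrow> V' i \<subseteq> V i"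
      and k: "k \<in> {1..m}" and Z: "vector_field (F k) (V' k) Z"
    note X' = fiber_vf_subset[where V = V, OF X V'(1) i sub] and Y' = fiber_vf_subset[where V = V, OF Y V'(1) i sub]
    note XY' = Fi.D_field[OF X' Y']
    show "g p (nabla (lift i X) (lift i Y) p) (lift k Z p) =
        g p (\<lambda>f. lift i (nablaF i X Y) p f + ?c * dt p f) (lift k Z p)"
      unfolding split[OF lift_tangent[OF V' k Z]] g_dt_lift(1)[OF V' k Z]
    proof (cases "k = i")
      case True
      note Z' = Z[unfolded True]
      show "g p (nabla (lift i X) (lift i Y) p) (lift k Z p) = g p (lift i (nablaF i X Y) p) (lift k Z p) + ?c * 0"
        using inner_lift_lift(2)[OF V' i X' Y' Z'] g_lift_lift[OF V' i XY' Z'] True by simp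
    next
      case False
      show "g p (nabla (lift i X) (lift i Y) p) (lift k Z p) = g p (lift i (nablaF i X Y) p) (lift k Z p) + ?c * 0"
        using inner_lift_lift(3)[OF V' i X' Y' k False Z] g_lift_other[OF V' i k False[symmetric] XY' Z] by simp
    qed
  qed
qed

lemma nabla_lift_other:
  assumes i: "i \<in> {1..m}" and k: "k \<in> {1..m}" and ik: "i \<noteq> k"
    and X: "vector_field (F i) (V i) X" and Y: "vector_field (F k) (V k) Y"
  shows "nabla (lift i X) (lift k Y) p = (\<lambda>f. 0)"
proof (rule warped_eqI[OF V p P.vf_tangent[OF N.D_field[OF lift_box_vf[OF V i X] lift_box_vf[OF V k Y]] p]
      P.tangent_space_zero])
  show "g p (nabla (lift i X) (lift k Y) p) (dt p) = g p (\<lambda>f. 0) (dt p)"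
    using inner_lift_other(1)[OF V p i k ik X Y] g_zero_left[OF V p dt_tangent[OF box_points[OF p]]] by simp
  fix V' r Z assume V': "open_family V'" "p \<in> fiber_box V'" and sub: "\<And>i. i \<in> {1..m} \<Longrightarrow> V' i \<subseteq> V i"
    and r: "r \<in> {1..m}" and Z: "vector_field (F r) (V' r) Z"
  note X' = fiber_vf_subset[where V = V, OF X V'(1) i sub] and Y' = fiber_vf_subset[where V = V, OF Y V'(1) k sub]
  show "g p (nabla (lift i X) (lift k Y) p) (lift r Z p) = g p (\<lambda>f. 0) (lift r Z p)"
    using inner_lift_other(2)[OF V' i k ik X' Y' r Z] g_zero_left[OF V' lift_tangent[OF V' r Z]] by simp
qed

end

section \<open>The quarter-symmetric connection on the time field and on lifts\<close>

abbreviation "Dbar \<equiv> quarter_symmetric g dt lam1 lam2 nabla"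

lemma Dbar_connection: "framed_connection M g Dbar"
proof -
  have "affine_connection M Dbar"
    by (rule PM.quarter_symmetric_affine[OF N.affine time_field_vf])
  then show ?thesis
    using framed_prod charted_prod by (simp add: framed_connection_def affine_manifold_def affine_manifold_axioms_def)
qed

sublocale Q: framed_connection "product_space I m F" "warped_metric I m F gF b"
  "quarter_symmetric (warped_metric I m F gF b) (time_field I m F) lam1 lam2 nabla"
  by (rule Dbar_connection)

text \<open>The factor by which \<open>Dbar\<close> multiplies a lift when the time field is
  differentiated along it. The form \<pi> takes the value -1 on the time field, whence the minus
  sign before \<open>lam1\<close>.\<close>

definition radial :: "nat \<Rightarrow> real \<Rightarrow> real" where
  "radial i t = hubble i t - lam1"

text \<open>The coefficient of \<open>dt\<close> in \<open>Dbar\<close> of two lifts from one fibre,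
  relative to the fibre metric: b b' comes from the Levi-Civita connection and -lam2 b^2 from the
  term with \<open>P\<close>.\<close>

definition second_form :: "nat \<Rightarrow> real \<Rightarrow> real" where
  "second_form i t = b i t * deriv (b i) t - lam2 * (b i t)\<^sup>2"

context
  fixes V :: "nat \<Rightarrow> 'a set" and p :: "real \<times> (nat \<Rightarrow> 'a)"
  assumes V: "open_family V" and p: "p \<in> fiber_box V"
begin

text \<open>Integral curves of the time field are geodesics of the Levi-Civita connection; both
  terms come from the correction, with signs reversed by the norm -1.\<close>

lemma Dbar_dt_dt: "Dbar dt dt p = (\<lambda>f. (lam2 - lam1) * dt p f)"
  by (rule ext) (simp add: quarter_symmetric_def nabla_dt_dt[OF V p] g_dt_dt[OF box_points[OF p]] algebra_simps)

lemma Dbar_dt_lift: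
  "i \<in> {1..m} \<Longrightarrow> vector_field (F i) (V i) X \<Longrightarrow> Dbar dt (lift i X) p = (\<lambda>f. hubble i (fst p) * lift i X p f)"
  by (rule ext) (simp add: quarter_symmetric_def nabla_dt_lift[OF V p] g_dt_lift[OF V p])

lemma Dbar_lift_dt:
  "i \<in> {1..m} \<Longrightarrow> vector_field (F i) (V i) X \<Longrightarrow> Dbar (lift i X) dt p = (\<lambda>f. radial i (fst p) * lift i X p f)"
  by (rule ext) (simp add: quarter_symmetric_def nabla_lift_dt[OF V p] g_dt_lift[OF V p] g_dt_dt[OF box_points[OF p]]
      radial_def algebra_simps)

lemma Dbar_lift_lift:
  "i \<in> {1..m} \<Longrightarrow> vector_field (F i) (V i) X \<Longrightarrow> vector_field (F i) (V i) Y \<Longrightarrow>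
    Dbar (lift i X) (lift i Y) p = (\<lambda>f. lift i (nablaF i X Y) p f +
      (second_form i (fst p) * gF i (snd p i) (X (snd p i)) (Y (snd p i))) * dt p f)"
  by (rule ext) (simp add: quarter_symmetric_def nabla_lift_lift[OF V p] g_dt_lift[OF V p] g_lift_lift[OF V p]
      second_form_def algebra_simps)

lemma Dbar_lift_other:
  "i \<in> {1..m} \<Longrightarrow> k \<in> {1..m} \<Longrightarrow> i \<noteq> k \<Longrightarrow> vector_field (F i) (V i) X \<Longrightarrow> vector_field (F k) (V k) Y \<Longrightarrow>
    Dbar (lift i X) (lift k Y) p = (\<lambda>f. 0)"
  by (rule ext) (simp add: quarter_symmetric_def nabla_lift_other[OF V p] g_dt_lift[OF V p] g_lift_other[OF V p])

end

lemma hubble_time: "i \<in> {1..m} \<Longrightarrow> smooth_on M (points M) (\<lambda>q. hubble i (fst q))"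
  unfolding hubble_def using b_pos[OF _ time_points] by (intro P.smooth_on_divide b_time b'_time) (auto simp: less_le)

lemma radial_time: "i \<in> {1..m} \<Longrightarrow> smooth_on M (points M) (\<lambda>q. radial i (fst q))"
  unfolding radial_def by (intro P.smooth_on_diff hubble_time P.smooth_on_const openin_points)

lemma second_form_time: "i \<in> {1..m} \<Longrightarrow> smooth_on M (points M) (\<lambda>q. second_form i (fst q))"
  unfolding second_form_def by (intro P.smooth_on_diff P.smooth_on_mult P.smooth_on_cmult b_time b'_time b_sq_time)

lemma radial_deriv:
  assumes "i \<in> {1..m}" "p \<in> points M"
  shows "dt p (\<lambda>q. radial i (fst q)) = deriv (deriv (b i)) (fst p) / b i (fst p) - (hubble i (fst p))\<^sup>2"
proof (rule dt_fun[OF radial_time[OF assms(1)] _ assms(2)])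
  note t = time_points[OF assms(2)]
  have bn: "b i (fst p) \<noteq> 0" using b_pos[OF assms(1) t] by simp
  have "((\<lambda>t. deriv (b i) t / b i t - lam1) has_real_derivative
      (deriv (deriv (b i)) (fst p) * b i (fst p) - deriv (b i) (fst p) * deriv (b i) (fst p)) /
        (b i (fst p) * b i (fst p)) - 0) (at (fst p))"
    by (intro DERIV_diff DERIV_divide b_deriv b_deriv2 assms(1) t bn DERIV_const)
  moreover have "(deriv (deriv (b i)) (fst p) * b i (fst p) - deriv (b i) (fst p) * deriv (b i) (fst p)) /
        (b i (fst p) * b i (fst p)) - 0 = deriv (deriv (b i)) (fst p) / b i (fst p) - (hubble i (fst p))\<^sup>2"
    using bn by (simp add: hubble_def power2_eq_square divide_simps)
  ultimately show "(radial i has_real_derivative deriv (deriv (b i)) (fst p) / b i (fst p) - (hubble i (fst p))\<^sup>2) (at (fst p))"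
    unfolding radial_def[abs_def] hubble_def[abs_def] by simp
qed

lemma second_form_deriv:
  assumes "i \<in> {1..m}" "p \<in> points M"
  shows "dt p (\<lambda>q. second_form i (fst q)) = (deriv (b i) (fst p))\<^sup>2 + b i (fst p) * deriv (deriv (b i)) (fst p)
    - 2 * lam2 * b i (fst p) * deriv (b i) (fst p)"
proof (rule dt_fun[OF second_form_time[OF assms(1)] _ assms(2)])
  note t = time_points[OF assms(2)]
  note d = b_deriv[OF assms(1) t] and d2 = b_deriv2[OF assms(1) t]
  have "((\<lambda>t. b i t * deriv (b i) t - lam2 * (b i t * b i t)) has_real_derivative
      (deriv (b i) (fst p) * deriv (b i) (fst p) + deriv (deriv (b i)) (fst p) * b i (fst p)) -
      lam2 * (deriv (b i) (fst p) * b i (fst p) + deriv (b i) (fst p) * b i (fst p))) (at (fst p))"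
    by (rule DERIV_diff[OF DERIV_mult[OF d d2] DERIV_cmult[OF DERIV_mult[OF d d]]])
  moreover have "(\<lambda>t. b i t * deriv (b i) t - lam2 * (b i t * b i t)) = second_form i"
    by (rule ext) (simp add: second_form_def power2_eq_square)
  ultimately show "(second_form i has_real_derivative (deriv (b i) (fst p))\<^sup>2 + b i (fst p) * deriv (deriv (b i)) (fst p)
    - 2 * lam2 * b i (fst p) * deriv (b i) (fst p)) (at (fst p))"
    by (simp add: power2_eq_square algebra_simps)
qed

end

section \<open>Curvature and Ricci tensor\<close>

context warped_connection
begin

abbreviation "RF i \<equiv> curvature (F i) (nablaF i)"

text \<open>The eigenvalue of X \<mapsto> R(dt, X) dt on lifts from the \<open>i\<close>-th fibre;
  it is the negative of the summand in parentheses in condition (2).\<close>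

definition radial_curv :: "nat \<Rightarrow> real \<Rightarrow> real" where
  "radial_curv i t = deriv (deriv (b i)) t / b i t - lam2 * hubble i t + lam1 * lam2 - lam1\<^sup>2"

text \<open>The coefficient of \<open>dt\<close> in R(X, dt) Y for two lifts from the
  \<open>i\<close>-th fibre, relative to the fibre metric.\<close>

definition time_curv :: "nat \<Rightarrow> real \<Rightarrow> real" where
  "time_curv i t = - b i t * deriv (deriv (b i)) t + lam1 * b i t * deriv (b i) t
    + (lam2\<^sup>2 - lam1 * lam2) * (b i t)\<^sup>2"

context
  fixes V :: "nat \<Rightarrow> 'a set" and p :: "real \<times> (nat \<Rightarrow> 'a)"
  assumes V: "open_family V" and p: "p \<in> fiber_box V"
begin

text \<open>The bracket vanishes and lam2 - lam1 is constant, so what remains is the time derivative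
  of \<open>radial\<close>, plus \<open>radial\<close> times \<open>hubble\<close>, minus lam2 -
  lam1 times \<open>radial\<close>.\<close>

lemma curv_dt_lift_dt:
  assumes i: "i \<in> {1..m}" and X: "vector_field (F i) (V i) X"
  shows "Q.R dt (lift i X) dt p f = radial_curv i (fst p) * lift i X p f"
proof -
  note pM = box_points[OF p]
  note t = dt_vf[OF V] and lX = lift_box_vf[OF V i X]
  have 1: "Dbar dt (Dbar (lift i X) dt) p f = dt p (\<lambda>q. radial i (fst q)) * lift i X p f
      + radial i (fst p) * Dbar dt (lift i X) p f"
    by (rule Q.D_cong_scale_right[OF t Q.D_field[OF lX t] lX box_time_smooth[OF V radial_time[OF i]] p
          Dbar_lift_dt[OF V _ i X]])
  have 2: "Dbar (lift i X) (Dbar dt dt) p f = lift i X p (\<lambda>q. lam2 - lam1) * dt p f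
      + (lam2 - lam1) * Dbar (lift i X) dt p f"
    by (rule Q.D_cong_scale_right[OF lX Q.D_field[OF t t] t P.smooth_on_const[OF openin_box[OF V]] p Dbar_dt_dt[OF V]])
  have 3: "Dbar (lie_bracket M dt (lift i X)) dt p f = 0"
    by (rule Q.D_cong_zero_left[OF P.lie_bracket_field[OF t lX] t p lie_dt_lift(1)[OF V _ i X]])
  have "Q.R dt (lift i X) dt p f = (dt p (\<lambda>q. radial i (fst q)) + radial i (fst p) * hubble i (fst p)
      - (lam2 - lam1) * radial i (fst p)) * lift i X p f"
    unfolding curvature_def 1 2 3 Dbar_dt_lift[OF V p i X] Dbar_lift_dt[OF V p i X]
      P.tangent_const[OF lift_tangent[OF V p i X] pM] by (simp add: algebra_simps)
  also have "dt p (\<lambda>q. radial i (fst q)) + radial i (fst p) * hubble i (fst p)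
      - (lam2 - lam1) * radial i (fst p) = radial_curv i (fst p)"
    unfolding radial_deriv[OF i pM] by (simp add: radial_curv_def radial_def power2_eq_square algebra_simps)
  finally show ?thesis .
qed

lemma second_form_product_smooth:
  assumes i: "i \<in> {1..m}" and X: "vector_field (F i) (V i) X" and Y: "vector_field (F i) (V i) Y"
  shows "smooth_on M (fiber_box V) (\<lambda>q. second_form i (fst q) * gF i (snd q i) (X (snd q i)) (Y (snd q i)))"
  by (rule P.smooth_on_mult[OF box_time_smooth[OF V second_form_time[OF i]] fiber_product_smooth[OF V i X Y]])

text \<open>The lift of the fibre derivative of \<open>Y\<close> along \<open>X\<close> appears with
  factor \<open>hubble\<close> in both iterated derivatives and cancels. Only multiples of the time
  field survive.\<close>

lemma curv_lift_dt_lift: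
  assumes i: "i \<in> {1..m}" and X: "vector_field (F i) (V i) X" and Y: "vector_field (F i) (V i) Y"
  shows "Q.R (lift i X) dt (lift i Y) p f =
    time_curv i (fst p) * gF i (snd p i) (X (snd p i)) (Y (snd p i)) * dt p f"
proof -
  interpret Fi: affine_manifold "F i" "nablaF i" by (rule fiber_affine[OF i])
  note pM = box_points[OF p]
  have bn: "b i (fst p) \<noteq> 0" using b_pos[OF i time_points[OF pM]] by simp
  note t = dt_vf[OF V] and lX = lift_box_vf[OF V i X] and lY = lift_box_vf[OF V i Y]
  note XY = Fi.D_field[OF X Y]
  let ?G = "gF i (snd p i) (X (snd p i)) (Y (snd p i))"
  let ?\<psi> = "\<lambda>q. second_form i (fst q) * gF i (snd q i) (X (snd q i)) (Y (snd q i))"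
  have 1: "Dbar (lift i X) (Dbar dt (lift i Y)) p f = lift i X p (\<lambda>q. hubble i (fst q)) * lift i Y p f
      + hubble i (fst p) * Dbar (lift i X) (lift i Y) p f"
    by (rule Q.D_cong_scale_right[OF lX Q.D_field[OF t lY] lY box_time_smooth[OF V hubble_time[OF i]] p
          Dbar_dt_lift[OF V _ i Y]])
  have 2: "Dbar dt (Dbar (lift i X) (lift i Y)) p f = Dbar dt (lift i (nablaF i X Y)) p f
      + dt p ?\<psi> * dt p f + ?\<psi> p * Dbar dt dt p f"
    by (rule Q.D_cong_add_scale_right[OF t Q.D_field[OF lX lY] lift_box_vf[OF V i XY] t
          second_form_product_smooth[OF i X Y] p Dbar_lift_lift[OF V _ i X Y]])
  have 3: "Dbar (lie_bracket M (lift i X) dt) (lift i Y) p f = 0"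
    by (rule Q.D_cong_zero_left[OF P.lie_bracket_field[OF lX t] lY p lie_dt_lift(2)[OF V _ i X]])
  have d: "dt p ?\<psi> = dt p (\<lambda>q. second_form i (fst q)) * ?G"
    by (rule separated_product(1)[OF V p i second_form_time[OF i] fiber_product_smooth_near[OF p i X Y]])
  have z: "lift i X p (\<lambda>q. hubble i (fst q)) = 0"
    by (rule lift_time[where X = X, OF i pM fiber_tangent[OF p i X]])
  have "Q.R (lift i X) dt (lift i Y) p f = (hubble i (fst p) * second_form i (fst p)
      - dt p (\<lambda>q. second_form i (fst q)) - (lam2 - lam1) * second_form i (fst p)) * ?G * dt p f"
    unfolding curvature_def 1 2 3 d z Dbar_dt_lift[OF V p i XY] Dbar_lift_lift[OF V p i X Y] Dbar_dt_dt[OF V p]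
    by (simp add: algebra_simps)
  also have "hubble i (fst p) * second_form i (fst p)
      - dt p (\<lambda>q. second_form i (fst q)) - (lam2 - lam1) * second_form i (fst p) = time_curv i (fst p)"
    unfolding second_form_deriv[OF i pM] using bn
    by (simp add: time_curv_def second_form_def hubble_def power2_eq_square algebra_simps)
  finally show ?thesis .
qed

lemma curv_lift_dt_other:
  assumes i: "i \<in> {1..m}" and k: "k \<in> {1..m}" and ik: "i \<noteq> k"
    and X: "vector_field (F i) (V i) X" and Y: "vector_field (F k) (V k) Y"
  shows "Q.R (lift i X) dt (lift k Y) p f = 0"
proof -
  note t = dt_vf[OF V] and lX = lift_box_vf[OF V i X] and lY = lift_box_vf[OF V k Y]
  have 1: "Dbar (lift i X) (Dbar dt (lift k Y)) p f = lift i X p (\<lambda>q. hubble k (fst q)) * lift k Y p f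
      + hubble k (fst p) * Dbar (lift i X) (lift k Y) p f"
    by (rule Q.D_cong_scale_right[OF lX Q.D_field[OF t lY] lY box_time_smooth[OF V hubble_time[OF k]] p
          Dbar_dt_lift[OF V _ k Y]])
  have 2: "Dbar dt (Dbar (lift i X) (lift k Y)) p f = 0"
    by (rule Q.D_cong_zero_right[OF t Q.D_field[OF lX lY] p Dbar_lift_other[OF V _ i k ik X Y]])
  have 3: "Dbar (lie_bracket M (lift i X) dt) (lift k Y) p f = 0"
    by (rule Q.D_cong_zero_left[OF P.lie_bracket_field[OF lX t] lY p lie_dt_lift(2)[OF V _ i X]])
  have z: "lift i X p (\<lambda>q. hubble k (fst q)) = 0"
    by (rule lift_time[where X = X, OF i box_points[OF p] fiber_tangent[OF p i X]])
  show ?thesis unfolding curvature_def 1 2 3 z Dbar_lift_other[OF V p i k ik X Y] by simp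
qed

lemma torsion_fiber:
  assumes i: "i \<in> {1..m}" and X: "vector_field (F i) (V i) X" and Y: "vector_field (F i) (V i) Y"
  shows "lift i (nablaF i X Y) p f - lift i (nablaF i Y X) p f = lift i (lie_bracket (F i) X Y) p f"
proof -
  have "\<forall>W X Y. vector_field (F i) W X \<and> vector_field (F i) W Y \<longrightarrow>
      (\<forall>p\<in>W. \<forall>f. nablaF i X Y p f - nablaF i Y X p f = lie_bracket (F i) X Y p f)"
    using levi_civita_fiber[OF i] unfolding levi_civita_def by (elim conjE)
  from this[rule_format, OF conjI[OF X Y] box_component[OF p i]]
  show ?thesis unfolding lift_def by simp
qed

text \<open>For one fibre, \<open>radial\<close> multiplies the torsion of the fibre connection,
  which vanishes, and the time components cancel by symmetry of the fibre metric. For two fibres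
  every term is zero.\<close>

lemma curv_lift_lift_dt:
  assumes i: "i \<in> {1..m}" and k: "k \<in> {1..m}" and X: "vector_field (F i) (V i) X" and E: "vector_field (F k) (V k) E"
  shows "Q.R (lift i X) (lift k E) dt p f = 0"
proof -
  note pM = box_points[OF p]
  note t = dt_vf[OF V]
  have 1: "Dbar (lift i X) (Dbar (lift k E) dt) p f = radial k (fst p) * Dbar (lift i X) (lift k E) p f"
    if i: "i \<in> {1..m}" and k: "k \<in> {1..m}" and X: "vector_field (F i) (V i) X" and E: "vector_field (F k) (V k) E" for i k X E
  proof -
    note lX = lift_box_vf[OF V i X] and lE = lift_box_vf[OF V k E]
    have "Dbar (lift i X) (Dbar (lift k E) dt) p f = lift i X p (\<lambda>q. radial k (fst q)) * lift k E p f
      + radial k (fst p) * Dbar (lift i X) (lift k E) p f"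
      by (rule Q.D_cong_scale_right[OF lX Q.D_field[OF lE t] lE box_time_smooth[OF V radial_time[OF k]] p
          Dbar_lift_dt[OF V _ k E]])
    then show ?thesis
      using lift_time[where X = X and h = "radial k", OF i pM fiber_tangent[OF p i X]] by simp
  qed
  show ?thesis
  proof (cases "i = k")
    case True
    note E' = E[folded True]
    interpret Fi: metric_manifold "F i" "gF i" by (rule fiber_metric[OF i])
    note XE = Fi.lie_bracket_field[OF X E']
    have "Dbar (lie_bracket M (lift i X) (lift i E)) dt p = Dbar (lift i (lie_bracket (F i) X E)) dt p"
      by (rule Q.D_cong[OF P.lie_bracket_field[OF lift_box_vf[OF V i X] lift_box_vf[OF V i E']] t p
            lie_lift_lift[OF V _ i X E'] refl])
    moreover have "gF i (snd p i) (E (snd p i)) (X (snd p i)) = gF i (snd p i) (X (snd p i)) (E (snd p i))"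
      by (rule Fi.g_sym[OF component_points[OF pM i] fiber_tangent[OF p i E'] fiber_tangent[OF p i X]])
    ultimately have "Q.R (lift i X) (lift i E) dt p f = radial i (fst p) *
        (lift i (nablaF i X E) p f - lift i (nablaF i E X) p f - lift i (lie_bracket (F i) X E) p f)"
      unfolding curvature_def 1[OF i i X E'] 1[OF i i E' X] Dbar_lift_lift[OF V p i X E'] Dbar_lift_lift[OF V p i E' X]
      by (simp add: Dbar_lift_dt[OF V p i XE] algebra_simps)
    then show ?thesis using torsion_fiber[OF i X E'] True by simp
  next
    case False
    have "Dbar (lie_bracket M (lift i X) (lift k E)) dt p f = 0"
      by (rule Q.D_cong_zero_left[OF P.lie_bracket_field[OF lift_box_vf[OF V i X] lift_box_vf[OF V k E]] t p
            lie_lift_other[OF V _ i k False X E]])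
    then show ?thesis
      unfolding curvature_def 1[OF i k X E] 1[OF k i E X] Dbar_lift_other[OF V p i k False X E]
        Dbar_lift_other[OF V p k i False[symmetric] E X] by simp
  qed
qed

text \<open>\<open>k\<close> may equal \<open>i\<close>, so that the formula serves both for
  curvature inside a fibre and for curvature between two fibres.\<close>

lemma Dbar_lift_Dbar:
  assumes i: "i \<in> {1..m}" and k: "k \<in> {1..m}" and E: "vector_field (F i) (V i) E" and Y: "vector_field (F i) (V i) Y"
    and X: "vector_field (F k) (V k) X"
  shows "Dbar (lift k X) (Dbar (lift i E) (lift i Y)) p f = Dbar (lift k X) (lift i (nablaF i E Y)) p f
    + lift k X p (\<lambda>q. second_form i (fst q) * gF i (snd q i) (E (snd q i)) (Y (snd q i))) * dt p f
    + second_form i (fst p) * gF i (snd p i) (E (snd p i)) (Y (snd p i)) * (radial k (fst p) * lift k X p f)"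
proof -
  interpret Fi: affine_manifold "F i" "nablaF i" by (rule fiber_affine[OF i])
  note lE = lift_box_vf[OF V i E] and lY = lift_box_vf[OF V i Y]
  show ?thesis
    using Q.D_cong_add_scale_right[OF lift_box_vf[OF V k X] Q.D_field[OF lE lY] lift_box_vf[OF V i Fi.D_field[OF E Y]] dt_vf[OF V]
          second_form_product_smooth[OF i E Y] p Dbar_lift_lift[OF V _ i E Y], of f]
    unfolding Dbar_lift_dt[OF V p k X] .
qed

text \<open>A Gauss equation: the fibre curvature is corrected by \<open>second_form\<close> times
  \<open>radial\<close>. The time component is left as an unspecified \<open>c\<close>, since it is
  orthogonal to every lift and does not enter the trace.\<close>

lemma curv_lift_lift_lift:
  assumes i: "i \<in> {1..m}" and X: "vector_field (F i) (V i) X" and E: "vector_field (F i) (V i) E"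
    and Y: "vector_field (F i) (V i) Y"
  obtains c where "Q.R (lift i X) (lift i E) (lift i Y) p = (\<lambda>f. lift i (RF i X E Y) p f +
    (second_form i (fst p) * radial i (fst p) *
      (gF i (snd p i) (E (snd p i)) (Y (snd p i)) * lift i X p f - gF i (snd p i) (X (snd p i)) (Y (snd p i)) * lift i E p f)
    + c * dt p f))"
proof -
  interpret Fi: affine_manifold "F i" "nablaF i" by (rule fiber_affine[OF i])
  note XE = Fi.lie_bracket_field[OF X E] and EY = Fi.D_field[OF E Y] and XY = Fi.D_field[OF X Y]
  let ?g = "\<lambda>A B. gF i (snd p i) (A (snd p i)) (B (snd p i))"
  let ?\<psi> = "\<lambda>A B q. second_form i (fst q) * gF i (snd q i) (A (snd q i)) (B (snd q i))"
  \<comment> \<open>The time components of the three terms of the curvature, collected without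
    simplification.\<close>
  define c where "c = ?\<psi> X (nablaF i E Y) p + lift i X p (?\<psi> E Y) - ?\<psi> E (nablaF i X Y) p - lift i E p (?\<psi> X Y)
    - ?\<psi> (lie_bracket (F i) X E) Y p"
  have br: "Dbar (lie_bracket M (lift i X) (lift i E)) (lift i Y) p = Dbar (lift i (lie_bracket (F i) X E)) (lift i Y) p"
    by (rule Q.D_cong[OF P.lie_bracket_field[OF lift_box_vf[OF V i X] lift_box_vf[OF V i E]] lift_box_vf[OF V i Y] p
          lie_lift_lift[OF V _ i X E] refl])
  have R: "lift i (RF i X E Y) p f = lift i (nablaF i X (nablaF i E Y)) p f - lift i (nablaF i E (nablaF i X Y)) p f
      - lift i (nablaF i (lie_bracket (F i) X E) Y) p f" for f
    by (simp add: lift_def curvature_def)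
  have "Q.R (lift i X) (lift i E) (lift i Y) p f = lift i (RF i X E Y) p f +
    (second_form i (fst p) * radial i (fst p) * (?g E Y * lift i X p f - ?g X Y * lift i E p f) + c * dt p f)" for f
    unfolding curvature_def[of M] br Dbar_lift_Dbar[OF i i E Y X] Dbar_lift_Dbar[OF i i X Y E]
      Dbar_lift_lift[OF V p i X EY] Dbar_lift_lift[OF V p i E XY] Dbar_lift_lift[OF V p i XE Y] R c_def
    by (simp add: algebra_simps)
  then show thesis by (intro that[of c] ext)
qed

text \<open>Only differentiating the time component of \<open>Dbar\<close> of \<open>X\<close> and
  \<open>Y\<close> along \<open>E\<close> contributes; its coefficient is constant along the other
  fibre, and the time field turns into \<open>radial k\<close> times \<open>E\<close>.\<close>

lemma curv_lift_other_lift: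
  assumes i: "i \<in> {1..m}" and k: "k \<in> {1..m}" and ik: "i \<noteq> k"
    and X: "vector_field (F i) (V i) X" and E: "vector_field (F k) (V k) E" and Y: "vector_field (F i) (V i) Y"
  shows "Q.R (lift i X) (lift k E) (lift i Y) p f =
    - (second_form i (fst p) * gF i (snd p i) (X (snd p i)) (Y (snd p i)) * radial k (fst p)) * lift k E p f"
proof -
  interpret Fi: affine_manifold "F i" "nablaF i" by (rule fiber_affine[OF i])
  note lX = lift_box_vf[OF V i X] and lY = lift_box_vf[OF V i Y] and lE = lift_box_vf[OF V k E]
  have 1: "Dbar (lift i X) (Dbar (lift k E) (lift i Y)) p f = 0"
    by (rule Q.D_cong_zero_right[OF lX Q.D_field[OF lE lY] p Dbar_lift_other[OF V _ k i ik[symmetric] E Y]])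
  have 3: "Dbar (lie_bracket M (lift i X) (lift k E)) (lift i Y) p f = 0"
    by (rule Q.D_cong_zero_left[OF P.lie_bracket_field[OF lX lE] lY p lie_lift_other[OF V _ i k ik X E]])
  have z: "lift k E p (\<lambda>q. second_form i (fst q) * gF i (snd q i) (X (snd q i)) (Y (snd q i))) = 0"
    by (rule separated_product(3)[OF V p i second_form_time[OF i] fiber_product_smooth_near[OF p i X Y] k ik[symmetric] E])
  show ?thesis
    unfolding curvature_def 1 3 Dbar_lift_Dbar[OF i k X Y E] z
      Dbar_lift_other[OF V p k i ik[symmetric] E Fi.D_field[OF X Y]] by simp
qed

lemma curv_lift_lift_other:
  assumes i: "i \<in> {1..m}" and k: "k \<in> {1..m}" and j: "j \<in> {1..m}" and ij: "i \<noteq> j" and kj: "k \<noteq> j"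
    and X: "vector_field (F i) (V i) X" and E: "vector_field (F k) (V k) E" and Y: "vector_field (F j) (V j) Y"
  shows "Q.R (lift i X) (lift k E) (lift j Y) p f = 0"
proof -
  note lX = lift_box_vf[OF V i X] and lY = lift_box_vf[OF V j Y] and lE = lift_box_vf[OF V k E]
  have 1: "Dbar (lift i X) (Dbar (lift k E) (lift j Y)) p f = 0"
    by (rule Q.D_cong_zero_right[OF lX Q.D_field[OF lE lY] p Dbar_lift_other[OF V _ k j kj E Y]])
  have 2: "Dbar (lift k E) (Dbar (lift i X) (lift j Y)) p f = 0"
    by (rule Q.D_cong_zero_right[OF lE Q.D_field[OF lX lY] p Dbar_lift_other[OF V _ i j ij X Y]])
  have 3: "Dbar (lie_bracket M (lift i X) (lift k E)) (lift j Y) p f = 0"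
  proof (cases "i = k")
    case True
    note E' = E[folded True]
    note XE = charted_space.lie_bracket_field[OF F_charted[OF i] X E']
    have "Dbar (lie_bracket M (lift i X) (lift i E)) (lift j Y) p = Dbar (lift i (lie_bracket (F i) X E)) (lift j Y) p"
      by (rule Q.D_cong[OF P.lie_bracket_field[OF lX lift_box_vf[OF V i E']] lY p lie_lift_lift[OF V _ i X E'] refl])
    then show ?thesis using Dbar_lift_other[OF V p i j ij XE Y] True by simp
  next
    case False
    show ?thesis
      by (rule Q.D_cong_zero_left[OF P.lie_bracket_field[OF lX lE] lY p lie_lift_other[OF V _ i k False X E]])
  qed
  show ?thesis unfolding curvature_def 1 2 3 by simp
qed

end

section \<open>Components of the Ricci tensor\<close>

abbreviation "ric \<equiv> ricci M g Dbar"
abbreviation "ricF i \<equiv> ricci (F i) (gF i) (nablaF i)"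

text \<open>The difference between the Ricci tensor of the product on the \<open>i\<close>-th fibre
  and that of the fibre, relative to the fibre metric. The three terms are the contributions to the
  trace of the time field, the other fibres and the fibre itself.\<close>

definition fiber_defect :: "nat \<Rightarrow> real \<Rightarrow> real" where
  "fiber_defect i t = time_curv i t - second_form i t * (\<Sum>s\<in>{1..m} - {i}. real (mdim (F s)) * radial s t)
    + (1 - real (mdim (F i))) * second_form i t * radial i t"

lemma fiber_connection: "i \<in> {1..m} \<Longrightarrow> framed_connection (F i) (gF i) (nablaF i)"
  using framed_fiber fiber_affine by (simp add: framed_connection_def affine_manifold_def)

context
  fixes V :: "nat \<Rightarrow> 'a set" and p :: "real \<times> (nat \<Rightarrow> 'a)" and E :: "nat \<Rightarrow> nat \<Rightarrow> 'a vfield"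
  assumes V: "open_family V" and p: "p \<in> fiber_box V"
    and E: "\<And>i. i \<in> {1..m} \<Longrightarrow> orthonormal_frame (F i) (gF i) (V i) (E i)"
begin

lemma frame_vf: "i \<in> {1..m} \<Longrightarrow> k < mdim (F i) \<Longrightarrow> vector_field (F i) (V i) (E i k)"
  using E unfolding orthonormal_frame_def by blast

lemma frame_lift_norm:
  assumes "i \<in> {1..m}" "k < mdim (F i)"
  shows "g p (lift i (E i k) p) (lift i (E i k) p) \<noteq> 0"
  using PM.frame_norm[OF product_frame[OF V E] _ p, of "Some (i, k)"] assms
  by (simp add: frame_idx_def frame_fields_def)

text \<open>The trace in the product frame, with the time direction split off; its minus sign is the
  norm of the time field.\<close>

lemma ric_expand:
  assumes "vector_field M (fiber_box V) A" "vector_field M (fiber_box V) B"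
  shows "ric A B p = - g p (Q.R A dt B p) (dt p) + (\<Sum>s\<in>{1..m}. \<Sum>k<mdim (F s).
    g p (Q.R A (lift s (E s k)) B p) (lift s (E s k) p) / g p (lift s (E s k) p) (lift s (E s k) p))"
proof -
  have "ric A B p = (\<Sum>a\<in>frame_idx. g p (Q.R A (frame_fields E a) B p) (frame_fields E a p) /
      g p (frame_fields E a p) (frame_fields E a p))"
    by (rule Q.ricci_frame[OF p assms product_frame[OF V E] p])
  then show ?thesis
    unfolding sum_frame_idx by (simp add: frame_fields_def g_dt_dt[OF box_points[OF p]])
qed

lemma curv_dt_dt: "vector_field M (fiber_box V) B \<Longrightarrow> Q.R dt dt B p = (\<lambda>f. 0)"
  using Q.R_antisym[OF dt_vf[OF V] dt_vf[OF V] _ p, of B] by (intro ext) (simp add: eq_neg_iff_add_eq_0)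

text \<open>Each frame vector is an eigenvector, so it contributes \<open>radial_curv\<close> of its
  fibre whatever its norm; the dimension counts these vectors.\<close>

lemma ric_dt_dt: "ric dt dt p = (\<Sum>i\<in>{1..m}. real (mdim (F i)) * radial_curv i (fst p))"
proof -
  note t = dt_vf[OF V] and pM = box_points[OF p]
  have "g p (Q.R dt (lift s (E s k)) dt p) (lift s (E s k) p) / g p (lift s (E s k) p) (lift s (E s k) p) =
     radial_curv s (fst p)" if s: "s \<in> {1..m}" and k: "k < mdim (F s)" for s k
  proof -
    have "Q.R dt (lift s (E s k)) dt p = (\<lambda>f. radial_curv s (fst p) * lift s (E s k) p f)"
      by (rule ext) (rule curv_dt_lift_dt[OF V p s frame_vf[OF s k]])
    then show ?thesis
      using PM.g_scale[OF pM lift_tangent[OF V p s frame_vf[OF s k]] lift_tangent[OF V p s frame_vf[OF s k]]]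
        frame_lift_norm[OF s k] by simp
  qed
  then have "(\<Sum>s\<in>{1..m}. \<Sum>k<mdim (F s).
    g p (Q.R dt (lift s (E s k)) dt p) (lift s (E s k) p) / g p (lift s (E s k) p) (lift s (E s k) p)) =
    (\<Sum>s\<in>{1..m}. \<Sum>k<mdim (F s). radial_curv s (fst p))"
    by (intro sum.cong refl) simp
  then show ?thesis
    unfolding ric_expand[OF t t] curv_dt_dt[OF t] g_zero_left[OF V p dt_tangent[OF pM]] by simp
qed

text \<open>R(dt, E) Y is a multiple of the time field for every lifted frame vector E, hence
  orthogonal to E.\<close>

lemma ric_dt_lift:
  assumes i: "i \<in> {1..m}" and Y: "vector_field (F i) (V i) Y"
  shows "ric dt (lift i Y) p = 0"
proof -
  note t = dt_vf[OF V] and pM = box_points[OF p] and lY = lift_box_vf[OF V i Y]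
  have "g p (Q.R dt (lift s (E s k)) (lift i Y) p) (lift s (E s k) p) = 0"
    if s: "s \<in> {1..m}" and k: "k < mdim (F s)" for s k
  proof -
    note Ek = frame_vf[OF s k]
    have a: "Q.R dt (lift s (E s k)) (lift i Y) p f = - Q.R (lift s (E s k)) dt (lift i Y) p f" for f
      by (rule Q.R_antisym[OF lift_box_vf[OF V s Ek] t lY p])
    have "\<exists>c. Q.R dt (lift s (E s k)) (lift i Y) p = (\<lambda>f. c * dt p f)"
    proof (cases "s = i")
      case True
      note Ek' = Ek[unfolded True]
      show ?thesis unfolding True
        by (rule exI[of _ "- (time_curv i (fst p) * gF i (snd p i) (E i k (snd p i)) (Y (snd p i)))"])
          (rule ext, simp add: a[unfolded True] curv_lift_dt_lift[OF V p i Ek' Y])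
    next
      case False
      show ?thesis
        by (rule exI[of _ 0]) (rule ext, simp add: a curv_lift_dt_other[OF V p s i False Ek Y])
    qed
    then obtain c where c: "Q.R dt (lift s (E s k)) (lift i Y) p = (\<lambda>f. c * dt p f)" by (elim exE)
    show ?thesis
      unfolding c PM.g_scale[OF pM dt_tangent[OF pM] lift_tangent[OF V p s Ek]] g_dt_lift(1)[OF V p s Ek] by simp
  qed
  then show ?thesis
    unfolding ric_expand[OF t lY] curv_dt_dt[OF lY] g_zero_left[OF V p dt_tangent[OF pM]]
    by (simp add: sum.neutral)
qed

text \<open>R(X, E) dt vanishes for lifts, and R(X, dt) dt is a multiple of X and so orthogonal to
  the time field.\<close>

lemma ric_lift_dt:
  assumes i: "i \<in> {1..m}" and X: "vector_field (F i) (V i) X"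
  shows "ric (lift i X) dt p = 0"
proof -
  note t = dt_vf[OF V] and pM = box_points[OF p] and lX = lift_box_vf[OF V i X]
  have "Q.R (lift i X) (lift s (E s k)) dt p = (\<lambda>f. 0)" if s: "s \<in> {1..m}" and k: "k < mdim (F s)" for s k
    by (rule ext) (rule curv_lift_lift_dt[OF V p i s X frame_vf[OF s k]])
  then have s0: "g p (Q.R (lift i X) (lift s (E s k)) dt p) (lift s (E s k) p) = 0"
    if "s \<in> {1..m}" "k < mdim (F s)" for s k
    using that g_zero_left[OF V p lift_tangent[OF V p that(1) frame_vf[OF that]]] by simp
  have c: "Q.R (lift i X) dt dt p = (\<lambda>f. (- radial_curv i (fst p)) * lift i X p f)"
    by (rule ext) (simp add: Q.R_antisym[OF t lX t p] curv_dt_lift_dt[OF V p i X])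
  have "g p (Q.R (lift i X) dt dt p) (dt p) = 0"
    unfolding c PM.g_scale[OF pM lift_tangent[OF V p i X] dt_tangent[OF pM]] g_dt_lift(2)[OF V p i X] by simp
  then show ?thesis
    unfolding ric_expand[OF lX t] by (simp add: s0 sum.neutral)
qed

text \<open>R(X, E) Y is nonzero at most for E from the fibre of Y, and then it is a multiple of X,
  which is orthogonal to E.\<close>

lemma ric_lift_other:
  assumes i: "i \<in> {1..m}" and j: "j \<in> {1..m}" and ij: "i \<noteq> j"
    and X: "vector_field (F i) (V i) X" and Y: "vector_field (F j) (V j) Y"
  shows "ric (lift i X) (lift j Y) p = 0"
proof -
  note pM = box_points[OF p] and lX = lift_box_vf[OF V i X] and lY = lift_box_vf[OF V j Y]
  have s0: "g p (Q.R (lift i X) (lift s (E s k)) (lift j Y) p) (lift s (E s k) p) = 0"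
    if s: "s \<in> {1..m}" and k: "k < mdim (F s)" for s k
  proof -
    note Ek = frame_vf[OF s k]
    show ?thesis
    proof (cases "s = j")
      case True
      note Ek' = Ek[unfolded True]
      let ?c = "second_form j (fst p) * gF j (snd p j) (E j k (snd p j)) (Y (snd p j)) * radial i (fst p)"
      have "Q.R (lift i X) (lift j (E j k)) (lift j Y) p = (\<lambda>f. ?c * lift i X p f)"
        by (rule ext) (simp add: Q.R_antisym[OF lift_box_vf[OF V j Ek'] lX lY p]
            curv_lift_other_lift[OF V p j i ij[symmetric] Ek' X Y])
      then show ?thesis
        using PM.g_scale[OF pM lift_tangent[OF V p i X] lift_tangent[OF V p j Ek']] g_lift_other[OF V p i j ij X Ek'] True
        by simp
    next
      case False
      have "Q.R (lift i X) (lift s (E s k)) (lift j Y) p = (\<lambda>f. 0)"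
        by (rule ext) (rule curv_lift_lift_other[OF V p i s j ij False X Ek Y])
      then show ?thesis using g_zero_left[OF V p lift_tangent[OF V p s Ek]] by simp
    qed
  qed
  have "Q.R (lift i X) dt (lift j Y) p = (\<lambda>f. 0)"
    by (rule ext) (rule curv_lift_dt_other[OF V p i j ij X Y])
  then have "g p (Q.R (lift i X) dt (lift j Y) p) (dt p) = 0"
    using g_zero_left[OF V p dt_tangent[OF pM]] by simp
  then show ?thesis
    unfolding ric_expand[OF lX lY] by (simp add: s0 sum.neutral)
qed

lemma ric_lift_lift:
  assumes i: "i \<in> {1..m}" and X: "vector_field (F i) (V i) X" and Y: "vector_field (F i) (V i) Y"
  shows "ric (lift i X) (lift i Y) p = ricF i X Y (snd p i) +
    fiber_defect i (fst p) * gF i (snd p i) (X (snd p i)) (Y (snd p i))"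
proof -
  interpret Fi: framed_connection "F i" "gF i" "nablaF i" by (rule fiber_connection[OF i])
  note pM = box_points[OF p] and lX = lift_box_vf[OF V i X] and lY = lift_box_vf[OF V i Y]
  note xi = box_component[OF p i] and xF = component_points[OF pM i]
  let ?x = "snd p i" and ?g = "\<lambda>A B. gF i (snd p i) (A (snd p i)) (B (snd p i))"
  let ?w = "second_form i (fst p)" and ?u = "\<lambda>s. radial s (fst p)"
  define T where "T s k = g p (Q.R (lift i X) (lift s (E s k)) (lift i Y) p) (lift s (E s k) p) /
    g p (lift s (E s k) p) (lift s (E s k) p)" for s k
  have Vi: "openin (sp_top (F i)) (V i)" using V i by (simp add: open_family_def)
  note Fr = Fi.orthonormal_imp_orthogonal[OF Vi E[OF i]]
  have tt: "Q.R (lift i X) dt (lift i Y) p = (\<lambda>f. (time_curv i (fst p) * ?g X Y) * dt p f)"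
    by (rule ext) (rule curv_lift_dt_lift[OF V p i X Y])
  have "g p (Q.R (lift i X) dt (lift i Y) p) (dt p) = - (time_curv i (fst p) * ?g X Y)"
    unfolding tt PM.g_scale[OF pM dt_tangent[OF pM] dt_tangent[OF pM]] g_dt_dt[OF pM] by simp
  then have ric: "ric (lift i X) (lift i Y) p = time_curv i (fst p) * ?g X Y + (\<Sum>s\<in>{1..m}. \<Sum>k<mdim (F s). T s k)"
    unfolding ric_expand[OF lX lY] T_def by simp
  \<comment> \<open>A frame vector from another fibre is mapped to a multiple of itself, so its norm
    cancels and all vectors of that fibre contribute equally.\<close>
  have other: "(\<Sum>k<mdim (F s). T s k) = - ?w * ?g X Y * (real (mdim (F s)) * ?u s)"
    if s: "s \<in> {1..m}" and si: "s \<noteq> i" for s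
  proof -
    have "T s k = - (?w * ?g X Y * ?u s)" if k: "k < mdim (F s)" for k
    proof -
      note Ek = frame_vf[OF s k] and tk = lift_tangent[OF V p s frame_vf[OF s k]]
      have c: "Q.R (lift i X) (lift s (E s k)) (lift i Y) p = (\<lambda>f. - (?w * ?g X Y * ?u s) * lift s (E s k) p f)"
        by (rule ext) (rule curv_lift_other_lift[OF V p i s si[symmetric] X Ek Y])
      show ?thesis unfolding T_def c PM.g_scale[OF pM tk tk] using frame_lift_norm[OF s k] by simp
    qed
    then have "(\<Sum>k<mdim (F s). T s k) = (\<Sum>k<mdim (F s). - (?w * ?g X Y * ?u s))" by (intro sum.cong) simp_all
    then show ?thesis by simp
  qed
  have same: "(\<Sum>k<mdim (F i). T i k) = ricF i X Y ?x + ?w * ?u i * (?g X Y - real (mdim (F i)) * ?g X Y)"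
  proof -
    let ?N = "\<lambda>k. ?g (E i k) (E i k)"
    \<comment> \<open>The unspecified time component drops out against a lift, and the factor b^2 of
      the numerator cancels the one in the norm of the lifted frame vector.\<close>
    have Tk: "T i k = gF i ?x (RF i X (E i k) Y ?x) (E i k ?x) / ?N k +
        ?w * ?u i * (?g X (E i k) * ?g Y (E i k) / ?N k - ?g X Y)" if k: "k < mdim (F i)" for k
    proof -
      note Ek = frame_vf[OF i k]
      note RXEY = Fi.R_field[OF X Ek Y]
      note tk = lift_tangent[OF V p i Ek] and tX = lift_tangent[OF V p i X] and tR = lift_tangent[OF V p i RXEY]
      obtain c where c: "Q.R (lift i X) (lift i (E i k)) (lift i Y) p = (\<lambda>f. lift i (RF i X (E i k) Y) p f +
        (?w * ?u i * (?g (E i k) Y * lift i X p f - ?g X Y * lift i (E i k) p f) + c * dt p f))"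
        by (rule curv_lift_lift_lift[OF V p i X Ek Y])
      define v where "v = (\<lambda>f. ?w * ?u i * (?g (E i k) Y * lift i X p f - ?g X Y * lift i (E i k) p f) + c * dt p f)"
      have c': "Q.R (lift i X) (lift i (E i k)) (lift i Y) p = (\<lambda>f. lift i (RF i X (E i k) Y) p f + v f)"
        unfolding c v_def ..
      have v: "v = (\<lambda>f. (?w * ?u i * ?g (E i k) Y) * lift i X p f + ((- (?w * ?u i * ?g X Y)) * lift i (E i k) p f + c * dt p f))"
        unfolding v_def by (rule ext) (simp add: algebra_simps)
      have t2: "(\<lambda>f. (- (?w * ?u i * ?g X Y)) * lift i (E i k) p f + c * dt p f) \<in> tangent_space M p"
        by (intro P.tangent_space_add P.tangent_space_scale tk dt_tangent[OF pM])
      have tv: "v \<in> tangent_space M p"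
        unfolding v by (intro P.tangent_space_add[OF _ t2] P.tangent_space_scale tX)
      have gv: "g p v (lift i (E i k) p) = ?w * ?u i * ?g (E i k) Y * ((b i (fst p))\<^sup>2 * ?g X (E i k))
          - ?w * ?u i * ?g X Y * ((b i (fst p))\<^sup>2 * ?N k)"
        unfolding v PM.g_add[OF pM P.tangent_space_scale[OF tX] tk t2] PM.g_scale[OF pM tX tk]
          PM.g_add[OF pM P.tangent_space_scale[OF tk] tk P.tangent_space_scale[OF dt_tangent[OF pM]]]
          PM.g_scale[OF pM tk tk] PM.g_scale[OF pM dt_tangent[OF pM] tk]
          g_dt_lift(1)[OF V p i Ek] g_lift_lift[OF V p i X Ek] g_lift_lift[OF V p i Ek Ek] by simp
      have "g p (Q.R (lift i X) (lift i (E i k)) (lift i Y) p) (lift i (E i k) p) =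
          (b i (fst p))\<^sup>2 * gF i ?x (RF i X (E i k) Y ?x) (E i k ?x) + g p v (lift i (E i k) p)"
        unfolding c' PM.g_add[OF pM tR tk tv] g_lift_lift[OF V p i RXEY Ek] ..
      moreover have "?N k \<noteq> 0" using Fi.frame_norm[OF Fr _ xi, of k] k by simp
      moreover have "b i (fst p) \<noteq> 0" using b_pos[OF i time_points[OF pM]] by simp
      moreover have "?g (E i k) Y = ?g Y (E i k)"
        by (rule Fi.g_sym[OF xF fiber_tangent[OF p i Ek] fiber_tangent[OF p i Y]])
      ultimately show ?thesis
        unfolding T_def gv g_lift_lift[OF V p i Ek Ek] by (simp add: field_simps)
    qed
    \<comment> \<open>By Parseval's identity the products of components add up to the inner product
      of \<open>X\<close> and \<open>Y\<close>, while the other term is counted once per frame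
      vector; this is the origin of the factor one minus the dimension.\<close>
    have "(\<Sum>k<mdim (F i). T i k) = (\<Sum>k<mdim (F i). gF i ?x (RF i X (E i k) Y ?x) (E i k ?x) / ?N k) +
        ?w * ?u i * ((\<Sum>k<mdim (F i). ?g X (E i k) * ?g Y (E i k) / ?N k) - real (mdim (F i)) * ?g X Y)"
    proof -
      have "(\<Sum>k<mdim (F i). T i k) = (\<Sum>k<mdim (F i). gF i ?x (RF i X (E i k) Y ?x) (E i k ?x) / ?N k +
        ?w * ?u i * (?g X (E i k) * ?g Y (E i k) / ?N k - ?g X Y))"
        by (rule sum.cong) (simp_all add: Tk)
      then show ?thesis by (simp add: sum.distrib sum_subtractf flip: sum_distrib_left)
    qed
    then show ?thesis
      unfolding Fi.ricci_frame[OF xi X Y Fr xi]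
        Fi.frame_parseval[OF Fr xi fiber_tangent[OF p i X] fiber_tangent[OF p i Y], symmetric] .
  qed
  have "(\<Sum>s\<in>{1..m}. \<Sum>k<mdim (F s). T s k) =
      (\<Sum>k<mdim (F i). T i k) + (\<Sum>s\<in>{1..m} - {i}. \<Sum>k<mdim (F s). T s k)"
    using i by (intro sum.remove) simp_all
  also have "(\<Sum>s\<in>{1..m} - {i}. \<Sum>k<mdim (F s). T s k) =
      (\<Sum>s\<in>{1..m} - {i}. - ?w * ?g X Y * (real (mdim (F s)) * ?u s))"
    by (rule sum.cong[OF refl]) (rule other, simp_all)
  also have "\<dots> = - ?w * ?g X Y * (\<Sum>s\<in>{1..m} - {i}. real (mdim (F s)) * ?u s)"
    by (rule sum_distrib_left[symmetric])
  finally show ?thesis unfolding ric same fiber_defect_def by (simp add: algebra_simps)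
qed

end

section \<open>The Einstein equation in terms of fibres and time\<close>

lemma point_with:
  assumes ne: "\<And>i. i \<in> {1..m} \<Longrightarrow> points (F i) \<noteq> {}" and t: "t \<in> I"
  obtains p where "p \<in> points M" "fst p = t"
proof -
  have "\<forall>i\<in>{1..m}. \<exists>x. x \<in> points (F i)" using ne by blast
  from bchoice[OF this] obtain x where "\<forall>i\<in>{1..m}. x i \<in> points (F i)" by (elim exE)
  then show thesis using t by (intro that[of "(t, \<lambda>i\<in>{1..m}. x i)"]) (simp_all add: points_prod)
qed

text \<open>Forward, the equation is evaluated on lifts and on the time field at suitable points;
  backward, it is checked on the product frame, whose orthogonality settles the mixed components.
  The sign of \<alpha> in the time equation is the norm of the time field.\<close>

lemma einstein_iff:
  assumes ne: "\<And>i. i \<in> {1..m} \<Longrightarrow> points (F i) \<noteq> {}" and I_ne: "I \<noteq> {}"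
    and dim: "\<And>i. i \<in> {1..m} \<Longrightarrow> mdim (F i) \<ge> 1"
  shows "einstein M g Dbar \<alpha> \<longleftrightarrow> (\<exists>a :: nat \<Rightarrow> real.
    (\<forall>i\<in>{1..m}. einstein (F i) (gF i) (nablaF i) (a i)) \<and>
    (\<forall>t\<in>I. (\<Sum>i\<in>{1..m}. real (mdim (F i)) * radial_curv i t) = - \<alpha>) \<and>
    (\<forall>i\<in>{1..m}. \<forall>t\<in>I. a i + fiber_defect i t = \<alpha> * (b i t)\<^sup>2))"
proof
  assume ein: "einstein M g Dbar \<alpha>"
  have ein': "ric A B p = \<alpha> * g p (A p) (B p)" if "vector_field M W A" "vector_field M W B" "p \<in> W" for W A B p
    using ein that unfolding einstein_def by metis
  obtain t0 where t0: "t0 \<in> I" using I_ne by blast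
  \<comment> \<open>The candidate for the constant of the fibre is what the product equation yields
    at one fixed time \<open>t0\<close>.\<close>
  define a where "a i = \<alpha> * (b i t0)\<^sup>2 - fiber_defect i t0" for i
  have fib: "ricF i X Y (snd p i) = (\<alpha> * (b i (fst p))\<^sup>2 - fiber_defect i (fst p)) *
      gF i (snd p i) (X (snd p i)) (Y (snd p i))"
    if i: "i \<in> {1..m}" and pM: "p \<in> points M" and W: "snd p i \<in> W"
      and X: "vector_field (F i) W X" and Y: "vector_field (F i) W Y" for i p W X Y
  proof -
    interpret Fi: framed_connection "F i" "gF i" "nablaF i" by (rule fiber_connection[OF i])
    obtain V1 E where V1: "open_family V1" "p \<in> fiber_box V1"
      and E0: "\<forall>i\<in>{1..m}. orthonormal_frame (F i) (gF i) (V1 i) (E i)" by (rule fiber_frames[OF pM])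
    \<comment> \<open>The box is shrunk in the \<open>i\<close>-th factor only, to the domain of the
      given fibre fields; the frames of all fibres restrict to it.\<close>
    define V where "V = V1(i := V1 i \<inter> W)"
    have V: "open_family V" "p \<in> fiber_box V"
      using V1 W Fi.vf_open[OF X] by (auto simp: V_def open_family_def fiber_box_def)
    have sub: "V s \<subseteq> V1 s" for s by (auto simp: V_def)
    have E: "orthonormal_frame (F s) (gF s) (V s) (E s)" if s: "s \<in> {1..m}" for s
    proof -
      have "openin (sp_top (F s)) (V s)" using V(1) s by (simp add: open_family_def)
      then show ?thesis
        using bspec[OF E0 s] charted_space.vf_subset[OF F_charted[OF s], of "V1 s" _ "V s"] sub[of s]
        unfolding orthonormal_frame_def by (metis subsetD)
    qed
    have Vi: "openin (sp_top (F i)) (V i)" using V(1) i unfolding open_family_def by (rule bspec)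
    have VW: "V i \<subseteq> W" by (simp add: V_def)
    note X' = Fi.vf_subset[OF X Vi VW] and Y' = Fi.vf_subset[OF Y Vi VW]
    show ?thesis
      using ric_lift_lift[OF V E i X' Y'] g_lift_lift[OF V i X' Y']
        ein'[OF lift_box_vf[OF V(1) i X'] lift_box_vf[OF V(1) i Y'] V(2)]
      by (simp add: algebra_simps)
  qed
  have 1: "einstein (F i) (gF i) (nablaF i) (a i)" if i: "i \<in> {1..m}" for i
    unfolding einstein_def
  proof (intro allI impI ballI; elim conjE)
    fix W X Y q assume X: "vector_field (F i) W X" and Y: "vector_field (F i) W Y" and q: "q \<in> W"
    obtain p0 where p0: "p0 \<in> points M" "fst p0 = t0" by (rule point_with[OF ne t0])
    have "q \<in> points (F i)" by (rule charted_space.vf_points[OF F_charted[OF i] X q])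
    \<comment> \<open>Exchanging the \<open>i\<close>-th component of a point at time
      \<open>t0\<close> for \<open>q\<close> gives a point of the product over \<open>q\<close> at
      that time, where the fibre equation has the constant \<open>a i\<close>.\<close>
    from slice_points[OF p0(1) i this] have "slice p0 i q \<in> points M" .
    from fib[OF i this _ X Y] q p0(2) show "ricF i X Y q = a i * gF i q (X q) (Y q)" by (simp add: a_def)
  qed
  have 2: "(\<Sum>i\<in>{1..m}. real (mdim (F i)) * radial_curv i t) = - \<alpha>" if t: "t \<in> I" for t
  proof -
    obtain p where p: "p \<in> points M" "fst p = t" by (rule point_with[OF ne t])
    obtain V E where V: "open_family V" "p \<in> fiber_box V"
      and E0: "\<forall>i\<in>{1..m}. orthonormal_frame (F i) (gF i) (V i) (E i)" by (rule fiber_frames[OF p(1)])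
    show ?thesis
      using ric_dt_dt[OF V bspec[OF E0]] ein'[OF dt_vf[OF V(1)] dt_vf[OF V(1)] V(2)] g_dt_dt[OF p(1)] p(2) by simp
  qed
  \<comment> \<open>At another time the same Ricci tensor of the fibre has two expressions.
    Comparing them on one frame vector, which has norm 1 or -1 and exists because the dimension is
    positive, equates their coefficients.\<close>
  have 3: "a i + fiber_defect i t = \<alpha> * (b i t)\<^sup>2" if i: "i \<in> {1..m}" and t: "t \<in> I" for i t
  proof -
    obtain p where p: "p \<in> points M" "fst p = t" by (rule point_with[OF ne t])
    obtain V E where V: "open_family V" "p \<in> fiber_box V"
      and E0: "\<forall>i\<in>{1..m}. orthonormal_frame (F i) (gF i) (V i) (E i)" by (rule fiber_frames[OF p(1)])
    have d: "0 < mdim (F i)" using dim[OF i] by simp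
    have E: "vector_field (F i) (V i) (E i 0)" using bspec[OF E0 i] d unfolding orthonormal_frame_def by blast
    have "gF i (snd p i) (E i 0 (snd p i)) (E i 0 (snd p i)) \<in> {-1, 1}"
      using bspec[OF E0 i] d box_component[OF V(2) i] unfolding orthonormal_frame_def by blast
    moreover have "ricF i (E i 0) (E i 0) (snd p i) = a i * gF i (snd p i) (E i 0 (snd p i)) (E i 0 (snd p i))"
      using 1[OF i] E box_component[OF V(2) i] unfolding einstein_def by metis
    ultimately have "a i = \<alpha> * (b i (fst p))\<^sup>2 - fiber_defect i (fst p)"
      using fib[OF i p(1) box_component[OF V(2) i] E E] by auto
    then show ?thesis using p(2) by simp
  qed
  show "\<exists>a :: nat \<Rightarrow> real. (\<forall>i\<in>{1..m}. einstein (F i) (gF i) (nablaF i) (a i)) \<and>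
    (\<forall>t\<in>I. (\<Sum>i\<in>{1..m}. real (mdim (F i)) * radial_curv i t) = - \<alpha>) \<and>
    (\<forall>i\<in>{1..m}. \<forall>t\<in>I. a i + fiber_defect i t = \<alpha> * (b i t)\<^sup>2)"
    by (rule exI[of _ a]) (intro conjI ballI 1 2 3)
next
  assume "\<exists>a :: nat \<Rightarrow> real. (\<forall>i\<in>{1..m}. einstein (F i) (gF i) (nablaF i) (a i)) \<and>
    (\<forall>t\<in>I. (\<Sum>i\<in>{1..m}. real (mdim (F i)) * radial_curv i t) = - \<alpha>) \<and>
    (\<forall>i\<in>{1..m}. \<forall>t\<in>I. a i + fiber_defect i t = \<alpha> * (b i t)\<^sup>2)"
  then obtain a where a0: "\<forall>i\<in>{1..m}. einstein (F i) (gF i) (nablaF i) (a i)"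
    and r0: "\<forall>t\<in>I. (\<Sum>i\<in>{1..m}. real (mdim (F i)) * radial_curv i t) = - \<alpha>"
    and d0: "\<forall>i\<in>{1..m}. \<forall>t\<in>I. a i + fiber_defect i t = \<alpha> * (b i t)\<^sup>2"
    by (elim exE conjE)
  show "einstein M g Dbar \<alpha>"
  proof (rule Q.einstein_frameI)
    fix p assume pM: "p \<in> points M"
    note t = time_points[OF pM]
    obtain V E where V: "open_family V" "p \<in> fiber_box V"
      and E0: "\<forall>i\<in>{1..m}. orthonormal_frame (F i) (gF i) (V i) (E i)" by (rule fiber_frames[OF pM])
    note E = bspec[OF E0]
    have Ei: "vector_field (F i) (V i) (E i k)" if "i \<in> {1..m}" "k < mdim (F i)" for i k
      using E[OF that(1)] that(2) unfolding orthonormal_frame_def by blast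
    have idx: "c = None \<or> (\<exists>i k. c = Some (i, k) \<and> i \<in> {1..m} \<and> k < mdim (F i))" if "c \<in> frame_idx" for c
      using that by (auto simp: frame_idx_def)
    have "ric (frame_fields E c) (frame_fields E d) p = \<alpha> * g p (frame_fields E c p) (frame_fields E d p)"
      if c: "c \<in> frame_idx" and d: "d \<in> frame_idx" for c d
      using idx[OF c] idx[OF d]
    proof (elim disjE exE conjE)
      assume "c = None" "d = None"
      then show ?thesis
        using ric_dt_dt[OF V E] bspec[OF r0 t] g_dt_dt[OF pM] by (simp add: frame_fields_def)
    next
      fix i k assume "c = None" "d = Some (i, k)" "i \<in> {1..m}" "k < mdim (F i)"
      then show ?thesis
        using ric_dt_lift[OF V E] g_dt_lift(1)[OF V] Ei by (simp add: frame_fields_def)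
    next
      fix i k assume "c = Some (i, k)" "d = None" "i \<in> {1..m}" "k < mdim (F i)"
      then show ?thesis
        using ric_lift_dt[OF V E] g_dt_lift(2)[OF V] Ei by (simp add: frame_fields_def)
    next
      fix i k j l assume i: "c = Some (i, k)" "i \<in> {1..m}" "k < mdim (F i)"
        and j: "d = Some (j, l)" "j \<in> {1..m}" "l < mdim (F j)"
      show ?thesis
      proof (cases "i = j")
        case True
        have l: "l < mdim (F i)" using j True by simp
        note X = Ei[OF i(2,3)] and Y = Ei[OF i(2) l]
        have "ricF i (E i k) (E i l) (snd p i) = a i * gF i (snd p i) (E i k (snd p i)) (E i l (snd p i))"
          using bspec[OF a0 i(2)] X Y box_component[OF V(2) i(2)] unfolding einstein_def by metis
        then have "ric (lift i (E i k)) (lift i (E i l)) p =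
            (a i + fiber_defect i (fst p)) * gF i (snd p i) (E i k (snd p i)) (E i l (snd p i))"
          using ric_lift_lift[OF V E i(2) X Y] by (simp add: algebra_simps)
        then show ?thesis
          using g_lift_lift[OF V i(2) X Y] bspec[OF bspec[OF d0 i(2)] t] i j True by (simp add: frame_fields_def)
      next
        case False
        show ?thesis
          using ric_lift_other[OF V E i(2) j(2) False Ei[OF i(2,3)] Ei[OF j(2,3)]]
            g_lift_other[OF V i(2) j(2) False Ei[OF i(2,3)] Ei[OF j(2,3)]] i j by (simp add: frame_fields_def)
      qed
    qed
    then show "\<exists>V E. p \<in> V \<and> PM.orthogonal_frame frame_idx V E \<and>
      (\<forall>a\<in>frame_idx. \<forall>b\<in>frame_idx. ric (E a) (E b) p = \<alpha> * g p (E a p) (E b p))"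
      using V(2) product_frame[OF V(1) E] by (intro exI[of _ "fiber_box V"] exI[of _ "frame_fields E"] conjI ballI)
  qed
qed

section \<open>The time and fibre equations in terms of the warping functions\<close>

lemma radial_curv_sum:
  "- (\<Sum>i\<in>{1..m}. real (mdim (F i)) * radial_curv i t) = (\<Sum>i\<in>{1..m}. real (mdim (F i)) *
    (lam2 * (deriv (b i) t / b i t) - deriv (deriv (b i)) t / b i t + lam1\<^sup>2 - lam1 * lam2))"
  unfolding sum_negf[symmetric] by (rule sum.cong) (simp_all add: radial_curv_def hubble_def algebra_simps)

text \<open>Splitting \<open>lam1\<close> off \<open>radial\<close> in the sum over the other fibres
  leaves the total dimension \<open>L\<close> of those fibres. Since the dimension of the product is
  1 + l + L, this is how it enters condition (3).\<close>

lemma fiber_defect_eq: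
  assumes i: "i \<in> {1..m}" and t: "t \<in> I"
  shows "fiber_defect i t = - b i t * deriv (deriv (b i)) t + (1 - real (mdim (F i))) * (deriv (b i) t)\<^sup>2
    + (lam2 * (b i t)\<^sup>2 - b i t * deriv (b i) t) * (\<Sum>s\<in>{1..m} - {i}. real (mdim (F s)) * (deriv (b s) t / b s t))
    + (lam2\<^sup>2 + (1 - real (mdim M)) * lam1 * lam2) * (b i t)\<^sup>2
    + ((real (mdim M) - 1) * lam1 + (real (mdim (F i)) - 1) * lam2) * b i t * deriv (b i) t"
proof -
  define l where "l = real (mdim (F i))"
  define L where "L = (\<Sum>s\<in>{1..m} - {i}. real (mdim (F s)))"
  define S where "S = (\<Sum>s\<in>{1..m} - {i}. real (mdim (F s)) * (deriv (b s) t / b s t))"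
  have bn: "b i t \<noteq> 0" using b_pos[OF i t] by simp
  have "(\<Sum>s\<in>{1..m} - {i}. real (mdim (F s)) * radial s t) = S - lam1 * L"
    unfolding S_def L_def sum_distrib_left sum_subtractf[symmetric]
    by (rule sum.cong) (simp_all add: radial_def hubble_def algebra_simps)
  moreover have "(\<Sum>s\<in>{1..m}. real (mdim (F s))) = l + L"
    unfolding l_def L_def using i by (intro sum.remove) simp_all
  then have n: "real (mdim M) = 1 + l + L" unfolding mdim_prod by simp
  \<comment> \<open>One power of the warping function cancels the denominator of
    \<open>hubble\<close>, so the product is polynomial in b and b'.\<close>
  have "second_form i t * radial i t = (deriv (b i) t)\<^sup>2 - (lam1 + lam2) * b i t * deriv (b i) t + lam1 * lam2 * (b i t)\<^sup>2"
    using bn by (simp add: second_form_def radial_def hubble_def power2_eq_square field_simps)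
  then have "(1 - l) * second_form i t * radial i t =
      (1 - l) * ((deriv (b i) t)\<^sup>2 - (lam1 + lam2) * b i t * deriv (b i) t + lam1 * lam2 * (b i t)\<^sup>2)"
    by (simp add: mult.assoc)
  ultimately have "fiber_defect i t = time_curv i t - second_form i t * (S - lam1 * L) +
      (1 - l) * ((deriv (b i) t)\<^sup>2 - (lam1 + lam2) * b i t * deriv (b i) t + lam1 * lam2 * (b i t)\<^sup>2)"
    by (simp add: fiber_defect_def l_def)
  then show ?thesis
    unfolding n S_def[symmetric] l_def[symmetric]
    by (simp add: time_curv_def second_form_def power2_eq_square algebra_simps)
qed

end

theorem theorem4p11:
  fixes I :: "real set" and m :: nat and l :: "nat \<Rightarrow> nat" and n :: nat
    and F :: "nat \<Rightarrow> ('a, 'j) smooth_space"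
    and gF :: "nat \<Rightarrow> 'a metric_field"
    and nablaF :: "nat \<Rightarrow> 'a connection_op"
    and b :: "nat \<Rightarrow> real \<Rightarrow> real"
    and M :: "(real \<times> (nat \<Rightarrow> 'a), (nat \<times> 'j) option) smooth_space"
    and g :: "(real \<times> (nat \<Rightarrow> 'a)) metric_field"
    and nabla :: "(real \<times> (nat \<Rightarrow> 'a)) connection_op"
    and lam1 lam2 \<alpha> :: real
  assumes "open I" and "is_interval I" and "I \<noteq> {}"
    and "m \<ge> 1"
    and "\<And>i. i \<in> {1..m} \<Longrightarrow> pseudo_riemannian (F i) (gF i)"
    and "\<And>i. i \<in> {1..m} \<Longrightarrow> mdim (F i) = l i \<and> l i \<ge> 1"
    and "\<And>i. i \<in> {1..m} \<Longrightarrow> levi_civita (F i) (gF i) (nablaF i)"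
    and "\<And>i. i \<in> {1..m} \<Longrightarrow> smooth_fun_on I (b i) \<and> (\<forall>t\<in>I. b i t > 0)"
    and "M = product_space I m F" and "g = warped_metric I m F gF b"
    and "n = mdim M"
    and "levi_civita M g nabla"
    and "lam1 \<noteq> 0" and "lam2 \<noteq> 0"
  shows "einstein M g (quarter_symmetric g (time_field I m F) lam1 lam2 nabla) \<alpha> \<longleftrightarrow>
    (\<exists>a :: nat \<Rightarrow> real.
      (\<forall>i\<in>{1..m}. einstein (F i) (gF i) (nablaF i) (a i)) \<and>
      (\<forall>t\<in>I. (\<Sum>i=1..m. real (l i) *
          (lam2 * (deriv (b i) t / b i t) - deriv (deriv (b i)) t / b i t
             + lam1\<^sup>2 - lam1 * lam2)) = \<alpha>) \<and>
      (\<forall>i\<in>{1..m}. \<forall>t\<in>I.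
          a i - b i t * deriv (deriv (b i)) t + (1 - real (l i)) * (deriv (b i) t)\<^sup>2
          + (lam2 * (b i t)\<^sup>2 - b i t * deriv (b i) t)
              * (\<Sum>s\<in>{1..m} - {i}. real (l s) * (deriv (b s) t / b s t))
          + (lam2\<^sup>2 + (1 - real n) * lam1 * lam2) * (b i t)\<^sup>2
          + ((real n - 1) * lam1 + (real (l i) - 1) * lam2) * b i t * deriv (b i) t
          = \<alpha> * (b i t)\<^sup>2))"
proof -
  have dim: "mdim (F i) = l i" if "i \<in> {1..m}" for i using assms(6) that by blast
  have W: "warped_connection I m F gF b nablaF nabla"
  proof (intro warped_connection.intro warped_product.intro warped_connection_axioms.intro)
    show "open I" by (rule assms(1))
    fix i assume i: "i \<in> {1..m}"
    show "framed_manifold (F i) (gF i)" by (rule pseudo_riemannian_framed[OF assms(5)[OF i]])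
    show "smooth_fun_on I (b i)" using assms(8)[OF i] by blast
    show "b i t > 0" if "t \<in> I" for t using assms(8)[OF i] that by blast
  next
    fix i assume i: "i \<in> {1..m}"
    show "levi_civita (F i) (gF i) (nablaF i)" by (rule assms(7)[OF i])
  next
    show "levi_civita (product_space I m F) (warped_metric I m F gF b) nabla"
      using assms(12) unfolding assms(9,10) .
  qed
  interpret warped_connection I m F gF b nablaF nabla lam1 lam2 by (rule W)
  have ne: "points (F i) \<noteq> {}" if "i \<in> {1..m}" for i
    using assms(5)[OF that] unfolding pseudo_riemannian_def smooth_manifold_def by (elim conjE)
  have ge: "mdim (F i) \<ge> 1" if "i \<in> {1..m}" for i using assms(6)[OF that] by simp
  \<comment> \<open>The sum in condition (2) is minus the time component of the Ricci tensor, which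
    turns the equation with -\<alpha> into the stated one.\<close>
  have time: "(\<Sum>i=1..m. real (l i) *
          (lam2 * (deriv (b i) t / b i t) - deriv (deriv (b i)) t / b i t
             + lam1\<^sup>2 - lam1 * lam2)) = - (\<Sum>i\<in>{1..m}. real (mdim (F i)) * radial_curv i t)" for t
    unfolding radial_curv_sum by (rule sum.cong) (simp_all add: dim)
  have fib: "a i - b i t * deriv (deriv (b i)) t + (1 - real (l i)) * (deriv (b i) t)\<^sup>2
          + (lam2 * (b i t)\<^sup>2 - b i t * deriv (b i) t)
              * (\<Sum>s\<in>{1..m} - {i}. real (l s) * (deriv (b s) t / b s t))
          + (lam2\<^sup>2 + (1 - real n) * lam1 * lam2) * (b i t)\<^sup>2
          + ((real n - 1) * lam1 + (real (l i) - 1) * lam2) * b i t * deriv (b i) t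
          = a i + fiber_defect i t" if i: "i \<in> {1..m}" and t: "t \<in> I" for a :: "nat \<Rightarrow> real" and i t
  proof -
    have "(\<Sum>s\<in>{1..m} - {i}. real (l s) * (deriv (b s) t / b s t)) =
        (\<Sum>s\<in>{1..m} - {i}. real (mdim (F s)) * (deriv (b s) t / b s t))"
      by (rule sum.cong) (simp_all add: dim)
    moreover have "n = mdim (product_space I m F)" using assms(11) unfolding assms(9) .
    ultimately show ?thesis
      unfolding fiber_defect_eq[OF i t] dim[OF i] by simp
  qed
  have "einstein M g (quarter_symmetric g (time_field I m F) lam1 lam2 nabla) \<alpha> \<longleftrightarrow> (\<exists>a :: nat \<Rightarrow> real.
    (\<forall>i\<in>{1..m}. einstein (F i) (gF i) (nablaF i) (a i)) \<and>
    (\<forall>t\<in>I. (\<Sum>i\<in>{1..m}. real (mdim (F i)) * radial_curv i t) = - \<alpha>) \<and>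
    (\<forall>i\<in>{1..m}. \<forall>t\<in>I. a i + fiber_defect i t = \<alpha> * (b i t)\<^sup>2))"
    unfolding assms(9,10) by (rule einstein_iff[OF ne assms(3) ge])
  also have "\<dots> \<longleftrightarrow> (\<exists>a :: nat \<Rightarrow> real.
      (\<forall>i\<in>{1..m}. einstein (F i) (gF i) (nablaF i) (a i)) \<and>
      (\<forall>t\<in>I. (\<Sum>i=1..m. real (l i) *
          (lam2 * (deriv (b i) t / b i t) - deriv (deriv (b i)) t / b i t
             + lam1\<^sup>2 - lam1 * lam2)) = \<alpha>) \<and>
      (\<forall>i\<in>{1..m}. \<forall>t\<in>I.
          a i - b i t * deriv (deriv (b i)) t + (1 - real (l i)) * (deriv (b i) t)\<^sup>2
          + (lam2 * (b i t)\<^sup>2 - b i t * deriv (b i) t)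
              * (\<Sum>s\<in>{1..m} - {i}. real (l s) * (deriv (b s) t / b s t))
          + (lam2\<^sup>2 + (1 - real n) * lam1 * lam2) * (b i t)\<^sup>2
          + ((real n - 1) * lam1 + (real (l i) - 1) * lam2) * b i t * deriv (b i) t
          = \<alpha> * (b i t)\<^sup>2))"
    unfolding time by (intro ex_cong1 conj_cong ball_cong refl) (simp_all only: fib minus_equation_iff[of _ \<alpha>] eq_commute[of "- \<alpha>"])
  finally show ?thesis .
qed

end
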